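(* Let $\psi$ be a complete Bernstein function and let $D$ be a nonempty bounded Lipschitz domain in $\mathbb{R}^d$, $d \ge 1$. Denote by $\mu_n^{\mathrm N}$ and $\mu_n^{\mathrm D}$ ($n = 1, 2, \ldots$) the Neumann and Dirichlet eigenvalues of $-\Delta$ in $D$, respectively, arranged in nondecreasing order and repeated according to multiplicity, and let $\lambda_n$ denote the Dirichlet eigenvalues of $\psi(-\Delta)$ in $D$, arranged in nondecreasing order and repeated according to multiplicity. Then $$\psi(\mu_n^{\mathrm N}) \le \lambda_n \le \psi(\mu_n^{\mathrm D}) \qquad \text{for } n = 1, 2, \ldots$$ Moreover, if $\psi$ does not extend to a meromorphic function in $\mathbb{C} \setminus \{0\}$, then both inequalities are strict for every $n$.
   Context: A function $\psi : [0,\infty) \to [0,\infty)$ is a complete Bernstein function if $$\psi(\xi) = c_1 \xi + c_0 + \frac{1}{\pi} \int_{(0,\infty)} \frac{\xi}{\xi+s}\, \mu(ds),$$ where $c_0, c_1 \ge 0$ and $\mu$ is a nonnegative Borel measure on $(0,\infty)$ such that the integral is finite for some (equivalently, all) $\xi > 0$. This formula defines a holomorphic function on $\mathbb{C} \setminus (-\infty,0]$; "$\psi$ extends to a meromorphic function in $\mathbb{C}\setminus\{0\}$" means that there is a meromorphic function on $\mathbb{C} \setminus \{0\}$ agreeing with $\psi$ on $(0,\infty)$. Write $\psi(\infty) = \lim_{\xi\to\infty}\psi(\xi) \in [0,\infty]$. Identify $L^2(D)$ with $\{u \in L^2(\mathbb{R}^d) : u = 0 \text{ a.e. in } \mathbb{R}^d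 \setminus D\}$. The eigenvalues are those of the self-adjoint operators on $L^2(D)$ associated with the following quadratic forms (each set equal to $+\infty$ off its domain). Dirichlet Laplacian: $\mathscr{E}^{\mathrm D}(u) = \int_{\mathbb{R}^d} |\nabla u|^2\,dx$ with domain $\{u \in H^1(\mathbb{R}^d) : u = 0 \text{ a.e. in } \mathbb{R}^d\setminus D\}$. Neumann Laplacian: $\mathscr{E}^{\mathrm N}(u) = \int_D |\nabla \tilde u|^2\,dx$ with domain the set of those $u \in L^2(D)$ which agree on $D$ with some $\tilde u \in H^1(\mathbb{R}^d)$. Dirichlet operator $\psi(-\Delta)$ in $D$: $\mathscr{E}^{\mathrm{SD}}(u) = (2\pi)^{-d} \int_{\mathbb{R}^d} \psi(|\xi|^2)\, |\mathscr{F}u(\xi)|^2\,d\xi$, with domain the set of $u \in L^2(D)$ for which this is finite, where $\mathscr{F}u(\xi) = \int_{\mathbb{R}^d} e^{-i\xi\cdot x} u(x)\,dx$. In each case the $n$th eigenvalue (counting multiplicities) is given by the Courant–Fischer formula $$\min\bigl\{ \max\{\mathscr{E}(u) : u \in E,\ \|u\|_2 = 1\} : E \text{ is an } n\text{-dimensional subspace of } L^2(D)\bigr\},$$ with $\mathscr{E}$ the corresponding form. The spectrum is purely discrete for $-\Delta$ with either boundary condition, and for $\psi(-\Delta)$ when $\psi(\infty) = \infty$; when $\psi(\infty) < \infty$, the $\lambda_n$ given by this formula converge to $\psi(\infty)$, the only point of the essential spectrum. *)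

theory Defs
  imports "HOL-Complex_Analysis.Complex_Analysis"
begin

text \<open>
  Throughout, \<open>\<real>\<^sup>d\<close> is an arbitrary Euclidean space \<open>'a\<close> with \<open>d = DIM('a) \<ge> 1\<close>, and
  \<open>L\<^sup>2\<close> consists of complex-valued Borel functions (not of equivalence classes); identification
  almost everywhere is made explicit where it matters.
\<close>

subsection \<open>Complete Bernstein functions\<close>

text \<open>Only the values of \<open>\<psi>\<close> on \<open>[0,\<infinity>)\<close> are relevant.\<close>

definition complete_Bernstein :: "(real \<Rightarrow> real) \<Rightarrow> bool" where
  "complete_Bernstein \<psi> \<longleftrightarrow>
     (\<exists>c\<^sub>0 c\<^sub>1. \<exists>M :: real measure.
        c\<^sub>0 \<ge> 0 \<and> c\<^sub>1 \<ge> 0 \<and> sets M = sets (restrict_space borel {0<..}) \<and>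
        (\<forall>\<xi>>0. integrable M (\<lambda>s. \<xi> / (\<xi> + s))) \<and>
        (\<forall>\<xi>\<ge>0. \<psi> \<xi> = c\<^sub>1 * \<xi> + c\<^sub>0 + 1 / pi * (\<integral>s. \<xi> / (\<xi> + s) \<partial>M)))"

definition extends_meromorphically :: "(real \<Rightarrow> real) \<Rightarrow> bool" where
  "extends_meromorphically \<psi> \<longleftrightarrow>
     (\<exists>f. f meromorphic_on (- {0}) \<and> (\<forall>\<xi>>0. f (complex_of_real \<xi>) = complex_of_real (\<psi> \<xi>)))"

subsection \<open>Lipschitz domains\<close>

text \<open>
  The unit vector \<open>e\<close> is the vertical direction of a rotated coordinate system, \<open>x - (x \<bullet> e) *\<^sub>R e\<close>
  is the horizontal part of \<open>x\<close>, and near each boundary point the domain is the part of a ball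
  that lies above a Lipschitz graph.  In dimension one the hyperplane is \<open>{0}\<close>.
\<close>

definition Lipschitz_domain :: "'a::euclidean_space set \<Rightarrow> bool" where
  "Lipschitz_domain D \<longleftrightarrow> open D \<and> connected D \<and>
     (\<forall>z\<in>frontier D. \<exists>e f L r. norm e = 1 \<and> r > 0 \<and> L-lipschitz_on {y. y \<bullet> e = 0} f \<and>
        D \<inter> ball z r = {x \<in> ball z r. f (x - (x \<bullet> e) *\<^sub>R e) < x \<bullet> e})"

subsection \<open>Square-integrable functions and the Sobolev space \<open>H\<^sup>1(\<real>\<^sup>d)\<close>\<close>

definition L2 :: "('a::euclidean_space \<Rightarrow> complex) set" where
  "L2 = {u. u \<in> borel_measurable borel \<and> integrable lborel (\<lambda>x. (cmod (u x))\<^sup>2)}"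

definition L2_norm :: "('a::euclidean_space \<Rightarrow> complex) \<Rightarrow> real" where
  "L2_norm u = sqrt (\<integral>x. (cmod (u x))\<^sup>2 \<partial>lborel)"

definition L2_on :: "'a::euclidean_space set \<Rightarrow> ('a \<Rightarrow> complex) set" where
  "L2_on D = {u \<in> L2. AE x in lborel. x \<notin> D \<longrightarrow> u x = 0}"

text \<open>Coinductively: \<open>\<phi>\<close> is differentiable, and so are its partial derivatives of every order.\<close>

coinductive smooth :: "('a::euclidean_space \<Rightarrow> real) \<Rightarrow> bool" where
  "\<lbrakk>\<And>x. \<phi> differentiable (at x);
    \<And>b. b \<in> Basis \<Longrightarrow> smooth (\<lambda>x. frechet_derivative \<phi> (at x) b)\<rbrakk> \<Longrightarrow> smooth \<phi>"

definition test_function :: "('a::euclidean_space \<Rightarrow> real) \<Rightarrow> bool" where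
  "test_function \<phi> \<longleftrightarrow> smooth \<phi> \<and> compact (closure {x. \<phi> x \<noteq> 0})"

text \<open>\<open>g b\<close> is the weak partial derivative of \<open>u\<close> in the direction of the basis vector \<open>b\<close>.\<close>

definition weak_gradient ::
    "('a::euclidean_space \<Rightarrow> complex) \<Rightarrow> ('a \<Rightarrow> 'a \<Rightarrow> complex) \<Rightarrow> bool" where
  "weak_gradient u g \<longleftrightarrow>
     (\<forall>b\<in>Basis. g b \<in> L2 \<and>
        (\<forall>\<phi>. test_function \<phi> \<longrightarrow>
           (\<integral>x. u x * of_real (frechet_derivative \<phi> (at x) b) \<partial>lborel) =
           - (\<integral>x. g b x * of_real (\<phi> x) \<partial>lborel)))"

definition H1 :: "('a::euclidean_space \<Rightarrow> complex) set" where
  "H1 = {u \<in> L2. \<exists>g. weak_gradient u g}"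

text \<open>The choice is harmless: the weak gradient is unique up to null sets.\<close>

definition grad_norm_sq :: "('a::euclidean_space \<Rightarrow> complex) \<Rightarrow> 'a \<Rightarrow> real" where
  "grad_norm_sq u x = (let g = (SOME g. weak_gradient u g) in \<Sum>b\<in>Basis. (cmod (g b x))\<^sup>2)"

subsection \<open>The quadratic forms\<close>

definition Dirichlet_form :: "'a::euclidean_space set \<Rightarrow> ('a \<Rightarrow> complex) \<Rightarrow> ennreal" where
  "Dirichlet_form D u =
     (if u \<in> H1 \<and> (AE x in lborel. x \<notin> D \<longrightarrow> u x = 0)
      then \<integral>\<^sup>+x. ennreal (grad_norm_sq u x) \<partial>lborel else \<infinity>)"

text \<open>
  For open \<open>D\<close> the value does not depend on the extension \<open>v\<close>: the weak gradient of \<open>v\<close> on \<open>D\<close>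
  is determined, up to null sets, by \<open>v\<close> on \<open>D\<close>.
\<close>

definition Neumann_form :: "'a::euclidean_space set \<Rightarrow> ('a \<Rightarrow> complex) \<Rightarrow> ennreal" where
  "Neumann_form D u =
     (let ext = (\<lambda>v. v \<in> H1 \<and> (AE x in lborel. x \<in> D \<longrightarrow> u x = v x))
      in if u \<in> L2_on D \<and> (\<exists>v. ext v)
         then \<integral>\<^sup>+x\<in>D. ennreal (grad_norm_sq (SOME v. ext v) x) \<partial>lborel else \<infinity>)"

text \<open>
  Applied only to elements of \<open>L2_on D\<close> with \<open>D\<close> bounded; these are integrable.
\<close>

definition Fourier :: "('a::euclidean_space \<Rightarrow> complex) \<Rightarrow> 'a \<Rightarrow> complex" where
  "Fourier u \<xi> = (\<integral>x. exp (- \<i> * complex_of_real (\<xi> \<bullet> x)) * u x \<partial>lborel)"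

definition psi_form ::
    "(real \<Rightarrow> real) \<Rightarrow> 'a::euclidean_space set \<Rightarrow> ('a \<Rightarrow> complex) \<Rightarrow> ennreal" where
  "psi_form \<psi> D u =
     (if u \<in> L2_on D
      then ennreal (1 / (2 * pi) ^ DIM('a)) *
           (\<integral>\<^sup>+\<xi>. ennreal (\<psi> ((norm \<xi>)\<^sup>2) * (cmod (Fourier u \<xi>))\<^sup>2) \<partial>lborel)
      else \<infinity>)"

subsection \<open>Eigenvalues\<close>

text \<open>
  The \<open>n\<close>-dimensional (complex) subspaces of \<open>L\<^sup>2(D)\<close>: spans of \<open>n\<close> functions that are linearly
  independent modulo equality almost everywhere.
\<close>

definition L2_subspaces :: "'a::euclidean_space set \<Rightarrow> nat \<Rightarrow> ('a \<Rightarrow> complex) set set" where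
  "L2_subspaces D n =
     {range (\<lambda>c x. \<Sum>i<n. c i * e i x) | e :: nat \<Rightarrow> 'a \<Rightarrow> complex.
        (\<forall>i<n. e i \<in> L2_on D) \<and>
        (\<forall>c. (AE x in lborel. (\<Sum>i<n. c i * e i x) = 0) \<longrightarrow> (\<forall>i<n. c i = 0))}"

text \<open>
  The Courant--Fischer value of the form \<open>F\<close>, for \<open>n \<ge> 1\<close>.  For nonempty bounded \<open>D\<close> and the three
  forms above the infimum is finite, since their domains contain all smooth functions with compact
  support in \<open>D\<close>, so \<open>enn2real\<close> loses nothing.
\<close>

definition eigenvalue ::
    "'a::euclidean_space set \<Rightarrow> (('a \<Rightarrow> complex) \<Rightarrow> ennreal) \<Rightarrow> nat \<Rightarrow> real" where
  "eigenvalue D F n =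
     enn2real (INF E\<in>L2_subspaces D n. SUP u\<in>{u \<in> E. L2_norm u = 1}. F u)"

abbreviation Neumann_eigenvalue :: "'a::euclidean_space set \<Rightarrow> nat \<Rightarrow> real" where
  "Neumann_eigenvalue D \<equiv> eigenvalue D (Neumann_form D)"

abbreviation Dirichlet_eigenvalue :: "'a::euclidean_space set \<Rightarrow> nat \<Rightarrow> real" where
  "Dirichlet_eigenvalue D \<equiv> eigenvalue D (Dirichlet_form D)"

abbreviation psi_eigenvalue ::
    "(real \<Rightarrow> real) \<Rightarrow> 'a::euclidean_space set \<Rightarrow> nat \<Rightarrow> real" where
  "psi_eigenvalue \<psi> D \<equiv> eigenvalue D (psi_form \<psi> D)"

end

theory Submission
  imports Defs "HOL-Probability.Probability"
begin

text \<open>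
  For \<open>\<sigma> > 0\<close> the minimum of \<open>\<integral>|\<nabla>v|\<^sup>2 + \<sigma> \<integral>|u - v|\<^sup>2\<close> over \<open>v \<in> H\<^sup>1(\<real>\<^sup>d)\<close> is
  \<open>(2\<pi>)\<^sup>-\<^sup>d \<integral>\<sigma>|\<xi>|\<^sup>2 / (\<sigma> + |\<xi>|\<^sup>2) |Fu|\<^sup>2\<close>, attained at \<open>v = \<sigma> (\<sigma> - \<Delta>)\<^sup>-\<^sup>1 u\<close>.  Discarding the part of the
  integrals outside \<open>D\<close> leaves a Neumann problem, so for \<open>u\<close> orthogonal to the first \<open>n - 1\<close> Neumann
  eigenfunctions the minimum is at least \<open>\<sigma>\<mu> / (\<sigma> + \<mu>)\<close> with \<open>\<mu>\<close> the \<open>n\<close>th Neumann eigenvalue.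
  Integrating \<open>1 / \<sigma>\<close> times this against the measure representing \<open>\<psi>\<close> gives the lower bound.  Near minimisers
  of the Rayleigh quotient replace the Neumann eigenfunctions, so no compact embedding is involved.

  In the case of equality, a minimising sequence \<open>u\<^sub>k\<close> makes the discarded part, which controls the mass of
  \<open>v\<^sub>k\<close> outside \<open>D\<close>, tend to \<open>0\<close> for almost every \<open>\<sigma>\<close>.  Along a line the Fourier transforms of functions
  supported in \<open>D\<close> extend to entire functions, which form a normal family.  In the limit
  \<open>(\<sigma> + |\<xi>|\<^sup>2) Fv = \<sigma> Fu\<close> with both transforms entire, so \<open>Fu\<close> vanishes at the complex zeros of
  \<open>\<sigma> + |\<xi>|\<^sup>2\<close>.  As \<open>Fu\<close> is not identically zero, almost all \<open>\<sigma>\<close> lie in a set that is discrete in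
  \<open>(0,\<infinity>)\<close>, and \<open>\<psi>\<close> is meromorphic.

  The upper bound is Jensen's inequality for the concave function \<open>\<psi>\<close> and the density \<open>|Fu|\<^sup>2\<close>.  It is
  strict because the density of a unit vector of \<open>L\<^sup>2(D)\<close> is bounded and cannot concentrate on a sphere.
\<close>

subsection \<open>Positive semidefinite forms\<close>

text \<open>A minimising sequence for the lower bound consists of unit vectors from unrelated
  subspaces and may tend weakly to zero, so a limit argument could end with nothing. The strict
  upper bound excludes this: \<lambda> < \<psi>(\<mu>) with \<mu> the Dirichlet eigenvalue forces a
  fixed amount of Fourier mass into a ball, and transforms of unit vectors of L2(D) are uniformly
  Lipschitz, so some frequency survives. Strictness on the left thus rests on strictness on the
  right. The excess is small only in the mean over \<sigma>, hence the subsequence along which it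
  vanishes for almost every \<sigma>. One complex direction suffices: as \<sigma> varies, a zero of
  \<sigma> + |\<xi>|^2 on a complex line moves along a curve, so parameters accumulating in
  (0,\<infinity>) become accumulating zeros of one entire function. A single \<epsilon> governs the
  accuracy of the Rayleigh quotients, the window [\<epsilon>, 1/\<epsilon>] of parameters and the
  frequency cut-off 1/\<epsilon>. The linear term of \<psi> is the limit \<sigma> -> \<infinity> of
  \<sigma> |\<xi>|^2 / (\<sigma> + |\<xi>|^2) and is recovered from the end \<sigma> = 1/\<epsilon>
  of the window.\<close>

lemma homogeneous_system_nontrivial:
  fixes L :: "nat \<Rightarrow> 'i \<Rightarrow> 'b::field"
  assumes "finite I" "m < card I"
  shows "\<exists>c. (\<exists>i\<in>I. c i \<noteq> 0) \<and> (\<forall>j<m. (\<Sum>i\<in>I. c i * L j i) = 0)"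
  using assms
proof (induction m arbitrary: I L)
  case 0
  then have "I \<noteq> {}" by auto
  then show ?case by (intro exI[of _ "\<lambda>_. 1"]) auto
next
  case (Suc m)
  show ?case
  proof (cases "\<forall>i\<in>I. L m i = 0")
    case True
    from Suc.IH[of I L] Suc.prems obtain c where
      "\<exists>i\<in>I. c i \<noteq> 0" "\<forall>j<m. (\<Sum>i\<in>I. c i * L j i) = 0" by auto
    with True show ?thesis by (intro exI[of _ c]) (auto simp: less_Suc_eq)
  next
    case False
    then obtain p where p: "p \<in> I" "L m p \<noteq> 0" by auto
    \<comment> \<open>One step of Gaussian elimination: equation \<open>m\<close> serves to remove
      the unknown \<open>p\<close> from the others.\<close>
    define L' where "L' j i = L j i - L m i / L m p * L j p" for j i
    have "m < card (I - {p})" using Suc.prems p by simp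
    from Suc.IH[OF _ this, of L'] Suc.prems obtain c where
      c: "\<exists>i\<in>I - {p}. c i \<noteq> 0" "\<And>j. j < m \<Longrightarrow> (\<Sum>i\<in>I - {p}. c i * L' j i) = 0" by auto
    define S where "S = (\<Sum>i\<in>I - {p}. c i * L m i)"
    \<comment> \<open>Back substitution: this value at \<open>p\<close> solves equation
      \<open>m\<close>.\<close>
    define c' where "c' = c(p := - S / L m p)"
    have sum: "(\<Sum>i\<in>I. c' i * L j i) = (\<Sum>i\<in>I - {p}. c i * L j i) - S / L m p * L j p" for j
    proof -
      have "(\<Sum>i\<in>I. c' i * L j i) = c' p * L j p + (\<Sum>i\<in>I - {p}. c' i * L j i)"
        using p Suc.prems by (simp add: sum.remove)
      also have "(\<Sum>i\<in>I - {p}. c' i * L j i) = (\<Sum>i\<in>I - {p}. c i * L j i)"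
        by (intro sum.cong) (auto simp: c'_def)
      finally show ?thesis by (simp add: c'_def)
    qed
    have "(\<Sum>i\<in>I. c' i * L j i) = 0" if "j < Suc m" for j
    proof (cases "j = m")
      case True
      then show ?thesis using p by (simp add: sum S_def)
    next
      case False
      then have "(\<Sum>i\<in>I - {p}. c i * L' j i) = 0" using c(2) that by simp
      moreover have "(\<Sum>i\<in>I - {p}. c i * L' j i) =
        (\<Sum>i\<in>I - {p}. c i * L j i) - S / L m p * L j p"
        unfolding L'_def S_def
        by (simp add: algebra_simps sum_subtractf sum_distrib_left sum_distrib_right sum_divide_distrib)
      ultimately show ?thesis by (simp add: sum)
    qed
    moreover have "\<exists>i\<in>I. c' i \<noteq> 0" using c(1) by (auto simp: c'_def)
    ultimately show ?thesis by blast
  qed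
qed

text \<open>Vectors are functions rather than classes, so the form may be degenerate: an inner
  product on \<open>D\<close> sees neither null sets nor values outside \<open>D\<close>. The locale
  serves the inner product, the energy and the defect in Plancherel's identity alike.\<close>

locale psd_form =
  fixes V :: "('x \<Rightarrow> complex) set" and B :: "('x \<Rightarrow> complex) \<Rightarrow> ('x \<Rightarrow> complex) \<Rightarrow> complex"
  assumes zero: "(\<lambda>x. 0) \<in> V"
    and lin: "\<And>c f g. f \<in> V \<Longrightarrow> g \<in> V \<Longrightarrow> (\<lambda>x. c * f x + g x) \<in> V"
    and B_lin: "\<And>c f g h. f \<in> V \<Longrightarrow> g \<in> V \<Longrightarrow> h \<in> V \<Longrightarrow>
                  B (\<lambda>x. c * f x + g x) h = c * B f h + B g h"
    and B_cnj: "\<And>f g. f \<in> V \<Longrightarrow> g \<in> V \<Longrightarrow> B g f = cnj (B f g)"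
    and B_nonneg: "\<And>f. f \<in> V \<Longrightarrow> 0 \<le> Re (B f f)"
begin

abbreviation Q :: "('x \<Rightarrow> complex) \<Rightarrow> real" where "Q f \<equiv> Re (B f f)"

lemma Q_lin:
  assumes "f \<in> V" "g \<in> V"
  shows "Q (\<lambda>x. c * f x + g x) = (cmod c)\<^sup>2 * Q f + 2 * Re (c * B f g) + Q g"
proof -
  let ?h = "\<lambda>x. c * f x + g x"
  have h: "?h \<in> V" using assms lin by auto
  have "B ?h ?h = c * B f ?h + B g ?h" using B_lin assms h by blast
  also have "B f ?h = cnj (c * B f f + B g f)" using B_cnj[OF h assms(1)] B_lin assms by auto
  also have "B g ?h = cnj (c * B f g + B g g)" using B_cnj[OF h assms(2)] B_lin assms by auto
  finally have *: "B ?h ?h = c * cnj c * cnj (B f f) + c * cnj (B g f) + cnj (c * B f g) + cnj (B g g)"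
    by (simp add: algebra_simps)
  have "cnj (B g f) = B f g" using B_cnj[of f g] assms by simp
  moreover have "Re (c * cnj c * cnj (B f f)) = (cmod c)\<^sup>2 * Q f"
    by (simp add: complex_mult_cnj cmod_power2)
  ultimately show ?thesis unfolding * by (simp del: complex_cnj_mult)
qed

lemma Q_scale: assumes "f \<in> V" shows "Q (\<lambda>x. c * f x) = (cmod c)\<^sup>2 * Q f"
proof -
  have z: "B (\<lambda>x. 0) h = 0" if "h \<in> V" for h
    using B_lin[of h "\<lambda>x. 0" h 0] that zero B_lin[OF zero zero that, of 1] by simp
  have "B f (\<lambda>x. 0) = 0" using B_cnj[OF zero assms] z[OF assms] by simp
  then show ?thesis using Q_lin[OF assms zero, of c] z[OF zero] by simp
qed

lemma scale: "f \<in> V \<Longrightarrow> (\<lambda>x. c * f x) \<in> V"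
  using lin[OF _ zero, of f c] by simp

text \<open>The quadratic \<open>Q (c f + g)\<close> is tested with \<open>c\<close> a real multiple
  of the conjugate of \<open>B f g\<close>, which makes the mixed term real. As the form may be
  degenerate, the case \<open>Q f = 0\<close> is separate.\<close>

lemma Cauchy_Schwarz:
  assumes "f \<in> V" "g \<in> V"
  shows "(cmod (B f g))\<^sup>2 \<le> Q f * Q g"
proof -
  have ineq: "0 \<le> (cmod c)\<^sup>2 * Q f + 2 * Re (c * B f g) + Q g" for c
    using Q_lin[OF assms, of c] B_nonneg[OF lin[OF assms, of c]] by simp
  have r: "Re (complex_of_real t * cnj (B f g) * B f g) = t * (cmod (B f g))\<^sup>2" for t
    by (simp add: cmod_power2 algebra_simps flip: power2_eq_square)
  have r2: "(cmod (complex_of_real t * cnj (B f g)))\<^sup>2 = t\<^sup>2 * (cmod (B f g))\<^sup>2" for t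
    by (simp add: norm_mult power_mult_distrib)
  have main: "0 \<le> t\<^sup>2 * (cmod (B f g))\<^sup>2 * Q f + 2 * (t * (cmod (B f g))\<^sup>2) + Q g" for t
    using ineq[of "complex_of_real t * cnj (B f g)"] unfolding r r2 by simp
  show ?thesis
  proof (cases "Q f = 0")
    case True
    have "(cmod (B f g))\<^sup>2 = 0"
    proof (rule ccontr)
      assume "(cmod (B f g))\<^sup>2 \<noteq> 0"
      \<comment> \<open>With \<open>Q f = 0\<close> the bound is affine in \<open>t\<close>; this
        \<open>t\<close> would make it equal to -1.\<close>
      then have "2 * ((- (Q g + 1) / (2 * (cmod (B f g))\<^sup>2)) * (cmod (B f g))\<^sup>2) = - (Q g + 1)" by simp
      with main[of "- (Q g + 1) / (2 * (cmod (B f g))\<^sup>2)"] True show False by simp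
    qed
    with True show ?thesis by simp
  next
    case False
    then have pos: "0 < Q f" using B_nonneg[OF assms(1)] by simp
    \<comment> \<open>The choice \<open>t = - 1 / Q f\<close> minimises the quadratic in
      \<open>main\<close>.\<close>
    have "0 \<le> (cmod (B f g))\<^sup>2 / Q f - 2 * (cmod (B f g))\<^sup>2 / Q f + Q g"
      using main[of "- 1 / Q f"] pos by (simp add: power2_eq_square)
    with pos show ?thesis by (simp add: field_simps)
  qed
qed

lemma comb_in: "(\<And>i. i < n \<Longrightarrow> e i \<in> V) \<Longrightarrow> (\<lambda>x. \<Sum>i<(n::nat). c i * e i x) \<in> V"
proof (induction n)
  case (Suc n)
  have "(\<lambda>x. c n * e n x + (\<Sum>i<n. c i * e i x)) \<in> V" using Suc by (intro lin) auto
  then show ?case by (simp add: add.commute)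
qed (simp add: zero)

lemma B_comb:
  assumes "\<And>i. i < n \<Longrightarrow> e i \<in> V" "h \<in> V"
  shows "B (\<lambda>x. \<Sum>i<(n::nat). c i * e i x) h = (\<Sum>i<n. c i * B (e i) h)"
  using assms
proof (induction n)
  case 0
  then show ?case using B_lin[OF zero zero, of h 1] by simp
next
  case (Suc n)
  have "B (\<lambda>x. c n * e n x + (\<Sum>i<n. c i * e i x)) h = c n * B (e n) h + B (\<lambda>x. \<Sum>i<n. c i * e i x) h"
    using Suc by (intro B_lin comb_in) auto
  then show ?case using Suc by (simp add: add.commute)
qed

text \<open>By Cauchy-Schwarz a null vector is orthogonal to everything, so null vectors form a
  linear space. This is what upgrades the Plancherel inequality to an identity.\<close>

lemma kernel_add:
  assumes "f \<in> V" "g \<in> V" "Q f = 0"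
  shows "Q (\<lambda>x. c * f x + g x) = Q g"
proof -
  have "(cmod (B f g))\<^sup>2 \<le> 0" using Cauchy_Schwarz[OF assms(1,2)] assms(3) by simp
  then have "B f g = 0" by simp
  then show ?thesis using Q_lin[OF assms(1,2), of c] assms(3) by simp
qed

end

section \<open>Orthogonal splitting along approximate eigenvectors\<close>

lemma psd_form_subspace:
  assumes "psd_form V B" "W \<subseteq> V" "(\<lambda>x. 0) \<in> W"
    and "\<And>c f g. f \<in> W \<Longrightarrow> g \<in> W \<Longrightarrow> (\<lambda>x. c * f x + g x) \<in> W"
  shows "psd_form W B"
proof -
  interpret psd_form V B by fact
  show ?thesis
    using assms(2-) by unfold_locales (auto intro: B_lin B_cnj B_nonneg dest: subsetD)
qed

text \<open>
  A substitute for the spectral theorem: \<open>w\<close> is the component of \<open>v\<close> orthogonal to at most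
  \<open>n - 1\<close> approximate eigenvectors \<open>\<phi> i\<close>, which are picked as near minimisers of the Rayleigh quotient.
\<close>

lemma approximate_spectral_splitting:
  fixes V :: "('x \<Rightarrow> complex) set" and n :: nat
  assumes "psd_form V a" "psd_form V ip" "0 < \<delta>" "1 \<le> n"
    and "\<And>e. (\<And>i. i < n \<Longrightarrow> e i \<in> V) \<Longrightarrow>
           (\<And>c. Re (ip (\<lambda>x. \<Sum>i<n. c i * e i x) (\<lambda>x. \<Sum>i<n. c i * e i x)) = 0 \<Longrightarrow> \<forall>i<n. c i = 0) \<Longrightarrow>
           \<exists>c. let y = (\<lambda>x. \<Sum>i<n. c i * e i x) in
             0 < Re (ip y y) \<and> \<mu> * Re (ip y y) \<le> Re (a y y)"
  shows "\<exists>m \<phi>. m < n \<and> (\<forall>i<m. \<phi> i \<in> V) \<and>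
     (\<forall>v\<in>V. \<exists>d s. s \<ge> 0 \<and>
        (let w = (\<lambda>x. v x + (\<Sum>i<m. d i * \<phi> i x)) in
          Re (ip v v) = Re (ip w w) + s \<and> Re (a v v) \<ge> (\<mu> - \<delta>) * Re (ip w w) - \<delta> * s))"
  using assms
proof (induction n arbitrary: V \<mu> \<delta>)
  case 0
  then show ?case by simp
next
  case (Suc n)
  interpret A: psd_form V a by fact
  interpret I: psd_form V ip by fact
  \<comment> \<open>If the Rayleigh quotient is at least \<open>\<mu> - \<delta>\<close> throughout,
    nothing is split off: \<open>m = 0\<close>, \<open>w = v\<close>, \<open>s = 0\<close>.\<close>
  have trivial: ?case if "\<And>v. v \<in> V \<Longrightarrow> (\<mu> - \<delta>) * I.Q v \<le> A.Q v"
    by (rule exI[of _ 0], rule exI[of _ "\<lambda>_ _. 0"]) (use that in \<open>auto intro!: exI[of _ 0]\<close>)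
  show ?case
  proof (cases "\<forall>v\<in>V. (\<mu> - \<delta>) * I.Q v \<le> A.Q v")
    case True
    then show ?thesis using trivial by blast
  next
    case False
    then obtain v1 where v1: "v1 \<in> V" "A.Q v1 < (\<mu> - \<delta>) * I.Q v1" by force
    have "0 \<le> A.Q v1" using A.B_nonneg v1 by blast
    then have "0 < (\<mu> - \<delta>) * I.Q v1" using v1 by simp
    with I.B_nonneg[OF v1(1)] have Qv1: "0 < I.Q v1" and mu: "\<delta> < \<mu>"
      by (auto simp: zero_less_mult_iff)
    define S where "S = A.Q ` {v \<in> V. I.Q v = 1}"
    have normed: "\<exists>c>0. I.Q (\<lambda>x. complex_of_real c * v x) = 1 \<and> A.Q (\<lambda>x. complex_of_real c * v x) = A.Q v / I.Q v"
      if "v \<in> V" "0 < I.Q v" for v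
    proof -
      define c where "c = 1 / sqrt (I.Q v)"
      have "0 < c" using that(2) by (simp add: c_def)
      have c2: "(cmod (complex_of_real c))\<^sup>2 = 1 / I.Q v"
        using that(2) unfolding c_def by (simp add: norm_divide power_divide)
      have "I.Q (\<lambda>x. complex_of_real c * v x) = 1"
        using I.Q_scale[OF that(1), of "complex_of_real c"] that(2) unfolding c2 by simp
      moreover have "A.Q (\<lambda>x. complex_of_real c * v x) = A.Q v / I.Q v"
        using A.Q_scale[OF that(1), of "complex_of_real c"] unfolding c2 by simp
      ultimately show ?thesis using \<open>0 < c\<close> by blast
    qed
    obtain c1 where c1: "I.Q (\<lambda>x. complex_of_real c1 * v1 x) = 1"
      "A.Q (\<lambda>x. complex_of_real c1 * v1 x) = A.Q v1 / I.Q v1"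
      using normed[OF v1(1) Qv1] by auto
    have Sne: "A.Q v1 / I.Q v1 \<in> S"
      unfolding S_def by (rule image_eqI[where x = "\<lambda>x. complex_of_real c1 * v1 x"])
        (use c1 I.scale[OF v1(1)] in auto)
    have bdd: "bdd_below S" unfolding S_def by (rule bdd_belowI[of _ 0]) (auto intro: A.B_nonneg)
    define l where "l = Inf S"
    have l_le: "l \<le> A.Q v / I.Q v" if "v \<in> V" "0 < I.Q v" for v
    proof -
      obtain c where c: "I.Q (\<lambda>x. complex_of_real c * v x) = 1"
        "A.Q (\<lambda>x. complex_of_real c * v x) = A.Q v / I.Q v" using normed[OF \<open>v \<in> V\<close> \<open>0 < I.Q v\<close>] by auto
      then have "A.Q v / I.Q v \<in> S"
        unfolding S_def by (intro image_eqI[where x = "\<lambda>x. complex_of_real c * v x"])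
          (use c I.scale[OF that(1)] in auto)
      then show ?thesis unfolding l_def using bdd by (rule cInf_lower)
    qed
    have l_ge0: "0 \<le> l" unfolding l_def using Sne
      by (intro cInf_greatest) (auto simp: S_def intro: A.B_nonneg)
    have l_mu: "l \<le> \<mu> - \<delta>"
    proof -
      have "A.Q v1 / I.Q v1 < \<mu> - \<delta>" using v1(2) Qv1 by (subst pos_divide_less_eq) auto
      with l_le[OF v1(1) Qv1] show ?thesis by simp
    qed
    have l_form: "l * I.Q v \<le> A.Q v" if "v \<in> V" for v
      using l_le[OF that] I.B_nonneg[OF that] A.B_nonneg[OF that]
      by (cases "I.Q v = 0") (auto simp: field_simps)
    \<comment> \<open>The near minimiser misses the infimum by less than
      \<open>\<kappa>\<^sup>2\<close>, and Cauchy-Schwarz takes a square root, so that cross terms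
      cost a factor \<open>\<kappa>\<close>. The three bounds keep the sum of all losses below
      \<open>\<delta>\<close>.\<close>
    define \<kappa> where "\<kappa> = min (1/2) (min (\<delta> / 4) (\<delta> / (4 * \<mu>)))"
    have \<kappa>: "0 < \<kappa>" "\<kappa> \<le> 1/2" "\<kappa> \<le> \<delta> / 4" "\<kappa> * \<mu> \<le> \<delta> / 4"
    proof -
      show "0 < \<kappa>" "\<kappa> \<le> 1/2" "\<kappa> \<le> \<delta> / 4" using mu Suc.prems(3) by (auto simp: \<kappa>_def)
      have "\<kappa> \<le> \<delta> / (4 * \<mu>)" by (auto simp: \<kappa>_def)
      then show "\<kappa> * \<mu> \<le> \<delta> / 4" using mu Suc.prems(3) by (simp add: field_simps)
    qed
    have "\<exists>s\<in>S. s < l + \<kappa>\<^sup>2"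
      unfolding l_def using Sne bdd \<kappa>(1) by (subst cInf_less_iff[symmetric]) auto
    then obtain f0 where f0: "f0 \<in> V" "I.Q f0 = 1" "A.Q f0 < l + \<kappa>\<^sup>2" by (auto simp: S_def)
    have if0: "ip f0 f0 = 1"
      using I.B_cnj[OF f0(1) f0(1)] f0(2) by (simp add: complex_eq_iff)
    define W where "W = {y \<in> V. ip y f0 = 0}"
    have ipz: "ip (\<lambda>x. 0) f0 = 0" using I.B_lin[OF I.zero I.zero f0(1), of 1] by simp
    have W: "W \<subseteq> V" "(\<lambda>x. 0) \<in> W" "\<And>c f g. f \<in> W \<Longrightarrow> g \<in> W \<Longrightarrow> (\<lambda>x. c * f x + g x) \<in> W"
      using I.zero ipz f0(1) by (auto simp: W_def I.lin I.B_lin)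
    have WA: "psd_form W a" by (rule psd_form_subspace[OF _ W]) fact
    have WI: "psd_form W ip" by (rule psd_form_subspace[OF _ W]) fact
    have cross0: "ip f0 y = 0" if "y \<in> W" for y
      using that I.B_cnj[of y f0] f0(1) by (auto simp: W_def)
    \<comment> \<open>Since \<open>l\<close> is the infimum of the Rayleigh quotient, this
      difference is again semidefinite. Its Cauchy-Schwarz inequality makes \<open>a f0 y\<close>
      small for \<open>y\<close> orthogonal to \<open>f0\<close>; for an exact eigenvector it would
      vanish.\<close>
    have "psd_form V (\<lambda>f g. a f g - of_real l * ip f g)"
    proof
      show "(\<lambda>x. 0) \<in> V" by (rule A.zero)
    next
      fix c f g assume "f \<in> V" "g \<in> V"
      then show "(\<lambda>x. c * f x + g x) \<in> V" by (rule A.lin)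
    next
      fix c f g h assume h: "f \<in> V" "g \<in> V" "h \<in> V"
      show "a (\<lambda>x. c * f x + g x) h - of_real l * ip (\<lambda>x. c * f x + g x) h =
        c * (a f h - of_real l * ip f h) + (a g h - of_real l * ip g h)"
        unfolding A.B_lin[OF h] I.B_lin[OF h] by (simp add: algebra_simps)
    next
      fix f g assume h: "f \<in> V" "g \<in> V"
      show "a g f - of_real l * ip g f = cnj (a f g - of_real l * ip f g)"
        unfolding A.B_cnj[OF h] I.B_cnj[OF h] by simp
    next
      fix f assume "f \<in> V"
      then show "0 \<le> Re (a f f - of_real l * ip f f)" using l_form by simp
    qed
    then interpret D: psd_form V "\<lambda>f g. a f g - of_real l * ip f g" .
    have cross: "2 * (cmod c * cmod (a f0 y)) \<le> \<kappa> * ((cmod c)\<^sup>2 + A.Q y)" if "y \<in> W" for y c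
    proof -
      have y: "y \<in> V" using that W by auto
      have "(cmod (a f0 y))\<^sup>2 \<le> (A.Q f0 - l) * (A.Q y - l * I.Q y)"
        using D.Cauchy_Schwarz[OF f0(1) y] cross0[OF that] f0(2) by simp
      also have "\<dots> \<le> \<kappa>\<^sup>2 * A.Q y"
        using f0(3) l_form[OF y] l_form[OF f0(1)] f0(2) l_ge0 I.B_nonneg[OF y] \<kappa>
        by (intro mult_mono) auto
      finally have "(cmod (a f0 y))\<^sup>2 \<le> (\<kappa> * sqrt (A.Q y))\<^sup>2"
        using A.B_nonneg[OF y] by (simp add: power_mult_distrib)
      then have *: "cmod (a f0 y) \<le> \<kappa> * sqrt (A.Q y)"
        using \<kappa> A.B_nonneg[OF y] by (meson mult_nonneg_nonneg order_less_imp_le power2_le_imp_le real_sqrt_ge_0_iff)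
      have "2 * (cmod c * cmod (a f0 y)) \<le> 2 * (cmod c * (\<kappa> * sqrt (A.Q y)))"
        using * by (simp add: mult_left_mono)
      also have "\<dots> = \<kappa> * (2 * cmod c * sqrt (A.Q y))" by simp
      also have "\<dots> \<le> \<kappa> * ((cmod c)\<^sup>2 + (sqrt (A.Q y))\<^sup>2)"
        using \<kappa> sum_squares_bound[of "cmod c" "sqrt (A.Q y)"] by (intro mult_left_mono) auto
      finally show ?thesis using A.B_nonneg[OF y] by simp
    qed
    have reBound: "\<bar>Re (c * a f0 y)\<bar> \<le> cmod c * cmod (a f0 y)" for c y
      by (metis abs_Re_le_cmod norm_mult)
    \<comment> \<open>The level that survives on the orthogonal complement \<open>W\<close>: since
      \<open>\<kappa> * \<mu> \<le> \<delta> / 4\<close>, one has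
      \<open>(1 + \<kappa>) * \<mu>' \<le> \<mu>\<close>.\<close>
    define \<mu>' where "\<mu>' = \<mu> - \<delta> / 2"
    \<comment> \<open>With a single vector allowed, the hypothesis applied to \<open>v1\<close>
      itself contradicts its small Rayleigh quotient.\<close>
    have n1: "1 \<le> n"
    proof (rule ccontr)
      assume "\<not> 1 \<le> n"
      then have n0: "n = 0" by simp
      have "\<exists>c. let y = (\<lambda>x. \<Sum>i<Suc n. c i * (\<lambda>i::nat. v1) i x) in
             0 < I.Q y \<and> \<mu> * I.Q y \<le> A.Q y"
        by (rule Suc.prems(5)) (use n0 v1 Qv1 in \<open>simp_all add: I.Q_scale\<close>)
      then obtain c where "0 < (cmod (c 0))\<^sup>2 * I.Q v1"
        "\<mu> * ((cmod (c 0))\<^sup>2 * I.Q v1) \<le> (cmod (c 0))\<^sup>2 * A.Q v1"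
        using n0 v1 by (auto simp: I.Q_scale A.Q_scale)
      then have "0 < (cmod (c 0))\<^sup>2" "(cmod (c 0))\<^sup>2 * (\<mu> * I.Q v1) \<le> (cmod (c 0))\<^sup>2 * A.Q v1"
        by (auto simp: zero_less_mult_iff algebra_simps)
      then have "\<mu> * I.Q v1 \<le> A.Q v1" by simp
      moreover have "(\<mu> - \<delta>) * I.Q v1 \<le> \<mu> * I.Q v1" using Qv1 Suc.prems(3) by (simp add: mult_right_mono)
      ultimately show False using v1(2) by linarith
    qed
    \<comment> \<open>The hypothesis passes to \<open>W\<close> by prepending \<open>f0\<close> to
      the given functions. In the resulting combination the component along \<open>f0\<close> has
      Rayleigh quotient at most about \<open>\<mu> - \<delta>\<close>, so the component in
      \<open>W\<close> must make up for it.\<close>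
    have H': "\<exists>c. let y = (\<lambda>x. \<Sum>i<n. c i * e i x) in 0 < I.Q y \<and> \<mu>' * I.Q y \<le> A.Q y"
      if e: "\<And>i. i < n \<Longrightarrow> e i \<in> W"
        and ind: "\<And>c. I.Q (\<lambda>x. \<Sum>i<n. c i * e i x) = 0 \<Longrightarrow> \<forall>i<n. c i = 0" for e
    proof -
      define e' where "e' = (\<lambda>i. case i of 0 \<Rightarrow> f0 | Suc j \<Rightarrow> e j)"
      have comb: "(\<lambda>x. \<Sum>i<Suc n. c i * e' i x) = (\<lambda>x. c 0 * f0 x + (\<Sum>i<n. c (Suc i) * e i x))" for c
        by (simp add: sum.lessThan_Suc_shift e'_def del: sum.lessThan_Suc)
      have yW: "(\<lambda>x. \<Sum>i<n. c i * e i x) \<in> W" for c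
        using psd_form.comb_in[OF WI, of n e] e by blast
      have Qz: "I.Q (\<lambda>x. c * f0 x + y x) = (cmod c)\<^sup>2 + I.Q y" if "y \<in> W" for c y
        using I.Q_lin[OF f0(1) subsetD[OF W(1) that], of c] cross0[OF that] f0(2) by simp
      have e'V: "e' i \<in> V" if "i < Suc n" for i
        using f0(1) subsetD[OF W(1) e] that by (cases i) (simp_all add: e'_def)
      have ind': "\<forall>i<Suc n. c i = 0" if Q0: "I.Q (\<lambda>x. \<Sum>i<Suc n. c i * e' i x) = 0" for c
      proof -
        define y where "y = (\<lambda>x. \<Sum>i<n. c (Suc i) * e i x)"
        have yW': "y \<in> W" unfolding y_def by (rule yW[of "\<lambda>i. c (Suc i)"])
        have cc: "(\<lambda>x. \<Sum>i<Suc n. c i * e' i x) = (\<lambda>x. c 0 * f0 x + y x)"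
          unfolding y_def by (rule comb[of c])
        have "I.Q (\<lambda>x. c 0 * f0 x + y x) = 0" using Q0 unfolding cc .
        then have "(cmod (c 0))\<^sup>2 + I.Q y = 0" using Qz[OF yW', of "c 0"] by linarith
        moreover have "0 \<le> I.Q y" using I.B_nonneg[OF subsetD[OF W(1) yW']] .
        ultimately have z: "(cmod (c 0))\<^sup>2 = 0" and "I.Q y = 0"
          using zero_le_power2[of "cmod (c 0)"] by linarith+
        then have z': "I.Q (\<lambda>x. \<Sum>i<n. c (Suc i) * e i x) = 0" unfolding y_def by -
        have c0: "c 0 = 0" using z by (simp only: power_eq_0_iff norm_eq_zero)
        have cs: "\<forall>i<n. c (Suc i) = 0" using ind[of "\<lambda>i. c (Suc i)"] z' by blast
        show "\<forall>i<Suc n. c i = 0"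
        proof (intro allI impI)
          fix i assume "i < Suc n" then show "c i = 0" using c0 cs[THEN spec, of "i - 1"]
            by (cases "i = 0") auto
        qed
      qed
      have "\<exists>c. let y = (\<lambda>x. \<Sum>i<Suc n. c i * e' i x) in 0 < I.Q y \<and> \<mu> * I.Q y \<le> A.Q y"
        by (rule Suc.prems(5)[OF e'V ind'])
      then obtain c where c: "0 < I.Q (\<lambda>x. c 0 * f0 x + (\<Sum>i<n. c (Suc i) * e i x))"
        "\<mu> * I.Q (\<lambda>x. c 0 * f0 x + (\<Sum>i<n. c (Suc i) * e i x)) \<le> A.Q (\<lambda>x. c 0 * f0 x + (\<Sum>i<n. c (Suc i) * e i x))"
        unfolding comb by (auto simp: Let_def)
      define y where "y = (\<lambda>x. \<Sum>i<n. c (Suc i) * e i x)"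
      have y: "y \<in> W" "y \<in> V" using yW W(1) by (auto simp: y_def)
      define t where "t = (cmod (c 0))\<^sup>2"
      have t0: "0 \<le> t" by (simp add: t_def)
      have z1: "0 < t + I.Q y" and z2: "\<mu> * (t + I.Q y) \<le> A.Q (\<lambda>x. c 0 * f0 x + y x)"
      proof -
        have e1: "(\<lambda>x. c 0 * f0 x + (\<Sum>i<n. c (Suc i) * e i x)) = (\<lambda>x. c 0 * f0 x + y x)"
          by (simp add: y_def)
        show "0 < t + I.Q y" "\<mu> * (t + I.Q y) \<le> A.Q (\<lambda>x. c 0 * f0 x + y x)"
          using c[unfolded e1] unfolding Qz[OF y(1)] t_def by auto
      qed
      have "A.Q (\<lambda>x. c 0 * f0 x + y x) = t * A.Q f0 + 2 * Re (c 0 * a f0 y) + A.Q y"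
        using A.Q_lin[OF f0(1) y(2)] by (simp add: t_def)
      also have "\<dots> \<le> t * (\<mu> - \<delta> + \<kappa>\<^sup>2) + \<kappa> * (t + A.Q y) + A.Q y"
        using cross[OF y(1), of "c 0"] reBound[of "c 0" y] l_mu f0(3) t0
          mult_left_mono[of "A.Q f0" "\<mu> - \<delta> + \<kappa>\<^sup>2" t] by (auto simp: t_def)
      finally have up: "\<mu> * (t + I.Q y) \<le> t * (\<mu> - \<delta> + \<kappa>\<^sup>2 + \<kappa>) + (1 + \<kappa>) * A.Q y"
        using z2 by (simp add: algebra_simps)
      have "\<kappa>\<^sup>2 \<le> \<kappa>" using \<kappa> by (simp add: power2_eq_square)
      then have coef: "\<mu> - \<delta> + \<kappa>\<^sup>2 + \<kappa> \<le> \<mu> - \<delta> / 2" using \<kappa> by simp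
      \<comment> \<open>The surplus \<open>\<delta> / 2 * t\<close> is what rules out
        \<open>I.Q y = 0\<close> below.\<close>
      have main: "\<mu> * I.Q y + \<delta> / 2 * t \<le> (1 + \<kappa>) * A.Q y"
        using up mult_left_mono[OF coef t0] by (simp add: algebra_simps)
      have "0 < I.Q y"
      proof (rule ccontr)
        assume "\<not> 0 < I.Q y"
        then have "I.Q y = 0" using I.B_nonneg[OF y(2)] by simp
        then have "\<forall>i<n. c (Suc i) = 0" using ind[of "\<lambda>i. c (Suc i)"] unfolding y_def by blast
        then have "y = (\<lambda>x. 0)" unfolding y_def by (intro ext sum.neutral) auto
        moreover have "A.Q (\<lambda>x. 0) = 0"
          using A.B_lin[OF A.zero A.zero A.zero, of 1] by simp
        ultimately have "\<delta> * t \<le> 0" "0 < t" using main z1 \<open>I.Q y = 0\<close> by simp_all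
        then show False using mult_pos_pos[OF Suc.prems(3), of t] by simp
      qed
      moreover have "\<mu>' * I.Q y \<le> A.Q y"
      proof (rule ccontr)
        assume "\<not> ?thesis"
        then have "(1 + \<kappa>) * A.Q y < (1 + \<kappa>) * (\<mu>' * I.Q y)" using \<kappa> by simp
        also have "\<dots> \<le> \<mu> * I.Q y"
        proof -
          have "(1 + \<kappa>) * \<mu>' = \<mu> - \<delta> / 2 + \<kappa> * \<mu> - \<kappa> * \<delta> / 2" by (simp add: \<mu>'_def algebra_simps)
          also have "\<dots> \<le> \<mu>" using \<kappa>(4) mult_pos_pos[OF \<kappa>(1) Suc.prems(3)] Suc.prems(3) by linarith
          finally have "(1 + \<kappa>) * \<mu>' \<le> \<mu>" .
          from mult_right_mono[OF this less_imp_le[OF \<open>0 < I.Q y\<close>]] show ?thesis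
            by (simp only: mult.assoc)
        qed
        finally show False using main t0 Suc.prems(3) mult_nonneg_nonneg[of "\<delta> / 2" t] by linarith
      qed
      ultimately show ?thesis
        by (intro exI[of _ "\<lambda>i. c (Suc i)"]) (simp add: y_def Let_def)
    qed
    have "0 < \<delta> / 4" using Suc.prems(3) by simp
    \<comment> \<open>The budget is \<open>\<delta> / 2\<close> for the drop to
      \<open>\<mu>'\<close>, \<open>\<delta> / 4\<close> for the induction and
      \<open>\<delta> / 4\<close> for \<open>\<kappa> * \<mu>\<close>.\<close>
    have "\<exists>m \<phi>. m < n \<and> (\<forall>i<m. \<phi> i \<in> W) \<and> (\<forall>v\<in>W. \<exists>d s. s \<ge> 0 \<and>
        (let w = (\<lambda>x. v x + (\<Sum>i<m. d i * \<phi> i x)) in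
          I.Q v = I.Q w + s \<and> A.Q v \<ge> (\<mu>' - \<delta> / 4) * I.Q w - \<delta> / 4 * s))"
      by (rule Suc.IH[OF WA WI \<open>0 < \<delta> / 4\<close> n1], rule H') assumption+
    then obtain m \<phi> where m0: "m < n \<and> (\<forall>i<m. \<phi> i \<in> W) \<and> (\<forall>v\<in>W. \<exists>d s. s \<ge> 0 \<and>
        (let w = (\<lambda>x. v x + (\<Sum>i<m. d i * \<phi> i x)) in
          I.Q v = I.Q w + s \<and> A.Q v \<ge> (\<mu>' - \<delta> / 4) * I.Q w - \<delta> / 4 * s))"
      by (elim exE) (rule that)
    then have m: "m < n" "\<And>i. i < m \<Longrightarrow> \<phi> i \<in> W" by auto
    note split = m0[THEN conjunct2, THEN conjunct2, rule_format]
    define \<psi> where "\<psi> = (\<lambda>i. case i of 0 \<Rightarrow> f0 | Suc j \<Rightarrow> \<phi> j)"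
    show ?thesis
    proof (rule exI[of _ "Suc m"], rule exI[of _ \<psi>], intro conjI ballI allI impI)
      show "Suc m < Suc n" using m by simp
      fix i assume "i < Suc m" then show "\<psi> i \<in> V"
        using f0 m W(1) by (auto simp: \<psi>_def split: nat.split)
    next
      fix v assume v: "v \<in> V"
      define c where "c = ip v f0"
      \<comment> \<open>The projection of \<open>v\<close> to \<open>W\<close>. In the end
        \<open>s\<close> collects the squared components along all vectors split off, here
        \<open>t\<close> and the \<open>s\<close> of the induction.\<close>
      define y where "y = (\<lambda>x. - c * f0 x + v x)"
      have y: "y \<in> W" "y \<in> V"
        using v f0 if0 I.lin[OF f0(1) v, of "-c"] I.B_lin[OF f0(1) v f0(1), of "-c"]
        by (auto simp: W_def y_def c_def)
      have vy: "v = (\<lambda>x. c * f0 x + y x)" by (auto simp: y_def)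
      obtain d s where ds: "s \<ge> 0" "I.Q y = I.Q (\<lambda>x. y x + (\<Sum>i<m. d i * \<phi> i x)) + s"
        "(\<mu>' - \<delta> / 4) * I.Q (\<lambda>x. y x + (\<Sum>i<m. d i * \<phi> i x)) - \<delta> / 4 * s \<le> A.Q y"
        using split[OF y(1)] unfolding Let_def by (elim exE conjE) (rule that)
      define w where "w = (\<lambda>x. y x + (\<Sum>i<m. d i * \<phi> i x))"
      define d' where "d' = (\<lambda>i. case i of 0 \<Rightarrow> - c | Suc j \<Rightarrow> d j)"
      have w: "(\<lambda>x. v x + (\<Sum>i<Suc m. d' i * \<psi> i x)) = w"
        by (simp add: sum.lessThan_Suc_shift \<psi>_def d'_def w_def y_def fun_eq_iff del: sum.lessThan_Suc)
      define t where "t = (cmod c)\<^sup>2"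
      have t0: "0 \<le> t" by (simp add: t_def)
      have Qv: "I.Q v = t + I.Q y"
        using I.Q_lin[OF f0(1) y(2), of c] cross0[OF y(1)] f0(2) by (simp add: vy[symmetric] t_def)
      have "(\<lambda>x. \<Sum>i<m. d i * \<phi> i x) \<in> V"
        using m W(1) by (intro I.comb_in) auto
      from I.lin[OF y(2) this, of 1] have wV: "w \<in> V" by (simp add: w_def)
      have X0: "0 \<le> I.Q w" using I.B_nonneg[OF wV] .
      have "A.Q v = t * A.Q f0 + 2 * Re (c * a f0 y) + A.Q y"
        using A.Q_lin[OF f0(1) y(2), of c] by (simp add: vy[symmetric] t_def)
      \<comment> \<open>The energy of the component along \<open>f0\<close> is dropped. Only the
        cross term is paid for, and this is why the conclusion has \<open>- \<delta> * s\<close>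
        instead of a positive contribution.\<close>
      also have "\<dots> \<ge> 0 - \<kappa> * (t + A.Q y) + A.Q y"
        using cross[OF y(1), of c] reBound[of c y] A.B_nonneg[OF f0(1)] t0
          mult_nonneg_nonneg[OF t0 A.B_nonneg[OF f0(1)]] unfolding t_def by linarith
      finally have 1: "(1 - \<kappa>) * A.Q y - \<kappa> * t \<le> A.Q v" by (simp add: algebra_simps)
      have 2: "(1 - \<kappa>) * ((\<mu>' - \<delta> / 4) * I.Q w - \<delta> / 4 * s) \<le> (1 - \<kappa>) * A.Q y"
        using ds(3) \<kappa> by (intro mult_left_mono) (auto simp: w_def)
      have 3: "(\<mu> - \<delta>) * I.Q w \<le> (1 - \<kappa>) * (\<mu>' - \<delta> / 4) * I.Q w"
      proof (rule mult_right_mono[OF _ X0])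
        have "(1 - \<kappa>) * (\<mu>' - \<delta> / 4) = \<mu> - 3 * \<delta> / 4 - \<kappa> * \<mu> + \<kappa> * (3 * \<delta> / 4)"
          by (simp add: \<mu>'_def field_simps)
        moreover have "0 \<le> \<kappa> * (3 * \<delta> / 4)" using \<kappa> Suc.prems(3) by simp
        ultimately show "\<mu> - \<delta> \<le> (1 - \<kappa>) * (\<mu>' - \<delta> / 4)" using \<kappa> Suc.prems(3) by linarith
      qed
      have 4: "(1 - \<kappa>) * (\<delta> / 4 * s) \<le> \<delta> * s"
      proof -
        have "(1 - \<kappa>) * (\<delta> / 4 * s) \<le> 1 * (\<delta> / 4 * s)"
          using \<kappa> ds(1) Suc.prems(3) by (intro mult_right_mono) auto
        also have "\<dots> \<le> \<delta> * s" using ds(1) Suc.prems(3) by simp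
        finally show ?thesis .
      qed
      have 5: "\<kappa> * t \<le> \<delta> * t" using \<kappa> t0 by (intro mult_right_mono) auto
      have "(\<mu> - \<delta>) * I.Q w - \<delta> * (t + s) \<le> A.Q v"
      proof -
        have "(1 - \<kappa>) * ((\<mu>' - \<delta> / 4) * I.Q w - \<delta> / 4 * s)
            = (1 - \<kappa>) * (\<mu>' - \<delta> / 4) * I.Q w - (1 - \<kappa>) * (\<delta> / 4 * s)"
          by (simp add: algebra_simps)
        moreover have "\<delta> * (t + s) = \<delta> * t + \<delta> * s" by (simp add: algebra_simps)
        ultimately show ?thesis using 1 2 3 4 5 by linarith
      qed
      moreover have "I.Q v = I.Q w + (t + s)" using Qv ds(2) by (simp add: w_def)
      ultimately show "\<exists>d s. s \<ge> 0 \<and> (let w = (\<lambda>x. v x + (\<Sum>i<Suc m. d i * \<psi> i x)) in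
          I.Q v = I.Q w + s \<and> A.Q v \<ge> (\<mu> - \<delta>) * I.Q w - \<delta> * s)"
        using t0 ds(1) w by (intro exI[of _ d'] exI[of _ "t + s"]) (simp add: Let_def del: sum.lessThan_Suc)
    qed
  qed
qed

subsection \<open>The Fourier transform and Plancherel's theorem\<close>

lemma integrable_dominated:
  fixes g :: "_ \<Rightarrow> 'b::{banach, second_countable_topology}" and f :: "_ \<Rightarrow> real"
  assumes "integrable M f" "g \<in> borel_measurable M" "\<And>x. norm (g x) \<le> f x"
  shows "integrable M g"
  by (rule Bochner_Integration.integrable_bound[OF assms(1,2)])
     (use assms(3) in \<open>auto intro!: AE_I2 order_trans[OF _ abs_ge_self]\<close>)

lemma borel_measurable_cnj [measurable (raw)]:
  "f \<in> borel_measurable M \<Longrightarrow> (\<lambda>x. cnj (f x)) \<in> borel_measurable M"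
  by (rule measurable_compose[OF _ borel_measurable_continuous_onI]) (auto intro: continuous_intros)

lemma ennreal_norm_integral_le:
  fixes f :: "_ \<Rightarrow> 'b::{banach, second_countable_topology}"
  shows "ennreal (norm (integral\<^sup>L M f)) \<le> (\<integral>\<^sup>+x. ennreal (norm (f x)) \<partial>M)"
  by (cases "integrable M f") (auto intro: integral_norm_bound_ennreal simp: not_integrable_integral_eq)

lemma lborel_integral_prod:
  fixes f :: "'a::euclidean_space \<Rightarrow> real \<Rightarrow> complex"
  assumes "\<And>b. b \<in> Basis \<Longrightarrow> integrable lborel (f b)"
  shows "integrable lborel (\<lambda>x::'a. \<Prod>b\<in>Basis. f b (x \<bullet> b))"
    and "(\<integral>x. (\<Prod>b\<in>Basis. f b ((x::'a) \<bullet> b)) \<partial>lborel) = (\<Prod>b\<in>Basis. \<integral>x. f b x \<partial>lborel)"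
proof -
  interpret product_sigma_finite "\<lambda>_::'a. lborel :: real measure" ..
  have [measurable]: "f b \<in> borel_measurable borel" if "b \<in> Basis" for b
    using assms[OF that] by simp
  have meas: "(\<lambda>x::'a. \<Prod>b\<in>Basis. f b (x \<bullet> b)) \<in> borel_measurable borel" by measurable
  have m2: "(\<lambda>g. \<Sum>b\<in>Basis. g b *\<^sub>R b) \<in> measurable (\<Pi>\<^sub>M b\<in>(Basis :: 'a set). (lborel :: real measure)) (borel :: 'a measure)"
    by measurable
  have eq: "(\<Prod>b\<in>Basis. f b ((\<Sum>b\<in>Basis. g b *\<^sub>R b) \<bullet> b)) = (\<Prod>b\<in>Basis. f b (g b))"
    for g :: "'a \<Rightarrow> real"
    by (intro prod.cong refl) simp
  show "integrable lborel (\<lambda>x::'a. \<Prod>b\<in>Basis. f b (x \<bullet> b))"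
    apply (subst lborel_eq)
    apply (subst integrable_distr_eq[OF m2 meas])
    unfolding eq using assms by (intro product_integrable_prod) auto
  show "(\<integral>x. (\<Prod>b\<in>Basis. f b ((x::'a) \<bullet> b)) \<partial>lborel) = (\<Prod>b\<in>Basis. \<integral>x. f b x \<partial>lborel)"
    apply (subst lborel_eq)
    apply (subst integral_distr[OF m2 meas])
    unfolding eq using assms by (intro product_integral_prod) auto
qed

lemma lborel_integral_affine:
  fixes f :: "'a::euclidean_space \<Rightarrow> complex"
  assumes [measurable]: "f \<in> borel_measurable borel" and "c \<noteq> 0"
  shows "(\<integral>x. f x \<partial>lborel) = of_real (\<bar>c\<bar> ^ DIM('a)) * (\<integral>x. f (t + c *\<^sub>R x) \<partial>lborel)"
proof -
  have "(\<integral>x. f x \<partial>lborel) = (\<integral>x. f x \<partial>density (distr lborel borel (\<lambda>x. t + c *\<^sub>R x)) (\<lambda>_. ennreal (\<bar>c\<bar> ^ DIM('a))))"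
    by (subst lborel_affine[OF assms(2), of t]) simp
  also have "\<dots> = (\<integral>x. (\<bar>c\<bar> ^ DIM('a)) *\<^sub>R f x \<partial>distr lborel borel (\<lambda>x. t + c *\<^sub>R x))"
    by (subst integral_density) auto
  also have "\<dots> = (\<integral>x. (\<bar>c\<bar> ^ DIM('a)) *\<^sub>R f (t + c *\<^sub>R x) \<partial>lborel)"
    by (subst integral_distr) auto
  also have "\<dots> = of_real (\<bar>c\<bar> ^ DIM('a)) * (\<integral>x. f (t + c *\<^sub>R x) \<partial>lborel)"
    by (simp add: scaleR_conv_of_real)
  finally show ?thesis .
qed

lemma lborel_integrable_affine:
  fixes f :: "'a::euclidean_space \<Rightarrow> 'b::{banach, second_countable_topology}"
  assumes "integrable lborel f" and "c \<noteq> 0"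
  shows "integrable lborel (\<lambda>x. f (t + c *\<^sub>R x))"
proof -
  have [measurable]: "f \<in> borel_measurable borel" using assms(1) by simp
  have "integrable (density (distr lborel borel (\<lambda>x. t + c *\<^sub>R x)) (\<lambda>_. ennreal (\<bar>c\<bar> ^ DIM('a)))) f"
    using assms(1) lborel_affine[OF assms(2), of t] by simp
  then have k: "integrable (distr lborel borel (\<lambda>x. t + c *\<^sub>R x)) (\<lambda>x. (\<bar>c\<bar> ^ DIM('a)) *\<^sub>R f x)"
    by (subst (asm) integrable_density) auto
  have "integrable (distr lborel borel (\<lambda>x. t + c *\<^sub>R x)) (\<lambda>x. inverse (\<bar>c\<bar> ^ DIM('a)) *\<^sub>R (\<bar>c\<bar> ^ DIM('a)) *\<^sub>R f x)"
    by (rule integrable_scaleR_right, rule k)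
  then have "integrable (distr lborel borel (\<lambda>x. t + c *\<^sub>R x)) f"
    using assms(2) by simp
  then show ?thesis by (subst (asm) integrable_distr_eq) auto
qed

section \<open>Gaussians\<close>

definition gauss :: "'a::euclidean_space \<Rightarrow> real" where
  "gauss x = exp (- (norm x)\<^sup>2 / 2)"

lemma gauss_measurable [measurable]: "gauss \<in> borel_measurable borel"
  unfolding gauss_def by measurable

lemma gauss_bounds: "0 < gauss x" "gauss x \<le> 1"
  by (auto simp: gauss_def)

lemma gauss_nonneg [simp]: "0 \<le> gauss x"
  by (simp add: gauss_def)

lemma tendsto_gauss: "(f \<longlongrightarrow> l) F \<Longrightarrow> ((\<lambda>x. gauss (f x)) \<longlongrightarrow> gauss l) F"
  unfolding gauss_def by (intro tendsto_intros) auto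

lemma gauss_prod: "gauss x = (\<Prod>b\<in>Basis. exp (- (x \<bullet> b)\<^sup>2 / 2))"
  unfolding gauss_def
proof -
  have "(norm x)\<^sup>2 = (\<Sum>b\<in>Basis. (x \<bullet> b)\<^sup>2)"
    unfolding power2_norm_eq_inner by (subst euclidean_inner) (simp add: power2_eq_square)
  then have "- (norm x)\<^sup>2 / 2 = (\<Sum>b\<in>Basis. - (x \<bullet> b)\<^sup>2 / 2)"
    by (simp add: sum_negf sum_divide_distrib)
  then show "exp (- (norm x)\<^sup>2 / 2) = (\<Prod>b\<in>Basis. exp (- (x \<bullet> b)\<^sup>2 / 2))"
    by (simp only:) (rule exp_sum, simp)
qed

text \<open>This is the characteristic function of the standard normal law, freed of the normalising
  factor. The case of several variables follows by separation of coordinates.\<close>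

lemma integral_exp_gauss_real:
  fixes t :: real
  shows "integrable lborel (\<lambda>x. exp (- (\<i> * complex_of_real (t * x))) * complex_of_real (exp (- x\<^sup>2 / 2)))"
    and "(\<integral>x. exp (- (\<i> * complex_of_real (t * x))) * complex_of_real (exp (- x\<^sup>2 / 2)) \<partial>lborel)
      = complex_of_real (sqrt (2 * pi) * exp (- t\<^sup>2 / 2))"
proof -
  have i0: "integrable lborel std_normal_density"
    using integrable_std_normal_moment[of 0] by simp
  have eq: "complex_of_real (exp (- x\<^sup>2 / 2)) = complex_of_real (sqrt (2 * pi)) * complex_of_real (std_normal_density x)" for x
    by (simp add: std_normal_density_def)
  have "integrable lborel (\<lambda>x. complex_of_real (std_normal_density x))"
    using i0 by (intro integrable_of_real)
  then have i1: "integrable lborel (\<lambda>x. complex_of_real (exp (- x\<^sup>2 / 2)))"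
    unfolding eq by simp
  show "integrable lborel (\<lambda>x. exp (- (\<i> * complex_of_real (t * x))) * complex_of_real (exp (- x\<^sup>2 / 2)))"
    by (rule Bochner_Integration.integrable_bound[OF i1]) (auto simp: norm_mult)
  have "complex_of_real (exp (- t\<^sup>2 / 2)) = char std_normal_distribution (- t)"
    by (simp add: char_std_normal_distribution)
  also have "\<dots> = (\<integral>x. std_normal_density x *\<^sub>R exp (\<i> * complex_of_real (- t * x)) \<partial>lborel)"
    unfolding char_def by (subst integral_density) (auto simp: normal_density_nonneg)
  finally have c: "complex_of_real (exp (- t\<^sup>2 / 2)) = (\<integral>x. std_normal_density x *\<^sub>R exp (\<i> * complex_of_real (- t * x)) \<partial>lborel)" .
  have "(\<integral>x. exp (- (\<i> * complex_of_real (t * x))) * complex_of_real (exp (- x\<^sup>2 / 2)) \<partial>lborel)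
    = (\<integral>x. complex_of_real (sqrt (2 * pi)) * (std_normal_density x *\<^sub>R exp (\<i> * complex_of_real (- t * x))) \<partial>lborel)"
    unfolding eq by (intro Bochner_Integration.integral_cong) (auto simp: scaleR_conv_of_real)
  also have "\<dots> = complex_of_real (sqrt (2 * pi)) * complex_of_real (exp (- t\<^sup>2 / 2))"
    unfolding c by (rule integral_mult_right_zero)
  finally show "(\<integral>x. exp (- (\<i> * complex_of_real (t * x))) * complex_of_real (exp (- x\<^sup>2 / 2)) \<partial>lborel)
      = complex_of_real (sqrt (2 * pi) * exp (- t\<^sup>2 / 2))" by simp
qed

lemma Fourier_gauss:
  fixes \<xi> :: "'a::euclidean_space"
  shows "integrable lborel (\<lambda>x::'a. complex_of_real (gauss x))"
    and "Fourier (\<lambda>x. complex_of_real (gauss x)) \<xi> = complex_of_real (sqrt (2 * pi) ^ DIM('a) * gauss \<xi>)"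
proof -
  have prod: "exp (- (\<i> * complex_of_real (\<eta> \<bullet> x))) * complex_of_real (gauss x)
    = (\<Prod>b\<in>Basis. exp (- (\<i> * complex_of_real ((\<eta> \<bullet> b) * (x \<bullet> b)))) * complex_of_real (exp (- (x \<bullet> b)\<^sup>2 / 2)))"
    for \<eta> x :: 'a
  proof -
    have "exp (- (\<i> * complex_of_real (\<eta> \<bullet> x))) = exp (\<Sum>b\<in>Basis. - (\<i> * complex_of_real ((\<eta> \<bullet> b) * (x \<bullet> b))))"
      by (subst euclidean_inner) (simp add: sum_negf sum_distrib_left)
    also have "\<dots> = (\<Prod>b\<in>Basis. exp (- (\<i> * complex_of_real ((\<eta> \<bullet> b) * (x \<bullet> b)))))"
      by (rule exp_sum) simp
    finally show ?thesis unfolding gauss_prod prod.distrib by simp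
  qed
  note P = lborel_integral_prod[of "\<lambda>b x. exp (- (\<i> * complex_of_real ((\<eta> \<bullet> b) * x))) * complex_of_real (exp (- x\<^sup>2 / 2))" for \<eta> :: 'a,
      OF integral_exp_gauss_real(1)]
  show "integrable lborel (\<lambda>x::'a. complex_of_real (gauss x))"
    using P(1)[of 0] prod[of 0] by simp
  have "Fourier (\<lambda>x. complex_of_real (gauss x)) \<xi> = (\<Prod>b\<in>Basis. complex_of_real (sqrt (2 * pi) * exp (- (\<xi> \<bullet> b)\<^sup>2 / 2)))"
    unfolding Fourier_def using P(2)[of \<xi>] prod[of \<xi>] integral_exp_gauss_real(2) by simp
  also have "\<dots> = complex_of_real (sqrt (2 * pi) ^ DIM('a) * gauss \<xi>)"
    unfolding gauss_prod by (simp add: prod.distrib)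
  finally show "Fourier (\<lambda>x. complex_of_real (gauss x)) \<xi> = complex_of_real (sqrt (2 * pi) ^ DIM('a) * gauss \<xi>)" .
qed

lemma integral_gauss: "(\<integral>x. complex_of_real (gauss (x::'a::euclidean_space)) \<partial>lborel) = complex_of_real (sqrt (2 * pi) ^ DIM('a))"
  using Fourier_gauss(2)[of "0::'a"] by (simp add: Fourier_def gauss_def)

section \<open>The Fourier integral\<close>

lemma Fourier_measurable [measurable]:
  assumes [measurable]: "u \<in> borel_measurable borel"
  shows "Fourier u \<in> borel_measurable borel"
  unfolding Fourier_def by measurable

lemma Fourier_integrand_integrable:
  assumes "integrable lborel u"
  shows "integrable lborel (\<lambda>x. exp (- \<i> * complex_of_real (\<xi> \<bullet> x)) * u x)"
  by (rule Bochner_Integration.integrable_bound[OF assms])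
     (use assms in \<open>auto simp: norm_mult\<close>)

lemma norm_Fourier_le: "cmod (Fourier u \<xi>) \<le> (\<integral>x. cmod (u x) \<partial>lborel)"
proof -
  have "cmod (Fourier u \<xi>) \<le> (\<integral>x. cmod (exp (- \<i> * complex_of_real (\<xi> \<bullet> x)) * u x) \<partial>lborel)"
    unfolding Fourier_def by (rule integral_norm_bound)
  then show ?thesis by (simp add: norm_mult)
qed

lemma Fourier_lin:
  assumes "integrable lborel u" "integrable lborel v"
  shows "Fourier (\<lambda>x. c * u x + v x) \<xi> = c * Fourier u \<xi> + Fourier v \<xi>"
  unfolding Fourier_def
  using Fourier_integrand_integrable[OF assms(1), of \<xi>] Fourier_integrand_integrable[OF assms(2), of \<xi>]
  by (simp add: distrib_left mult.left_commute)

text \<open>Fubini for a kernel symmetric in the two variables. Every later transfer of a transform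
  from one factor to the other goes through this identity.\<close>

lemma Fourier_multiplication_formula:
  fixes u g :: "'a::euclidean_space \<Rightarrow> complex"
  assumes u: "integrable lborel u" and g: "integrable lborel g"
  shows "(\<integral>\<xi>. Fourier u \<xi> * g \<xi> \<partial>lborel) = (\<integral>x. u x * Fourier g x \<partial>lborel)"
proof -
  have [measurable]: "u \<in> borel_measurable borel" "g \<in> borel_measurable borel" using u g by auto
  let ?f = "\<lambda>x \<xi>. exp (- \<i> * complex_of_real (\<xi> \<bullet> x)) * u x * g \<xi>"
  have int: "integrable (lborel \<Otimes>\<^sub>M lborel) (case_prod ?f)"
  proof (rule lborel_pair.Fubini_integrable)
    show "integrable lborel (\<lambda>x. \<integral>y. norm (case (x, y) of (x, \<xi>) \<Rightarrow> ?f x \<xi>) \<partial>lborel)"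
      using u by (simp add: norm_mult)
    show "AE x in lborel. integrable lborel (\<lambda>y. case (x, y) of (x, \<xi>) \<Rightarrow> ?f x \<xi>)"
    proof (rule AE_I2)
      fix x :: 'a
      have "integrable lborel (\<lambda>\<xi>. u x * g \<xi>)" using g by simp
      then show "integrable lborel (\<lambda>y. case (x, y) of (x, \<xi>) \<Rightarrow> ?f x \<xi>)"
        by (rule Bochner_Integration.integrable_bound) (auto simp: norm_mult)
    qed
  qed measurable
  have "(\<integral>\<xi>. Fourier u \<xi> * g \<xi> \<partial>lborel) = (\<integral>\<xi>. (\<integral>x. ?f x \<xi> \<partial>lborel) \<partial>lborel)"
    unfolding Fourier_def using g by simp
  also have "\<dots> = (\<integral>x. (\<integral>\<xi>. ?f x \<xi> \<partial>lborel) \<partial>lborel)"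
    by (rule lborel_pair.Fubini_integral[OF int])
  also have "\<dots> = (\<integral>x. u x * Fourier g x \<partial>lborel)"
  proof (intro Bochner_Integration.integral_cong refl)
    fix x :: 'a
    have "(\<integral>\<xi>. ?f x \<xi> \<partial>lborel) = (\<integral>\<xi>. u x * (exp (- \<i> * complex_of_real (x \<bullet> \<xi>)) * g \<xi>) \<partial>lborel)"
      by (simp add: inner_commute mult_ac)
    then show "(\<integral>\<xi>. ?f x \<xi> \<partial>lborel) = u x * Fourier g x"
      unfolding Fourier_def by simp
  qed
  finally show ?thesis .
qed

text \<open>The class on which the Fourier integral converges and Plancherel's identity makes sense
  at once. For bounded open \<open>D\<close> it contains \<open>L2_on D\<close>.\<close>

definition L12 :: "('a::euclidean_space \<Rightarrow> complex) set" where
  "L12 = {u \<in> L2. integrable lborel u}"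

lemma L12_D:
  assumes "u \<in> L12"
  shows "u \<in> borel_measurable borel" "integrable lborel u" "integrable lborel (\<lambda>x. (cmod (u x))\<^sup>2)" "u \<in> L2"
  using assms by (auto simp: L12_def L2_def)

lemma L2_lin:
  assumes "u \<in> L2" "v \<in> L2"
  shows "(\<lambda>x. c * u x + v x) \<in> L2"
proof -
  have [measurable]: "u \<in> borel_measurable borel" "v \<in> borel_measurable borel"
    using assms by (auto simp: L2_def)
  have "integrable lborel (\<lambda>x. 2 * ((cmod c)\<^sup>2 * (cmod (u x))\<^sup>2 + (cmod (v x))\<^sup>2))"
    using assms by (intro integrable_mult_right integrable_add) (auto simp: L2_def)
  moreover have "(cmod (c * u x + v x))\<^sup>2 \<le> 2 * ((cmod c)\<^sup>2 * (cmod (u x))\<^sup>2 + (cmod (v x))\<^sup>2)" for x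
  proof -
    have "(cmod (c * u x + v x))\<^sup>2 \<le> (cmod (c * u x) + cmod (v x))\<^sup>2"
      by (intro power_mono norm_triangle_ineq) auto
    also have "\<dots> \<le> 2 * ((cmod (c * u x))\<^sup>2 + (cmod (v x))\<^sup>2)"
      using sum_squares_bound[of "cmod (c * u x)" "cmod (v x)"] by (simp add: power2_sum)
    finally show ?thesis by (simp add: norm_mult power_mult_distrib)
  qed
  ultimately have "integrable lborel (\<lambda>x. (cmod (c * u x + v x))\<^sup>2)"
    by (elim integrable_dominated) simp_all
  then show ?thesis by (simp add: L2_def)
qed

lemma L12_lin: "u \<in> L12 \<Longrightarrow> v \<in> L12 \<Longrightarrow> (\<lambda>x. c * u x + v x) \<in> L12"
  by (auto simp: L12_def intro: L2_lin)

lemma L2_product_integrable: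
  assumes "u \<in> L2" "v \<in> L2"
  shows "integrable lborel (\<lambda>x. u x * cnj (v x))"
proof -
  have [measurable]: "u \<in> borel_measurable borel" "v \<in> borel_measurable borel"
    using assms by (auto simp: L2_def)
  have int: "integrable lborel (\<lambda>x. (cmod (u x))\<^sup>2 + (cmod (v x))\<^sup>2)"
    using assms by (auto simp: L2_def)
  have bound: "cmod (u x * cnj (v x)) \<le> (cmod (u x))\<^sup>2 + (cmod (v x))\<^sup>2" for x
  proof -
    have "0 \<le> cmod (u x) * cmod (v x)" by simp
    then show ?thesis
      using sum_squares_bound[of "cmod (u x)" "cmod (v x)"]
      unfolding norm_mult complex_mod_cnj by linarith
  qed
  have "(\<lambda>x. u x * cnj (v x)) \<in> borel_measurable lborel" by measurable
  from int this bound show ?thesis by (rule integrable_dominated)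
qed

lemma cnj_Fourier: "cnj (Fourier u \<xi>) = Fourier (\<lambda>x. cnj (u x)) (- \<xi>)"
proof -
  have "cnj (Fourier u \<xi>) = (\<integral>x. cnj (exp (- \<i> * complex_of_real (\<xi> \<bullet> x)) * u x) \<partial>lborel)"
    unfolding Fourier_def by (rule Bochner_Integration.integral_cnj[symmetric])
  then show ?thesis unfolding Fourier_def by (simp add: exp_cnj)
qed


section \<open>Heat kernel regularisation\<close>

lemma Fourier_scaled_gauss:
  fixes w :: "'a::euclidean_space"
  assumes "0 < \<epsilon>"
  shows "Fourier (\<lambda>\<xi>. complex_of_real (gauss (\<epsilon> *\<^sub>R \<xi>))) w
    = complex_of_real (sqrt (2 * pi) ^ DIM('a) / \<epsilon> ^ DIM('a) * gauss ((1 / \<epsilon>) *\<^sub>R w))"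
proof -
  have "Fourier (\<lambda>\<xi>. complex_of_real (gauss (\<epsilon> *\<^sub>R \<xi>))) w
    = of_real (\<bar>1 / \<epsilon>\<bar> ^ DIM('a)) * Fourier (\<lambda>x. complex_of_real (gauss x)) ((1 / \<epsilon>) *\<^sub>R w)"
    unfolding Fourier_def
    by (subst lborel_integral_affine[of _ "1 / \<epsilon>" 0]) (use assms in \<open>simp_all add: divide_inverse mult_ac\<close>)
  then show ?thesis
    unfolding Fourier_gauss(2) using assms by (simp add: power_divide)
qed

lemma integrable_scaled_gauss:
  assumes "0 < \<epsilon>"
  shows "integrable lborel (\<lambda>\<xi>::'a::euclidean_space. complex_of_real (gauss (\<epsilon> *\<^sub>R \<xi>)))"
  using lborel_integrable_affine[OF Fourier_gauss(1), of \<epsilon> 0] assms by simp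

text \<open>The transform of the Gaussian \<open>gauss (\<epsilon> *\<^sub>R \<xi>)\<close>: an
  approximate identity of width \<epsilon>, with total mass \<open>(2 * pi) ^ DIM('a)\<close> rather
  than 1.\<close>

definition heat_kernel :: "real \<Rightarrow> 'a::euclidean_space \<Rightarrow> real" where
  "heat_kernel \<epsilon> w = sqrt (2 * pi) ^ DIM('a) / \<epsilon> ^ DIM('a) * gauss ((1 / \<epsilon>) *\<^sub>R w)"

lemma heat_kernel_measurable [measurable]: "heat_kernel \<epsilon> \<in> borel_measurable borel"
  unfolding heat_kernel_def by measurable

lemma heat_kernel_nonneg: "0 < \<epsilon> \<Longrightarrow> 0 \<le> heat_kernel \<epsilon> w"
  by (simp add: heat_kernel_def)

lemma heat_kernel_minus: "heat_kernel \<epsilon> (x - y) = heat_kernel \<epsilon> (y - x)"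
  by (simp add: heat_kernel_def gauss_def norm_minus_commute)

lemma sqrt_two_pi_power: "sqrt (2 * pi) ^ n * sqrt (2 * pi) ^ n = (2 * pi) ^ n"
  by (subst power_mult_distrib[symmetric]) simp

lemma nn_integral_heat_kernel:
  fixes x :: "'a::euclidean_space"
  assumes "0 < \<epsilon>"
  shows "(\<integral>\<^sup>+y. ennreal (heat_kernel \<epsilon> (y - x)) \<partial>lborel) = ennreal ((2 * pi) ^ DIM('a))"
proof -
  have "integrable lborel (\<lambda>y::'a. complex_of_real (heat_kernel \<epsilon> y))"
    unfolding heat_kernel_def of_real_mult
    using assms by (intro integrable_mult_right integrable_scaled_gauss) auto
  from lborel_integrable_affine[OF this, of 1 "- x"]
  have int: "integrable lborel (\<lambda>y. complex_of_real (heat_kernel \<epsilon> (y - x)))" by simp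
  have "(\<integral>y. complex_of_real (heat_kernel \<epsilon> (y - x)) \<partial>lborel)
      = of_real (\<bar>\<epsilon>\<bar> ^ DIM('a)) * (\<integral>y. complex_of_real (heat_kernel \<epsilon> (x + \<epsilon> *\<^sub>R y - x)) \<partial>lborel)"
    using assms by (intro lborel_integral_affine) auto
  also have "\<dots> = (\<integral>y. of_real (\<bar>\<epsilon>\<bar> ^ DIM('a)) * complex_of_real (heat_kernel \<epsilon> (x + \<epsilon> *\<^sub>R y - x)) \<partial>lborel)"
    by (rule integral_mult_right_zero[symmetric])
  also have "\<dots> = (\<integral>y. complex_of_real (sqrt (2 * pi) ^ DIM('a)) * complex_of_real (gauss (y::'a)) \<partial>lborel)"
    using assms by (intro Bochner_Integration.integral_cong) (auto simp: heat_kernel_def)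
  also have "\<dots> = complex_of_real ((2 * pi) ^ DIM('a))"
    by (subst integral_mult_right_zero) (simp only: integral_gauss of_real_mult[symmetric] sqrt_two_pi_power)
  finally have "complex_of_real (\<integral>y. heat_kernel \<epsilon> (y - x) \<partial>lborel) = complex_of_real ((2 * pi) ^ DIM('a))"
    by simp
  then have val: "(\<integral>y. heat_kernel \<epsilon> (y - x) \<partial>lborel) = (2 * pi) ^ DIM('a)"
    using of_real_eq_iff by blast
  have "integrable lborel (\<lambda>y. heat_kernel \<epsilon> (y - x))"
    using int by (simp add: complex_of_real_integrable_eq)
  from nn_integral_eq_integral[OF this AE_I2[OF heat_kernel_nonneg[OF assms]]] show ?thesis
    unfolding val .
qed

text \<open>The weight makes the conjugate of \<open>Fourier u\<close> times the Gaussian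
  integrable, so the multiplication formula applies. It is used once for the outer integral, and
  once to recognise the transform of that product as a conjugated convolution.\<close>

lemma regularized_Plancherel:
  fixes u :: "'a::euclidean_space \<Rightarrow> complex"
  assumes u: "integrable lborel u" and \<epsilon>: "0 < \<epsilon>"
  shows "(\<integral>\<xi>. complex_of_real ((cmod (Fourier u \<xi>))\<^sup>2 * gauss (\<epsilon> *\<^sub>R \<xi>)) \<partial>lborel)
    = (\<integral>x. u x * cnj (\<integral>y. u y * complex_of_real (heat_kernel \<epsilon> (y - x)) \<partial>lborel) \<partial>lborel)"
proof -
  have [measurable]: "u \<in> borel_measurable borel" using u by simp
  define g where "g \<xi> = cnj (Fourier u \<xi>) * complex_of_real (gauss (\<epsilon> *\<^sub>R \<xi>))" for \<xi>
  have g_int: "integrable lborel g"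
  proof -
    have "integrable lborel (\<lambda>\<xi>::'a. (\<integral>x. cmod (u x) \<partial>lborel) * gauss (\<epsilon> *\<^sub>R \<xi>))"
      using integrable_scaled_gauss[OF \<epsilon>] by (intro integrable_mult_right) (simp add: complex_of_real_integrable_eq)
    moreover have "g \<in> borel_measurable lborel" unfolding g_def by measurable
    moreover have "norm (g \<xi>) \<le> (\<integral>x. cmod (u x) \<partial>lborel) * gauss (\<epsilon> *\<^sub>R \<xi>)" for \<xi>
      by (simp add: g_def norm_mult mult_right_mono norm_Fourier_le)
    ultimately show ?thesis by (rule integrable_dominated)
  qed
  have Fg: "Fourier g x = cnj (\<integral>y. u y * complex_of_real (heat_kernel \<epsilon> (y - x)) \<partial>lborel)" for x
  proof -
    \<comment> \<open>A modulated Gaussian, whose transform is the heat kernel centred at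
      \<open>x\<close>.\<close>
    let ?h = "\<lambda>\<xi>. exp (\<i> * complex_of_real (x \<bullet> \<xi>)) * complex_of_real (gauss (\<epsilon> *\<^sub>R \<xi>))"
    have h: "integrable lborel ?h"
      by (rule Bochner_Integration.integrable_bound[OF integrable_scaled_gauss[OF \<epsilon>]])
         (auto simp: norm_mult norm_exp_eq_Re)
    have Fh: "Fourier ?h y = complex_of_real (heat_kernel \<epsilon> (y - x))" for y
    proof -
      have "Fourier ?h y = Fourier (\<lambda>\<xi>. complex_of_real (gauss (\<epsilon> *\<^sub>R \<xi>))) (y - x)"
        unfolding Fourier_def mult.assoc[symmetric] exp_add[symmetric]
        by (simp add: inner_diff_left algebra_simps)
      then show ?thesis using \<epsilon> by (simp add: Fourier_scaled_gauss heat_kernel_def)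
    qed
    have "cnj (Fourier g x) = (\<integral>\<xi>. cnj (exp (- \<i> * complex_of_real (x \<bullet> \<xi>)) * g \<xi>) \<partial>lborel)"
      unfolding Fourier_def by (rule Bochner_Integration.integral_cnj[symmetric])
    also have "\<dots> = (\<integral>\<xi>. Fourier u \<xi> * ?h \<xi> \<partial>lborel)"
      by (intro Bochner_Integration.integral_cong) (auto simp: g_def exp_cnj)
    also have "\<dots> = (\<integral>y. u y * complex_of_real (heat_kernel \<epsilon> (y - x)) \<partial>lborel)"
      unfolding Fourier_multiplication_formula[OF u h] Fh ..
    finally show ?thesis by (metis complex_cnj_cnj)
  qed
  have "(\<integral>\<xi>. complex_of_real ((cmod (Fourier u \<xi>))\<^sup>2 * gauss (\<epsilon> *\<^sub>R \<xi>)) \<partial>lborel) = (\<integral>\<xi>. Fourier u \<xi> * g \<xi> \<partial>lborel)"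
    by (intro Bochner_Integration.integral_cong refl) (simp only: g_def of_real_mult complex_norm_square mult.assoc)
  also have "\<dots> = (\<integral>x. u x * Fourier g x \<partial>lborel)"
    by (rule Fourier_multiplication_formula[OF u g_int])
  finally show ?thesis unfolding Fg .
qed

text \<open>Schur's test: |u(x)| |u(y)| is at most half the sum of the squares, and the heat kernel
  has the same mass in either variable. The bound does not depend on \<epsilon>.\<close>

lemma regularized_Plancherel_bound:
  fixes u :: "'a::euclidean_space \<Rightarrow> complex"
  assumes "u \<in> L12" and \<epsilon>: "0 < \<epsilon>"
  shows "(\<integral>\<^sup>+\<xi>. ennreal ((cmod (Fourier u \<xi>))\<^sup>2 * gauss (\<epsilon> *\<^sub>R \<xi>)) \<partial>lborel)
    \<le> ennreal ((2 * pi) ^ DIM('a) * (\<integral>x. (cmod (u x))\<^sup>2 \<partial>lborel))"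
proof -
  note u = L12_D[OF assms(1)]
  note [measurable] = u(1)
  let ?K = "heat_kernel \<epsilon> :: 'a \<Rightarrow> real"
  let ?C = "(2 * pi) ^ DIM('a)"
  define N where "N = (\<integral>\<^sup>+x. ennreal ((cmod (u x))\<^sup>2) \<partial>lborel)"
  have N: "N = ennreal (\<integral>x. (cmod (u x))\<^sup>2 \<partial>lborel)"
    unfolding N_def using u(3) by (rule nn_integral_eq_integral) simp
  have K0: "0 \<le> ?K w" for w by (rule heat_kernel_nonneg[OF \<epsilon>])
  have inner: "ennreal (cmod (\<integral>y. u y * complex_of_real (?K (y - x)) \<partial>lborel))
      \<le> (\<integral>\<^sup>+y. ennreal (cmod (u y) * ?K (y - x)) \<partial>lborel)" for x
  proof -
    have "ennreal (norm (\<integral>y. u y * complex_of_real (?K (y - x)) \<partial>lborel))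
      \<le> (\<integral>\<^sup>+y. ennreal (norm (u y * complex_of_real (?K (y - x)))) \<partial>lborel)"
      by (rule ennreal_norm_integral_le)
    then show ?thesis using K0 by (simp add: norm_mult)
  qed
  have young: "ennreal (a * (b * k)) \<le> ennreal (1/2) * (ennreal (a\<^sup>2) * ennreal k) + ennreal (1/2) * (ennreal (b\<^sup>2) * ennreal k)"
    if "0 \<le> a" "0 \<le> b" "0 \<le> k" for a b k :: real
  proof -
    have "a * (b * k) = (a * b) * k" by simp
    also have "\<dots> \<le> ((a\<^sup>2 + b\<^sup>2) / 2) * k"
      using sum_squares_bound[of a b] that by (intro mult_right_mono) auto
    also have "\<dots> = 1/2 * (a\<^sup>2 * k) + 1/2 * (b\<^sup>2 * k)" by (simp add: field_simps)
    finally have "ennreal (a * (b * k)) \<le> ennreal (1/2 * (a\<^sup>2 * k) + 1/2 * (b\<^sup>2 * k))"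
      by (rule ennreal_leI)
    also have "\<dots> = ennreal (1/2 * (a\<^sup>2 * k)) + ennreal (1/2 * (b\<^sup>2 * k))"
      using that by (intro ennreal_plus) auto
    also have "\<dots> = ennreal (1/2) * (ennreal (a\<^sup>2) * ennreal k) + ennreal (1/2) * (ennreal (b\<^sup>2) * ennreal k)"
    proof -
      have "ennreal (1/2 * (t * k)) = ennreal (1/2) * (ennreal t * ennreal k)" if "0 \<le> t" for t
        by (subst ennreal_mult[symmetric]; (subst ennreal_mult[symmetric])?) (use that \<open>0 \<le> k\<close> in auto)
      then show ?thesis by simp
    qed
    finally show ?thesis .
  qed
  have "(\<integral>\<^sup>+\<xi>. ennreal ((cmod (Fourier u \<xi>))\<^sup>2 * gauss (\<epsilon> *\<^sub>R \<xi>)) \<partial>lborel)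
      = ennreal (\<integral>\<xi>. (cmod (Fourier u \<xi>))\<^sup>2 * gauss (\<epsilon> *\<^sub>R \<xi>) \<partial>lborel)"
  proof (rule nn_integral_eq_integral)
    have "integrable lborel (\<lambda>\<xi>::'a. (\<integral>x. cmod (u x) \<partial>lborel)\<^sup>2 * gauss (\<epsilon> *\<^sub>R \<xi>))"
      using integrable_scaled_gauss[OF \<epsilon>] by (intro integrable_mult_right) (simp add: complex_of_real_integrable_eq)
    moreover have "(\<lambda>\<xi>. (cmod (Fourier u \<xi>))\<^sup>2 * gauss (\<epsilon> *\<^sub>R \<xi>)) \<in> borel_measurable lborel" by measurable
    moreover have "norm ((cmod (Fourier u \<xi>))\<^sup>2 * gauss (\<epsilon> *\<^sub>R \<xi>))
        \<le> (\<integral>x. cmod (u x) \<partial>lborel)\<^sup>2 * gauss (\<epsilon> *\<^sub>R \<xi>)" for \<xi>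
      by (simp add: mult_right_mono power_mono norm_Fourier_le)
    ultimately show "integrable lborel (\<lambda>\<xi>. (cmod (Fourier u \<xi>))\<^sup>2 * gauss (\<epsilon> *\<^sub>R \<xi>))"
      by (rule integrable_dominated)
  qed simp
  also have "\<dots> \<le> ennreal (cmod (\<integral>\<xi>. complex_of_real ((cmod (Fourier u \<xi>))\<^sup>2 * gauss (\<epsilon> *\<^sub>R \<xi>)) \<partial>lborel))"
    by (intro ennreal_leI) (subst integral_complex_of_real, simp)
  also have "\<dots> = ennreal (cmod (\<integral>x. u x * cnj (\<integral>y. u y * complex_of_real (?K (y - x)) \<partial>lborel) \<partial>lborel))"
    unfolding regularized_Plancherel[OF u(2) \<epsilon>] ..
  also have "\<dots> \<le> (\<integral>\<^sup>+x. ennreal (cmod (u x * cnj (\<integral>y. u y * complex_of_real (?K (y - x)) \<partial>lborel))) \<partial>lborel)"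
    by (rule ennreal_norm_integral_le)
  also have "\<dots> \<le> (\<integral>\<^sup>+x. ennreal (cmod (u x)) * (\<integral>\<^sup>+y. ennreal (cmod (u y) * ?K (y - x)) \<partial>lborel) \<partial>lborel)"
    using inner by (intro nn_integral_mono) (simp add: norm_mult ennreal_mult mult_left_mono)
  also have "\<dots> = (\<integral>\<^sup>+x. (\<integral>\<^sup>+y. ennreal (cmod (u x) * (cmod (u y) * ?K (y - x))) \<partial>lborel) \<partial>lborel)"
    using K0 by (simp add: nn_integral_cmult[symmetric] ennreal_mult'')
  also have "\<dots> \<le> (\<integral>\<^sup>+x. (\<integral>\<^sup>+y. ennreal (1/2) * (ennreal ((cmod (u x))\<^sup>2) * ennreal (?K (y - x)))
       + ennreal (1/2) * (ennreal ((cmod (u y))\<^sup>2) * ennreal (?K (y - x))) \<partial>lborel) \<partial>lborel)"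
    using K0 by (intro nn_integral_mono young) auto
  also have "\<dots> = ennreal (1/2) * (\<integral>\<^sup>+x. ennreal ((cmod (u x))\<^sup>2) * (\<integral>\<^sup>+y. ennreal (?K (y - x)) \<partial>lborel) \<partial>lborel)
      + ennreal (1/2) * (\<integral>\<^sup>+x. (\<integral>\<^sup>+y. ennreal ((cmod (u y))\<^sup>2) * ennreal (?K (y - x)) \<partial>lborel) \<partial>lborel)"
    by (simp add: nn_integral_add nn_integral_cmult)
  also have "(\<integral>\<^sup>+x. (\<integral>\<^sup>+y. ennreal ((cmod (u y))\<^sup>2) * ennreal (?K (y - x)) \<partial>lborel) \<partial>lborel)
     = (\<integral>\<^sup>+y. (\<integral>\<^sup>+x. ennreal ((cmod (u y))\<^sup>2) * ennreal (?K (y - x)) \<partial>lborel) \<partial>lborel)"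
    by (rule lborel_pair.Fubini') measurable
  also have "\<dots> = (\<integral>\<^sup>+y. ennreal ((cmod (u y))\<^sup>2) * (\<integral>\<^sup>+x. ennreal (?K (x - y)) \<partial>lborel) \<partial>lborel)"
    by (simp add: nn_integral_cmult heat_kernel_minus)
  also have "ennreal (1/2) * (\<integral>\<^sup>+x. ennreal ((cmod (u x))\<^sup>2) * (\<integral>\<^sup>+y. ennreal (?K (y - x)) \<partial>lborel) \<partial>lborel) + ennreal (1/2) * \<dots>
     = ennreal (1/2) * (N * ennreal ?C) + ennreal (1/2) * (N * ennreal ?C)"
    unfolding nn_integral_heat_kernel[OF \<epsilon>] N_def by (simp add: nn_integral_multc)
  also have "\<dots> = (ennreal (1/2) + ennreal (1/2)) * (N * ennreal ?C)"
    by (simp only: distrib_right)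
  also have "ennreal (1/2) + ennreal (1/2) = 1"
    by (subst ennreal_plus[symmetric]) auto
  also have "1 * (N * ennreal ?C) = ennreal (?C * (\<integral>x. (cmod (u x))\<^sup>2 \<partial>lborel))"
    unfolding N by (simp only: mult_1 mult.commute[of ?C], rule ennreal_mult[symmetric]) auto
  finally show ?thesis .
qed


text \<open>Fatou's lemma as the Gaussian weight opens up to 1. This yields one half of Plancherel's
  theorem.\<close>

lemma integrable_Fourier_sq:
  fixes u :: "'a::euclidean_space \<Rightarrow> complex"
  assumes "u \<in> L12"
  shows "integrable lborel (\<lambda>\<xi>. (cmod (Fourier u \<xi>))\<^sup>2)"
    and "(\<integral>\<xi>. (cmod (Fourier u \<xi>))\<^sup>2 \<partial>lborel) \<le> (2 * pi) ^ DIM('a) * (\<integral>x. (cmod (u x))\<^sup>2 \<partial>lborel)"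
proof -
  note u = L12_D[OF assms(1)]
  note [measurable] = u(1)
  let ?B = "(2 * pi) ^ DIM('a) * (\<integral>x. (cmod (u x))\<^sup>2 \<partial>lborel)"
  let ?f = "\<lambda>n \<xi>. (cmod (Fourier u \<xi>))\<^sup>2 * gauss ((1 / real (Suc n)) *\<^sub>R \<xi>)"
  have "(\<lambda>n. ?f n \<xi>) \<longlonglongrightarrow> (cmod (Fourier u \<xi>))\<^sup>2 * gauss (0 *\<^sub>R \<xi>)" for \<xi>
    by (intro tendsto_intros tendsto_gauss LIMSEQ_Suc[OF lim_1_over_n])
  then have lim: "(\<lambda>n. ?f n \<xi>) \<longlonglongrightarrow> (cmod (Fourier u \<xi>))\<^sup>2" for \<xi>
    by (simp add: gauss_def)
  have "(\<integral>\<^sup>+\<xi>. ennreal ((cmod (Fourier u \<xi>))\<^sup>2) \<partial>lborel) = (\<integral>\<^sup>+\<xi>. liminf (\<lambda>n. ennreal (?f n \<xi>)) \<partial>lborel)"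
    using lim by (intro nn_integral_cong lim_imp_Liminf[symmetric] tendsto_ennrealI) auto
  also have "\<dots> \<le> liminf (\<lambda>n. \<integral>\<^sup>+\<xi>. ennreal (?f n \<xi>) \<partial>lborel)"
    by (rule nn_integral_liminf) measurable
  also have "\<dots> \<le> liminf (\<lambda>n. ennreal ?B)"
    by (intro Liminf_mono always_eventually allI regularized_Plancherel_bound[OF assms]) simp
  also have "\<dots> = ennreal ?B" by (simp add: Liminf_const)
  finally have le: "(\<integral>\<^sup>+\<xi>. ennreal ((cmod (Fourier u \<xi>))\<^sup>2) \<partial>lborel) \<le> ennreal ?B" .
  show int: "integrable lborel (\<lambda>\<xi>. (cmod (Fourier u \<xi>))\<^sup>2)"
    using le by (intro integrableI_nonneg) (auto simp: top_unique intro: le_less_trans)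
  show "(\<integral>\<xi>. (cmod (Fourier u \<xi>))\<^sup>2 \<partial>lborel) \<le> ?B"
    using le unfolding nn_integral_eq_integral[OF int AE_I2[OF zero_le_power2]]
    by (subst (asm) ennreal_le_iff) auto
qed

section \<open>From the inequality to Plancherel's identity\<close>

lemma Fourier_L2: "u \<in> L12 \<Longrightarrow> Fourier u \<in> L2"
  using integrable_Fourier_sq(1)[of u] by (auto simp: L2_def dest: L12_D)

text \<open>The Gaussian regularisation only yields that this form is positive semidefinite.  It vanishes
  because its kernel is then a linear space, and contains the indicators of bounded open sets.\<close>

definition Plancherel_defect :: "('a::euclidean_space \<Rightarrow> complex) \<Rightarrow> ('a \<Rightarrow> complex) \<Rightarrow> complex" where
  "Plancherel_defect u v = (2 * pi) ^ DIM('a) * (\<integral>x. u x * cnj (v x) \<partial>lborel)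
     - (\<integral>\<xi>. Fourier u \<xi> * cnj (Fourier v \<xi>) \<partial>lborel)"

lemma Re_Plancherel_defect:
  fixes u :: "'a::euclidean_space \<Rightarrow> complex"
  shows "Re (Plancherel_defect u u) = (2 * pi) ^ DIM('a) * (\<integral>x. (cmod (u x))\<^sup>2 \<partial>lborel)
     - (\<integral>\<xi>. (cmod (Fourier u \<xi>))\<^sup>2 \<partial>lborel)"
proof -
  have "Plancherel_defect u u = complex_of_real ((2 * pi) ^ DIM('a) * (\<integral>x. (cmod (u x))\<^sup>2 \<partial>lborel)
     - (\<integral>\<xi>. (cmod (Fourier u \<xi>))\<^sup>2 \<partial>lborel))"
    unfolding Plancherel_defect_def of_real_diff of_real_mult integral_complex_of_real[symmetric] complex_norm_square
    by simp
  then show ?thesis by (simp only: Re_complex_of_real)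
qed

lemma psd_Plancherel: "psd_form L12 (Plancherel_defect :: ('a::euclidean_space \<Rightarrow> complex) \<Rightarrow> _)"
proof
  show "(\<lambda>x. 0) \<in> (L12 :: ('a \<Rightarrow> complex) set)" by (simp add: L12_def L2_def)
next
  fix f g h :: "'a \<Rightarrow> complex" and c assume h: "f \<in> L12" "g \<in> L12" "h \<in> L12"
  have 1: "(\<integral>x. (c * f x + g x) * cnj (h x) \<partial>lborel) = c * (\<integral>x. f x * cnj (h x) \<partial>lborel) + (\<integral>x. g x * cnj (h x) \<partial>lborel)"
    if "f \<in> L2" "g \<in> L2" "h \<in> L2" for f g h :: "'a \<Rightarrow> complex"
    using L2_product_integrable[OF that(1,3)] L2_product_integrable[OF that(2,3)]
    by (simp add: distrib_right mult.assoc)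
  show "Plancherel_defect (\<lambda>x. c * f x + g x) h = c * Plancherel_defect f h + Plancherel_defect g h"
    unfolding Plancherel_defect_def Fourier_lin[OF L12_D(2)[OF h(1)] L12_D(2)[OF h(2)]]
    by (subst 1[OF Fourier_L2[OF h(1)] Fourier_L2[OF h(2)] Fourier_L2[OF h(3)]],
        subst 1[OF L12_D(4)[OF h(1)] L12_D(4)[OF h(2)] L12_D(4)[OF h(3)]])
       (simp add: algebra_simps)
next
  fix f g :: "'a \<Rightarrow> complex"
  have 1: "(\<integral>x. g x * cnj (f x) \<partial>lborel) = cnj (\<integral>x. f x * cnj (g x) \<partial>lborel)" for f g :: "'a \<Rightarrow> complex"
    by (subst Bochner_Integration.integral_cnj[symmetric]) (simp add: mult.commute)
  show "Plancherel_defect g f = cnj (Plancherel_defect f g)"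
    unfolding Plancherel_defect_def using 1[of g f] 1[of "Fourier g" "Fourier f"] by simp
next
  fix f :: "'a \<Rightarrow> complex" assume "f \<in> L12"
  then show "0 \<le> Re (Plancherel_defect f f)"
    unfolding Re_Plancherel_defect using integrable_Fourier_sq(2)[of f] by simp
qed (rule L12_lin)

text \<open>At every point of an open set the convolution with the heat kernel converges to the full
  mass, since \<open>x + \<epsilon> z\<close> stays in the set for small \<epsilon>. The outer
  integral only involves such points, so dominated convergence gives equality in the limit.\<close>

lemma Plancherel_defect_open:
  fixes U :: "'a::euclidean_space set"
  assumes "open U" "bounded U"
  shows "(\<lambda>x. complex_of_real (indicator U x)) \<in> L12"
    and "Re (Plancherel_defect (\<lambda>x. complex_of_real (indicator U x)) (\<lambda>x. complex_of_real (indicator U x))) = 0"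
proof -
  define u where "u = (\<lambda>x. complex_of_real (indicator U x))"
  have U [measurable]: "U \<in> sets borel" using assms(1) by simp
  have fin: "emeasure lborel U < \<infinity>" using assms(2) by (rule emeasure_bounded_finite)
  have um [measurable]: "u \<in> borel_measurable borel" unfolding u_def by measurable
  have iU: "integrable lborel (indicator U :: 'a \<Rightarrow> real)" using fin by simp
  have sq: "(cmod (u x))\<^sup>2 = indicator U x" for x by (simp add: u_def split: split_indicator)
  have u: "integrable lborel u" unfolding u_def using iU by simp
  then show L: "(\<lambda>x. complex_of_real (indicator U x)) \<in> L12"
    using iU um sq unfolding u_def L12_def L2_def by simp
  let ?e = "\<lambda>n. 1 / real (Suc n)"
  let ?\<kappa> = "complex_of_real (sqrt (2 * pi) ^ DIM('a))"
  have inner: "(\<integral>y. u y * complex_of_real (heat_kernel (?e n) (y - x)) \<partial>lborel)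
      = ?\<kappa> * (\<integral>z. u (x + ?e n *\<^sub>R z) * complex_of_real (gauss z) \<partial>lborel)" for n x
  proof -
    have "(\<integral>y. u y * complex_of_real (heat_kernel (?e n) (y - x)) \<partial>lborel)
      = of_real (\<bar>?e n\<bar> ^ DIM('a)) * (\<integral>z. u (x + ?e n *\<^sub>R z) * complex_of_real (heat_kernel (?e n) (x + ?e n *\<^sub>R z - x)) \<partial>lborel)"
    proof (rule lborel_integral_affine)
      show "(\<lambda>y. u y * complex_of_real (heat_kernel (?e n) (y - x))) \<in> borel_measurable borel" by measurable
    qed simp
    also have "\<dots> = (\<integral>z. of_real (\<bar>?e n\<bar> ^ DIM('a)) * (u (x + ?e n *\<^sub>R z) * complex_of_real (heat_kernel (?e n) (x + ?e n *\<^sub>R z - x))) \<partial>lborel)"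
      by (rule integral_mult_right_zero[symmetric])
    also have "\<dots> = (\<integral>z. ?\<kappa> * (u (x + ?e n *\<^sub>R z) * complex_of_real (gauss z)) \<partial>lborel)"
      by (intro Bochner_Integration.integral_cong refl) (simp add: heat_kernel_def power_divide del: of_nat_Suc)
    also have "\<dots> = ?\<kappa> * (\<integral>z. u (x + ?e n *\<^sub>R z) * complex_of_real (gauss z) \<partial>lborel)"
      by (rule integral_mult_right_zero)
    finally show ?thesis .
  qed
  have gi: "integrable lborel (\<lambda>z::'a. gauss z)"
    using Fourier_gauss(1) by (simp add: complex_of_real_integrable_eq)
  have lim_inner: "(\<lambda>n. \<integral>z. u (x + ?e n *\<^sub>R z) * complex_of_real (gauss z) \<partial>lborel) \<longlonglongrightarrow> ?\<kappa>" if "x \<in> U" for x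
  proof -
    have "(\<lambda>n. \<integral>z. u (x + ?e n *\<^sub>R z) * complex_of_real (gauss z) \<partial>lborel) \<longlonglongrightarrow> (\<integral>z. complex_of_real (gauss (z::'a)) \<partial>lborel)"
    proof (rule integral_dominated_convergence[where w = gauss])
      show "AE z in lborel. (\<lambda>n. u (x + ?e n *\<^sub>R z) * complex_of_real (gauss z)) \<longlonglongrightarrow> complex_of_real (gauss z)"
      proof (rule AE_I2)
        fix z :: 'a
        have "(\<lambda>n. x + ?e n *\<^sub>R z) \<longlonglongrightarrow> x + 0 *\<^sub>R z"
          by (intro tendsto_intros LIMSEQ_Suc[OF lim_1_over_n])
        then have "\<forall>\<^sub>F n in sequentially. x + ?e n *\<^sub>R z \<in> U"
          using topological_tendstoD[OF _ assms(1)] that by fastforce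
        then have "\<forall>\<^sub>F n in sequentially. u (x + ?e n *\<^sub>R z) * complex_of_real (gauss z) = complex_of_real (gauss z)"
          by eventually_elim (simp add: u_def)
        then show "(\<lambda>n. u (x + ?e n *\<^sub>R z) * complex_of_real (gauss z)) \<longlonglongrightarrow> complex_of_real (gauss z)"
          by (rule tendsto_eventually)
      qed
      show "AE z in lborel. norm (u (x + ?e n *\<^sub>R z) * complex_of_real (gauss z)) \<le> gauss z" for n
        by (rule AE_I2) (simp add: u_def norm_mult split: split_indicator)
      show "integrable lborel (gauss :: 'a \<Rightarrow> real)" by (rule gi)
    qed measurable
    then show ?thesis unfolding integral_gauss .
  qed
  have \<kappa>2: "?\<kappa> * ?\<kappa> = complex_of_real ((2 * pi) ^ DIM('a))"
    by (simp only: of_real_mult[symmetric] sqrt_two_pi_power)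
  have "(\<lambda>n. \<integral>x. u x * cnj (?\<kappa> * (\<integral>z. u (x + ?e n *\<^sub>R z) * complex_of_real (gauss z) \<partial>lborel)) \<partial>lborel)
      \<longlonglongrightarrow> (\<integral>x. u x * cnj (?\<kappa> * ?\<kappa>) \<partial>lborel)"
  proof (rule integral_dominated_convergence[where w = "\<lambda>x. indicator U x * (sqrt (2 * pi) ^ DIM('a) * (\<integral>z. gauss (z::'a) \<partial>lborel))"])
    show "AE x in lborel. (\<lambda>n. u x * cnj (?\<kappa> * (\<integral>z. u (x + ?e n *\<^sub>R z) * complex_of_real (gauss z) \<partial>lborel)))
      \<longlonglongrightarrow> u x * cnj (?\<kappa> * ?\<kappa>)"
    proof (rule AE_I2)
      fix x
      show "(\<lambda>n. u x * cnj (?\<kappa> * (\<integral>z. u (x + ?e n *\<^sub>R z) * complex_of_real (gauss z) \<partial>lborel)))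
        \<longlonglongrightarrow> u x * cnj (?\<kappa> * ?\<kappa>)"
      proof (cases "x \<in> U")
        case True
        show ?thesis by (intro tendsto_intros lim_inner True)
      next
        case False
        then show ?thesis by (simp add: u_def)
      qed
    qed
    show "AE x in lborel. norm (u x * cnj (?\<kappa> * (\<integral>z. u (x + ?e n *\<^sub>R z) * complex_of_real (gauss z) \<partial>lborel)))
       \<le> indicator U x * (sqrt (2 * pi) ^ DIM('a) * (\<integral>z. gauss (z::'a) \<partial>lborel))" for n
    proof (rule AE_I2)
      fix x
      have "cmod (\<integral>z. u (x + ?e n *\<^sub>R z) * complex_of_real (gauss z) \<partial>lborel) \<le> (\<integral>z. gauss (z::'a) \<partial>lborel)"
        by (rule Bochner_Integration.integral_norm_bound_integral[OF _ gi])
           (auto simp: u_def norm_mult split: split_indicator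
             intro!: Bochner_Integration.integrable_bound[OF Fourier_gauss(1)])
      then have "sqrt (2 * pi) ^ DIM('a) * cmod (\<integral>z. u (x + ?e n *\<^sub>R z) * complex_of_real (gauss z) \<partial>lborel)
         \<le> sqrt (2 * pi) ^ DIM('a) * (\<integral>z. gauss (z::'a) \<partial>lborel)"
        by (intro mult_left_mono) auto
      then show "norm (u x * cnj (?\<kappa> * (\<integral>z. u (x + ?e n *\<^sub>R z) * complex_of_real (gauss z) \<partial>lborel)))
       \<le> indicator U x * (sqrt (2 * pi) ^ DIM('a) * (\<integral>z. gauss (z::'a) \<partial>lborel))"
        by (cases "x \<in> U") (simp_all add: u_def norm_mult norm_power)
    qed
    show "integrable lborel (\<lambda>x. indicator U x * (sqrt (2 * pi) ^ DIM('a) * (\<integral>z. gauss (z::'a) \<partial>lborel)))"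
      using iU by (intro integrable_mult_left)
  qed measurable
  then have lim1: "(\<lambda>n. \<integral>\<xi>. complex_of_real ((cmod (Fourier u \<xi>))\<^sup>2 * gauss (?e n *\<^sub>R \<xi>)) \<partial>lborel)
      \<longlonglongrightarrow> (\<integral>x. u x * cnj (?\<kappa> * ?\<kappa>) \<partial>lborel)"
    by (subst regularized_Plancherel[OF u]) (simp_all only: inner zero_less_divide_1_iff of_nat_0_less_iff zero_less_Suc)
  have lim2: "(\<lambda>n. \<integral>\<xi>. complex_of_real ((cmod (Fourier u \<xi>))\<^sup>2 * gauss (?e n *\<^sub>R \<xi>)) \<partial>lborel)
      \<longlonglongrightarrow> (\<integral>\<xi>. complex_of_real ((cmod (Fourier u \<xi>))\<^sup>2) \<partial>lborel)"
  proof (rule integral_dominated_convergence[where w = "\<lambda>\<xi>. (cmod (Fourier u \<xi>))\<^sup>2"])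
    show "AE \<xi> in lborel. (\<lambda>n. complex_of_real ((cmod (Fourier u \<xi>))\<^sup>2 * gauss (?e n *\<^sub>R \<xi>)))
      \<longlonglongrightarrow> complex_of_real ((cmod (Fourier u \<xi>))\<^sup>2)"
    proof (rule AE_I2)
      fix \<xi>
      have "(\<lambda>n. complex_of_real ((cmod (Fourier u \<xi>))\<^sup>2 * gauss (?e n *\<^sub>R \<xi>)))
         \<longlonglongrightarrow> complex_of_real ((cmod (Fourier u \<xi>))\<^sup>2 * gauss (0 *\<^sub>R \<xi>))"
        by (intro tendsto_intros tendsto_gauss LIMSEQ_Suc[OF lim_1_over_n])
      then show "(\<lambda>n. complex_of_real ((cmod (Fourier u \<xi>))\<^sup>2 * gauss (?e n *\<^sub>R \<xi>)))
         \<longlonglongrightarrow> complex_of_real ((cmod (Fourier u \<xi>))\<^sup>2)" by (simp add: gauss_def)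
    qed
    show "integrable lborel (\<lambda>\<xi>. (cmod (Fourier u \<xi>))\<^sup>2)"
      using integrable_Fourier_sq(1)[OF L] by (simp add: u_def)
    show "AE \<xi> in lborel. norm (complex_of_real ((cmod (Fourier u \<xi>))\<^sup>2 * gauss (?e n *\<^sub>R \<xi>))) \<le> (cmod (Fourier u \<xi>))\<^sup>2" for n
      by (rule AE_I2) (simp add: mult_left_le gauss_bounds norm_mult norm_power)
  qed measurable
  have "(\<integral>x. u x * cnj (?\<kappa> * ?\<kappa>) \<partial>lborel) = complex_of_real ((2 * pi) ^ DIM('a) * (\<integral>x. (cmod (u x))\<^sup>2 \<partial>lborel))"
    unfolding \<kappa>2 sq by (simp add: u_def mult.commute)
  with LIMSEQ_unique[OF lim1 lim2]
  have "complex_of_real ((2 * pi) ^ DIM('a) * (\<integral>x. (cmod (u x))\<^sup>2 \<partial>lborel)) = complex_of_real (\<integral>\<xi>. (cmod (Fourier u \<xi>))\<^sup>2 \<partial>lborel)"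
    by (simp only: integral_complex_of_real)
  then have "(2 * pi) ^ DIM('a) * (\<integral>x. (cmod (u x))\<^sup>2 \<partial>lborel) = (\<integral>\<xi>. (cmod (Fourier u \<xi>))\<^sup>2 \<partial>lborel)"
    by (simp only: of_real_eq_iff)
  then show "Re (Plancherel_defect (\<lambda>x. complex_of_real (indicator U x)) (\<lambda>x. complex_of_real (indicator U x))) = 0"
    unfolding Re_Plancherel_defect u_def by simp
qed

lemma L2_dist_expand:
  assumes "u \<in> L2" "v \<in> L2"
  shows "(\<integral>x. (cmod (u x - v x))\<^sup>2 \<partial>lborel)
    = (\<integral>x. (cmod (u x))\<^sup>2 \<partial>lborel) + (\<integral>x. (cmod (v x))\<^sup>2 \<partial>lborel) - 2 * Re (\<integral>x. u x * cnj (v x) \<partial>lborel)"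
proof -
  have i: "integrable lborel (\<lambda>x. (cmod (u x))\<^sup>2)" "integrable lborel (\<lambda>x. (cmod (v x))\<^sup>2)"
    using assms by (auto simp: L2_def)
  note p = L2_product_integrable[OF assms]
  have re: "integrable lborel (\<lambda>x. 2 * Re (u x * cnj (v x)))"
    using p by (intro integrable_mult_right integrable_Re)
  have "(cmod (u x - v x))\<^sup>2 = (cmod (u x))\<^sup>2 + (cmod (v x))\<^sup>2 - 2 * Re (u x * cnj (v x))" for x
    unfolding cmod_power2 by (simp add: power2_eq_square algebra_simps)
  then have "(\<integral>x. (cmod (u x - v x))\<^sup>2 \<partial>lborel)
    = (\<integral>x. (cmod (u x))\<^sup>2 + (cmod (v x))\<^sup>2 - 2 * Re (u x * cnj (v x)) \<partial>lborel)" by simp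
  also have "\<dots> = (\<integral>x. (cmod (u x))\<^sup>2 \<partial>lborel) + (\<integral>x. (cmod (v x))\<^sup>2 \<partial>lborel) - (\<integral>x. 2 * Re (u x * cnj (v x)) \<partial>lborel)"
    by (simp only: Bochner_Integration.integral_diff[OF Bochner_Integration.integrable_add[OF i] re]
        Bochner_Integration.integral_add[OF i])
  also have "(\<integral>x. 2 * Re (u x * cnj (v x)) \<partial>lborel) = 2 * Re (\<integral>x. u x * cnj (v x) \<partial>lborel)"
    using p by (subst integral_mult_right_zero) (subst integral_Re, auto)
  finally show ?thesis .
qed

text \<open>The defect is at most a constant times the squared L2 norm, so a limit in L2 of null
  vectors is null. Open sets lead to bounded Borel sets by outer regularity, these to simple
  functions, and these to \<open>u\<close>.\<close>

lemma Plancherel_defect_zero: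
  fixes u :: "'a::euclidean_space \<Rightarrow> complex"
  assumes uL: "u \<in> L12"
  shows "Re (Plancherel_defect u u) = 0"
proof -
  interpret P: psd_form L12 "Plancherel_defect :: ('a \<Rightarrow> complex) \<Rightarrow> _" by (rule psd_Plancherel)
  let ?N = "\<lambda>f. f \<in> L12 \<and> P.Q f = 0"
  have N_lin: "?N (\<lambda>x. c * f x + g x)" if "?N f" "?N g" for f g :: "'a \<Rightarrow> complex" and c
    using that P.kernel_add[of f g c] L12_lin[of f g c] by simp
  have N_sum: "?N (\<lambda>x. \<Sum>i\<in>I. c i * f i x)" if "finite I" "\<And>i. i \<in> I \<Longrightarrow> ?N (f i)"
    for I :: "complex set" and f :: "complex \<Rightarrow> 'a \<Rightarrow> complex" and c
    using that
  proof (induction I rule: finite_induct)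
    case empty
    have "P.Q (\<lambda>x. 0) = 0" using P.B_lin[OF P.zero P.zero P.zero, of 1] by simp
    with P.zero show ?case by simp
  next
    case (insert i I)
    then have "?N (\<lambda>x. \<Sum>i\<in>I. c i * f i x)" "?N (f i)" by auto
    from N_lin[OF this(2,1), of "c i"] show ?case using insert(1,2) by simp
  qed
  have approx: "P.Q f = 0"
    if "f \<in> L12" and "\<And>e. e > 0 \<Longrightarrow> \<exists>g. ?N g \<and> (\<integral>x. (cmod (f x - g x))\<^sup>2 \<partial>lborel) \<le> e" for f
  proof -
    have "P.Q f \<le> 0 + e" if "e > 0" for e
    proof -
      have "0 < e / (2 * pi) ^ DIM('a)" using that by simp
      from \<open>\<And>e. e > 0 \<Longrightarrow> \<exists>g. ?N g \<and> (\<integral>x. (cmod (f x - g x))\<^sup>2 \<partial>lborel) \<le> e\<close>[OF this]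
      obtain g where g: "g \<in> L12" "P.Q g = 0" "(\<integral>x. (cmod (f x - g x))\<^sup>2 \<partial>lborel) \<le> e / (2 * pi) ^ DIM('a)" by auto
      have "P.Q f = P.Q (\<lambda>x. (-1) * g x + f x)"
        using P.kernel_add[OF g(1) \<open>f \<in> L12\<close> g(2), of "-1"] by simp
      also have "\<dots> \<le> (2 * pi) ^ DIM('a) * (\<integral>x. (cmod ((-1) * g x + f x))\<^sup>2 \<partial>lborel)"
        unfolding Re_Plancherel_defect by (simp add: integral_nonneg_AE)
      also have "\<dots> \<le> e" using g(3) by (simp add: field_simps)
      finally show ?thesis by simp
    qed
    then have "P.Q f \<le> 0" by (rule field_le_epsilon)
    with P.B_nonneg[OF \<open>f \<in> L12\<close>] show ?thesis by simp
  qed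
  have N_ind: "?N (\<lambda>x. complex_of_real (indicator A x))" if A [measurable]: "A \<in> sets borel" "bounded A" for A :: "'a set"
  proof -
    have fin: "emeasure lborel A < \<infinity>" using A(2) by (rule emeasure_bounded_finite)
    then have iA: "integrable lborel (indicator A :: 'a \<Rightarrow> real)" by simp
    have sq: "(cmod (complex_of_real (indicator A x)))\<^sup>2 = indicator A x" for x by (simp split: split_indicator)
    have L: "(\<lambda>x. complex_of_real (indicator A x)) \<in> L12"
      unfolding L12_def L2_def using iA sq by simp
    have "P.Q (\<lambda>x. complex_of_real (indicator A x)) = 0"
    proof (rule approx[OF L])
      fix e :: real assume "e > 0"
      obtain r where r: "A \<subseteq> ball 0 r" using A(2) bounded_subset_ballD by blast
      obtain U where U: "open U" "A \<subseteq> U" "emeasure lborel (U - A) < e"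
        using outer_regular_lborel[OF A(1) \<open>e > 0\<close>] .
      \<comment> \<open>Outer regularity provides an open set that may be unbounded; the ball
        restores boundedness and still covers \<open>A\<close>.\<close>
      let ?U = "U \<inter> ball 0 r"
      have [measurable]: "U \<in> sets borel" using U by simp
      have "open ?U" "bounded ?U" using U(1) by (auto intro: bounded_subset[OF bounded_ball])
      from Plancherel_defect_open[OF this]
      have "?N (\<lambda>x. complex_of_real (indicator ?U x))" by simp
      moreover have "(\<integral>x. (cmod (complex_of_real (indicator A x) - complex_of_real (indicator ?U x)))\<^sup>2 \<partial>lborel) \<le> e"
      proof -
        have "(cmod (complex_of_real (indicator A x) - complex_of_real (indicator ?U x)))\<^sup>2 = indicator (?U - A) x" for x
          using U(2) r by (auto split: split_indicator)
        then have "(\<integral>x. (cmod (complex_of_real (indicator A x) - complex_of_real (indicator ?U x)))\<^sup>2 \<partial>lborel) = measure lborel (?U - A)"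
          by simp
        also have "\<dots> \<le> measure lborel (U - A)"
          using U(3) by (intro measure_mono_fmeasurable) (auto simp: fmeasurable_def intro: less_trans)
        also have "\<dots> \<le> e" using U(3) \<open>e > 0\<close> unfolding measure_def
          by (simp add: enn2real_leI less_imp_le)
        finally show ?thesis .
      qed
      ultimately show "\<exists>g. ?N g \<and> (\<integral>x. (cmod (complex_of_real (indicator A x) - g x))\<^sup>2 \<partial>lborel) \<le> e" by blast
    qed
    with L show ?thesis by simp
  qed
  note um = L12_D(1)[OF uL]
  note [measurable] = um
  obtain F where F: "\<And>i. simple_function borel (F i)" "\<And>x. (\<lambda>i. F i x) \<longlonglongrightarrow> u x"
    "\<And>i x. dist (F i x) 0 \<le> 2 * dist (u x) 0"
    using borel_measurable_implies_sequence_metric[OF um, of 0] by auto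
  have [measurable]: "ball 0 (real i) \<in> sets (borel :: 'a measure)" for i by simp
  have [measurable]: "F i \<in> borel_measurable borel" for i using F(1) by (rule borel_measurable_simple_function)
  define n where "n i x = complex_of_real (indicator (ball 0 (real i)) x) * F i x" for i and x :: 'a
  have Nn: "?N (n i)" for i
  proof -
    have fin: "finite (range (F i))" using F(1)[of i] by (simp add: simple_function_def)
    have meas: "F i -` {y} \<inter> ball 0 (real i) \<in> sets borel" for y
      by measurable
    have eq: "n i = (\<lambda>x. \<Sum>y\<in>range (F i). y * complex_of_real (indicator (F i -` {y} \<inter> ball 0 (real i)) x))"
    proof
      fix x
      have "(\<Sum>y\<in>range (F i). y * complex_of_real (indicator (F i -` {y} \<inter> ball 0 (real i)) x))
        = (\<Sum>y\<in>range (F i). if y = F i x then y * complex_of_real (indicator (ball 0 (real i)) x) else 0)"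
        by (intro sum.cong) (auto split: split_indicator)
      also have "\<dots> = n i x" using fin by (simp add: n_def)
      finally show "n i x = (\<Sum>y\<in>range (F i). y * complex_of_real (indicator (F i -` {y} \<inter> ball 0 (real i)) x))" ..
    qed
    show ?thesis unfolding eq
      by (rule N_sum[OF fin], rule N_ind[OF meas]) (auto intro: bounded_subset[OF bounded_ball])
  qed
  have "(\<lambda>i. \<integral>x. (cmod (u x - n i x))\<^sup>2 \<partial>lborel) \<longlonglongrightarrow> (\<integral>x. 0 \<partial>(lborel :: 'a measure))"
  \<comment> \<open>The simple functions are bounded by twice |u|, so the difference is bounded by
    three times |u|; 9 is the square of 3.\<close>
  proof (rule integral_dominated_convergence[where w = "\<lambda>x. 9 * (cmod (u x))\<^sup>2"])
    show "AE x in lborel. (\<lambda>i. (cmod (u x - n i x))\<^sup>2) \<longlonglongrightarrow> 0"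
    proof (rule AE_I2)
      fix x :: 'a
      have "\<forall>\<^sub>F i in sequentially. norm x < real i"
        using eventually_gt_at_top filterlim_real_sequentially filterlim_at_top_dense by blast
      then have "\<forall>\<^sub>F i in sequentially. F i x = n i x"
        by eventually_elim (simp add: n_def)
      with F(2)[of x] have "(\<lambda>i. n i x) \<longlonglongrightarrow> u x" by (rule Lim_transform_eventually)
      then have "(\<lambda>i. (cmod (u x - n i x))\<^sup>2) \<longlonglongrightarrow> (cmod (u x - u x))\<^sup>2" by (intro tendsto_intros)
      then show "(\<lambda>i. (cmod (u x - n i x))\<^sup>2) \<longlonglongrightarrow> 0" by simp
    qed
    show "AE x in lborel. norm ((cmod (u x - n i x))\<^sup>2) \<le> 9 * (cmod (u x))\<^sup>2" for i
    proof (rule AE_I2)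
      fix x
      have "cmod (n i x) \<le> 2 * cmod (u x)" using F(3)[of i x] by (auto simp: n_def norm_mult split: split_indicator)
      then have "cmod (u x - n i x) \<le> 3 * cmod (u x)" using norm_triangle_ineq4[of "u x" "n i x"] by linarith
      then have "(cmod (u x - n i x))\<^sup>2 \<le> (3 * cmod (u x))\<^sup>2" by (intro power_mono) auto
      then show "norm ((cmod (u x - n i x))\<^sup>2) \<le> 9 * (cmod (u x))\<^sup>2" by (simp add: power_mult_distrib)
    qed
    show "integrable lborel (\<lambda>x. 9 * (cmod (u x))\<^sup>2)" using L12_D(3)[OF uL] by simp
  qed (unfold n_def, measurable)
  then have lim: "(\<lambda>i. \<integral>x. (cmod (u x - n i x))\<^sup>2 \<partial>lborel) \<longlonglongrightarrow> 0" by simp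
  show ?thesis
  proof (rule approx[OF uL])
    fix e :: real assume "e > 0"
    with lim have "\<forall>\<^sub>F i in sequentially. (\<integral>x. (cmod (u x - n i x))\<^sup>2 \<partial>lborel) < e" by (rule order_tendstoD(2))
    then obtain i where "(\<integral>x. (cmod (u x - n i x))\<^sup>2 \<partial>lborel) < e" by (auto simp: eventually_sequentially)
    with Nn[of i] show "\<exists>g. ?N g \<and> (\<integral>x. (cmod (u x - g x))\<^sup>2 \<partial>lborel) \<le> e" by (blast intro: less_imp_le)
  qed
qed

lemma Plancherel:
  fixes u :: "'a::euclidean_space \<Rightarrow> complex"
  assumes "u \<in> L12"
  shows "(\<integral>\<xi>. (cmod (Fourier u \<xi>))\<^sup>2 \<partial>lborel) = (2 * pi) ^ DIM('a) * (\<integral>x. (cmod (u x))\<^sup>2 \<partial>lborel)"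
  using Plancherel_defect_zero[OF assms] unfolding Re_Plancherel_defect by simp

section \<open>Injectivity and the inverse transform\<close>

lemma Fourier_zero_imp_AE_zero:
  assumes "u \<in> L12" "\<And>\<xi>. Fourier u \<xi> = 0"
  shows "AE x in lborel. u x = 0"
proof -
  have "(\<integral>x. (cmod (u x))\<^sup>2 \<partial>lborel) = 0" using Plancherel[OF assms(1)] assms(2) by simp
  then show ?thesis
    using L12_D[OF assms(1)] by (subst (asm) integral_nonneg_eq_0_iff_AE) auto
qed

text \<open>Written through the forward transform, so that Plancherel's theorem carries over by a
  reflection.\<close>

definition inverse_Fourier :: "('a::euclidean_space \<Rightarrow> complex) \<Rightarrow> 'a \<Rightarrow> complex" where
  "inverse_Fourier w x = Fourier w (- x) / of_real ((2 * pi) ^ DIM('a))"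

lemma inverse_Fourier_L2:
  fixes w :: "'a::euclidean_space \<Rightarrow> complex"
  assumes "w \<in> L12"
  shows "inverse_Fourier w \<in> L2"
    and "(2 * pi) ^ DIM('a) * (\<integral>x. (cmod (inverse_Fourier w x))\<^sup>2 \<partial>lborel) = (\<integral>\<xi>. (cmod (w \<xi>))\<^sup>2 \<partial>lborel)"
proof -
  let ?c = "(2 * pi) ^ DIM('a)"
  note w = L12_D[OF assms]
  note [measurable] = w(1)
  have c: "0 < ?c" by simp
  have eq: "(cmod (inverse_Fourier w x))\<^sup>2 = (cmod (Fourier w (0 + (-1) *\<^sub>R x)))\<^sup>2 / ?c\<^sup>2" for x
    by (simp add: inverse_Fourier_def norm_divide power_divide norm_power power_mult_distrib norm_mult)
  have i: "integrable lborel (\<lambda>x. (cmod (Fourier w (0 + (-1) *\<^sub>R x)))\<^sup>2)"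
    by (rule lborel_integrable_affine[OF integrable_Fourier_sq(1)[OF assms]]) simp
  show "inverse_Fourier w \<in> L2"
  proof -
    have "inverse_Fourier w \<in> borel_measurable borel"
      unfolding inverse_Fourier_def[abs_def] by measurable
    then show ?thesis unfolding L2_def using i eq by simp
  qed
  have "complex_of_real (\<integral>x. (cmod (Fourier w x))\<^sup>2 \<partial>lborel) = (\<integral>x. complex_of_real ((cmod (Fourier w x))\<^sup>2) \<partial>lborel)"
    by (simp only: integral_complex_of_real)
  also have "\<dots> = of_real (\<bar>-1\<bar> ^ DIM('a)) * (\<integral>x. complex_of_real ((cmod (Fourier w (0 + (-1) *\<^sub>R x)))\<^sup>2) \<partial>lborel)"
    by (rule lborel_integral_affine) auto
  finally have "complex_of_real (\<integral>x. (cmod (Fourier w x))\<^sup>2 \<partial>lborel) = complex_of_real (\<integral>x. (cmod (Fourier w (0 + (-1) *\<^sub>R x)))\<^sup>2 \<partial>lborel)"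
    by (simp only: integral_complex_of_real) simp
  then have refl: "(\<integral>x. (cmod (Fourier w (0 + (-1) *\<^sub>R x)))\<^sup>2 \<partial>lborel) = ?c * (\<integral>x. (cmod (w x))\<^sup>2 \<partial>lborel)"
    unfolding Plancherel[OF assms, symmetric] of_real_eq_iff by simp
  have "(\<integral>x. (cmod (inverse_Fourier w x))\<^sup>2 \<partial>lborel) = (\<integral>x. (cmod (Fourier w (0 + (-1) *\<^sub>R x)))\<^sup>2 \<partial>lborel) / ?c\<^sup>2"
    unfolding eq by (rule integral_divide_zero)
  also have "\<dots> = (\<integral>x. (cmod (w x))\<^sup>2 \<partial>lborel) / ?c"
    unfolding refl using c by (simp add: power2_eq_square)
  finally show "?c * (\<integral>x. (cmod (inverse_Fourier w x))\<^sup>2 \<partial>lborel) = (\<integral>\<xi>. (cmod (w \<xi>))\<^sup>2 \<partial>lborel)"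
    using c by simp
qed

text \<open>The inverse transform of \<open>w\<close> is square integrable but perhaps not
  integrable, so Plancherel cannot be applied to the difference. Both squares are expanded instead,
  and the mixed terms are matched by the multiplication formula.\<close>

lemma L2_dist_inverse_Fourier:
  fixes u w :: "'a::euclidean_space \<Rightarrow> complex"
  assumes "u \<in> L12" "w \<in> L12"
  shows "(2 * pi) ^ DIM('a) * (\<integral>x. (cmod (u x - inverse_Fourier w x))\<^sup>2 \<partial>lborel) = (\<integral>\<xi>. (cmod (Fourier u \<xi> - w \<xi>))\<^sup>2 \<partial>lborel)"
proof -
  let ?c = "(2 * pi) ^ DIM('a)"
  have c: "0 < ?c" by simp
  have wc: "integrable lborel (\<lambda>x. cnj (w x))" using L12_D(2)[OF assms(2)] by simp
  have "cnj (inverse_Fourier w x) = Fourier (\<lambda>x. cnj (w x)) x / of_real ?c" for x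
    unfolding inverse_Fourier_def by (simp add: cnj_Fourier)
  then have "of_real ?c * (\<integral>x. u x * cnj (inverse_Fourier w x) \<partial>lborel) = (\<integral>x. u x * Fourier (\<lambda>x. cnj (w x)) x \<partial>lborel)"
    using c by simp
  also have "\<dots> = (\<integral>\<xi>. Fourier u \<xi> * cnj (w \<xi>) \<partial>lborel)"
    by (rule Fourier_multiplication_formula[OF L12_D(2)[OF assms(1)] wc, symmetric])
  finally have "Re (of_real ?c * (\<integral>x. u x * cnj (inverse_Fourier w x) \<partial>lborel)) = Re (\<integral>\<xi>. Fourier u \<xi> * cnj (w \<xi>) \<partial>lborel)"
    by simp
  then have cross: "?c * Re (\<integral>x. u x * cnj (inverse_Fourier w x) \<partial>lborel) = Re (\<integral>\<xi>. Fourier u \<xi> * cnj (w \<xi>) \<partial>lborel)"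
    by (simp only: Re_complex_of_real Im_complex_of_real times_complex.sel)
  show ?thesis
    unfolding L2_dist_expand[OF L12_D(4)[OF assms(1)] inverse_Fourier_L2(1)[OF assms(2)]]
      L2_dist_expand[OF Fourier_L2[OF assms(1)] L12_D(4)[OF assms(2)]] Plancherel[OF assms(1)]
      inverse_Fourier_L2(2)[OF assms(2), symmetric] cross[symmetric]
    by (simp add: algebra_simps)
qed

subsection \<open>Test functions and weak derivatives\<close>

definition smooth1 :: "(real \<Rightarrow> real) \<Rightarrow> bool" where
  "smooth1 F \<longleftrightarrow> (\<exists>G. G 0 = F \<and> (\<forall>n t. (G n has_real_derivative G (Suc n) t) (at t)))"

lemma smooth1_deriv:
  assumes "smooth1 F"
  obtains F' where "smooth1 F'" "\<And>t. (F has_real_derivative F' t) (at t)"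
proof -
  obtain G where G: "G 0 = F" "\<And>n t. (G n has_real_derivative G (Suc n) t) (at t)"
    using assms by (auto simp: smooth1_def)
  have "smooth1 (G (Suc 0))" unfolding smooth1_def by (rule exI[of _ "\<lambda>n. G (Suc n)"]) (use G in auto)
  then show thesis using that G(2)[of 0] G(1) by auto
qed

lemma smooth1_sin: "smooth1 sin"
  unfolding smooth1_def
proof (rule exI[of _ "\<lambda>n t. sin (t + real n * (pi / 2))"], intro conjI allI)
  fix n t
  define a where "a = t + real n * (pi / 2)"
  have "t + real (Suc n) * (pi / 2) = a + pi / 2" by (simp add: a_def field_simps)
  then have "cos (t + real n * (pi / 2)) = sin (t + real (Suc n) * (pi / 2))"
    using sin_add[of a "pi / 2"] unfolding a_def[symmetric] by simp
  moreover have "((\<lambda>t. sin (t + real n * (pi / 2))) has_real_derivative cos (t + real n * (pi / 2))) (at t)"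
    by (auto intro!: derivative_eq_intros)
  ultimately show "((\<lambda>t. sin (t + real n * (pi / 2))) has_real_derivative sin (t + real (Suc n) * (pi / 2))) (at t)"
    by simp
qed simp

text \<open>The polynomial in \<open>1 / t\<close> makes the family closed under differentiation.\<close>

definition exp_flat :: "real poly \<Rightarrow> real \<Rightarrow> real" where
  "exp_flat p t = (if t > 0 then poly p (1 / t) * exp (- (1 / t)) else 0)"

lemma poly_exp_decay: "((\<lambda>y. poly p y * exp (- y)) \<longlongrightarrow> (0::real)) at_top"
proof -
  have "((\<lambda>y. \<Sum>i\<le>degree p. coeff p i * (y ^ i / exp y)) \<longlongrightarrow> (\<Sum>i\<le>degree p. coeff p i * 0)) at_top"
    by (intro tendsto_intros tendsto_power_div_exp_0)
  then show ?thesis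
    by (simp add: poly_altdef exp_minus sum_distrib_right divide_inverse mult.assoc)
qed

text \<open>With y = 1/t the derivative of p(y) exp(-y) is y^2 (p - p')(y) exp(-y), which explains
  the polynomial. Only the flatness at 0 is delicate.\<close>

lemma exp_flat_deriv:
  "(exp_flat p has_real_derivative exp_flat (monom 1 2 * (p - pderiv p)) t) (at t)"
proof -
  consider "t > 0" | "t < 0" | "t = 0" by linarith
  then show ?thesis
  proof cases
    case 1
    have "((\<lambda>t. poly p (1 / t) * exp (- (1 / t))) has_real_derivative
        poly (pderiv p) (1 / t) * (- (1 / t\<^sup>2)) * exp (- (1 / t)) + poly p (1 / t) * (exp (- (1 / t)) * (1 / t\<^sup>2))) (at t)"
      using 1 by (auto intro!: derivative_eq_intros DERIV_chain2[OF poly_DERIV] simp: power2_eq_square field_simps)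
    moreover have "poly (pderiv p) (1 / t) * (- (1 / t\<^sup>2)) * exp (- (1 / t)) + poly p (1 / t) * (exp (- (1 / t)) * (1 / t\<^sup>2))
      = exp_flat (monom 1 2 * (p - pderiv p)) t"
      using 1 by (simp add: exp_flat_def poly_monom power_divide algebra_simps)
    ultimately have "((\<lambda>t. poly p (1 / t) * exp (- (1 / t))) has_real_derivative exp_flat (monom 1 2 * (p - pderiv p)) t) (at t)"
      by simp
    then show ?thesis
      by (rule has_field_derivative_transform_within_open[of _ _ _ "{0<..}"]) (use 1 in \<open>auto simp: exp_flat_def\<close>)
  next
    case 2
    have "((\<lambda>_. 0) has_real_derivative 0) (at t)" by simp
    then have "(exp_flat p has_real_derivative 0) (at t)"
      by (rule has_field_derivative_transform_within_open[of _ _ _ "{..<0}"]) (use 2 in \<open>auto simp: exp_flat_def\<close>)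
    then show ?thesis using 2 by (simp add: exp_flat_def)
  next
    case 3
    have r: "((\<lambda>h. exp_flat p h / h) \<longlongrightarrow> 0) (at_right 0)"
    proof -
      \<comment> \<open>Dividing by \<open>h\<close> multiplies the polynomial in
        \<open>1 / h\<close> by its variable, which is what \<open>pCons 0 p\<close>
        expresses.\<close>
      have "((\<lambda>h. poly (pCons 0 p) (inverse h) * exp (- inverse h)) \<longlongrightarrow> 0) (at_right 0)"
        by (rule filterlim_compose[OF poly_exp_decay filterlim_inverse_at_top_right])
      moreover have "\<forall>\<^sub>F h in at_right 0. poly (pCons 0 p) (inverse h) * exp (- inverse h) = exp_flat p h / h"
        unfolding eventually_at_right_field by (intro exI[of _ 1]) (auto simp: exp_flat_def field_simps)
      ultimately show ?thesis by (rule Lim_transform_eventually)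
    qed
    have l: "((\<lambda>h. exp_flat p h / h) \<longlongrightarrow> 0) (at_left 0)"
    proof (rule Lim_transform_eventually[OF tendsto_const])
      show "\<forall>\<^sub>F h in at_left 0. 0 = exp_flat p h / h"
        unfolding eventually_at_left_field by (intro exI[of _ "-1"]) (auto simp: exp_flat_def)
    qed
    have "((\<lambda>h. exp_flat p h / h) \<longlongrightarrow> 0) (at 0)" using l r by (rule filterlim_split_at)
    then have "(exp_flat p has_real_derivative 0) (at 0)"
      unfolding has_field_derivative_iff by (simp add: exp_flat_def)
    then show ?thesis using 3 by (simp add: exp_flat_def)
  qed
qed

lemma smooth1_exp_flat: "smooth1 (exp_flat p)"
  unfolding smooth1_def
  by (rule exI[of _ "\<lambda>n. exp_flat (((\<lambda>p. monom 1 2 * (p - pderiv p)) ^^ n) p)"]) (simp add: exp_flat_deriv)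

text \<open>A class of expressions closed under partial derivatives, so that coinduction on \<open>smooth\<close> is
  needed only once.\<close>

inductive smooth_term :: "('a::euclidean_space \<Rightarrow> real) \<Rightarrow> bool" where
  const: "smooth_term (\<lambda>x. c)"
| inner: "smooth_term (\<lambda>x. x \<bullet> v)"
| add: "smooth_term f \<Longrightarrow> smooth_term g \<Longrightarrow> smooth_term (\<lambda>x. f x + g x)"
| mult: "smooth_term f \<Longrightarrow> smooth_term g \<Longrightarrow> smooth_term (\<lambda>x. f x * g x)"
| comp: "smooth1 F \<Longrightarrow> smooth_term f \<Longrightarrow> smooth_term (\<lambda>x. F (f x))"

lemma smooth_term_deriv:
  "smooth_term f \<Longrightarrow> \<exists>g. (\<forall>b\<in>Basis. smooth_term (g b)) \<and>
     (\<forall>x. (f has_derivative (\<lambda>h. \<Sum>b\<in>Basis. (h \<bullet> b) * g b x)) (at x))"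
proof (induction rule: smooth_term.induct)
  case (const c)
  show ?case by (rule exI[of _ "\<lambda>_ _. 0"]) (auto intro: smooth_term.const)
next
  case (inner v)
  have "((\<lambda>x. x \<bullet> v) has_derivative (\<lambda>h. \<Sum>b\<in>Basis. (h \<bullet> b) * (v \<bullet> b))) (at x)" for x
    unfolding euclidean_inner[symmetric] by (auto intro!: derivative_eq_intros)
  then show ?case by (intro exI[of _ "\<lambda>b _. v \<bullet> b"]) (auto intro: smooth_term.const)
next
  case (add f g)
  then obtain f' g' where *: "\<forall>b\<in>Basis. smooth_term (f' b)" "\<forall>b\<in>Basis. smooth_term (g' b)"
    "\<And>x. (f has_derivative (\<lambda>h. \<Sum>b\<in>Basis. (h \<bullet> b) * f' b x)) (at x)"
    "\<And>x. (g has_derivative (\<lambda>h. \<Sum>b\<in>Basis. (h \<bullet> b) * g' b x)) (at x)" by auto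
  show ?case
    by (rule exI[of _ "\<lambda>b x. f' b x + g' b x"])
       (use * has_derivative_add[OF *(3,4)] in \<open>auto intro: smooth_term.add simp: distrib_left sum.distrib\<close>)
next
  case (mult f g)
  then obtain f' g' where *: "\<forall>b\<in>Basis. smooth_term (f' b)" "\<forall>b\<in>Basis. smooth_term (g' b)"
    "\<And>x. (f has_derivative (\<lambda>h. \<Sum>b\<in>Basis. (h \<bullet> b) * f' b x)) (at x)"
    "\<And>x. (g has_derivative (\<lambda>h. \<Sum>b\<in>Basis. (h \<bullet> b) * g' b x)) (at x)" by auto
  have "((\<lambda>x. f x * g x) has_derivative (\<lambda>h. \<Sum>b\<in>Basis. (h \<bullet> b) * (f x * g' b x + f' b x * g x))) (at x)" for x
  proof -
    have "(\<lambda>h. \<Sum>b\<in>Basis. (h \<bullet> b) * (f x * g' b x + f' b x * g x)) =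
      (\<lambda>h. f x * (\<Sum>b\<in>Basis. (h \<bullet> b) * g' b x) + (\<Sum>b\<in>Basis. (h \<bullet> b) * f' b x) * g x)"
      by (simp add: distrib_left sum.distrib sum_distrib_left sum_distrib_right mult_ac)
    then show ?thesis using has_derivative_mult[OF *(3,4)[of x]] by simp
  qed
  moreover have "\<forall>b\<in>Basis. smooth_term (\<lambda>x. f x * g' b x + f' b x * g x)"
    using * mult.hyps by (auto intro!: smooth_term.add smooth_term.mult)
  ultimately show ?case by (intro exI[of _ "\<lambda>b x. f x * g' b x + f' b x * g x"]) auto
next
  case (comp F f)
  then obtain f' where *: "\<forall>b\<in>Basis. smooth_term (f' b)"
    "\<And>x. (f has_derivative (\<lambda>h. \<Sum>b\<in>Basis. (h \<bullet> b) * f' b x)) (at x)" by auto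
  obtain F' where F': "smooth1 F'" "\<And>t. (F has_real_derivative F' t) (at t)"
    using smooth1_deriv[OF comp.hyps(1)] by metis
  have "((\<lambda>x. F (f x)) has_derivative (\<lambda>h. \<Sum>b\<in>Basis. (h \<bullet> b) * (F' (f x) * f' b x))) (at x)" for x
  proof -
    have "((\<lambda>x. F (f x)) has_derivative (\<lambda>h. F' (f x) * (\<Sum>b\<in>Basis. (h \<bullet> b) * f' b x))) (at x)"
      by (rule has_derivative_compose[OF *(2) F'(2)[unfolded has_field_derivative_def]])
    then show ?thesis by (simp add: sum_distrib_left mult_ac)
  qed
  moreover have "\<forall>b\<in>Basis. smooth_term (\<lambda>x. F' (f x) * f' b x)"
  proof
    fix b :: 'a assume "b \<in> Basis"
    then have "smooth_term (f' b)" using *(1) by blast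
    from smooth_term.mult[OF smooth_term.comp[OF F'(1) comp.hyps(2)] this]
    show "smooth_term (\<lambda>x. F' (f x) * f' b x)" .
  qed
  ultimately show ?case by (intro exI[of _ "\<lambda>b x. F' (f x) * f' b x"]) auto
qed

lemma smooth_term_imp_smooth: "smooth_term f \<Longrightarrow> smooth f"
proof (coinduction arbitrary: f rule: smooth.coinduct)
  case smooth
  obtain g where g: "\<forall>b\<in>Basis. smooth_term (g b)"
    "\<And>x. (f has_derivative (\<lambda>h. \<Sum>b\<in>Basis. (h \<bullet> b) * g b x)) (at x)"
    using smooth_term_deriv[OF smooth] by auto
  have "frechet_derivative f (at x) b = g b x" if "b \<in> Basis" for b x
  proof -
    have "frechet_derivative f (at x) b = (\<Sum>b'\<in>Basis. (b \<bullet> b') * g b' x)"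
      using frechet_derivative_at[OF g(2)] by metis
    also have "\<dots> = (\<Sum>b'\<in>Basis. if b' = b then g b' x else 0)"
      using that by (intro sum.cong) (auto simp: inner_Basis)
    finally show ?thesis using that by simp
  qed
  then show ?case using g(1) by (auto intro: differentiableI[OF g(2)])
qed

section \<open>Bump functions\<close>

lemma smooth_term_prod: "finite I \<Longrightarrow> (\<And>i. i \<in> I \<Longrightarrow> smooth_term (f i)) \<Longrightarrow> smooth_term (\<lambda>x. \<Prod>i\<in>I. f i x)"
  by (induction I rule: finite_induct) (auto intro: smooth_term.intros)

text \<open>Positive exactly in the open cube of half side \<open>1 / s\<close> about
  \<open>x0\<close>. The product form makes it a smooth term; its value at the centre is positive
  but not normalised to 1.\<close>

definition bump :: "'a::euclidean_space \<Rightarrow> real \<Rightarrow> 'a \<Rightarrow> real" where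
  "bump x0 s x = (\<Prod>b\<in>Basis. exp_flat 1 (1 + s * ((x - x0) \<bullet> b)) * exp_flat 1 (1 - s * ((x - x0) \<bullet> b)))"

lemma smooth_term_bump: "smooth_term (bump x0 s)"
proof -
  have eq: "1 + s * ((x - x0) \<bullet> b) = (1 - s * (x0 \<bullet> b)) + s * (x \<bullet> b)"
    "1 - s * ((x - x0) \<bullet> b) = (1 + s * (x0 \<bullet> b)) + (- s) * (x \<bullet> b)" for x b :: 'a
    by (simp_all add: inner_diff_left algebra_simps)
  have affine: "smooth_term (\<lambda>x. exp_flat 1 (c + d * (x \<bullet> b)))" for c d and b :: 'a
    by (rule smooth_term.comp[OF smooth1_exp_flat
          smooth_term.add[OF smooth_term.const smooth_term.mult[OF smooth_term.const smooth_term.inner]]])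
  show ?thesis unfolding bump_def[abs_def] eq
    by (rule smooth_term_prod[OF finite_Basis smooth_term.mult[OF affine affine]])
qed

lemma exp_flat_1: "0 \<le> exp_flat 1 t" "exp_flat 1 t > 0 \<longleftrightarrow> t > 0" "exp_flat 1 t = 0 \<longleftrightarrow> t \<le> 0"
  by (auto simp: exp_flat_def)

lemma bump_nonneg: "0 \<le> bump x0 s x"
  unfolding bump_def by (intro prod_nonneg mult_nonneg_nonneg) (auto simp: exp_flat_1)

lemma bump_nonzero_iff:
  assumes "s > 0"
  shows "bump x0 s x \<noteq> 0 \<longleftrightarrow> x \<in> box (x0 - (1 / s) *\<^sub>R One) (x0 + (1 / s) *\<^sub>R One)"
proof -
  have "bump x0 s x \<noteq> 0 \<longleftrightarrow> (\<forall>b\<in>Basis. 0 < 1 + s * ((x - x0) \<bullet> b) \<and> 0 < 1 - s * ((x - x0) \<bullet> b))"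
    unfolding bump_def by (auto simp: exp_flat_1 not_le)
  also have "\<dots> \<longleftrightarrow> x \<in> box (x0 - (1 / s) *\<^sub>R One) (x0 + (1 / s) *\<^sub>R One)"
    unfolding mem_box
  proof (intro ball_cong refl)
    fix b :: 'a assume "b \<in> Basis"
    then have 1: "(x0 - (1 / s) *\<^sub>R One) \<bullet> b = x0 \<bullet> b - 1 / s" "(x0 + (1 / s) *\<^sub>R One) \<bullet> b = x0 \<bullet> b + 1 / s"
      by (simp_all add: inner_diff_left inner_add_left)
    have 2: "0 < 1 + s * t \<longleftrightarrow> - 1 / s < t" "0 < 1 - s * t \<longleftrightarrow> t < 1 / s" for t
      using assms by (simp_all add: field_simps) (rule iffI; linarith)
    show "(0 < 1 + s * ((x - x0) \<bullet> b) \<and> 0 < 1 - s * ((x - x0) \<bullet> b)) \<longleftrightarrow>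
      ((x0 - (1 / s) *\<^sub>R One) \<bullet> b < x \<bullet> b \<and> x \<bullet> b < (x0 + (1 / s) *\<^sub>R One) \<bullet> b)"
      unfolding 1 2 by (auto simp: inner_diff_left)
  qed
  finally show ?thesis .
qed

lemma test_function_bump_mult:
  assumes "s > 0" "smooth_term f"
  shows "test_function (\<lambda>x. bump x0 s x * f x)"
proof -
  have "closure {x. bump x0 s x * f x \<noteq> 0} \<subseteq> cbox (x0 - (1 / s) *\<^sub>R One) (x0 + (1 / s) *\<^sub>R One)"
    using bump_nonzero_iff[OF assms(1), of x0] box_subset_cbox
    by (intro closure_minimal closed_cbox) auto
  then have "bounded (closure {x. bump x0 s x * f x \<noteq> 0})" using bounded_cbox bounded_subset by blast
  then have "compact (closure {x. bump x0 s x * f x \<noteq> 0})" by (simp add: compact_eq_bounded_closed)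
  then show ?thesis unfolding test_function_def
    using smooth_term_imp_smooth[OF smooth_term.mult[OF smooth_term_bump assms(2)]] by simp
qed

lemma integrable_indicator_bounded:
  fixes A :: "'a::euclidean_space set"
  assumes "A \<in> sets borel" "bounded A"
  shows "integrable lborel (indicator A :: 'a \<Rightarrow> real)"
  using assms(1) emeasure_bounded_finite[OF assms(2)] by (intro integrable_real_indicator) auto

section \<open>Integration by parts\<close>

lemma smoothD:
  assumes "smooth \<phi>"
  shows "\<phi> differentiable (at x)" "b \<in> Basis \<Longrightarrow> smooth (\<lambda>x. frechet_derivative \<phi> (at x) b)"
  using assms by (auto elim: smooth.cases)

lemma smooth_continuous: "smooth \<phi> \<Longrightarrow> continuous_on UNIV \<phi>"
  by (meson differentiable_imp_continuous_on differentiable_on_def differentiable_at_withinI smoothD(1))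

lemma smooth_measurable: "smooth \<phi> \<Longrightarrow> \<phi> \<in> borel_measurable borel"
  by (rule borel_measurable_continuous_onI[OF smooth_continuous])

lemma smooth_directional_derivative:
  assumes "smooth \<phi>"
  shows "((\<lambda>t. \<phi> (x + t *\<^sub>R b)) has_real_derivative frechet_derivative \<phi> (at (x + s *\<^sub>R b)) b) (at s)"
proof -
  have d: "(\<phi> has_derivative frechet_derivative \<phi> (at (x + s *\<^sub>R b))) (at (x + s *\<^sub>R b))"
    using smoothD(1)[OF assms] frechet_derivative_works by blast
  have "((\<lambda>t. x + t *\<^sub>R b) has_derivative (\<lambda>t. t *\<^sub>R b)) (at s)"
    by (auto intro!: derivative_eq_intros)
  from has_derivative_compose[OF this d]
  have "((\<lambda>t. \<phi> (x + t *\<^sub>R b)) has_derivative (\<lambda>t. frechet_derivative \<phi> (at (x + s *\<^sub>R b)) (t *\<^sub>R b))) (at s)" .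
  moreover have "frechet_derivative \<phi> (at (x + s *\<^sub>R b)) (t *\<^sub>R b) = frechet_derivative \<phi> (at (x + s *\<^sub>R b)) b * t" for t
    using linear_cmul[OF has_derivative_linear[OF d], of t b] by simp
  ultimately show ?thesis by (simp add: has_field_derivative_def)
qed

lemma frechet_derivative_mult:
  fixes f g :: "'a::euclidean_space \<Rightarrow> real"
  assumes "f differentiable (at x)" "g differentiable (at x)"
  shows "frechet_derivative (\<lambda>x. f x * g x) (at x) b
    = f x * frechet_derivative g (at x) b + frechet_derivative f (at x) b * g x"
  using frechet_derivative_at[OF has_derivative_mult[OF
      assms(1)[unfolded frechet_derivative_works] assms(2)[unfolded frechet_derivative_works]]]
  by metis

lemma frechet_derivative_eq_zero:
  assumes "open U" "x \<in> U" "\<And>y. y \<in> U \<Longrightarrow> f y = 0"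
  shows "frechet_derivative f (at x) b = (0::real)"
proof -
  have "((\<lambda>_. 0::real) has_derivative (\<lambda>_. 0)) (at x)" by simp
  then have "(f has_derivative (\<lambda>_. 0)) (at x)"
    by (rule has_derivative_transform_within_open[OF _ assms(1,2)]) (simp add: assms(3))
  from frechet_derivative_at[OF this] show ?thesis by metis
qed

lemma test_function_support:
  assumes "test_function \<phi>"
  shows "x \<notin> closure {x. \<phi> x \<noteq> 0} \<Longrightarrow> \<phi> x = 0"
    and "x \<notin> closure {x. \<phi> x \<noteq> 0} \<Longrightarrow> frechet_derivative \<phi> (at x) b = 0"
proof -
  have sub: "\<phi> y = 0" if "y \<notin> closure {x. \<phi> x \<noteq> 0}" for y
    using that closure_subset[of "{x. \<phi> x \<noteq> 0}"] by (rule_tac ccontr) auto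
  then show "x \<notin> closure {x. \<phi> x \<noteq> 0} \<Longrightarrow> \<phi> x = 0" .
  assume x: "x \<notin> closure {x. \<phi> x \<noteq> 0}"
  show "frechet_derivative \<phi> (at x) b = 0"
    by (rule frechet_derivative_eq_zero[OF open_Compl[OF closed_closure]], rule ComplI, erule notE[OF x],
        rule sub, erule ComplD)
qed

lemma test_function_radius:
  assumes "test_function \<phi>"
  obtains R where "0 < R" "\<And>x. R < norm x \<Longrightarrow> \<phi> x = 0" "\<And>x b. R < norm x \<Longrightarrow> frechet_derivative \<phi> (at x) b = 0"
proof -
  have "bounded (closure {x. \<phi> x \<noteq> 0})"
    using assms by (auto simp: test_function_def compact_imp_bounded)
  then obtain R where R: "0 < R" "\<And>x. x \<in> closure {x. \<phi> x \<noteq> 0} \<Longrightarrow> norm x \<le> R"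
    by (auto simp: bounded_pos)
  then have "x \<notin> closure {x. \<phi> x \<noteq> 0}" if "R < norm x" for x using that by force
  with R(1) test_function_support[OF assms] show thesis using that by blast
qed

lemma continuous_compact_support:
  fixes f :: "'a::euclidean_space \<Rightarrow> real"
  assumes "continuous_on UNIV f" "\<And>x. R < norm x \<Longrightarrow> f x = 0"
  shows "integrable lborel f" "\<exists>M>0. \<forall>x. \<bar>f x\<bar> \<le> M * indicator (cball 0 R) x"
proof -
  have c: "continuous_on (cball 0 R) f" using assms(1) continuous_on_subset by blast
  have "integrable lborel (\<lambda>x. indicator (cball 0 R) x *\<^sub>R f x)"
    by (rule borel_integrable_compact[OF compact_cball c])
  moreover have "(\<lambda>x. indicator (cball 0 R) x *\<^sub>R f x) = f"
    using assms(2) by (auto split: split_indicator)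
  ultimately show "integrable lborel f" by simp
  have "bounded (f ` cball 0 R)" using compact_continuous_image[OF c compact_cball] compact_imp_bounded by blast
  then obtain M where "M > 0" "\<forall>x\<in>cball 0 R. \<bar>f x\<bar> \<le> M" by (auto simp: bounded_pos)
  then show "\<exists>M>0. \<forall>x. \<bar>f x\<bar> \<le> M * indicator (cball 0 R) x"
    using assms(2) by (intro exI[of _ M]) (auto split: split_indicator)
qed

text \<open>Differentiate the translation-invariant integral of \<open>f\<close>.\<close>

lemma integral_partial_derivative_zero:
  fixes f f' :: "'a::euclidean_space \<Rightarrow> real"
  assumes b: "b \<in> Basis"
    and der: "\<And>x s. ((\<lambda>t. f (x + t *\<^sub>R b)) has_real_derivative f' (x + s *\<^sub>R b)) (at s)"
    and cont: "continuous_on UNIV f" "continuous_on UNIV f'"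
    and supp: "\<And>x. R < norm x \<Longrightarrow> f x = 0" "\<And>x. R < norm x \<Longrightarrow> f' x = 0"
  shows "(\<integral>x. f' x \<partial>lborel) = 0"
proof -
  have [measurable]: "f \<in> borel_measurable borel" "f' \<in> borel_measurable borel"
    using cont by (auto intro: borel_measurable_continuous_onI)
  have fi: "integrable lborel f" by (rule continuous_compact_support(1)[OF cont(1) supp(1)])
  obtain M where M: "M > 0" "\<And>x. \<bar>f' x\<bar> \<le> M * indicator (cball 0 R) x"
    using continuous_compact_support(2)[OF cont(2) supp(2)] by blast
  define h where "h n = 1 / real (Suc n)" for n
  have h: "0 < h n" "h n \<le> 1" for n by (simp_all add: h_def)
  define q where "q n x = (f (x + h n *\<^sub>R b) - f x) / h n" for n x
  have shift: "integrable lborel (\<lambda>x. f (x + h n *\<^sub>R b))" for n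
    using lborel_integrable_affine[OF fi, of 1 "h n *\<^sub>R b"] by (simp add: add.commute)
  have q0: "(\<integral>x. q n x \<partial>lborel) = 0" for n
  proof -
    have "complex_of_real (\<integral>x. f x \<partial>lborel) = (\<integral>x. complex_of_real (f x) \<partial>lborel)" by simp
    also have "\<dots> = of_real (\<bar>1\<bar> ^ DIM('a)) * (\<integral>x. complex_of_real (f (h n *\<^sub>R b + 1 *\<^sub>R x)) \<partial>lborel)"
      by (rule lborel_integral_affine) auto
    also have "\<dots> = complex_of_real (\<integral>x. f (x + h n *\<^sub>R b) \<partial>lborel)"
      by (simp add: add.commute)
    finally have "(\<integral>x. f x \<partial>lborel) = (\<integral>x. f (x + h n *\<^sub>R b) \<partial>lborel)" by (simp only: of_real_eq_iff)
    then show ?thesis unfolding q_def using fi shift by simp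
  qed
  \<comment> \<open>By the mean value theorem the quotient is a value of \<open>f'\<close> at
    distance less than 1 from \<open>x\<close>, whence the radius \<open>R + 1\<close>.\<close>
  have qbound: "\<bar>q n x\<bar> \<le> M * indicator (cball 0 (R + 1)) x" for n x
  proof -
    have "\<exists>z. 0 < z \<and> z < h n \<and> f (x + h n *\<^sub>R b) - f (x + 0 *\<^sub>R b) = (h n - 0) * f' (x + z *\<^sub>R b)"
      by (rule MVT2) (use h der in auto)
    then obtain z where z: "0 < z" "z < h n" "q n x = f' (x + z *\<^sub>R b)"
      using h(1)[of n] by (auto simp: q_def)
    have "norm x \<le> norm (x + z *\<^sub>R b) + norm (z *\<^sub>R b)" by (metis norm_triangle_sub add.commute add_diff_cancel_left' norm_minus_commute)
    then have "norm x \<le> norm (x + z *\<^sub>R b) + 1" using z(1,2) h(2)[of n] b by simp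
    then show ?thesis using M(2)[of "x + z *\<^sub>R b"] M(1) z(3) by (auto split: split_indicator_asm split_indicator)
  qed
  have "(\<lambda>n. \<integral>x. q n x \<partial>lborel) \<longlonglongrightarrow> (\<integral>x. f' x \<partial>lborel)"
  proof (rule integral_dominated_convergence[where w = "\<lambda>x. M * indicator (cball 0 (R + 1)) x"])
    show "AE x in lborel. (\<lambda>n. q n x) \<longlonglongrightarrow> f' x"
    proof (rule AE_I2)
      fix x
      have "((\<lambda>t. (f (x + (0 + t) *\<^sub>R b) - f (x + 0 *\<^sub>R b)) / t) \<longlongrightarrow> f' (x + 0 *\<^sub>R b)) (at 0)"
        using der[of x 0] unfolding DERIV_def .
      moreover have "filterlim h (at 0) sequentially"
        unfolding filterlim_at h_def using LIMSEQ_Suc[OF lim_1_over_n] by simp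
      ultimately show "(\<lambda>n. q n x) \<longlonglongrightarrow> f' x"
        unfolding q_def by (auto dest: filterlim_compose)
    qed
    show "integrable lborel (\<lambda>x. M * indicator (cball 0 (R + 1)) x)"
      by (intro integrable_mult_right integrable_indicator_bounded) auto
  qed (use qbound in \<open>auto simp: q_def\<close>)
  then show ?thesis unfolding q0 by (simp add: LIMSEQ_const_iff)
qed

lemma integration_by_parts:
  fixes f \<phi> :: "'a::euclidean_space \<Rightarrow> real"
  assumes f: "smooth f" and \<phi>: "test_function \<phi>" and b: "b \<in> Basis"
  shows "(\<integral>x. f x * frechet_derivative \<phi> (at x) b \<partial>lborel) = - (\<integral>x. frechet_derivative f (at x) b * \<phi> x \<partial>lborel)"
    and "integrable lborel (\<lambda>x. f x * frechet_derivative \<phi> (at x) b)"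
    and "integrable lborel (\<lambda>x. frechet_derivative f (at x) b * \<phi> x)"
proof -
  have s: "smooth \<phi>" using \<phi> by (simp add: test_function_def)
  obtain R where R: "0 < R" "\<And>x. R < norm x \<Longrightarrow> \<phi> x = 0" "\<And>x b. R < norm x \<Longrightarrow> frechet_derivative \<phi> (at x) b = 0"
    using test_function_radius[OF \<phi>] by blast
  note c = smooth_continuous[OF f] smooth_continuous[OF s] smooth_continuous[OF smoothD(2)[OF f b]]
    smooth_continuous[OF smoothD(2)[OF s b]]
  show i1: "integrable lborel (\<lambda>x. f x * frechet_derivative \<phi> (at x) b)"
    by (rule continuous_compact_support(1)[of _ R]) (intro continuous_intros c, simp add: R)
  show i2: "integrable lborel (\<lambda>x. frechet_derivative f (at x) b * \<phi> x)"
    by (rule continuous_compact_support(1)[of _ R]) (intro continuous_intros c, simp add: R)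
  have "(\<integral>x. f x * frechet_derivative \<phi> (at x) b + frechet_derivative f (at x) b * \<phi> x \<partial>lborel) = 0"
  proof (rule integral_partial_derivative_zero[OF b, of "\<lambda>x. f x * \<phi> x" _ R])
    show "((\<lambda>t. f (x + t *\<^sub>R b) * \<phi> (x + t *\<^sub>R b)) has_real_derivative
      f (x + s *\<^sub>R b) * frechet_derivative \<phi> (at (x + s *\<^sub>R b)) b + frechet_derivative f (at (x + s *\<^sub>R b)) b * \<phi> (x + s *\<^sub>R b)) (at s)" for x s
      by (rule DERIV_cong[OF DERIV_mult[OF smooth_directional_derivative[OF f] smooth_directional_derivative[OF s]]])
         (simp add: algebra_simps)
  qed (auto simp: R intro!: continuous_intros c)
  then show "(\<integral>x. f x * frechet_derivative \<phi> (at x) b \<partial>lborel) = - (\<integral>x. frechet_derivative f (at x) b * \<phi> x \<partial>lborel)"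
    using i1 i2 by simp
qed

section \<open>Localisation and uniqueness of weak derivatives\<close>

lemma smooth_term_cos_sin:
  "smooth_term (\<lambda>x. cos (\<xi> \<bullet> x))" "smooth_term (\<lambda>x. sin (\<xi> \<bullet> x))"
proof -
  have "smooth_term (\<lambda>x. sin (pi / 2 + x \<bullet> (- \<xi>)))"
    by (rule smooth_term.comp[OF smooth1_sin smooth_term.add[OF smooth_term.const smooth_term.inner]])
  moreover have "sin (pi / 2 + x \<bullet> (- \<xi>)) = cos (\<xi> \<bullet> x)" for x
    by (simp add: cos_sin_eq inner_commute)
  ultimately show "smooth_term (\<lambda>x. cos (\<xi> \<bullet> x))" by simp
  show "smooth_term (\<lambda>x. sin (\<xi> \<bullet> x))"
    unfolding inner_commute[of \<xi>] by (rule smooth_term.comp[OF smooth1_sin smooth_term.inner])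
qed

lemma frechet_derivative_cos_sin:
  "frechet_derivative (\<lambda>x. cos (\<xi> \<bullet> x)) (at x) b = - sin (\<xi> \<bullet> x) * (\<xi> \<bullet> b)"
  "frechet_derivative (\<lambda>x. sin (\<xi> \<bullet> x)) (at x) b = cos (\<xi> \<bullet> x) * (\<xi> \<bullet> b)"
proof -
  have "((\<lambda>x. cos (\<xi> \<bullet> x)) has_derivative (\<lambda>h. - sin (\<xi> \<bullet> x) * (\<xi> \<bullet> h))) (at x)"
    by (auto intro!: derivative_eq_intros)
  from frechet_derivative_at[OF this] show "frechet_derivative (\<lambda>x. cos (\<xi> \<bullet> x)) (at x) b = - sin (\<xi> \<bullet> x) * (\<xi> \<bullet> b)"
    by metis
  have "((\<lambda>x. sin (\<xi> \<bullet> x)) has_derivative (\<lambda>h. cos (\<xi> \<bullet> x) * (\<xi> \<bullet> h))) (at x)"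
    by (auto intro!: derivative_eq_intros)
  from frechet_derivative_at[OF this] show "frechet_derivative (\<lambda>x. sin (\<xi> \<bullet> x)) (at x) b = cos (\<xi> \<bullet> x) * (\<xi> \<bullet> b)"
    by metis
qed

lemma L2_times_compact_support:
  fixes g :: "'a::euclidean_space \<Rightarrow> complex"
  assumes "g \<in> L2" "continuous_on UNIV f" "\<And>x. R < norm x \<Longrightarrow> f x = 0"
  shows "(\<lambda>x. g x * of_real (f x)) \<in> L12"
proof -
  have [measurable]: "g \<in> borel_measurable borel" "f \<in> borel_measurable borel"
    using assms by (auto simp: L2_def intro: borel_measurable_continuous_onI)
  obtain M where M: "M > 0" "\<And>x. \<bar>f x\<bar> \<le> M * indicator (cball 0 R) x"
    using continuous_compact_support(2)[OF assms(2,3)] by blast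
  have g2: "integrable lborel (\<lambda>x. (cmod (g x))\<^sup>2)" using assms(1) by (simp add: L2_def)
  have i2: "integrable lborel (\<lambda>x. (cmod (g x * of_real (f x)))\<^sup>2)"
  proof (rule integrable_dominated)
    show "integrable lborel (\<lambda>x. M\<^sup>2 * (cmod (g x))\<^sup>2)" using g2 by simp
    have "\<bar>f x\<bar>\<^sup>2 \<le> M\<^sup>2" for x
      using M(1) M(2)[of x] by (intro power_mono) (auto split: split_indicator_asm)
    then show "norm ((cmod (g x * of_real (f x)))\<^sup>2) \<le> M\<^sup>2 * (cmod (g x))\<^sup>2" for x
      by (simp add: norm_mult power_mult_distrib mult.commute mult_right_mono)
  qed measurable
  have i1: "integrable lborel (\<lambda>x. g x * of_real (f x))"
  proof (rule integrable_dominated)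
    have "integrable lborel (indicator (cball 0 R) :: 'a \<Rightarrow> real)"
      by (intro integrable_indicator_bounded) auto
    with g2 show "integrable lborel (\<lambda>x. (cmod (g x))\<^sup>2 + M\<^sup>2 * indicator (cball 0 R) x)" by simp
    show "norm (g x * of_real (f x)) \<le> (cmod (g x))\<^sup>2 + M\<^sup>2 * indicator (cball 0 R) x" for x
    proof -
      have "\<bar>f x\<bar>\<^sup>2 \<le> (M * indicator (cball 0 R) x)\<^sup>2"
        by (intro power_mono M(2)) simp
      then have "\<bar>f x\<bar>\<^sup>2 \<le> M\<^sup>2 * indicator (cball 0 R) x" by (simp split: split_indicator_asm split_indicator)
      moreover have "0 \<le> cmod (g x) * \<bar>f x\<bar>" by simp
      ultimately show ?thesis
        using sum_squares_bound[of "cmod (g x)" "\<bar>f x\<bar>"] unfolding norm_mult norm_of_real by linarith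
    qed
  qed measurable
  show ?thesis using i1 i2 by (simp add: L12_def L2_def)
qed

lemma L2_times_test_function:
  assumes "g \<in> L2" "test_function \<phi>"
  shows "(\<lambda>x. g x * of_real (\<phi> x)) \<in> L12"
    and "b \<in> Basis \<Longrightarrow> (\<lambda>x. g x * of_real (frechet_derivative \<phi> (at x) b)) \<in> L12"
proof -
  have s: "smooth \<phi>" using assms(2) by (simp add: test_function_def)
  obtain R where R: "0 < R" "\<And>x. R < norm x \<Longrightarrow> \<phi> x = 0" "\<And>x b. R < norm x \<Longrightarrow> frechet_derivative \<phi> (at x) b = 0"
    using test_function_radius[OF assms(2)] by blast
  show "(\<lambda>x. g x * of_real (\<phi> x)) \<in> L12"
    by (rule L2_times_compact_support[OF assms(1) smooth_continuous[OF s] R(2)])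
  show "(\<lambda>x. g x * of_real (frechet_derivative \<phi> (at x) b)) \<in> L12" if "b \<in> Basis"
    by (rule L2_times_compact_support[OF assms(1) smooth_continuous[OF smoothD(2)[OF s that]] R(3)])
qed

lemma exp_minus_i: "exp (- \<i> * complex_of_real t) = of_real (cos t) - \<i> * of_real (sin t)"
  using cis_conv_exp[of "-t"] by (simp add: complex_eq_iff)

text \<open>Test functions are real valued, so the exponential enters the weak formulation only
  through its real and imaginary parts.\<close>

lemma Fourier_cos_sin:
  assumes "g \<in> L2" "s > 0" "smooth_term f"
  shows "Fourier (\<lambda>x. g x * of_real (bump x0 s x * f x)) \<xi>
    = (\<integral>x. g x * of_real (bump x0 s x * (f x * cos (\<xi> \<bullet> x))) \<partial>lborel)
      - \<i> * (\<integral>x. g x * of_real (bump x0 s x * (f x * sin (\<xi> \<bullet> x))) \<partial>lborel)"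
proof -
  have i: "integrable lborel (\<lambda>x. g x * of_real (bump x0 s x * (f x * cos (\<xi> \<bullet> x))))"
    "integrable lborel (\<lambda>x. g x * of_real (bump x0 s x * (f x * sin (\<xi> \<bullet> x))))"
    by (intro L12_D(2) L2_times_test_function assms(1) test_function_bump_mult assms(2) smooth_term.mult assms(3) smooth_term_cos_sin)+
  have "Fourier (\<lambda>x. g x * of_real (bump x0 s x * f x)) \<xi>
    = (\<integral>x. g x * of_real (bump x0 s x * (f x * cos (\<xi> \<bullet> x))) - \<i> * (g x * of_real (bump x0 s x * (f x * sin (\<xi> \<bullet> x)))) \<partial>lborel)"
    unfolding Fourier_def exp_minus_i by (intro Bochner_Integration.integral_cong refl) (simp add: algebra_simps)
  also have "\<dots> = (\<integral>x. g x * of_real (bump x0 s x * (f x * cos (\<xi> \<bullet> x))) \<partial>lborel)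
      - (\<integral>x. \<i> * (g x * of_real (bump x0 s x * (f x * sin (\<xi> \<bullet> x)))) \<partial>lborel)"
    by (rule Bochner_Integration.integral_diff[OF i(1) integrable_mult_right[OF i(2)]])
  also have "(\<integral>x. \<i> * (g x * of_real (bump x0 s x * (f x * sin (\<xi> \<bullet> x)))) \<partial>lborel)
     = \<i> * (\<integral>x. g x * of_real (bump x0 s x * (f x * sin (\<xi> \<bullet> x))) \<partial>lborel)"
    by (rule integral_mult_right_zero)
  finally show ?thesis .
qed

text \<open>A bump times a trigonometric function is a test function, so \<open>g\<close> times a bump has vanishing
  Fourier transform.\<close>

lemma du_Bois_Reymond:
  fixes g :: "'a::euclidean_space \<Rightarrow> complex"
  assumes g: "g \<in> L2" and U: "open U"
    and van: "\<And>\<phi>. test_function \<phi> \<Longrightarrow> closure {x. \<phi> x \<noteq> 0} \<subseteq> U \<Longrightarrow> (\<integral>x. g x * of_real (\<phi> x) \<partial>lborel) = 0"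
  shows "AE x in lborel. x \<in> U \<longrightarrow> g x = 0"
proof -
  define Bx where "Bx p = (case p of (x0::'a, s) \<Rightarrow> box (x0 - (1 / s) *\<^sub>R One) (x0 + (1 / s) *\<^sub>R One))" for p
  define F where "F = {(x0, s). 0 < s \<and> cbox (x0 - (1 / s) *\<^sub>R One) (x0 + (1 / s) *\<^sub>R One) \<subseteq> U}"
  have local: "AE x in lborel. x \<in> Bx p \<longrightarrow> g x = 0" if pF: "p \<in> F" for p
  proof -
    obtain x0 s where p: "p = (x0, s)" "0 < s" "cbox (x0 - (1 / s) *\<^sub>R One) (x0 + (1 / s) *\<^sub>R One) \<subseteq> U"
      using pF by (auto simp: F_def)
    have z: "(\<integral>x. g x * of_real (bump x0 s x * f x) \<partial>lborel) = 0" if "smooth_term f" for f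
    proof (rule van[OF test_function_bump_mult[OF p(2) that]])
      have "closure {x. bump x0 s x * f x \<noteq> 0} \<subseteq> cbox (x0 - (1 / s) *\<^sub>R One) (x0 + (1 / s) *\<^sub>R One)"
        using bump_nonzero_iff[OF p(2), of x0] box_subset_cbox
        by (intro closure_minimal closed_cbox) auto
      then show "closure {x. bump x0 s x * f x \<noteq> 0} \<subseteq> U" using p(3) by blast
    qed
    have "Fourier (\<lambda>x. g x * of_real (bump x0 s x * 1)) \<xi> = 0" for \<xi>
      unfolding Fourier_cos_sin[OF g p(2) smooth_term.const]
      by (subst z, intro smooth_term.mult smooth_term.const smooth_term_cos_sin)+ simp
    then have "AE x in lborel. g x * of_real (bump x0 s x * 1) = 0"
      by (intro Fourier_zero_imp_AE_zero L2_times_test_function[OF g] test_function_bump_mult p(2) smooth_term.const)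
    then show ?thesis
      by eventually_elim (auto simp: Bx_def p(1) bump_nonzero_iff[OF p(2), symmetric])
  qed
  have cover: "\<exists>p\<in>F. x0 \<in> Bx p" if x0: "x0 \<in> U" for x0
  proof -
    obtain e where e: "0 < e" "ball x0 e \<subseteq> U" by (rule openE[OF U x0])
    \<comment> \<open>The cube of half side \<open>e / (2 d)\<close> has l1 radius
      \<open>e / 2\<close>, hence lies in the ball of radius \<open>e\<close>.\<close>
    define s where "s = 2 * real DIM('a) / e"
    have s: "0 < s" using e by (simp add: s_def)
    have "cbox (x0 - (1 / s) *\<^sub>R One) (x0 + (1 / s) *\<^sub>R One) \<subseteq> ball x0 e"
    proof
      fix y assume y: "y \<in> cbox (x0 - (1 / s) *\<^sub>R One) (x0 + (1 / s) *\<^sub>R One)"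
      have "\<bar>(y - x0) \<bullet> b\<bar> \<le> 1 / s" if "b \<in> Basis" for b
        using y that by (fastforce simp: mem_box inner_diff_left inner_add_left abs_le_iff)
      then have "(\<Sum>b\<in>Basis. \<bar>(y - x0) \<bullet> b\<bar>) \<le> real DIM('a) * (1 / s)"
        by (rule sum_bounded_above)
      also have "\<dots> < e" using e by (simp add: s_def field_simps)
      finally show "y \<in> ball x0 e" using norm_le_l1[of "y - x0"] by (simp add: dist_norm norm_minus_commute)
    qed
    then have "(x0, s) \<in> F" using s e by (auto simp: F_def)
    moreover have "x0 \<in> Bx (x0, s)" using s by (auto simp: Bx_def mem_box inner_diff_left inner_add_left)
    ultimately show ?thesis by blast
  qed
  \<comment> \<open>The local statements hold up to null sets, so a countable subcover is taken
    before they are combined.\<close>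
  have "\<And>S. S \<in> Bx ` F \<Longrightarrow> open S" by (auto simp: Bx_def F_def)
  then obtain F' where F': "F' \<subseteq> Bx ` F" "countable F'" "\<Union>F' = \<Union>(Bx ` F)" using Lindelof by metis
  have "AE x in lborel. \<forall>S\<in>F'. x \<in> S \<longrightarrow> g x = 0"
    using F'(1,2) local by (subst AE_ball_countable) auto
  moreover have "\<exists>S\<in>F'. x \<in> S" if "x \<in> U" for x
    using cover[OF that] F'(3) by (metis UN_I UnionE)
  ultimately show ?thesis by (auto elim!: eventually_mono)
qed

lemma weak_gradientD:
  assumes "weak_gradient u g" "b \<in> Basis"
  shows "g b \<in> L2"
    and "test_function \<phi> \<Longrightarrow> (\<integral>x. u x * of_real (frechet_derivative \<phi> (at x) b) \<partial>lborel) = - (\<integral>x. g b x * of_real (\<phi> x) \<partial>lborel)"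
  using assms unfolding weak_gradient_def by blast+

text \<open>Locality: test functions supported in \<open>U\<close> see only the common values of
  \<open>u\<close> and \<open>v\<close> there. This is what makes the choices in the definitions of
  the forms harmless.\<close>

lemma weak_gradient_unique:
  assumes "weak_gradient u g" "weak_gradient v h" "open U" "AE x in lborel. x \<in> U \<longrightarrow> u x = v x"
    and "u \<in> L2" "v \<in> L2" and b: "b \<in> Basis"
  shows "AE x in lborel. x \<in> U \<longrightarrow> g b x = h b x"
proof -
  have gh: "g b \<in> L2" "h b \<in> L2" using weak_gradientD(1) assms(1,2) b by blast+
  have "AE x in lborel. x \<in> U \<longrightarrow> (-1) * h b x + g b x = 0"
  proof (rule du_Bois_Reymond[OF L2_lin[OF gh(2,1)] assms(3)])
    fix \<phi> :: "'a \<Rightarrow> real" assume \<phi>: "test_function \<phi>" "closure {x. \<phi> x \<noteq> 0} \<subseteq> U"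
    have i: "integrable lborel (\<lambda>x. g b x * of_real (\<phi> x))" "integrable lborel (\<lambda>x. h b x * of_real (\<phi> x))"
      using L12_D(2)[OF L2_times_test_function(1)[OF _ \<phi>(1)]] gh by auto
    have "(\<integral>x. u x * of_real (frechet_derivative \<phi> (at x) b) \<partial>lborel) = (\<integral>x. v x * of_real (frechet_derivative \<phi> (at x) b) \<partial>lborel)"
    proof (rule integral_cong_AE)
      have [measurable]: "(\<lambda>x. frechet_derivative \<phi> (at x) b) \<in> borel_measurable borel"
        using \<phi>(1) b by (intro smooth_measurable smoothD(2)) (auto simp: test_function_def)
      have [measurable]: "u \<in> borel_measurable borel" "v \<in> borel_measurable borel" using assms by (auto simp: L2_def)
      show "(\<lambda>x. u x * of_real (frechet_derivative \<phi> (at x) b)) \<in> borel_measurable lborel"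
        "(\<lambda>x. v x * of_real (frechet_derivative \<phi> (at x) b)) \<in> borel_measurable lborel" by measurable
      show "AE x in lborel. u x * of_real (frechet_derivative \<phi> (at x) b) = v x * of_real (frechet_derivative \<phi> (at x) b)"
        using assms(4) by eventually_elim (use test_function_support(2)[OF \<phi>(1)] \<phi>(2) in auto)
    qed
    then have "(\<integral>x. g b x * of_real (\<phi> x) \<partial>lborel) = (\<integral>x. h b x * of_real (\<phi> x) \<partial>lborel)"
      unfolding weak_gradientD(2)[OF assms(1) b \<phi>(1)] weak_gradientD(2)[OF assms(2) b \<phi>(1)] by simp
    then show "(\<integral>x. ((-1) * h b x + g b x) * of_real (\<phi> x) \<partial>lborel) = 0"
      using i by (simp add: left_diff_distrib)
  qed
  then show ?thesis by eventually_elim auto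
qed


text \<open>The norm bound is Cauchy-Schwarz on \<open>D\<close>, obtained from 2|u| \<le> c |u|^2 +
  1/c by optimising in \<open>c\<close>. It bounds the transforms of unit vectors uniformly.\<close>

lemma L2_on_imp_L12:
  assumes "u \<in> L2_on D" "bounded D" "open D"
  shows "u \<in> L12" and "(\<integral>x. cmod (u x) \<partial>lborel) \<le> sqrt (measure lborel D) * L2_norm u"
proof -
  have u: "u \<in> L2" and z: "AE x in lborel. x \<notin> D \<longrightarrow> u x = 0" using assms(1) by (auto simp: L2_on_def)
  have [measurable]: "u \<in> borel_measurable borel" "D \<in> sets borel" using u assms(3) by (auto simp: L2_def)
  have iD: "integrable lborel (indicator D :: 'a \<Rightarrow> real)" by (rule integrable_indicator_bounded) (use assms in auto)
  have u2: "integrable lborel (\<lambda>x. (cmod (u x))\<^sup>2)" using u by (simp add: L2_def)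
  have "integrable lborel u"
  proof (rule Bochner_Integration.integrable_bound)
    show "integrable lborel (\<lambda>x. (cmod (u x))\<^sup>2 + indicator D x)" using u2 iD by simp
    show "AE x in lborel. norm (u x) \<le> norm ((cmod (u x))\<^sup>2 + indicator D x)"
      using z
    proof eventually_elim
      case (elim x)
      have "0 \<le> cmod (u x)" by simp
      moreover have "2 * cmod (u x) \<le> (cmod (u x))\<^sup>2 + 1" using sum_squares_bound[of "cmod (u x)" 1] by simp
      ultimately have "cmod (u x) \<le> (cmod (u x))\<^sup>2 + 1" by linarith
      then show ?case using elim by (auto split: split_indicator)
    qed
  qed measurable
  with u show L: "u \<in> L12" by (simp add: L12_def)
  have "(\<integral>x. cmod (u x) \<partial>lborel) \<le> (1/2) * (c * (\<integral>x. (cmod (u x))\<^sup>2 \<partial>lborel) + measure lborel D / c)" if "0 < c" for c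
  proof -
    have "(\<integral>x. cmod (u x) \<partial>lborel) \<le> (\<integral>x. (1/2) * (c * (cmod (u x))\<^sup>2 + indicator D x / c) \<partial>lborel)"
    proof (rule integral_mono_AE)
      show "integrable lborel (\<lambda>x. cmod (u x))" using L12_D(2)[OF L] by simp
      show "integrable lborel (\<lambda>x. (1/2) * (c * (cmod (u x))\<^sup>2 + indicator D x / c))" using u2 iD by simp
      show "AE x in lborel. cmod (u x) \<le> (1/2) * (c * (cmod (u x))\<^sup>2 + indicator D x / c)"
        using z
      proof eventually_elim
        case (elim x)
        have "2 * (sqrt c * cmod (u x)) * (1 / sqrt c) \<le> (sqrt c * cmod (u x))\<^sup>2 + (1 / sqrt c)\<^sup>2"
          by (rule sum_squares_bound)
        then have "2 * cmod (u x) \<le> c * (cmod (u x))\<^sup>2 + 1 / c"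
          using that by (simp add: power_mult_distrib power_divide)
        then show ?case using elim that by (auto split: split_indicator)
      qed
    qed
    also have "\<dots> = (1/2) * (c * (\<integral>x. (cmod (u x))\<^sup>2 \<partial>lborel) + measure lborel D / c)"
      using u2 iD by simp
    finally show ?thesis .
  qed
  note young = this
  define N where "N = L2_norm u"
  have N2: "(\<integral>x. (cmod (u x))\<^sup>2 \<partial>lborel) = N\<^sup>2" by (simp add: N_def L2_norm_def integral_nonneg_AE)
  have N0: "0 \<le> N" by (simp add: N_def L2_norm_def integral_nonneg_AE)
  define m where "m = sqrt (measure lborel D)"
  have m2: "measure lborel D = m\<^sup>2" "0 \<le> m" by (simp_all add: m_def)
  have "(\<integral>x. cmod (u x) \<partial>lborel) \<le> m * N + e" if "e > 0" for e
  proof -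
    \<comment> \<open>The optimal parameter \<open>m / N\<close> degenerates if either number is
      zero, hence the perturbed quotient \<open>(m + d) / (N + d)\<close>, which costs at most
      \<open>e\<close>.\<close>
    define d where "d = e / (m + N + 1)"
    have d: "0 < d" using that m2 N0 by (simp add: d_def)
    have "(\<integral>x. cmod (u x) \<partial>lborel) \<le> (1/2) * ((m + d) / (N + d) * N\<^sup>2 + m\<^sup>2 / ((m + d) / (N + d)))"
      using young[of "(m + d) / (N + d)"] d m2 N0 unfolding N2 by simp
    also have "(m + d) / (N + d) * N\<^sup>2 \<le> (m + d) * N"
    proof -
      have "N\<^sup>2 / (N + d) \<le> N" using d N0 by (simp add: pos_divide_le_eq power2_eq_square mult_left_mono)
      then have "(m + d) * (N\<^sup>2 / (N + d)) \<le> (m + d) * N" using d m2 by (intro mult_left_mono) auto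
      then show ?thesis by simp
    qed
    also have "m\<^sup>2 / ((m + d) / (N + d)) \<le> m * (N + d)"
    proof -
      have "m\<^sup>2 / (m + d) \<le> m" using d m2 by (simp add: pos_divide_le_eq power2_eq_square mult_left_mono)
      then have "(m\<^sup>2 / (m + d)) * (N + d) \<le> m * (N + d)" using d N0 by (intro mult_right_mono) auto
      then show ?thesis by simp
    qed
    also have "(1/2) * ((m + d) * N + m * (N + d)) = m * N + d * (m + N) / 2" by (simp add: field_simps)
    also have "d * (m + N) / 2 \<le> e"
    proof -
      have "d * (m + N) \<le> d * (m + N + 1)" using d by simp
      also have "\<dots> = e" using m2 N0 by (simp add: d_def)
      finally show ?thesis using that by simp
    qed
    finally show ?thesis by simp
  qed
  then have "(\<integral>x. cmod (u x) \<partial>lborel) \<le> m * N" by (rule field_le_epsilon)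
  then show "(\<integral>x. cmod (u x) \<partial>lborel) \<le> sqrt (measure lborel D) * L2_norm u" by (simp add: m_def N_def)
qed

section \<open>Weak derivatives on the Fourier side\<close>

lemma bump_scale: "bump 0 s x = bump 0 1 (s *\<^sub>R x)"
  by (simp add: bump_def)

lemma exp_flat_le_1: "exp_flat 1 t \<le> 1"
  by (simp add: exp_flat_def)

lemma bump_le_1: "bump x0 s x \<le> 1"
  unfolding bump_def by (intro prod_le_1 conjI mult_nonneg_nonneg mult_le_one exp_flat_1 exp_flat_le_1)

lemma frechet_derivative_bump_scale:
  "frechet_derivative (bump 0 s) (at x) b = s * frechet_derivative (bump 0 1) (at (s *\<^sub>R x)) b"
proof -
  have d: "(bump 0 1 has_derivative frechet_derivative (bump 0 1) (at (s *\<^sub>R x))) (at (s *\<^sub>R x))"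
    using smoothD(1)[OF smooth_term_imp_smooth[OF smooth_term_bump]] frechet_derivative_works by blast
  have "((\<lambda>x. s *\<^sub>R x) has_derivative (\<lambda>h. s *\<^sub>R h)) (at x)" by (auto intro!: derivative_eq_intros)
  from has_derivative_compose[OF this d]
  have "((\<lambda>x. bump 0 1 (s *\<^sub>R x)) has_derivative (\<lambda>h. frechet_derivative (bump 0 1) (at (s *\<^sub>R x)) (s *\<^sub>R h))) (at x)" .
  then have "(bump 0 s has_derivative (\<lambda>h. frechet_derivative (bump 0 1) (at (s *\<^sub>R x)) (s *\<^sub>R h))) (at x)"
    unfolding bump_scale[symmetric] .
  from frechet_derivative_at[OF this] have "frechet_derivative (bump 0 s) (at x) b = frechet_derivative (bump 0 1) (at (s *\<^sub>R x)) (s *\<^sub>R b)"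
    by metis
  also have "\<dots> = s * frechet_derivative (bump 0 1) (at (s *\<^sub>R x)) b"
    using linear_cmul[OF has_derivative_linear[OF d], of s b] by simp
  finally show ?thesis .
qed

text \<open>The exponential is not compactly supported, but a bump times its real or imaginary part
  is a test function. The last term is the derivative falling on the bump; it disappears as the bump
  is spread out.\<close>

lemma Fourier_weak_derivative_cutoff:
  fixes u :: "'a::euclidean_space \<Rightarrow> complex"
  assumes u: "u \<in> L2" and wg: "weak_gradient u g" and b: "b \<in> Basis" and s: "0 < s"
  shows "Fourier (\<lambda>x. g b x * of_real (bump 0 s x)) \<xi>
    = \<i> * of_real (\<xi> \<bullet> b) * Fourier (\<lambda>x. u x * of_real (bump 0 s x)) \<xi>
      - Fourier (\<lambda>x. u x * of_real (frechet_derivative (bump 0 s) (at x) b)) \<xi>"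
proof -
  let ?\<chi> = "bump 0 s :: 'a \<Rightarrow> real"
  let ?d = "\<lambda>x. frechet_derivative ?\<chi> (at x) b"
  let ?c = "\<lambda>x. cos (\<xi> \<bullet> x)" and ?s = "\<lambda>x. sin (\<xi> \<bullet> x)"
  have gb: "g b \<in> L2" by (rule weak_gradientD(1)[OF wg b])
  have sm\<chi>: "smooth ?\<chi>" by (rule smooth_term_imp_smooth[OF smooth_term_bump])
  have smc: "smooth ?c" "smooth ?s" using smooth_term_imp_smooth smooth_term_cos_sin by blast+
  have t\<chi>: "test_function ?\<chi>" using test_function_bump_mult[OF s smooth_term.const, of 0 1] by simp
  have tc: "test_function (\<lambda>x. ?\<chi> x * ?c x)" "test_function (\<lambda>x. ?\<chi> x * ?s x)"
    by (intro test_function_bump_mult s smooth_term_cos_sin)+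
  have dc: "frechet_derivative (\<lambda>x. ?\<chi> x * ?c x) (at x) b = - (\<xi> \<bullet> b) * (?\<chi> x * ?s x) + ?d x * ?c x"
    "frechet_derivative (\<lambda>x. ?\<chi> x * ?s x) (at x) b = (\<xi> \<bullet> b) * (?\<chi> x * ?c x) + ?d x * ?s x" for x
    unfolding frechet_derivative_mult[OF smoothD(1)[OF sm\<chi>] smoothD(1)[OF smc(1)]]
      frechet_derivative_mult[OF smoothD(1)[OF sm\<chi>] smoothD(1)[OF smc(2)]] frechet_derivative_cos_sin
    by simp_all
  have cont: "continuous_on UNIV ?d" "continuous_on UNIV ?c" "continuous_on UNIV ?s"
    using smooth_continuous smoothD(2)[OF sm\<chi> b] smc by blast+
  obtain R where R: "\<And>x. R < norm x \<Longrightarrow> ?d x = 0" using test_function_radius[OF t\<chi>] by metis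
  have i1: "integrable lborel (\<lambda>x. u x * of_real (?d x * ?c x))" "integrable lborel (\<lambda>x. u x * of_real (?d x * ?s x))"
    by (intro L12_D(2) L2_times_compact_support[OF u, of _ R] continuous_intros cont; simp add: R)+
  have i2: "integrable lborel (\<lambda>x. u x * of_real (?\<chi> x * ?c x))" "integrable lborel (\<lambda>x. u x * of_real (?\<chi> x * ?s x))"
    by (intro L12_D(2) L2_times_test_function(1)[OF u] tc)+
  have w: "(\<integral>x. u x * of_real (frechet_derivative \<phi> (at x) b) \<partial>lborel) = - (\<integral>x. g b x * of_real (\<phi> x) \<partial>lborel)"
    if "test_function \<phi>" for \<phi> by (rule weak_gradientD(2)[OF wg b that])
  have F\<chi>: "Fourier (\<lambda>x. h x * of_real (?\<chi> x)) \<xi> = (\<integral>x. h x * of_real (?\<chi> x * ?c x) \<partial>lborel) - \<i> * (\<integral>x. h x * of_real (?\<chi> x * ?s x) \<partial>lborel)"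
    if "h \<in> L2" for h
    using Fourier_cos_sin[OF that s smooth_term.const, of 0 1 \<xi>] by simp
  have Fd: "Fourier (\<lambda>x. u x * of_real (?d x)) \<xi> = (\<integral>x. u x * of_real (?d x * ?c x) \<partial>lborel) - \<i> * (\<integral>x. u x * of_real (?d x * ?s x) \<partial>lborel)"
  proof -
    have "Fourier (\<lambda>x. u x * of_real (?d x)) \<xi>
      = (\<integral>x. u x * of_real (?d x * ?c x) - \<i> * (u x * of_real (?d x * ?s x)) \<partial>lborel)"
      unfolding Fourier_def exp_minus_i by (intro Bochner_Integration.integral_cong refl) (simp add: algebra_simps)
    also have "\<dots> = (\<integral>x. u x * of_real (?d x * ?c x) \<partial>lborel) - (\<integral>x. \<i> * (u x * of_real (?d x * ?s x)) \<partial>lborel)"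
      by (rule Bochner_Integration.integral_diff[OF i1(1) integrable_mult_right[OF i1(2)]])
    also have "(\<integral>x. \<i> * (u x * of_real (?d x * ?s x)) \<partial>lborel) = \<i> * (\<integral>x. u x * of_real (?d x * ?s x) \<partial>lborel)"
      by (rule integral_mult_right_zero)
    finally show ?thesis .
  qed
  have e1: "(\<integral>x. u x * of_real (frechet_derivative (\<lambda>x. ?\<chi> x * ?c x) (at x) b) \<partial>lborel)
     = - of_real (\<xi> \<bullet> b) * (\<integral>x. u x * of_real (?\<chi> x * ?s x) \<partial>lborel) + (\<integral>x. u x * of_real (?d x * ?c x) \<partial>lborel)"
  proof -
    have "(\<integral>x. u x * of_real (frechet_derivative (\<lambda>x. ?\<chi> x * ?c x) (at x) b) \<partial>lborel)
      = (\<integral>x. - of_real (\<xi> \<bullet> b) * (u x * of_real (?\<chi> x * ?s x)) + u x * of_real (?d x * ?c x) \<partial>lborel)"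
      unfolding dc by (intro Bochner_Integration.integral_cong refl) (simp add: algebra_simps)
    also have "\<dots> = (\<integral>x. - of_real (\<xi> \<bullet> b) * (u x * of_real (?\<chi> x * ?s x)) \<partial>lborel) + (\<integral>x. u x * of_real (?d x * ?c x) \<partial>lborel)"
      by (rule Bochner_Integration.integral_add[OF integrable_mult_right[OF i2(2)] i1(1)])
    also have "(\<integral>x. - of_real (\<xi> \<bullet> b) * (u x * of_real (?\<chi> x * ?s x)) \<partial>lborel) = - of_real (\<xi> \<bullet> b) * (\<integral>x. u x * of_real (?\<chi> x * ?s x) \<partial>lborel)"
      by (rule integral_mult_right_zero)
    finally show ?thesis .
  qed
  have e2: "(\<integral>x. u x * of_real (frechet_derivative (\<lambda>x. ?\<chi> x * ?s x) (at x) b) \<partial>lborel)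
     = of_real (\<xi> \<bullet> b) * (\<integral>x. u x * of_real (?\<chi> x * ?c x) \<partial>lborel) + (\<integral>x. u x * of_real (?d x * ?s x) \<partial>lborel)"
  proof -
    have "(\<integral>x. u x * of_real (frechet_derivative (\<lambda>x. ?\<chi> x * ?s x) (at x) b) \<partial>lborel)
      = (\<integral>x. of_real (\<xi> \<bullet> b) * (u x * of_real (?\<chi> x * ?c x)) + u x * of_real (?d x * ?s x) \<partial>lborel)"
      unfolding dc by (intro Bochner_Integration.integral_cong refl) (simp add: algebra_simps)
    also have "\<dots> = (\<integral>x. of_real (\<xi> \<bullet> b) * (u x * of_real (?\<chi> x * ?c x)) \<partial>lborel) + (\<integral>x. u x * of_real (?d x * ?s x) \<partial>lborel)"
      by (rule Bochner_Integration.integral_add[OF integrable_mult_right[OF i2(1)] i1(2)])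
    also have "(\<integral>x. of_real (\<xi> \<bullet> b) * (u x * of_real (?\<chi> x * ?c x)) \<partial>lborel) = of_real (\<xi> \<bullet> b) * (\<integral>x. u x * of_real (?\<chi> x * ?c x) \<partial>lborel)"
      by (rule integral_mult_right_zero)
    finally show ?thesis .
  qed
  have g1: "(\<integral>x. g b x * of_real (?\<chi> x * ?c x) \<partial>lborel) = of_real (\<xi> \<bullet> b) * (\<integral>x. u x * of_real (?\<chi> x * ?s x) \<partial>lborel) - (\<integral>x. u x * of_real (?d x * ?c x) \<partial>lborel)"
    using arg_cong[OF w[OF tc(1)], of uminus] unfolding e1 by simp
  have g2: "(\<integral>x. g b x * of_real (?\<chi> x * ?s x) \<partial>lborel) = - of_real (\<xi> \<bullet> b) * (\<integral>x. u x * of_real (?\<chi> x * ?c x) \<partial>lborel) - (\<integral>x. u x * of_real (?d x * ?s x) \<partial>lborel)"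
    using arg_cong[OF w[OF tc(2)], of uminus] unfolding e2 by simp
  show ?thesis
    unfolding F\<chi>[OF gb] F\<chi>[OF u] Fd g1 g2 by (simp add: algebra_simps)
qed

lemma nn_integral_sq_eq:
  assumes "u \<in> L2"
  shows "(\<integral>\<^sup>+x. ennreal ((cmod (u x))\<^sup>2) \<partial>lborel) = ennreal (\<integral>x. (cmod (u x))\<^sup>2 \<partial>lborel)"
  using assms by (intro nn_integral_eq_integral) (auto simp: L2_def)

lemma tendsto_bump_scaled:
  fixes x :: "'a::euclidean_space"
  shows "(\<lambda>k. bump 0 (1 / real (Suc k)) x) \<longlonglongrightarrow> bump 0 1 (0 :: 'a)"
proof -
  have "isCont (bump 0 1) (0 *\<^sub>R x)"
    using smooth_continuous[OF smooth_term_imp_smooth[OF smooth_term_bump[of "0 :: 'a" 1]]]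
    by (simp add: continuous_on_eq_continuous_at[OF open_UNIV])
  moreover have "(\<lambda>k. (1 / real (Suc k)) *\<^sub>R x) \<longlonglongrightarrow> 0 *\<^sub>R x"
    by (intro tendsto_intros LIMSEQ_Suc[OF lim_1_over_n])
  ultimately have "(\<lambda>k. bump 0 1 ((1 / real (Suc k)) *\<^sub>R x)) \<longlonglongrightarrow> bump 0 1 (0 *\<^sub>R x)"
    by (rule isCont_tendsto_compose)
  moreover have "bump 0 (1 / real (Suc k)) x = bump 0 1 ((1 / real (Suc k)) *\<^sub>R x)" for k
    by (rule bump_scale)
  ultimately show ?thesis by (simp only: scaleR_zero_left)
qed

lemma bump_measurable [measurable]: "bump x0 s \<in> borel_measurable borel"
  by (rule smooth_measurable[OF smooth_term_imp_smooth[OF smooth_term_bump]])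

text \<open>The weak derivative need not be integrable, so Plancherel is applied to its product with
  a wide bump. As the bump spreads out, the term with its derivative is of order
  \<open>1 / k\<close>, and Fatou's lemma gives the bound.\<close>

lemma gradient_Fourier_bound:
  fixes u :: "'a::euclidean_space \<Rightarrow> complex"
  assumes u: "u \<in> L12" and wg: "weak_gradient u g" and b: "b \<in> Basis"
  shows "(\<integral>\<^sup>+\<xi>. ennreal ((\<xi> \<bullet> b)\<^sup>2 * (cmod (Fourier u \<xi>))\<^sup>2) \<partial>lborel)
    \<le> ennreal ((2 * pi) ^ DIM('a)) * (\<integral>\<^sup>+x. ennreal ((cmod (g b x))\<^sup>2) \<partial>lborel)"
proof -
  let ?C = "(2 * pi) ^ DIM('a)"
  let ?s = "\<lambda>k. 1 / real (Suc k)"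
  let ?\<chi> = "\<lambda>k. bump 0 (?s k) :: 'a \<Rightarrow> real"
  \<comment> \<open>The widened bumps converge pointwise to this constant; its square appears on
    both sides and is cancelled at the end.\<close>
  define \<beta> where "\<beta> = bump 0 1 (0::'a)"
  have \<beta>: "0 < \<beta>" using bump_nonneg[of 0 1 "0::'a"] bump_nonzero_iff[of 1 "0::'a" 0] by (simp add: \<beta>_def mem_box order_less_le)
  note [measurable] = L12_D(1)[OF u]
  have gb: "g b \<in> L2" by (rule weak_gradientD(1)[OF wg b])
  then have [measurable]: "g b \<in> borel_measurable borel" by (simp add: L2_def)
  define F where "F k = Fourier (\<lambda>x. g b x * of_real (?\<chi> k x))" for k
  have [measurable]: "F k \<in> borel_measurable borel" for k unfolding F_def by measurable
  have t\<chi>: "test_function (?\<chi> k)" for k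
    using test_function_bump_mult[OF _ smooth_term.const, of "?s k" 0 1] by simp
  have bump_abs: "\<bar>bump x0 s x\<bar> \<le> 1" for x0 s and x :: 'a using bump_nonneg[of x0 s x] bump_le_1[of x0 s x] by simp
  have lim1: "(\<lambda>k. Fourier (\<lambda>x. u x * of_real (?\<chi> k x)) \<xi>) \<longlonglongrightarrow> Fourier (\<lambda>x. u x * of_real \<beta>) \<xi>" for \<xi>
    unfolding Fourier_def
  proof (rule integral_dominated_convergence[where w = "\<lambda>x. cmod (u x)"])
    show "AE x in lborel. (\<lambda>k. exp (- \<i> * complex_of_real (\<xi> \<bullet> x)) * (u x * of_real (?\<chi> k x)))
       \<longlonglongrightarrow> exp (- \<i> * complex_of_real (\<xi> \<bullet> x)) * (u x * of_real \<beta>)"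
      unfolding \<beta>_def by (intro AE_I2 tendsto_intros tendsto_bump_scaled)
    show "AE x in lborel. norm (exp (- \<i> * complex_of_real (\<xi> \<bullet> x)) * (u x * of_real (?\<chi> k x))) \<le> cmod (u x)" for k
      using bump_abs by (intro AE_I2) (simp add: norm_mult mult_left_le)
    show "integrable lborel (\<lambda>x. cmod (u x))" using L12_D(2)[OF u] by simp
  qed measurable
  have sm: "smooth (bump 0 1 :: 'a \<Rightarrow> real)" by (rule smooth_term_imp_smooth[OF smooth_term_bump])
  have t1: "test_function (bump 0 1 :: 'a \<Rightarrow> real)"
    using test_function_bump_mult[OF _ smooth_term.const, of 1 0 1] by simp
  obtain R where R: "\<And>x b. R < norm x \<Longrightarrow> frechet_derivative (bump 0 1) (at (x::'a)) b = 0"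
    using test_function_radius[OF t1] by metis
  obtain M where M: "M > 0" "\<And>x. \<bar>frechet_derivative (bump 0 1) (at (x::'a)) b\<bar> \<le> M * indicator (cball 0 R) x"
    using continuous_compact_support(2)[OF smooth_continuous[OF smoothD(2)[OF sm b]] R] by blast
  have M': "\<bar>frechet_derivative (bump 0 1) (at (x::'a)) b\<bar> \<le> M" for x
    using M(1) M(2)[of x] by (auto split: split_indicator_asm)
  have lim2: "(\<lambda>k. Fourier (\<lambda>x. u x * of_real (frechet_derivative (?\<chi> k) (at x) b)) \<xi>) \<longlonglongrightarrow> 0" for \<xi>
  proof (rule Lim_null_comparison)
    show "\<forall>\<^sub>F k in sequentially. norm (Fourier (\<lambda>x. u x * of_real (frechet_derivative (?\<chi> k) (at x) b)) \<xi>)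
        \<le> ?s k * (M * (\<integral>x. cmod (u x) \<partial>lborel))"
    proof (rule always_eventually, rule allI)
      fix k
      have "cmod (Fourier (\<lambda>x. u x * of_real (frechet_derivative (?\<chi> k) (at x) b)) \<xi>)
        \<le> (\<integral>x. cmod (u x * of_real (frechet_derivative (?\<chi> k) (at x) b)) \<partial>lborel)"
        by (rule norm_Fourier_le)
      also have "\<dots> \<le> (\<integral>x. (?s k * M) * cmod (u x) \<partial>lborel)"
      proof (rule integral_mono_AE)
        show "integrable lborel (\<lambda>x. cmod (u x * of_real (frechet_derivative (?\<chi> k) (at x) b)))"
          using L12_D(2)[OF L2_times_test_function(2)[OF L12_D(4)[OF u] t\<chi> b]] by simp
        show "integrable lborel (\<lambda>x. (?s k * M) * cmod (u x))" using L12_D(2)[OF u] by simp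
        show "AE x in lborel. cmod (u x * of_real (frechet_derivative (?\<chi> k) (at x) b)) \<le> (?s k * M) * cmod (u x)"
        proof (rule AE_I2)
          fix x
          have "\<bar>frechet_derivative (?\<chi> k) (at x) b\<bar> = ?s k * \<bar>frechet_derivative (bump 0 1) (at (?s k *\<^sub>R x)) b\<bar>"
            by (subst frechet_derivative_bump_scale) (simp add: abs_mult)
          also have "\<dots> \<le> ?s k * M" by (intro mult_left_mono M') simp
          finally have "cmod (u x) * \<bar>frechet_derivative (?\<chi> k) (at x) b\<bar> \<le> cmod (u x) * (?s k * M)"
            by (rule mult_left_mono) simp
          then show "cmod (u x * of_real (frechet_derivative (?\<chi> k) (at x) b)) \<le> (?s k * M) * cmod (u x)"
            by (simp only: norm_mult norm_of_real mult.commute[of "?s k * M"])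
        qed
      qed
      also have "\<dots> = ?s k * (M * (\<integral>x. cmod (u x) \<partial>lborel))" by simp
      finally show "norm (Fourier (\<lambda>x. u x * of_real (frechet_derivative (?\<chi> k) (at x) b)) \<xi>) \<le> ?s k * (M * (\<integral>x. cmod (u x) \<partial>lborel))" .
    qed
    have "(\<lambda>k. ?s k * (M * (\<integral>x. cmod (u x) \<partial>lborel))) \<longlonglongrightarrow> 0 * (M * (\<integral>x. cmod (u x) \<partial>lborel))"
      by (intro tendsto_intros LIMSEQ_Suc[OF lim_1_over_n])
    then show "(\<lambda>k. ?s k * (M * (\<integral>x. cmod (u x) \<partial>lborel))) \<longlonglongrightarrow> 0" by simp
  qed
  have limF: "(\<lambda>k. F k \<xi>) \<longlonglongrightarrow> \<i> * of_real (\<xi> \<bullet> b) * (of_real \<beta> * Fourier u \<xi>)" for \<xi>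
  proof -
    have "(\<lambda>k. \<i> * of_real (\<xi> \<bullet> b) * Fourier (\<lambda>x. u x * of_real (?\<chi> k x)) \<xi>
      - Fourier (\<lambda>x. u x * of_real (frechet_derivative (?\<chi> k) (at x) b)) \<xi>)
      \<longlonglongrightarrow> \<i> * of_real (\<xi> \<bullet> b) * Fourier (\<lambda>x. u x * of_real \<beta>) \<xi> - 0"
      by (intro tendsto_intros lim1 lim2)
    moreover have "Fourier (\<lambda>x. u x * of_real \<beta>) \<xi> = of_real \<beta> * Fourier u \<xi>"
    proof -
      have "Fourier (\<lambda>x. u x * of_real \<beta>) \<xi> = (\<integral>x. of_real \<beta> * (exp (- \<i> * complex_of_real (\<xi> \<bullet> x)) * u x) \<partial>lborel)"
        unfolding Fourier_def by (intro Bochner_Integration.integral_cong refl) (simp add: mult_ac)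
      also have "\<dots> = of_real \<beta> * Fourier u \<xi>" unfolding Fourier_def by (rule integral_mult_right_zero)
      finally show ?thesis .
    qed
    ultimately show ?thesis
      unfolding F_def by (subst Fourier_weak_derivative_cutoff[OF L12_D(4)[OF u] wg b]) simp_all
  qed
  have limG: "(\<lambda>k. \<integral>x. (cmod (g b x * of_real (?\<chi> k x)))\<^sup>2 \<partial>lborel) \<longlonglongrightarrow> (\<integral>x. (cmod (g b x * of_real \<beta>))\<^sup>2 \<partial>lborel)"
  proof (rule integral_dominated_convergence[where w = "\<lambda>x. (cmod (g b x))\<^sup>2"])
    show "AE x in lborel. (\<lambda>k. (cmod (g b x * of_real (?\<chi> k x)))\<^sup>2) \<longlonglongrightarrow> (cmod (g b x * of_real \<beta>))\<^sup>2"
      unfolding \<beta>_def by (intro AE_I2 tendsto_intros tendsto_bump_scaled)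
    show "AE x in lborel. norm ((cmod (g b x * of_real (?\<chi> k x)))\<^sup>2) \<le> (cmod (g b x))\<^sup>2" for k
    proof (rule AE_I2)
      fix x
      have "(cmod (g b x * of_real (?\<chi> k x)))\<^sup>2 \<le> (cmod (g b x))\<^sup>2"
        using bump_abs by (intro power_mono) (auto simp: norm_mult mult_left_le)
      then show "norm ((cmod (g b x * of_real (?\<chi> k x)))\<^sup>2) \<le> (cmod (g b x))\<^sup>2" by simp
    qed
    show "integrable lborel (\<lambda>x. (cmod (g b x))\<^sup>2)" using gb by (simp add: L2_def)
  qed measurable
  have nnF: "(\<integral>\<^sup>+\<xi>. ennreal ((cmod (F k \<xi>))\<^sup>2) \<partial>lborel) = ennreal (?C * (\<integral>x. (cmod (g b x * of_real (?\<chi> k x)))\<^sup>2 \<partial>lborel))" for k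
  proof -
    have L: "(\<lambda>x. g b x * of_real (?\<chi> k x)) \<in> L12" by (rule L2_times_test_function(1)[OF gb t\<chi>])
    show ?thesis unfolding F_def nn_integral_sq_eq[OF Fourier_L2[OF L]] Plancherel[OF L] ..
  qed
  have "(\<integral>\<^sup>+\<xi>. ennreal (\<beta>\<^sup>2) * ennreal ((\<xi> \<bullet> b)\<^sup>2 * (cmod (Fourier u \<xi>))\<^sup>2) \<partial>lborel)
      = (\<integral>\<^sup>+\<xi>. liminf (\<lambda>k. ennreal ((cmod (F k \<xi>))\<^sup>2)) \<partial>lborel)"
  proof (rule nn_integral_cong)
    fix \<xi>
    have "(\<lambda>k. ennreal ((cmod (F k \<xi>))\<^sup>2)) \<longlonglongrightarrow> ennreal ((cmod (\<i> * of_real (\<xi> \<bullet> b) * (of_real \<beta> * Fourier u \<xi>)))\<^sup>2)"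
      by (intro tendsto_ennrealI tendsto_intros limF)
    from lim_imp_Liminf[OF _ this]
    have "liminf (\<lambda>k. ennreal ((cmod (F k \<xi>))\<^sup>2)) = ennreal ((cmod (\<i> * of_real (\<xi> \<bullet> b) * (of_real \<beta> * Fourier u \<xi>)))\<^sup>2)"
      by simp
    also have "(cmod (\<i> * of_real (\<xi> \<bullet> b) * (of_real \<beta> * Fourier u \<xi>)))\<^sup>2 = \<beta>\<^sup>2 * ((\<xi> \<bullet> b)\<^sup>2 * (cmod (Fourier u \<xi>))\<^sup>2)"
      by (simp add: norm_mult power_mult_distrib)
    finally show "ennreal (\<beta>\<^sup>2) * ennreal ((\<xi> \<bullet> b)\<^sup>2 * (cmod (Fourier u \<xi>))\<^sup>2) = liminf (\<lambda>k. ennreal ((cmod (F k \<xi>))\<^sup>2))"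
      by (simp only:) (rule ennreal_mult[symmetric]; simp)
  qed
  also have "\<dots> \<le> liminf (\<lambda>k. \<integral>\<^sup>+\<xi>. ennreal ((cmod (F k \<xi>))\<^sup>2) \<partial>lborel)"
    by (rule nn_integral_liminf) measurable
  also have "\<dots> = liminf (\<lambda>k. ennreal (?C * (\<integral>x. (cmod (g b x * of_real (?\<chi> k x)))\<^sup>2 \<partial>lborel)))"
    unfolding nnF ..
  also have "\<dots> = ennreal (?C * (\<integral>x. (cmod (g b x * of_real \<beta>))\<^sup>2 \<partial>lborel))"
    by (intro lim_imp_Liminf tendsto_ennrealI tendsto_intros limG) simp
  also have "(\<integral>x. (cmod (g b x * of_real \<beta>))\<^sup>2 \<partial>lborel) = \<beta>\<^sup>2 * (\<integral>x. (cmod (g b x))\<^sup>2 \<partial>lborel)"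
    by (simp add: norm_mult power_mult_distrib mult.commute)
  finally have "ennreal (\<beta>\<^sup>2) * (\<integral>\<^sup>+\<xi>. ennreal ((\<xi> \<bullet> b)\<^sup>2 * (cmod (Fourier u \<xi>))\<^sup>2) \<partial>lborel)
     \<le> ennreal (?C * (\<beta>\<^sup>2 * (\<integral>x. (cmod (g b x))\<^sup>2 \<partial>lborel)))"
    by (subst nn_integral_cmult[symmetric]) auto
  also have "\<dots> = ennreal (\<beta>\<^sup>2) * ennreal (?C * (\<integral>x. (cmod (g b x))\<^sup>2 \<partial>lborel))"
    by (subst ennreal_mult[symmetric]) (auto simp: mult_ac integral_nonneg_AE)
  also have "ennreal (?C * (\<integral>x. (cmod (g b x))\<^sup>2 \<partial>lborel)) = ennreal ?C * (\<integral>\<^sup>+x. ennreal ((cmod (g b x))\<^sup>2) \<partial>lborel)"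
    unfolding nn_integral_sq_eq[OF gb] by (subst ennreal_mult) (auto simp: integral_nonneg_AE)
  finally show ?thesis
    using \<beta> by (subst (asm) ennreal_mult_le_mult_iff) auto
qed

lemma Fourier_test_derivative:
  fixes \<phi> :: "'a::euclidean_space \<Rightarrow> real"
  assumes t: "test_function \<phi>" and b: "b \<in> Basis"
  shows "Fourier (\<lambda>x. of_real (frechet_derivative \<phi> (at x) b)) \<xi> = \<i> * of_real (\<xi> \<bullet> b) * Fourier (\<lambda>x. of_real (\<phi> x)) \<xi>"
proof -
  have smc: "smooth (\<lambda>x. cos (\<xi> \<bullet> x))" "smooth (\<lambda>x. sin (\<xi> \<bullet> x))" using smooth_term_imp_smooth smooth_term_cos_sin by blast+
  have s: "smooth \<phi>" using t by (simp add: test_function_def)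
  obtain R where R: "\<And>x. R < norm x \<Longrightarrow> \<phi> x = 0" using test_function_radius[OF t] by metis
  have i: "integrable lborel (\<lambda>x. cos (\<xi> \<bullet> x) * \<phi> x)" "integrable lborel (\<lambda>x. sin (\<xi> \<bullet> x) * \<phi> x)"
    by (rule continuous_compact_support(1)[of _ R], intro continuous_intros smooth_continuous[OF s], simp add: R)+
  have split: "Fourier (\<lambda>x. of_real (f x)) \<xi> = of_real (\<integral>x. cos (\<xi> \<bullet> x) * f x \<partial>lborel) - \<i> * of_real (\<integral>x. sin (\<xi> \<bullet> x) * f x \<partial>lborel)"
    if "integrable lborel (\<lambda>x. cos (\<xi> \<bullet> x) * f x)" "integrable lborel (\<lambda>x. sin (\<xi> \<bullet> x) * f x)" for f :: "'a \<Rightarrow> real"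
  proof -
    have "Fourier (\<lambda>x. of_real (f x)) \<xi> = (\<integral>x. of_real (cos (\<xi> \<bullet> x) * f x) - \<i> * of_real (sin (\<xi> \<bullet> x) * f x) \<partial>lborel)"
      unfolding Fourier_def exp_minus_i by (intro Bochner_Integration.integral_cong refl) (simp add: algebra_simps)
    also have "\<dots> = (\<integral>x. of_real (cos (\<xi> \<bullet> x) * f x) \<partial>lborel) - (\<integral>x. \<i> * of_real (sin (\<xi> \<bullet> x) * f x) \<partial>lborel)"
      by (rule Bochner_Integration.integral_diff[OF integrable_of_real[OF that(1)] integrable_mult_right[OF integrable_of_real[OF that(2)]]])
    also have "(\<integral>x. \<i> * of_real (sin (\<xi> \<bullet> x) * f x) \<partial>lborel) = \<i> * (\<integral>x. of_real (sin (\<xi> \<bullet> x) * f x) \<partial>lborel)"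
      by (rule integral_mult_right_zero)
    finally show ?thesis by (simp only: integral_complex_of_real)
  qed
  have 1: "(\<integral>x. cos (\<xi> \<bullet> x) * frechet_derivative \<phi> (at x) b \<partial>lborel) = (\<xi> \<bullet> b) * (\<integral>x. sin (\<xi> \<bullet> x) * \<phi> x \<partial>lborel)"
  proof -
    have "(\<integral>x. cos (\<xi> \<bullet> x) * frechet_derivative \<phi> (at x) b \<partial>lborel) = - (\<integral>x. - sin (\<xi> \<bullet> x) * (\<xi> \<bullet> b) * \<phi> x \<partial>lborel)"
      using integration_by_parts(1)[OF smc(1) t b] unfolding frechet_derivative_cos_sin .
    also have "(\<integral>x. - sin (\<xi> \<bullet> x) * (\<xi> \<bullet> b) * \<phi> x \<partial>lborel) = (\<integral>x. - (\<xi> \<bullet> b) * (sin (\<xi> \<bullet> x) * \<phi> x) \<partial>lborel)"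
      by (intro Bochner_Integration.integral_cong refl) (simp add: mult_ac)
    also have "\<dots> = - (\<xi> \<bullet> b) * (\<integral>x. sin (\<xi> \<bullet> x) * \<phi> x \<partial>lborel)" by (rule integral_mult_right_zero)
    finally show ?thesis by simp
  qed
  have 2: "(\<integral>x. sin (\<xi> \<bullet> x) * frechet_derivative \<phi> (at x) b \<partial>lborel) = - (\<xi> \<bullet> b) * (\<integral>x. cos (\<xi> \<bullet> x) * \<phi> x \<partial>lborel)"
  proof -
    have "(\<integral>x. sin (\<xi> \<bullet> x) * frechet_derivative \<phi> (at x) b \<partial>lborel) = - (\<integral>x. cos (\<xi> \<bullet> x) * (\<xi> \<bullet> b) * \<phi> x \<partial>lborel)"
      using integration_by_parts(1)[OF smc(2) t b] unfolding frechet_derivative_cos_sin .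
    also have "(\<integral>x. cos (\<xi> \<bullet> x) * (\<xi> \<bullet> b) * \<phi> x \<partial>lborel) = (\<integral>x. (\<xi> \<bullet> b) * (cos (\<xi> \<bullet> x) * \<phi> x) \<partial>lborel)"
      by (intro Bochner_Integration.integral_cong refl) (simp add: mult_ac)
    also have "\<dots> = (\<xi> \<bullet> b) * (\<integral>x. cos (\<xi> \<bullet> x) * \<phi> x \<partial>lborel)" by (rule integral_mult_right_zero)
    finally show ?thesis by simp
  qed
  show ?thesis
    unfolding split[OF integration_by_parts(2)[OF smc(1) t b] integration_by_parts(2)[OF smc(2) t b]] split[OF i] 1 2
    by (simp add: algebra_simps)
qed

lemma integral_inverse_Fourier_test:
  fixes w :: "'a::euclidean_space \<Rightarrow> complex" and f :: "'a \<Rightarrow> real"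
  assumes "integrable lborel w" "integrable lborel f"
  shows "(\<integral>x. inverse_Fourier w x * of_real (f x) \<partial>lborel)
    = (\<integral>\<xi>. w \<xi> * cnj (Fourier (\<lambda>x. of_real (f x)) \<xi>) \<partial>lborel) / of_real ((2 * pi) ^ DIM('a))"
proof -
  have wc: "integrable lborel (\<lambda>\<xi>. cnj (w \<xi>))" using assms(1) by simp
  have "inverse_Fourier w x * of_real (f x) = cnj (Fourier (\<lambda>\<xi>. cnj (w \<xi>)) x * of_real (f x)) / of_real ((2 * pi) ^ DIM('a))" for x
    by (simp add: inverse_Fourier_def cnj_Fourier)
  then have "(\<integral>x. inverse_Fourier w x * of_real (f x) \<partial>lborel)
    = (\<integral>x. cnj (Fourier (\<lambda>\<xi>. cnj (w \<xi>)) x * of_real (f x)) \<partial>lborel) / of_real ((2 * pi) ^ DIM('a))"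
    by (simp only: integral_divide_zero)
  also have "(\<integral>x. cnj (Fourier (\<lambda>\<xi>. cnj (w \<xi>)) x * of_real (f x)) \<partial>lborel)
    = cnj (\<integral>x. Fourier (\<lambda>\<xi>. cnj (w \<xi>)) x * of_real (f x) \<partial>lborel)"
    by (rule Bochner_Integration.integral_cnj)
  also have "\<dots> = cnj (\<integral>\<xi>. cnj (w \<xi>) * Fourier (\<lambda>x. of_real (f x)) \<xi> \<partial>lborel)"
    by (simp only: Fourier_multiplication_formula[OF wc integrable_of_real[OF assms(2)]])
  also have "\<dots> = (\<integral>\<xi>. w \<xi> * cnj (Fourier (\<lambda>x. of_real (f x)) \<xi>) \<partial>lborel)"
    by (subst Bochner_Integration.integral_cnj[symmetric]) simp
  finally show ?thesis .
qed

text \<open>The derivative of the test function becomes multiplication by i times the frequency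
  coordinate. Conjugation turns this factor into its negative, and this is the sign in the weak
  formulation.\<close>

lemma weak_gradient_inverse_Fourier:
  fixes w :: "'a::euclidean_space \<Rightarrow> complex"
  assumes w: "w \<in> L12" and wb: "\<And>b. b \<in> Basis \<Longrightarrow> (\<lambda>\<xi>. \<i> * of_real (\<xi> \<bullet> b) * w \<xi>) \<in> L12"
  shows "weak_gradient (inverse_Fourier w) (\<lambda>b. inverse_Fourier (\<lambda>\<xi>. \<i> * of_real (\<xi> \<bullet> b) * w \<xi>))"
  unfolding weak_gradient_def
proof (intro ballI conjI allI impI)
  fix b :: 'a assume b: "b \<in> Basis"
  show "inverse_Fourier (\<lambda>\<xi>. \<i> * of_real (\<xi> \<bullet> b) * w \<xi>) \<in> L2" by (rule inverse_Fourier_L2(1)[OF wb[OF b]])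
  fix \<phi> :: "'a \<Rightarrow> real" assume t: "test_function \<phi>"
  have s: "smooth \<phi>" using t by (simp add: test_function_def)
  obtain R where R: "\<And>x. R < norm x \<Longrightarrow> \<phi> x = 0" "\<And>x b. R < norm x \<Longrightarrow> frechet_derivative \<phi> (at x) b = 0"
    using test_function_radius[OF t] by metis
  have i1: "integrable lborel \<phi>"
    by (rule continuous_compact_support(1)[OF smooth_continuous[OF s] R(1)])
  have i2: "integrable lborel (\<lambda>x. frechet_derivative \<phi> (at x) b)"
    by (rule continuous_compact_support(1)[OF smooth_continuous[OF smoothD(2)[OF s b]] R(2)])
  note i = i1 i2
  have "(\<integral>\<xi>. w \<xi> * cnj (\<i> * of_real (\<xi> \<bullet> b) * Fourier (\<lambda>x. of_real (\<phi> x)) \<xi>) \<partial>lborel)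
     = (\<integral>\<xi>. - (\<i> * of_real (\<xi> \<bullet> b) * w \<xi> * cnj (Fourier (\<lambda>x. of_real (\<phi> x)) \<xi>)) \<partial>lborel)"
    by (intro Bochner_Integration.integral_cong refl) (simp add: mult_ac)
  also have "\<dots> = - (\<integral>\<xi>. \<i> * of_real (\<xi> \<bullet> b) * w \<xi> * cnj (Fourier (\<lambda>x. of_real (\<phi> x)) \<xi>) \<partial>lborel)"
    by (rule Bochner_Integration.integral_minus)
  finally show "(\<integral>x. inverse_Fourier w x * of_real (frechet_derivative \<phi> (at x) b) \<partial>lborel)
     = - (\<integral>x. inverse_Fourier (\<lambda>\<xi>. \<i> * of_real (\<xi> \<bullet> b) * w \<xi>) x * of_real (\<phi> x) \<partial>lborel)"
    unfolding integral_inverse_Fourier_test[OF L12_D(2)[OF w] i(2)] integral_inverse_Fourier_test[OF L12_D(2)[OF wb[OF b]] i(1)]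
      Fourier_test_derivative[OF t b]
    by simp
qed

subsection \<open>The Dirichlet and Neumann forms\<close>

definition restr :: "'a set \<Rightarrow> ('a \<Rightarrow> complex) \<Rightarrow> 'a \<Rightarrow> complex" where
  "restr D v x = indicator D x * v x"

definition ip :: "'a::euclidean_space set \<Rightarrow> ('a \<Rightarrow> complex) \<Rightarrow> ('a \<Rightarrow> complex) \<Rightarrow> complex" where
  "ip D v w = (\<integral>x. restr D v x * cnj (restr D w x) \<partial>lborel)"

definition grad :: "('a::euclidean_space \<Rightarrow> complex) \<Rightarrow> 'a \<Rightarrow> 'a \<Rightarrow> complex" where
  "grad u = (SOME g. weak_gradient u g)"

definition energy :: "'a::euclidean_space set \<Rightarrow> ('a \<Rightarrow> complex) \<Rightarrow> ('a \<Rightarrow> complex) \<Rightarrow> complex" where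
  "energy D v w = (\<Sum>b\<in>Basis. ip D (grad v b) (grad w b))"

lemma restr_L2:
  assumes "v \<in> L2" "D \<in> sets borel"
  shows "restr D v \<in> L2"
proof -
  have [measurable]: "v \<in> borel_measurable borel" "D \<in> sets borel" using assms by (auto simp: L2_def)
  have "integrable lborel (\<lambda>x. (cmod (restr D v x))\<^sup>2)"
    by (rule integrable_dominated[of _ "\<lambda>x. (cmod (v x))\<^sup>2"])
       (use assms in \<open>auto simp: L2_def restr_def norm_mult split: split_indicator\<close>)
  then show ?thesis by (simp add: L2_def restr_def[abs_def])
qed

lemma restr_L2_on: "v \<in> L2 \<Longrightarrow> D \<in> sets borel \<Longrightarrow> restr D v \<in> L2_on D"
  by (auto simp: L2_on_def restr_L2 restr_def)

lemma restr_lin: "restr D (\<lambda>x. c * f x + g x) = (\<lambda>x. c * restr D f x + restr D g x)"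
  by (auto simp: restr_def algebra_simps)

lemma Re_ip: "Re (ip D v v) = (\<integral>x. (cmod (restr D v x))\<^sup>2 \<partial>lborel)"
proof -
  have "ip D v v = complex_of_real (\<integral>x. (cmod (restr D v x))\<^sup>2 \<partial>lborel)"
    unfolding ip_def integral_complex_of_real[symmetric] complex_norm_square by simp
  then show ?thesis by (simp only: Re_complex_of_real)
qed

lemma psd_ip:
  fixes D :: "'a::euclidean_space set"
  assumes "D \<in> sets borel"
  shows "psd_form L2 (ip D)"
proof
  show "(\<lambda>x::'a. 0) \<in> L2" by (simp add: L2_def)
  show "\<And>c (f :: 'a \<Rightarrow> complex) g. f \<in> L2 \<Longrightarrow> g \<in> L2 \<Longrightarrow> (\<lambda>x. c * f x + g x) \<in> L2" by (rule L2_lin)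
next
  fix c and f g h :: "'a \<Rightarrow> complex" assume h: "f \<in> L2" "g \<in> L2" "h \<in> L2"
  show "ip D (\<lambda>x. c * f x + g x) h = c * ip D f h + ip D g h"
    unfolding ip_def restr_lin
    using L2_product_integrable[OF restr_L2[OF h(1) assms] restr_L2[OF h(3) assms]]
      L2_product_integrable[OF restr_L2[OF h(2) assms] restr_L2[OF h(3) assms]]
    by (simp add: distrib_right mult.assoc)
next
  fix f g :: "'a \<Rightarrow> complex" show "ip D g f = cnj (ip D f g)"
    unfolding ip_def by (subst Bochner_Integration.integral_cnj[symmetric]) (simp add: mult.commute)
next
  fix f :: "'a \<Rightarrow> complex" show "0 \<le> Re (ip D f f)" unfolding Re_ip by (simp add: integral_nonneg_AE)
qed

lemma ip_cong_AE:
  assumes "AE x in lborel. x \<in> D \<longrightarrow> f x = f' x" "f \<in> L2" "f' \<in> L2" "h \<in> L2" "D \<in> sets borel"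
  shows "ip D f h = ip D f' h"
proof -
  have [measurable]: "f \<in> borel_measurable borel" "f' \<in> borel_measurable borel" "h \<in> borel_measurable borel" "D \<in> sets borel"
    using assms by (auto simp: L2_def)
  show ?thesis unfolding ip_def
  proof (rule integral_cong_AE)
    show "(\<lambda>x. restr D f x * cnj (restr D h x)) \<in> borel_measurable lborel"
      "(\<lambda>x. restr D f' x * cnj (restr D h x)) \<in> borel_measurable lborel" unfolding restr_def by measurable
    show "AE x in lborel. restr D f x * cnj (restr D h x) = restr D f' x * cnj (restr D h x)"
      using assms(1) by eventually_elim (auto simp: restr_def split: split_indicator)
  qed
qed

lemma weak_gradient_lin:
  assumes "weak_gradient u g" "weak_gradient v h" "u \<in> L2" "v \<in> L2"
  shows "weak_gradient (\<lambda>x. c * u x + v x) (\<lambda>b x. c * g b x + h b x)"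
  unfolding weak_gradient_def
proof (intro ballI conjI allI impI)
  fix b :: 'a assume b: "b \<in> Basis"
  note gb = weak_gradientD(1)[OF assms(1) b] weak_gradientD(1)[OF assms(2) b]
  show "(\<lambda>x. c * g b x + h b x) \<in> L2" by (rule L2_lin[OF gb])
  fix \<phi> :: "'a \<Rightarrow> real" assume t: "test_function \<phi>"
  have lin: "(\<integral>x. (c * f x + k x) * of_real (r x) \<partial>lborel) = c * (\<integral>x. f x * of_real (r x) \<partial>lborel) + (\<integral>x. k x * of_real (r x) \<partial>lborel)"
    if "integrable lborel (\<lambda>x. f x * of_real (r x))" "integrable lborel (\<lambda>x. k x * of_real (r x))"
    for f k :: "'a \<Rightarrow> complex" and r :: "'a \<Rightarrow> real"
    using that by (simp add: distrib_right mult.assoc)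
  show "(\<integral>x. (c * u x + v x) * of_real (frechet_derivative \<phi> (at x) b) \<partial>lborel) = - (\<integral>x. (c * g b x + h b x) * of_real (\<phi> x) \<partial>lborel)"
    unfolding lin[OF L12_D(2)[OF L2_times_test_function(2)[OF assms(3) t b]] L12_D(2)[OF L2_times_test_function(2)[OF assms(4) t b]]]
      lin[OF L12_D(2)[OF L2_times_test_function(1)[OF gb(1) t]] L12_D(2)[OF L2_times_test_function(1)[OF gb(2) t]]]
      weak_gradientD(2)[OF assms(1) b t] weak_gradientD(2)[OF assms(2) b t]
    by simp
qed

lemma H1_D:
  assumes "u \<in> H1"
  shows "u \<in> L2" "weak_gradient u (grad u)" "b \<in> Basis \<Longrightarrow> grad u b \<in> L2"
proof -
  show "u \<in> L2" using assms by (simp add: H1_def)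
  show wg: "weak_gradient u (grad u)" 
  proof -
    from assms obtain g where "weak_gradient u g" by (auto simp: H1_def)
    then show ?thesis unfolding grad_def by (rule someI[of "weak_gradient u" g])
  qed
  show "b \<in> Basis \<Longrightarrow> grad u b \<in> L2" by (rule weak_gradientD(1)[OF wg])
qed

lemma H1_I: "u \<in> L2 \<Longrightarrow> weak_gradient u g \<Longrightarrow> u \<in> H1"
  by (auto simp: H1_def)

lemma H1_lin: "f \<in> H1 \<Longrightarrow> g \<in> H1 \<Longrightarrow> (\<lambda>x. c * f x + g x) \<in> H1"
  using H1_I[OF L2_lin weak_gradient_lin] H1_D(1,2) by blast

lemma grad_AE:
  assumes "u \<in> L2" "weak_gradient u g" "b \<in> Basis" "v \<in> H1" "open U" "AE x in lborel. x \<in> U \<longrightarrow> v x = u x"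
  shows "AE x in lborel. x \<in> U \<longrightarrow> grad v b x = g b x"
  by (rule weak_gradient_unique[OF H1_D(2)[OF assms(4)] assms(2,5,6) H1_D(1)[OF assms(4)] assms(1,3)])

text \<open>The gradient is picked by a choice operator and so is linear only up to null sets, which
  the integrals do not see.\<close>

lemma psd_energy:
  fixes D :: "'a::euclidean_space set"
  assumes D: "D \<in> sets borel"
  shows "psd_form H1 (energy D)"
proof
  interpret I: psd_form L2 "ip D" by (rule psd_ip[OF D])
  have "weak_gradient (\<lambda>x::'a. 0) (\<lambda>b x. 0)" by (auto simp: weak_gradient_def L2_def)
  then show "(\<lambda>x::'a. 0) \<in> H1" by (rule H1_I[OF I.zero])
  show "\<And>c (f :: 'a \<Rightarrow> complex) g. f \<in> H1 \<Longrightarrow> g \<in> H1 \<Longrightarrow> (\<lambda>x. c * f x + g x) \<in> H1" by (rule H1_lin)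
  fix c and f g h :: "'a \<Rightarrow> complex" assume h: "f \<in> H1" "g \<in> H1" "h \<in> H1"
  have "ip D (grad (\<lambda>x. c * f x + g x) b) (grad h b) = c * ip D (grad f b) (grad h b) + ip D (grad g b) (grad h b)"
    if b: "b \<in> Basis" for b
  proof -
    have "AE x in lborel. x \<in> UNIV \<longrightarrow> grad (\<lambda>x. c * f x + g x) b x = c * grad f b x + grad g b x"
      by (rule grad_AE[OF L2_lin[OF H1_D(1)[OF h(1)] H1_D(1)[OF h(2)]]
            weak_gradient_lin[OF H1_D(2)[OF h(1)] H1_D(2)[OF h(2)] H1_D(1)[OF h(1)] H1_D(1)[OF h(2)]] b H1_lin[OF h(1,2)]]) auto
    then have "AE x in lborel. x \<in> D \<longrightarrow> grad (\<lambda>x. c * f x + g x) b x = c * grad f b x + grad g b x" by auto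
    then have "ip D (grad (\<lambda>x. c * f x + g x) b) (grad h b) = ip D (\<lambda>x. c * grad f b x + grad g b x) (grad h b)"
      by (rule ip_cong_AE) (use H1_D(3)[OF H1_lin[OF h(1,2)] b] H1_D(3)[OF h(1) b] H1_D(3)[OF h(2) b] H1_D(3)[OF h(3) b] D in \<open>auto intro: L2_lin\<close>)
    also have "\<dots> = c * ip D (grad f b) (grad h b) + ip D (grad g b) (grad h b)"
      by (rule I.B_lin[OF H1_D(3)[OF h(1) b] H1_D(3)[OF h(2) b] H1_D(3)[OF h(3) b]])
    finally show ?thesis .
  qed
  then show "energy D (\<lambda>x. c * f x + g x) h = c * energy D f h + energy D g h"
    unfolding energy_def by (simp add: sum.distrib sum_distrib_left)
next
  interpret I: psd_form L2 "ip D" by (rule psd_ip[OF D])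
  fix f g :: "'a \<Rightarrow> complex" assume h: "f \<in> H1" "g \<in> H1"
  show "energy D g f = cnj (energy D f g)"
    unfolding energy_def cnj_sum by (intro sum.cong refl I.B_cnj H1_D(3) h)
next
  interpret I: psd_form L2 "ip D" by (rule psd_ip[OF D])
  fix f :: "'a \<Rightarrow> complex" assume h: "f \<in> H1"
  show "0 \<le> Re (energy D f f)" unfolding energy_def Re_sum by (intro sum_nonneg I.B_nonneg H1_D(3)[OF h])
qed

lemma nn_integral_gradient:
  fixes g :: "'a::euclidean_space \<Rightarrow> 'a \<Rightarrow> complex"
  assumes g: "\<And>b. b \<in> Basis \<Longrightarrow> g b \<in> L2" and D: "D \<in> sets borel"
  shows "(\<integral>\<^sup>+x. ennreal (\<Sum>b\<in>Basis. (cmod (g b x))\<^sup>2) * indicator D x \<partial>lborel) = ennreal (\<Sum>b\<in>Basis. Re (ip D (g b) (g b)))"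
proof -
  have [measurable]: "b \<in> Basis \<Longrightarrow> restr D (g b) \<in> borel_measurable borel" for b
    using restr_L2[OF g D] by (auto simp: L2_def)
  have "(\<integral>\<^sup>+x. ennreal (\<Sum>b\<in>Basis. (cmod (g b x))\<^sup>2) * indicator D x \<partial>lborel)
    = (\<integral>\<^sup>+x. (\<Sum>b\<in>Basis. ennreal ((cmod (restr D (g b) x))\<^sup>2)) \<partial>lborel)"
    by (intro nn_integral_cong) (auto simp: restr_def sum_ennreal split: split_indicator)
  also have "\<dots> = (\<Sum>b\<in>Basis. \<integral>\<^sup>+x. ennreal ((cmod (restr D (g b) x))\<^sup>2) \<partial>lborel)"
    by (rule nn_integral_sum) measurable
  also have "\<dots> = (\<Sum>b\<in>Basis. ennreal (Re (ip D (g b) (g b))))"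
    by (intro sum.cong refl) (simp add: nn_integral_sq_eq[OF restr_L2[OF g D]] Re_ip)
  also have "\<dots> = ennreal (\<Sum>b\<in>Basis. Re (ip D (g b) (g b)))"
    by (intro sum_ennreal) (simp add: Re_ip integral_nonneg_AE)
  finally show ?thesis .
qed

text \<open>Two extensions agree on the open set \<open>D\<close>, hence so do their weak gradients
  there. The chosen extension may therefore be replaced by any convenient one.\<close>

lemma Neumann_form_eq:
  fixes D :: "'a::euclidean_space set"
  assumes D: "open D" and u: "u \<in> L2_on D" and v: "v \<in> H1" and eq: "AE x in lborel. x \<in> D \<longrightarrow> u x = v x"
  shows "Neumann_form D u = ennreal (Re (energy D v v))"
proof -
  define w where "w = (SOME v. v \<in> H1 \<and> (AE x in lborel. x \<in> D \<longrightarrow> u x = v x))"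
  have "w \<in> H1 \<and> (AE x in lborel. x \<in> D \<longrightarrow> u x = w x)"
    unfolding w_def by (rule someI[of _ v]) (use v eq in blast)
  then have w: "w \<in> H1" "AE x in lborel. x \<in> D \<longrightarrow> u x = w x" by auto
  have "AE x in lborel. x \<in> D \<longrightarrow> w x = v x" using w(2) eq by eventually_elim auto
  from grad_AE[OF H1_D(1)[OF v] H1_D(2)[OF v] _ w(1) D this]
  have "AE x in lborel. \<forall>b\<in>Basis. x \<in> D \<longrightarrow> grad w b x = grad v b x"
    by (subst AE_ball_countable) (auto intro: countable_finite)
  then have ae: "AE x in lborel. ennreal (grad_norm_sq w x) * indicator D x = ennreal (\<Sum>b\<in>Basis. (cmod (grad v b x))\<^sup>2) * indicator D x"
    by eventually_elim (auto simp: grad_norm_sq_def grad_def[symmetric] split: split_indicator)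
  have "Neumann_form D u = (\<integral>\<^sup>+x\<in>D. ennreal (grad_norm_sq w x) \<partial>lborel)"
    unfolding Neumann_form_def Let_def w_def using u v eq by auto
  also have "\<dots> = (\<integral>\<^sup>+x. ennreal (\<Sum>b\<in>Basis. (cmod (grad v b x))\<^sup>2) * indicator D x \<partial>lborel)"
    by (rule nn_integral_cong_AE[OF ae])
  also have "\<dots> = ennreal (Re (energy D v v))"
    unfolding energy_def Re_sum using D by (intro nn_integral_gradient H1_D(3)[OF v]) auto
  finally show ?thesis .
qed

lemma Dirichlet_form_eq:
  fixes u :: "'a::euclidean_space \<Rightarrow> complex"
  assumes "u \<in> H1" "AE x in lborel. x \<notin> D \<longrightarrow> u x = 0"
  shows "Dirichlet_form D u = ennreal (Re (energy UNIV u u))"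
proof -
  have "Dirichlet_form D u = (\<integral>\<^sup>+x. ennreal (\<Sum>b\<in>Basis. (cmod (grad u b x))\<^sup>2) * indicator UNIV x \<partial>lborel)"
    unfolding Dirichlet_form_def grad_norm_sq_def grad_def Let_def using assms by simp
  also have "\<dots> = ennreal (Re (energy UNIV u u))"
    unfolding energy_def Re_sum by (intro nn_integral_gradient H1_D(3)[OF assms(1)]) auto
  finally show ?thesis .
qed

lemma Dirichlet_form_Fourier_bound:
  fixes u :: "'a::euclidean_space \<Rightarrow> complex"
  assumes "u \<in> L12"
  shows "(\<integral>\<^sup>+\<xi>. ennreal ((norm \<xi>)\<^sup>2 * (cmod (Fourier u \<xi>))\<^sup>2) \<partial>lborel) \<le> ennreal ((2 * pi) ^ DIM('a)) * Dirichlet_form D u"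
proof (cases "u \<in> H1 \<and> (AE x in lborel. x \<notin> D \<longrightarrow> u x = 0)")
  case False
  then have "Dirichlet_form D u = \<infinity>" by (simp only: Dirichlet_form_def if_False)
  then show ?thesis by (simp add: ennreal_mult_top)
next
  case True
  note [measurable] = L12_D(1)[OF assms]
  have u: "u \<in> H1" using True by blast
  have gm [measurable]: "b \<in> Basis \<Longrightarrow> grad u b \<in> borel_measurable borel" for b
    using H1_D(3)[OF u] by (auto simp: L2_def)
  have "(norm \<xi>)\<^sup>2 = (\<Sum>b\<in>Basis. (\<xi> \<bullet> b)\<^sup>2)" for \<xi> :: 'a
    unfolding power2_norm_eq_inner by (subst euclidean_inner) (simp add: power2_eq_square)
  then have "(\<integral>\<^sup>+\<xi>. ennreal ((norm \<xi>)\<^sup>2 * (cmod (Fourier u \<xi>))\<^sup>2) \<partial>lborel)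
    = (\<integral>\<^sup>+\<xi>. (\<Sum>b\<in>Basis. ennreal ((\<xi> \<bullet> b)\<^sup>2 * (cmod (Fourier u \<xi>))\<^sup>2)) \<partial>lborel)"
    by (intro nn_integral_cong) (simp add: sum_ennreal sum_distrib_right)
  also have "\<dots> = (\<Sum>b\<in>Basis. \<integral>\<^sup>+\<xi>. ennreal ((\<xi> \<bullet> b)\<^sup>2 * (cmod (Fourier u \<xi>))\<^sup>2) \<partial>lborel)"
    by (rule nn_integral_sum) measurable
  also have "\<dots> \<le> (\<Sum>b\<in>Basis. ennreal ((2 * pi) ^ DIM('a)) * (\<integral>\<^sup>+x. ennreal ((cmod (grad u b x))\<^sup>2) \<partial>lborel))"
    by (intro sum_mono gradient_Fourier_bound[OF assms H1_D(2)[OF u]])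
  also have "\<dots> = ennreal ((2 * pi) ^ DIM('a)) * (\<integral>\<^sup>+x. (\<Sum>b\<in>Basis. ennreal ((cmod (grad u b x))\<^sup>2)) \<partial>lborel)"
    by (subst nn_integral_sum) (auto simp: sum_distrib_left)
  also have "(\<integral>\<^sup>+x. (\<Sum>b\<in>Basis. ennreal ((cmod (grad u b x))\<^sup>2)) \<partial>lborel) = Dirichlet_form D u"
    using True unfolding Dirichlet_form_def grad_norm_sq_def grad_def Let_def by (simp add: sum_ennreal)
  finally show ?thesis .
qed

section \<open>Finiteness of the Courant-Fischer values\<close>

lemma weak_gradient_test_function:
  assumes t: "test_function f"
  shows "weak_gradient (\<lambda>x. of_real (f x)) (\<lambda>b x. of_real (frechet_derivative f (at x) b))" "(\<lambda>x. complex_of_real (f x)) \<in> L2"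
proof -
  have s: "smooth f" using t by (simp add: test_function_def)
  obtain R where R: "\<And>x. R < norm x \<Longrightarrow> f x = 0" "\<And>x b. R < norm x \<Longrightarrow> frechet_derivative f (at x) b = 0"
    using test_function_radius[OF t] by metis
  have L: "(\<lambda>x. complex_of_real (h x)) \<in> L2" if c: "continuous_on UNIV h" and z: "\<And>x. R < norm x \<Longrightarrow> h x = 0" for h :: "'a \<Rightarrow> real"
  proof -
    have "integrable lborel (\<lambda>x. (h x)\<^sup>2)"
      by (rule continuous_compact_support(1)[of _ R]) (intro continuous_intros c, simp add: z)
    then show ?thesis using borel_measurable_continuous_onI[OF c] by (simp add: L2_def)
  qed
  show "(\<lambda>x. complex_of_real (f x)) \<in> L2" by (rule L[OF smooth_continuous[OF s] R(1)])
  show "weak_gradient (\<lambda>x. of_real (f x)) (\<lambda>b x. of_real (frechet_derivative f (at x) b))"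
    unfolding weak_gradient_def
  proof (intro ballI conjI allI impI)
    fix b :: 'a assume b: "b \<in> Basis"
    show "(\<lambda>x. complex_of_real (frechet_derivative f (at x) b)) \<in> L2"
      by (rule L[OF smooth_continuous[OF smoothD(2)[OF s b]] R(2)])
    fix \<phi> :: "'a \<Rightarrow> real" assume p: "test_function \<phi>"
    show "(\<integral>x. complex_of_real (f x) * of_real (frechet_derivative \<phi> (at x) b) \<partial>lborel) =
        - (\<integral>x. of_real (frechet_derivative f (at x) b) * of_real (\<phi> x) \<partial>lborel)"
      unfolding of_real_mult[symmetric] integral_complex_of_real integration_by_parts(1)[OF s p b] by simp
  qed
qed

text \<open>Iterates Q(f + g) \<le> 2 Q f + 2 Q g, which follows from the nonnegativity of Q(g - f).
  The constant is crude; it serves only to bound a supremum.\<close>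

lemma (in psd_form) Q_sum_le:
  assumes "\<And>i. i < n \<Longrightarrow> e i \<in> V"
  shows "Q (\<lambda>x. \<Sum>i<(n::nat). c i * e i x) \<le> 2 ^ n * (\<Sum>i<n. (cmod (c i))\<^sup>2 * Q (e i))"
  using assms
proof (induction n)
  case 0
  show ?case using B_lin[OF zero zero zero, of 1] by simp
next
  case (Suc n)
  let ?g = "\<lambda>x. \<Sum>i<n. c i * e i x"
  have g: "?g \<in> V" using Suc by (intro comb_in) auto
  have en: "e n \<in> V" using Suc by auto
  have "0 \<le> Q (\<lambda>x. (- c n) * e n x + ?g x)" by (rule B_nonneg[OF lin[OF en g]])
  also have "Q (\<lambda>x. (- c n) * e n x + ?g x) = (cmod (c n))\<^sup>2 * Q (e n) - 2 * Re (c n * B (e n) ?g) + Q ?g"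
    using Q_lin[OF en g, of "- c n"] by simp
  finally have "2 * Re (c n * B (e n) ?g) \<le> (cmod (c n))\<^sup>2 * Q (e n) + Q ?g" by simp
  then have "Q (\<lambda>x. c n * e n x + ?g x) \<le> 2 * ((cmod (c n))\<^sup>2 * Q (e n)) + 2 * Q ?g"
    using Q_lin[OF en g, of "c n"] by linarith
  also have "2 * Q ?g \<le> 2 * (2 ^ n * (\<Sum>i<n. (cmod (c i))\<^sup>2 * Q (e i)))" using Suc by simp
  also have "2 * ((cmod (c n))\<^sup>2 * Q (e n)) \<le> 2 ^ Suc n * ((cmod (c n))\<^sup>2 * Q (e n))"
    using B_nonneg[OF en] by (intro mult_right_mono mult_nonneg_nonneg) (auto simp: one_le_power)
  finally show ?case by (simp add: algebra_simps)
qed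

lemma L2_norm_sq: "(L2_norm u)\<^sup>2 = (\<integral>x. (cmod (u x))\<^sup>2 \<partial>lborel)"
  by (simp add: L2_norm_def integral_nonneg_AE)

lemma L2_norm_eq_1: "L2_norm u = 1 \<longleftrightarrow> (\<integral>x. (cmod (u x))\<^sup>2 \<partial>lborel) = 1"
  unfolding L2_norm_def by simp

text \<open>Bumps with disjoint supports along a segment in \<open>D\<close> span a suitable subspace.\<close>

lemma Dirichlet_INF_finite:
  fixes D :: "'a::euclidean_space set"
  assumes "open D" "D \<noteq> {}"
  shows "(INF E\<in>L2_subspaces D n. SUP u\<in>{u \<in> E. L2_norm u = 1}. Dirichlet_form D u) < \<infinity>"
proof -
  obtain x0 where "x0 \<in> D" using assms by blast
  then obtain r where r: "0 < r" "ball x0 r \<subseteq> D" using assms(1) by (meson openE)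
  obtain b :: 'a where b: "b \<in> Basis" using nonempty_Basis by blast
  \<comment> \<open>The centres \<open>y i\<close> are spaced by \<open>r / (2 (n + 1))\<close> and
    stay within \<open>r / 2\<close> of \<open>x0\<close>. Half side
    \<open>r / (8 (n + 1) d)\<close> keeps the cubes disjoint and inside the ball.\<close>
  define s where "s = 8 * real (Suc n) * real DIM('a) / r"
  have s: "0 < s" using r by (simp add: s_def)
  have s1: "1 / s = r / (8 * real (Suc n) * real DIM('a))" by (simp add: s_def)
  define y where "y i = x0 + (real i * r / (2 * real (Suc n))) *\<^sub>R b" for i
  define \<eta> where "\<eta> i = bump (y i) s" for i
  define e where "e i x = complex_of_real (\<eta> i x)" for i x
  let ?Bx = "\<lambda>i. box (y i - (1 / s) *\<^sub>R One) (y i + (1 / s) *\<^sub>R One)"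
  have t: "test_function (\<eta> i)" for i
    using test_function_bump_mult[OF s smooth_term.const, of "y i" 1] by (simp add: \<eta>_def)
  have nz: "\<eta> i x \<noteq> 0 \<longleftrightarrow> x \<in> ?Bx i" for i x unfolding \<eta>_def by (rule bump_nonzero_iff[OF s])
  have small: "1 / s \<le> r / (8 * real (Suc n))"
    unfolding s1 using r(1) by (intro divide_left_mono) (auto simp: mult_le_cancel_left1)
  have coord: "\<bar>(x - y i) \<bullet> b'\<bar> < 1 / s" if "x \<in> ?Bx i" "b' \<in> Basis" for x i b'
    using that by (fastforce simp: mem_box inner_diff_left inner_add_left abs_less_iff)
  have disj: "i = j" if "x \<in> ?Bx i" "x \<in> ?Bx j" for x i j
  proof (rule ccontr)
    assume "i \<noteq> j"
    have "(y i - y j) \<bullet> b = (real i - real j) * r / (2 * real (Suc n))"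
      using b by (simp add: y_def inner_diff_left inner_add_left diff_divide_distrib left_diff_distrib del: of_nat_Suc)
    then have "\<bar>(y i - y j) \<bullet> b\<bar> = \<bar>real i - real j\<bar> * r / (2 * real (Suc n))" using r(1) by (simp add: abs_mult)
    also have "\<dots> \<ge> 1 * r / (2 * real (Suc n))"
      using \<open>i \<noteq> j\<close> r(1) by (intro divide_right_mono mult_right_mono) auto
    finally have f1: "r / (2 * real (Suc n)) \<le> \<bar>(y i - y j) \<bullet> b\<bar>" by simp
    have "(y i - y j) \<bullet> b = (x - y j) \<bullet> b - (x - y i) \<bullet> b" by (simp add: inner_diff_left)
    then have f2: "\<bar>(y i - y j) \<bullet> b\<bar> < 2 * (1 / s)"
      using coord[OF that(1) b] coord[OF that(2) b] by linarith
    have f3: "2 * (r / (8 * real (Suc n))) \<le> r / (2 * real (Suc n))" using r(1) by (simp add: field_simps)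
    have f4: "2 * (1 / s) \<le> 2 * (r / (8 * real (Suc n)))" using small by (rule mult_left_mono) simp
    show False using less_le_trans[OF f2 order_trans[OF f4 order_trans[OF f3 f1]]] by simp
  qed
  have inD: "?Bx i \<subseteq> D" if "i < n" for i
  proof
    fix x assume x: "x \<in> ?Bx i"
    have "norm (x - y i) \<le> (\<Sum>b\<in>Basis. \<bar>(x - y i) \<bullet> b\<bar>)" by (rule norm_le_l1)
    also have "\<dots> \<le> real DIM('a) * (1 / s)" by (rule sum_bounded_above) (use coord[OF x] in force)
    also have "\<dots> = r / (8 * real (Suc n))" unfolding s1 by simp
    also have "\<dots> < r / 2" using r(1) by (intro divide_strict_left_mono) auto
    finally have 1: "norm (x - y i) < r / 2" .
    have "norm (y i - x0) = real i * r / (2 * real (Suc n))" using b r(1) by (simp add: y_def)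
    also have "\<dots> \<le> real (Suc n) * r / (2 * real (Suc n))"
      using that r(1) by (intro divide_right_mono mult_right_mono) auto
    also have "\<dots> = r / 2" by (simp del: of_nat_Suc)
    finally have "norm (x - x0) < r" using 1 norm_triangle_ineq[of "x - y i" "y i - x0"] by simp
    then show "x \<in> D" using r(2) by (auto simp: dist_norm norm_minus_commute)
  qed
  have eH: "e i \<in> H1" for i unfolding e_def by (rule H1_I[OF weak_gradient_test_function(2,1)[OF t]])
  have zero_out: "e i x = 0" if "x \<notin> D" "i < n" for i x using nz[of i x] inD[OF that(2)] that(1) by (auto simp: e_def)
  have eD: "e i \<in> L2_on D" if "i < n" for i
    using H1_D(1)[OF eH] zero_out that by (auto simp: L2_on_def)
  have single: "(\<Sum>i<n. c i * e i x) = c j * e j x" if "x \<in> ?Bx j" "j < n" for c j x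
  proof -
    have "(\<Sum>i<n. c i * e i x) = (\<Sum>i<n. if i = j then c j * e j x else 0)"
      using disj that nz by (intro sum.cong) (auto simp: e_def)
    then show ?thesis using that by simp
  qed
  \<comment> \<open>At each point at most one summand is nonzero. Hence the norm of a combination
    controls every coefficient, which gives both independence and the energy bound.\<close>
  have dom: "(cmod (c j * e j x))\<^sup>2 \<le> (cmod (\<Sum>i<n. c i * e i x))\<^sup>2" if "j < n" for c j x
    using single[of x j c] that nz[of j x] by (cases "x \<in> ?Bx j") (auto simp: e_def)
  have eN: "0 < Re (ip UNIV (e j) (e j))" for j
  proof (rule ccontr)
    have i: "integrable lborel (\<lambda>x. (cmod (e j x))\<^sup>2)" using H1_D(1)[OF eH] by (simp add: L2_def)
    have eq: "Re (ip UNIV (e j) (e j)) = (\<integral>x. (cmod (e j x))\<^sup>2 \<partial>lborel)" by (simp add: Re_ip restr_def)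
    assume "\<not> ?thesis"
    moreover have "0 \<le> (\<integral>x. (cmod (e j x))\<^sup>2 \<partial>lborel)" by (rule integral_nonneg_AE) simp
    ultimately have "(\<integral>x. (cmod (e j x))\<^sup>2 \<partial>lborel) = 0"
      unfolding eq by linarith
    then have "AE x in lborel. (cmod (e j x))\<^sup>2 = 0" using i by (subst (asm) integral_nonneg_eq_0_iff_AE) auto
    then have "AE x in lborel. x \<notin> ?Bx j" by eventually_elim (use nz in \<open>auto simp: e_def\<close>)
    then have e0: "emeasure lborel (?Bx j) = 0" by (subst (asm) AE_iff_measurable[where N = "?Bx j"]) auto
    have e1: "emeasure lborel (?Bx j) = ennreal ((2 / s) ^ DIM('a))"
    proof -
      have "(\<Prod>b\<in>Basis. (y j + (1 / s) *\<^sub>R One - (y j - (1 / s) *\<^sub>R One)) \<bullet> b) = (\<Prod>b\<in>(Basis :: 'a set). 2 / s)"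
        by (intro prod.cong refl) (simp add: inner_diff_left inner_add_left)
      moreover have "(y j - (1 / s) *\<^sub>R One) \<bullet> b \<le> (y j + (1 / s) *\<^sub>R One) \<bullet> b" if "b \<in> Basis" for b
        using that s by (simp add: inner_diff_left inner_add_left)
      ultimately show ?thesis by (subst emeasure_lborel_box) auto
    qed
    have e2: "0 < (2 / s) ^ DIM('a)" using s by simp
    have "ennreal ((2 / s) ^ DIM('a)) = 0" using e0 unfolding e1 .
    then have "(2 / s) ^ DIM('a) \<le> 0" by (simp only: ennreal_eq_0_iff)
    with e2 show False by linarith
  qed
  have nrm: "(cmod (c j))\<^sup>2 * Re (ip UNIV (e j) (e j)) \<le> (\<integral>x. (cmod (\<Sum>i<n. c i * e i x))\<^sup>2 \<partial>lborel)" if j: "j < n" for c j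
  proof -
    interpret I: psd_form L2 "ip (UNIV :: 'a set)" by (rule psd_ip) simp
    have L: "(\<lambda>x. \<Sum>i<n. c i * e i x) \<in> L2" using H1_D(1)[OF eH] by (intro I.comb_in)
    have L2: "(\<lambda>x. c j * e j x) \<in> L2" by (rule I.scale[OF H1_D(1)[OF eH]])
    have "(cmod (c j))\<^sup>2 * Re (ip UNIV (e j) (e j)) = (\<integral>x. (cmod (c j * e j x))\<^sup>2 \<partial>lborel)"
      by (simp add: Re_ip restr_def norm_mult power_mult_distrib)
    also have "\<dots> \<le> (\<integral>x. (cmod (\<Sum>i<n. c i * e i x))\<^sup>2 \<partial>lborel)"
      using L L2 by (intro integral_mono_AE AE_I2 dom[OF j]) (auto simp: L2_def)
    finally show ?thesis .
  qed
  define E where "E = range (\<lambda>c x. \<Sum>i<n. c i * e i x)"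
  have "E \<in> L2_subspaces D n"
    unfolding L2_subspaces_def E_def
  proof (intro CollectI exI conjI allI impI refl eD)
    fix c i assume z: "AE x in lborel. (\<Sum>i<n. c i * e i x) = 0" and i: "i < n"
    have "(\<integral>x. (cmod (\<Sum>i<n. c i * e i x))\<^sup>2 \<partial>lborel) = 0"
      by (rule integral_eq_zero_AE) (use z in \<open>eventually_elim, simp\<close>)
    with nrm[OF i, of c] eN[of i] have "(cmod (c i))\<^sup>2 * Re (ip UNIV (e i) (e i)) \<le> 0" by simp
    with eN[of i] show "c i = 0" by (simp add: mult_le_0_iff)
  qed (auto intro: eD)
  moreover have "(SUP u\<in>{u \<in> E. L2_norm u = 1}. Dirichlet_form D u)
    \<le> ennreal (2 ^ n * (\<Sum>i<n. Re (energy UNIV (e i) (e i)) / Re (ip UNIV (e i) (e i))))"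
  proof (rule SUP_least)
    interpret A: psd_form H1 "energy (UNIV :: 'a set)" by (rule psd_energy) simp
    fix u assume "u \<in> {u \<in> E. L2_norm u = 1}"
    then obtain c where c: "u = (\<lambda>x. \<Sum>i<n. c i * e i x)" "L2_norm u = 1" by (auto simp: E_def)
    have uH: "u \<in> H1" unfolding c(1) using eH by (intro A.comb_in)
    have "u x = 0" if "x \<notin> D" for x unfolding c(1) using zero_out[OF that] by simp
    then have "Dirichlet_form D u = ennreal (A.Q u)" using uH by (intro Dirichlet_form_eq) auto
    also have "A.Q u \<le> 2 ^ n * (\<Sum>i<n. (cmod (c i))\<^sup>2 * A.Q (e i))" unfolding c(1) using eH by (intro A.Q_sum_le)
    also have "(\<Sum>i<n. (cmod (c i))\<^sup>2 * A.Q (e i)) \<le> (\<Sum>i<n. A.Q (e i) / Re (ip UNIV (e i) (e i)))"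
    proof (rule sum_mono)
      fix i assume "i \<in> {..<n}"
      then have "(cmod (c i))\<^sup>2 * Re (ip UNIV (e i) (e i)) \<le> 1"
        using nrm[of i c] c(2) unfolding L2_norm_eq_1 c(1) by simp
      then have "(cmod (c i))\<^sup>2 \<le> 1 / Re (ip UNIV (e i) (e i))" using eN[of i] by (simp add: field_simps)
      from mult_right_mono[OF this A.B_nonneg[OF eH[of i]]]
      show "(cmod (c i))\<^sup>2 * A.Q (e i) \<le> A.Q (e i) / Re (ip UNIV (e i) (e i))" by simp
    qed
    finally show "Dirichlet_form D u \<le> ennreal (2 ^ n * (\<Sum>i<n. A.Q (e i) / Re (ip UNIV (e i) (e i))))"
      by (simp add: ennreal_leI)
  qed
  ultimately have "(INF E\<in>L2_subspaces D n. SUP u\<in>{u \<in> E. L2_norm u = 1}. Dirichlet_form D u)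
    \<le> ennreal (2 ^ n * (\<Sum>i<n. Re (energy UNIV (e i) (e i)) / Re (ip UNIV (e i) (e i))))"
    by (rule INF_lower2)
  then show ?thesis by (simp add: le_less_trans)
qed


section \<open>The variational inequality behind the lower bound\<close>

lemma ennreal_enn2real_le: "ennreal (enn2real x) \<le> x"
  by (cases x) auto

text \<open>This is the hypothesis of \<open>approximate_spectral_splitting\<close> for the Neumann
  problem. The restrictions to \<open>D\<close> span a competitor in the Courant-Fischer formula;
  the supremum need not be attained, so \<open>\<mu>\<close> is taken strictly below the
  eigenvalue.\<close>

lemma Courant_Fischer_lower:
  fixes D :: "'a::euclidean_space set"
  assumes D: "open D" and \<mu>: "\<mu> < Neumann_eigenvalue D n" "1 \<le> n"
    and e: "\<And>i. i < n \<Longrightarrow> e i \<in> H1"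
    and ind: "\<And>c. Re (ip D (\<lambda>x. \<Sum>i<n. c i * e i x) (\<lambda>x. \<Sum>i<n. c i * e i x)) = 0 \<Longrightarrow> \<forall>i<n. c i = 0"
  shows "\<exists>c. let y = (\<lambda>x. \<Sum>i<n. c i * e i x) in 0 < Re (ip D y y) \<and> \<mu> * Re (ip D y y) \<le> Re (energy D y y)"
proof -
  have Db: "D \<in> sets borel" using D by simp
  interpret A: psd_form H1 "energy D" by (rule psd_energy[OF Db])
  interpret I: psd_form L2 "ip D" by (rule psd_ip[OF Db])
  have yH: "(\<lambda>x. \<Sum>i<n. c i * e i x) \<in> H1" for c using e by (rule A.comb_in)
  show ?thesis
  proof (cases "\<mu> < 0")
    \<comment> \<open>A negative \<open>\<mu>\<close> is invisible in \<open>ennreal\<close>. Here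
      every combination of positive norm will do.\<close>
    case True
    let ?c = "\<lambda>i::nat. if i = 0 then 1 else 0 :: complex"
    have "I.Q (\<lambda>x. \<Sum>i<n. ?c i * e i x) \<noteq> 0" using ind[of ?c] \<mu>(2) by fastforce
    with I.B_nonneg[OF H1_D(1)[OF yH[of ?c]]] have pos: "0 < I.Q (\<lambda>x. \<Sum>i<n. ?c i * e i x)" by simp
    then have "\<mu> * I.Q (\<lambda>x. \<Sum>i<n. ?c i * e i x) \<le> 0" using True by (simp add: mult_le_0_iff)
    also have "0 \<le> A.Q (\<lambda>x. \<Sum>i<n. ?c i * e i x)" by (rule A.B_nonneg[OF yH])
    finally show ?thesis using pos unfolding Let_def by (intro exI[of _ ?c] conjI)
  next
    case False
    define f where "f i = restr D (e i)" for i
    define E where "E = range (\<lambda>c x. \<Sum>i<n. c i * f i x)"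
    have fy: "(\<lambda>x. \<Sum>i<n. c i * f i x) = restr D (\<lambda>x. \<Sum>i<n. c i * e i x)" for c
      by (auto simp: f_def restr_def sum_distrib_left mult_ac)
    have "E \<in> L2_subspaces D n"
      unfolding L2_subspaces_def E_def
    proof (intro CollectI exI conjI allI impI refl)
      fix i assume "i < n" then show "f i \<in> L2_on D" unfolding f_def by (rule restr_L2_on[OF H1_D(1)[OF e] Db])
    next
      fix c i assume z: "AE x in lborel. (\<Sum>i<n. c i * f i x) = 0" and i: "i < n"
      have "I.Q (\<lambda>x. \<Sum>i<n. c i * e i x) = 0"
        unfolding Re_ip fy[symmetric] by (rule integral_eq_zero_AE) (use z in \<open>eventually_elim, simp\<close>)
      from ind[OF this] i show "c i = 0" by blast
    qed (rule refl)
    then have "(INF E\<in>L2_subspaces D n. SUP u\<in>{u \<in> E. L2_norm u = 1}. Neumann_form D u)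
      \<le> (SUP u\<in>{u \<in> E. L2_norm u = 1}. Neumann_form D u)" by (rule INF_lower)
    moreover have "ennreal \<mu> < (INF E\<in>L2_subspaces D n. SUP u\<in>{u \<in> E. L2_norm u = 1}. Neumann_form D u)"
    proof -
      have "ennreal \<mu> < ennreal (Neumann_eigenvalue D n)" using \<mu>(1) False by (simp add: ennreal_less_iff)
      also have "\<dots> \<le> (INF E\<in>L2_subspaces D n. SUP u\<in>{u \<in> E. L2_norm u = 1}. Neumann_form D u)"
        unfolding eigenvalue_def by (rule ennreal_enn2real_le)
      finally show ?thesis .
    qed
    ultimately have "ennreal \<mu> < (SUP u\<in>{u \<in> E. L2_norm u = 1}. Neumann_form D u)" by simp
    then obtain u where u: "u \<in> E" "L2_norm u = 1" "ennreal \<mu> < Neumann_form D u"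
      by (auto simp: less_SUP_iff)
    then obtain c where c: "u = restr D (\<lambda>x. \<Sum>i<n. c i * e i x)" unfolding E_def fy by blast
    define y where "y = (\<lambda>x. \<Sum>i<n. c i * e i x)"
    have y: "y \<in> H1" unfolding y_def by (rule yH)
    have uy: "u = restr D y" using c by (simp add: y_def)
    have "Neumann_form D u = ennreal (A.Q y)"
      unfolding uy by (rule Neumann_form_eq[OF D restr_L2_on[OF H1_D(1)[OF y] Db] y]) (auto simp: restr_def)
    then have "\<mu> < A.Q y" using u(3) False by (simp add: ennreal_less_iff)
    moreover have "I.Q y = 1" using u(2) unfolding Re_ip uy L2_norm_eq_1 .
    ultimately show ?thesis
      by (intro exI[of _ c]) (simp add: Let_def y_def[symmetric])
  qed
qed

text \<open>The bound is the minimum over \<open>t \<ge> 0\<close> of \<open>\<theta> t\<^sup>2 + \<sigma> (U - t)\<^sup>2\<close>.\<close>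

lemma quadratic_minimum:
  fixes \<theta> \<sigma> U t :: real
  assumes "0 \<le> \<theta>" "0 < \<sigma>"
  shows "\<sigma> * \<theta> / (\<theta> + \<sigma>) * U\<^sup>2 \<le> \<theta> * t\<^sup>2 + \<sigma> * (U - t)\<^sup>2"
proof -
  have "0 \<le> (\<theta> * t - \<sigma> * (U - t))\<^sup>2" by simp
  also have "\<dots> = (\<theta> * t\<^sup>2 + \<sigma> * (U - t)\<^sup>2) * (\<theta> + \<sigma>) - \<sigma> * \<theta> * U\<^sup>2"
    by (simp add: power2_eq_square algebra_simps)
  finally have "\<sigma> * \<theta> * U\<^sup>2 \<le> (\<theta> * t\<^sup>2 + \<sigma> * (U - t)\<^sup>2) * (\<theta> + \<sigma>)" by simp
  then have "\<sigma> * \<theta> * U\<^sup>2 / (\<theta> + \<sigma>) \<le> \<theta> * t\<^sup>2 + \<sigma> * (U - t)\<^sup>2"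
    using assms by (simp add: pos_divide_le_eq)
  then show ?thesis by simp
qed

text \<open>If \<open>u\<close> is orthogonal to the vectors split off, its inner products with
  \<open>v\<close> and with the component \<open>w\<close> coincide. So the squared distance from
  \<open>u\<close> to \<open>v\<close> exceeds \<open>(U - t)\<^sup>2\<close> by at least
  \<open>s\<close>, and since \<sigma> \<ge> \<epsilon> this surplus pays for the loss
  \<open>\<epsilon> * s\<close> in the splitting. It remains to minimise over \<open>t\<close>. The
  vectors do not depend on \<sigma>, so one \<open>u\<close> serves for all parameters.\<close>

lemma Neumann_resolvent_lower_bound:
  fixes D :: "'a::euclidean_space set"
  assumes D: "open D" and n: "1 \<le> n" and \<epsilon>: "0 < \<epsilon>"
    and \<theta>: "\<theta> = max 0 (Neumann_eigenvalue D n - 2 * \<epsilon>)"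
  obtains m \<phi> where "m < n" "\<And>i. i < m \<Longrightarrow> \<phi> i \<in> L2"
    "\<And>u v \<sigma>. u \<in> L2 \<Longrightarrow> (\<And>i. i < m \<Longrightarrow> ip D u (\<phi> i) = 0) \<Longrightarrow> v \<in> H1 \<Longrightarrow> \<epsilon> \<le> \<sigma> \<Longrightarrow>
      \<sigma> * \<theta> / (\<theta> + \<sigma>) * Re (ip D u u) \<le> Re (energy D v v) + \<sigma> * Re (ip D (\<lambda>x. u x - v x) (\<lambda>x. u x - v x))"
proof -
  have Db: "D \<in> sets borel" using D by simp
  interpret A: psd_form H1 "energy D" by (rule psd_energy[OF Db])
  interpret I: psd_form L2 "ip D" by (rule psd_ip[OF Db])
  let ?\<mu> = "Neumann_eigenvalue D n - \<epsilon>"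
  have HL: "H1 \<subseteq> (L2 :: ('a \<Rightarrow> complex) set)" using H1_D(1) by blast
  have IH1: "psd_form H1 (ip D)"
    by (rule psd_form_subspace[OF psd_ip[OF Db] HL A.zero A.lin])
  have "\<exists>m \<phi>. m < n \<and> (\<forall>i<m. \<phi> i \<in> H1) \<and>
     (\<forall>v\<in>H1. \<exists>d s. s \<ge> 0 \<and>
        (let w = (\<lambda>x. v x + (\<Sum>i<m. d i * \<phi> i x)) in
          I.Q v = I.Q w + s \<and> A.Q v \<ge> (?\<mu> - \<epsilon>) * I.Q w - \<epsilon> * s))"
    by (rule approximate_spectral_splitting[OF psd_energy[OF Db] IH1 \<epsilon> n])
       (rule Courant_Fischer_lower[OF D _ n], use \<epsilon> in auto)
  then obtain m \<phi> where 0: "m < n \<and> (\<forall>i<m. \<phi> i \<in> H1) \<and>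
     (\<forall>v\<in>H1. \<exists>d s. s \<ge> 0 \<and>
        (let w = (\<lambda>x. v x + (\<Sum>i<m. d i * \<phi> i x)) in
          I.Q v = I.Q w + s \<and> A.Q v \<ge> (?\<mu> - \<epsilon>) * I.Q w - \<epsilon> * s))" by (elim exE) (rule that)
  show thesis
  proof (rule that[of m \<phi>])
    show "m < n" using 0 by blast
    show \<phi>L: "\<phi> i \<in> L2" if "i < m" for i using 0 HL that by blast
    fix u v :: "'a \<Rightarrow> complex" and \<sigma> :: real
    assume u: "u \<in> L2" and orth: "\<And>i. i < m \<Longrightarrow> ip D u (\<phi> i) = 0" and v: "v \<in> H1" and \<sigma>: "\<epsilon> \<le> \<sigma>"
    have vL: "v \<in> L2" by (rule H1_D(1)[OF v])
    obtain d s where ds0: "s \<ge> 0 \<and>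
        (let w = (\<lambda>x. v x + (\<Sum>i<m. d i * \<phi> i x)) in
          I.Q v = I.Q w + s \<and> A.Q v \<ge> (?\<mu> - \<epsilon>) * I.Q w - \<epsilon> * s)"
      using 0[THEN conjunct2, THEN conjunct2, rule_format, OF v] by (elim exE) (rule that)
    define p where "p = (\<lambda>x. \<Sum>i<m. d i * \<phi> i x)"
    define w where "w = (\<lambda>x. 1 * v x + p x)"
    have ds: "s \<ge> 0" "I.Q v = I.Q w + s" "(?\<mu> - \<epsilon>) * I.Q w - \<epsilon> * s \<le> A.Q v"
      using ds0 unfolding Let_def w_def p_def by auto
    have pL: "p \<in> L2" unfolding p_def using \<phi>L by (rule I.comb_in)
    have wL: "w \<in> L2" unfolding w_def by (rule I.lin[OF vL pL])
    have "ip D p u = (\<Sum>i<m. d i * ip D (\<phi> i) u)" unfolding p_def by (rule I.B_comb[OF \<phi>L u])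
    also have "\<dots> = 0"
    proof (rule sum.neutral, rule ballI)
      fix i assume "i \<in> {..<m}"
      then have i: "i < m" by simp
      have "ip D (\<phi> i) u = cnj (ip D u (\<phi> i))" by (rule I.B_cnj[OF u \<phi>L[OF i]])
      then show "d i * ip D (\<phi> i) u = 0" using orth[OF i] by simp
    qed
    finally have "ip D w u = ip D v u" unfolding w_def using I.B_lin[OF vL pL u, of 1] by simp
    with I.Cauchy_Schwarz[OF wL u] have cs: "(cmod (ip D v u))\<^sup>2 \<le> I.Q w * I.Q u" by simp
    define U where "U = sqrt (I.Q u)"
    define t where "t = sqrt (I.Q w)"
    have U: "0 \<le> U" "U\<^sup>2 = I.Q u" using I.B_nonneg[OF u] by (auto simp: U_def)
    have t: "0 \<le> t" "t\<^sup>2 = I.Q w" using I.B_nonneg[OF wL] by (auto simp: t_def)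
    have "(cmod (ip D v u))\<^sup>2 \<le> (t * U)\<^sup>2" using cs U t by (simp add: power_mult_distrib)
    then have "cmod (ip D v u) \<le> t * U" using U t by (simp add: power2_le_iff_abs_le abs_mult)
    then have re: "Re (ip D v u) \<le> t * U" using complex_Re_le_cmod[of "ip D v u"] by linarith
    have "I.Q (\<lambda>x. (-1) * v x + u x) = I.Q v - 2 * Re (ip D v u) + I.Q u"
      using I.Q_lin[OF vL u, of "-1"] by simp
    \<comment> \<open>The norm of \<open>v\<close> contains \<open>s\<close>, but its inner product
      with \<open>u\<close> is bounded through \<open>w\<close> alone.\<close>
    then have diff: "I.Q (\<lambda>x. u x - v x) \<ge> (U - t)\<^sup>2 + s"
      using re ds(2) U(2) t(2) by (simp add: power2_diff algebra_simps)
    have A1: "\<theta> * t\<^sup>2 - \<epsilon> * s \<le> A.Q v"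
    proof (cases "0 \<le> ?\<mu> - \<epsilon>")
      case True
      then have "\<theta> = ?\<mu> - \<epsilon>" using \<theta> by simp
      then show ?thesis using ds(3) t(2) by simp
    next
      case False
      then have "\<theta> = 0" using \<theta> by simp
      then show ?thesis using A.B_nonneg[OF v] mult_nonneg_nonneg[OF less_imp_le[OF \<epsilon>] ds(1)] by simp
    qed
    have "\<epsilon> * s \<le> \<sigma> * s" using \<sigma> ds(1) by (rule mult_right_mono)
    moreover have "\<sigma> * ((U - t)\<^sup>2 + s) \<le> \<sigma> * I.Q (\<lambda>x. u x - v x)" using diff \<sigma> \<epsilon> by (intro mult_left_mono) auto
    moreover have "\<sigma> * ((U - t)\<^sup>2 + s) = \<sigma> * (U - t)\<^sup>2 + \<sigma> * s" by (rule distrib_left)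
    moreover have "\<sigma> * \<theta> / (\<theta> + \<sigma>) * U\<^sup>2 \<le> \<theta> * t\<^sup>2 + \<sigma> * (U - t)\<^sup>2"
      using \<theta> \<sigma> \<epsilon> by (intro quadratic_minimum) auto
    ultimately show "\<sigma> * \<theta> / (\<theta> + \<sigma>) * I.Q u \<le> A.Q v + \<sigma> * I.Q (\<lambda>x. u x - v x)"
      using A1 unfolding U(2) by linarith
  qed
qed

text \<open>Dimension count: \<open>m\<close> linear conditions on \<open>n > m\<close>
  coefficients. With \<open>m = 0\<close> it merely supplies a unit vector.\<close>

lemma subspace_orthogonal_unit_vector:
  fixes D :: "'a::euclidean_space set"
  assumes D: "open D" and E: "E \<in> L2_subspaces D n" and m: "m < n" and \<phi>: "\<And>i. i < m \<Longrightarrow> \<phi> i \<in> L2"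
  obtains u where "u \<in> E" "u \<in> L2_on D" "L2_norm u = 1" "\<And>i. i < m \<Longrightarrow> ip D u (\<phi> i) = 0"
proof -
  have Db: "D \<in> sets borel" using D by simp
  interpret I: psd_form L2 "ip D" by (rule psd_ip[OF Db])
  obtain e where e: "E = range (\<lambda>c x. \<Sum>i<n. c i * e i x)" "\<And>i. i < n \<Longrightarrow> e i \<in> L2_on D"
    "\<And>c. (AE x in lborel. (\<Sum>i<n. c i * e i x) = 0) \<Longrightarrow> \<forall>i<n. c i = 0"
    using E unfolding L2_subspaces_def by blast
  have eL: "e i \<in> L2" if "i < n" for i using e(2)[OF that] by (simp add: L2_on_def)
  obtain c where c: "\<exists>i\<in>{..<n}. c i \<noteq> 0" "\<forall>j<m. (\<Sum>i<n. c i * ip D (e i) (\<phi> j)) = 0"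
    using homogeneous_system_nontrivial[of "{..<n}" m "\<lambda>j i. ip D (e i) (\<phi> j)"] m by auto
  define y where "y = (\<lambda>x. \<Sum>i<n. c i * e i x)"
  have yL: "y \<in> L2" unfolding y_def using eL by (rule I.comb_in)
  have yD: "y \<in> L2_on D"
  proof -
    have "AE x in lborel. \<forall>i\<in>{..<n}. x \<notin> D \<longrightarrow> e i x = 0"
      using e(2) by (subst AE_ball_countable) (auto simp: L2_on_def countable_finite)
    then have "AE x in lborel. x \<notin> D \<longrightarrow> y x = 0" by eventually_elim (auto simp: y_def)
    then show ?thesis using yL by (simp add: L2_on_def)
  qed
  have y2: "integrable lborel (\<lambda>x. (cmod (y x))\<^sup>2)" using yL by (simp add: L2_def)
  have "(\<integral>x. (cmod (y x))\<^sup>2 \<partial>lborel) \<noteq> 0"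
  proof
    assume "(\<integral>x. (cmod (y x))\<^sup>2 \<partial>lborel) = 0"
    then have "AE x in lborel. (cmod (y x))\<^sup>2 = 0" using y2 by (subst (asm) integral_nonneg_eq_0_iff_AE) auto
    then have "AE x in lborel. (\<Sum>i<n. c i * e i x) = 0" by eventually_elim (simp add: y_def)
    from e(3)[OF this] c(1) show False by auto
  qed
  moreover have "0 \<le> (\<integral>x. (cmod (y x))\<^sup>2 \<partial>lborel)" by (rule integral_nonneg_AE) simp
  ultimately have N: "0 < L2_norm y" unfolding L2_norm_def by (simp only: real_sqrt_gt_0_iff less_le) auto
  define k where "k = complex_of_real (1 / L2_norm y)"
  define u where "u = (\<lambda>x. k * y x)"
  have "u = (\<lambda>x. \<Sum>i<n. (k * c i) * e i x)" by (simp add: u_def y_def sum_distrib_left mult.assoc)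
  then have "u \<in> E" unfolding e(1) by (intro image_eqI[of _ _ "\<lambda>i. k * c i"]) auto
  moreover have "u \<in> L2_on D" using yD I.scale[OF yL, of k] by (auto simp: L2_on_def u_def elim: eventually_mono)
  moreover have "L2_norm u = 1"
  proof -
    have "(\<integral>x. (cmod (u x))\<^sup>2 \<partial>lborel) = (cmod k)\<^sup>2 * (\<integral>x. (cmod (y x))\<^sup>2 \<partial>lborel)"
      by (simp add: u_def norm_mult power_mult_distrib)
    also have "\<dots> = 1" unfolding L2_norm_sq[symmetric] using N by (simp add: k_def norm_divide power_divide)
    finally show ?thesis unfolding L2_norm_eq_1 .
  qed
  moreover have "ip D u (\<phi> j) = 0" if "j < m" for j
  proof -
    have "ip D (\<lambda>x. k * y x + 0) (\<phi> j) = k * ip D y (\<phi> j) + ip D (\<lambda>x. 0) (\<phi> j)"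
      by (rule I.B_lin[OF yL I.zero \<phi>[OF that]])
    moreover have "ip D (\<lambda>x. 0) (\<phi> j) = 0" by (simp add: ip_def restr_def)
    moreover have "ip D y (\<phi> j) = 0" unfolding y_def using I.B_comb[OF eL \<phi>[OF that], where c = c] c(2) that by simp
    ultimately show ?thesis by (simp add: u_def)
  qed
  ultimately show thesis using that by blast
qed

subsection \<open>The upper bound\<close>

locale Bernstein_representation =
  fixes \<psi> :: "real \<Rightarrow> real" and c\<^sub>0 c\<^sub>1 :: real and M :: "real measure"
  assumes c0: "c\<^sub>0 \<ge> 0" and c1: "c\<^sub>1 \<ge> 0"
    and sets_M: "sets M = sets (restrict_space borel {0<..})"
    and integrable_M: "\<And>\<xi>. \<xi> > 0 \<Longrightarrow> integrable M (\<lambda>s. \<xi> / (\<xi> + s))"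
    and \<psi>_eq: "\<And>\<xi>. \<xi> \<ge> 0 \<Longrightarrow> \<psi> \<xi> = c\<^sub>1 * \<xi> + c\<^sub>0 + 1 / pi * (\<integral>s. \<xi> / (\<xi> + s) \<partial>M)"
begin

lemma space_M: "space M = {0<..}"
  using sets_eq_imp_space_eq[OF sets_M] by (simp add: space_restrict_space)

lemma measurable_M [measurable (raw)]: "f \<in> borel_measurable borel \<Longrightarrow> f \<in> borel_measurable M"
  using measurable_cong_sets[OF sets_M refl] measurable_restrict_space1 by blast

lemma M_pos: "s \<in> space M \<Longrightarrow> 0 < s"
  by (simp add: space_M)

text \<open>The representing measure may be infinite, but it integrates \<open>1 / (1 + s)\<close>.
  All integrability over \<open>M\<close> is reduced to comparison with this weight.\<close>

lemma integrable_M_bound: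
  fixes f :: "real \<Rightarrow> 'b::{banach, second_countable_topology}"
  assumes "f \<in> borel_measurable M" "\<And>s. 0 < s \<Longrightarrow> norm (f s) \<le> C / (1 + s)"
  shows "integrable M f"
proof (rule Bochner_Integration.integrable_bound)
  show "integrable M (\<lambda>s. C * (1 / (1 + s)))" using integrable_M[of 1] by (intro integrable_mult_right) simp
  show "AE s in M. norm (f s) \<le> norm (C * (1 / (1 + s)))"
  proof (rule AE_I2)
    fix s assume "s \<in> space M"
    then have "norm (f s) \<le> C / (1 + s)" using assms(2) M_pos by blast
    also have "\<dots> \<le> norm (C * (1 / (1 + s)))" using abs_ge_self[of "C / (1 + s)"] by simp
    finally show "norm (f s) \<le> norm (C * (1 / (1 + s)))" .
  qed
qed (rule assms(1))

lemma integrable_M0: "0 \<le> \<xi> \<Longrightarrow> integrable M (\<lambda>s. \<xi> / (\<xi> + s))"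
  using integrable_M[of \<xi>] by (cases "\<xi> = 0") auto

lemma \<psi>_mono:
  assumes "0 \<le> x" "x \<le> y"
  shows "\<psi> x \<le> \<psi> y"
proof -
  have "(\<integral>s. x / (x + s) \<partial>M) \<le> (\<integral>s. y / (y + s) \<partial>M)"
  proof (rule integral_mono)
    fix s assume "s \<in> space M"
    then have "0 < s" by (rule M_pos)
    then show "x / (x + s) \<le> y / (y + s)"
      using assms by (simp add: divide_simps mult_right_mono algebra_simps)
  qed (use assms integrable_M0 in auto)
  then have "1 / pi * (\<integral>s. x / (x + s) \<partial>M) \<le> 1 / pi * (\<integral>s. y / (y + s) \<partial>M)" by (intro mult_left_mono) auto
  then show ?thesis using \<psi>_eq[of x] \<psi>_eq[of y] assms c1 mult_left_mono[OF assms(2) c1] by simp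
qed

lemma \<psi>_nonneg: "0 \<le> x \<Longrightarrow> 0 \<le> \<psi> x"
proof -
  assume x: "0 \<le> x"
  have "0 \<le> (\<integral>s. x / (x + s) \<partial>M)"
    by (rule integral_nonneg_AE, rule AE_I2) (use x in \<open>auto dest!: M_pos\<close>)
  then show ?thesis using \<psi>_eq[OF x] c0 c1 x by simp
qed

text \<open>The derivative of \<psi> at \<open>t\<close>, taken under the integral sign.\<close>

definition slope :: "real \<Rightarrow> real" where
  "slope t = c\<^sub>1 + 1 / pi * (\<integral>s. s / (t + s)\<^sup>2 \<partial>M)"

text \<open>Strict concavity in quantitative form: the factor of the quadratic correction in \<open>tangent_bound\<close>.\<close>

definition curvature :: "real \<Rightarrow> real" where
  "curvature t = 1 / pi * (\<integral>s. s / ((1 + s) * (t + s)\<^sup>2) \<partial>M)"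

lemma slope_integrable: "0 < t \<Longrightarrow> integrable M (\<lambda>s. s / (t + s)\<^sup>2)"
proof (rule Bochner_Integration.integrable_bound[of _ "\<lambda>s. (1 / t) * (t / (t + s))"])
  assume t: "0 < t"
  show "integrable M (\<lambda>s. (1 / t) * (t / (t + s)))" by (intro integrable_mult_right integrable_M t)
  show "AE s in M. norm (s / (t + s)\<^sup>2) \<le> norm ((1 / t) * (t / (t + s)))"
  proof (rule AE_I2)
    fix s assume "s \<in> space M"
    then have s: "0 < s" by (rule M_pos)
    have "s / (t + s)\<^sup>2 \<le> 1 / (t + s)" using s t by (simp add: divide_simps power2_eq_square)
    then show "norm (s / (t + s)\<^sup>2) \<le> norm ((1 / t) * (t / (t + s)))" using s t by simp
  qed
qed measurable

lemma curvature_integrable: "0 < t \<Longrightarrow> integrable M (\<lambda>s. s / ((1 + s) * (t + s)\<^sup>2))"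
proof (rule Bochner_Integration.integrable_bound[OF slope_integrable[of t]])
  assume t: "0 < t"
  show "AE s in M. norm (s / ((1 + s) * (t + s)\<^sup>2)) \<le> norm (s / (t + s)\<^sup>2)"
  proof (rule AE_I2)
    fix s assume "s \<in> space M"
    then have s: "0 < s" by (rule M_pos)
    have "s / ((1 + s) * (t + s)\<^sup>2) = (s / (t + s)\<^sup>2) / (1 + s)" by simp
    also have "\<dots> \<le> s / (t + s)\<^sup>2" using s t by (simp add: pos_divide_le_eq mult_le_cancel_left1)
    finally show "norm (s / ((1 + s) * (t + s)\<^sup>2)) \<le> norm (s / (t + s)\<^sup>2)" using s t by simp
  qed
qed measurable

lemma slope_nonneg: "0 \<le> slope t"
proof -
  have "0 \<le> (\<integral>s. s / (t + s)\<^sup>2 \<partial>M)" by (rule integral_nonneg_AE, rule AE_I2) (auto dest!: M_pos)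
  then show ?thesis using c1 by (simp add: slope_def)
qed

lemma curvature_nonneg: "0 \<le> curvature t"
proof -
  have "0 \<le> (\<integral>s. s / ((1 + s) * (t + s)\<^sup>2) \<partial>M)" by (rule integral_nonneg_AE, rule AE_I2) (auto dest!: M_pos)
  then show ?thesis by (simp add: curvature_def)
qed

text \<open>The integrand is strictly positive on (0,\<infinity>), so the curvature vanishes only if
  the measure does, that is, if \<psi> is affine.\<close>

lemma curvature_zero:
  assumes "0 < t" "curvature t = 0"
  shows "AE s in M. False"
proof -
  have "(\<integral>s. s / ((1 + s) * (t + s)\<^sup>2) \<partial>M) = 0" using assms by (simp add: curvature_def)
  then have "AE s in M. s / ((1 + s) * (t + s)\<^sup>2) = 0"
    using curvature_integrable[OF assms(1)]
    by (subst (asm) integral_nonneg_eq_0_iff_AE) (auto intro!: AE_I2 dest!: M_pos)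
  with AE_space show ?thesis
    by eventually_elim (use assms in \<open>auto dest!: M_pos simp: add_pos_pos add_eq_0_iff\<close>)
qed

text \<open>For a single s the second order remainder of x/(x + s) at t is exactly -(x - t)^2 s /
  ((x + s)(t + s)^2). The estimate x + s \<le> (x + 1)(1 + s) separates the variables, so that the
  integral over \<open>M\<close> becomes a factor independent of x.\<close>

lemma tangent_bound:
  assumes t: "0 < t" and x: "0 \<le> x"
  shows "\<psi> x \<le> \<psi> t + slope t * (x - t) - curvature t * ((x - t)\<^sup>2 / (x + 1))"
proof -
  let ?r = "\<lambda>s. t / (t + s) + (x - t) * (s / (t + s)\<^sup>2) - ((x - t)\<^sup>2 / (x + 1)) * (s / ((1 + s) * (t + s)\<^sup>2))"
  have i1: "integrable M (\<lambda>s. t / (t + s))" by (rule integrable_M[OF t])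
  have i2: "integrable M (\<lambda>s. (x - t) * (s / (t + s)\<^sup>2))" by (intro integrable_mult_right slope_integrable t)
  have i3: "integrable M (\<lambda>s. ((x - t)\<^sup>2 / (x + 1)) * (s / ((1 + s) * (t + s)\<^sup>2)))" by (intro integrable_mult_right curvature_integrable t)
  have "(\<integral>s. x / (x + s) \<partial>M) \<le> (\<integral>s. ?r s \<partial>M)"
  proof (rule integral_mono)
    show "integrable M (\<lambda>s. x / (x + s))" by (rule integrable_M0[OF x])
    show "integrable M ?r"
      by (intro Bochner_Integration.integrable_diff Bochner_Integration.integrable_add i1 i2 i3)
    fix s assume "s \<in> space M"
    then have s: "0 < s" by (rule M_pos)
    have pos: "0 < x + s" "0 < t + s" "0 < (x + 1) * (1 + s)" using s t x by auto
    have id: "x / (x + s) = t / (t + s) + (x - t) * (s / (t + s)\<^sup>2) - (x - t)\<^sup>2 * s / ((x + s) * (t + s)\<^sup>2)"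
    proof -
      have "x / (x + s) - t / (t + s) = s * (x - t) / ((x + s) * (t + s))"
        using pos by (simp add: diff_frac_eq algebra_simps)
      moreover have "(x - t) * (s / (t + s)\<^sup>2) - (x - t)\<^sup>2 * s / ((x + s) * (t + s)\<^sup>2)
        = s * (x - t) * ((x + s) - (x - t)) / ((x + s) * (t + s)\<^sup>2)"
      proof -
        have e: "(x - t) * (s / (t + s)\<^sup>2) = s * (x - t) * (x + s) / ((x + s) * (t + s)\<^sup>2)"
          using pos by (simp add: mult_ac)
        have e2: "(x - t)\<^sup>2 * s = s * (x - t) * (x - t)" by (simp add: power2_eq_square)
        show ?thesis by (simp only: e e2 diff_divide_distrib[symmetric] right_diff_distrib)
      qed
      moreover have "s * (x - t) * ((x + s) - (x - t)) / ((x + s) * (t + s)\<^sup>2) = s * (x - t) / ((x + s) * (t + s))"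
        using pos by (simp add: power2_eq_square add.commute)
      ultimately show ?thesis by simp
    qed
    have "((x - t)\<^sup>2 / (x + 1)) * (s / ((1 + s) * (t + s)\<^sup>2)) = (x - t)\<^sup>2 * s / (((x + 1) * (1 + s)) * (t + s)\<^sup>2)"
      by (simp add: mult_ac)
    also have "\<dots> \<le> (x - t)\<^sup>2 * s / ((x + s) * (t + s)\<^sup>2)"
    proof (rule divide_left_mono)
      have "x + s \<le> (x + 1) * (1 + s)" using s x by (simp add: algebra_simps)
      then show "(x + s) * (t + s)\<^sup>2 \<le> ((x + 1) * (1 + s)) * (t + s)\<^sup>2" by (rule mult_right_mono) simp
      show "0 \<le> (x - t)\<^sup>2 * s" using s by simp
      show "0 < (x + 1) * (1 + s) * (t + s)\<^sup>2 * ((x + s) * (t + s)\<^sup>2)"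
        using pos s x by (intro mult_pos_pos zero_less_power) auto
    qed
    finally show "x / (x + s) \<le> ?r s" using id by linarith
  qed
  also have "(\<integral>s. ?r s \<partial>M) = (\<integral>s. t / (t + s) \<partial>M) + (x - t) * (\<integral>s. s / (t + s)\<^sup>2 \<partial>M)
      - ((x - t)\<^sup>2 / (x + 1)) * (\<integral>s. s / ((1 + s) * (t + s)\<^sup>2) \<partial>M)"
    by (simp only: Bochner_Integration.integral_diff[OF Bochner_Integration.integrable_add[OF i1 i2] i3]
      Bochner_Integration.integral_add[OF i1 i2] integral_mult_right_zero)
  finally have "1 / pi * (\<integral>s. x / (x + s) \<partial>M) \<le> 1 / pi * ((\<integral>s. t / (t + s) \<partial>M) + (x - t) * (\<integral>s. s / (t + s)\<^sup>2 \<partial>M)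
      - ((x - t)\<^sup>2 / (x + 1)) * (\<integral>s. s / ((1 + s) * (t + s)\<^sup>2) \<partial>M))" by (rule mult_left_mono) simp
  also have "\<dots> = 1 / pi * (\<integral>s. t / (t + s) \<partial>M) + (slope t - c\<^sub>1) * (x - t) - curvature t * ((x - t)\<^sup>2 / (x + 1))"
    by (simp add: slope_def curvature_def right_diff_distrib distrib_left mult_ac)
  finally show ?thesis using \<psi>_eq[OF x] \<psi>_eq[of t] t by (simp add: algebra_simps)
qed

lemma \<psi>_measurable: "(\<lambda>\<xi>. \<psi> ((norm \<xi>)\<^sup>2)) \<in> borel_measurable (borel :: 'a::euclidean_space measure)"
proof -
  \<comment> \<open>Nothing is known about \<psi> on negative arguments; this modification is
    monotone on the whole line.\<close>
  define f where "f x = \<psi> (max 0 x)" for x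
  have "mono f" unfolding f_def by (rule monoI) (auto intro: \<psi>_mono)
  then have [measurable]: "f \<in> borel_measurable borel" by (rule borel_measurable_mono)
  have "(\<lambda>\<xi>::'a. f ((norm \<xi>)\<^sup>2)) \<in> borel_measurable borel" by measurable
  then show ?thesis by (simp add: f_def)
qed

end

text \<open>The Fourier transforms of unit vectors of \<open>L\<^sup>2(D)\<close> are uniformly bounded, so their mass cannot
  concentrate on small sets.\<close>

lemma Fourier_mass_spread:
  fixes D :: "'a::euclidean_space set" and g :: "'a \<Rightarrow> real"
  assumes D: "open D" "bounded D" and [measurable]: "g \<in> borel_measurable borel"
    and fin: "emeasure lborel {\<xi>. g \<xi> < 1} < \<infinity>" and null: "emeasure lborel {\<xi>. g \<xi> \<le> 0} = 0"
  obtains \<delta> where "0 < \<delta>"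
    "\<And>u. u \<in> L2_on D \<Longrightarrow> L2_norm u = 1 \<Longrightarrow> ennreal \<delta> \<le> (\<integral>\<^sup>+\<xi>. ennreal (g \<xi> * (cmod (Fourier u \<xi>))\<^sup>2) \<partial>lborel)"
proof -
  let ?C = "(2 * pi) ^ DIM('a)"
  let ?V = "measure lborel D"
  define A where "A k = {\<xi>. g \<xi> < 1 / real (Suc k)}" for k
  have Am [measurable]: "A k \<in> sets borel" for k unfolding A_def by measurable
  have Afin: "emeasure lborel (A k) \<noteq> \<infinity>" for k
  proof -
    have "emeasure lborel (A k) \<le> emeasure lborel {\<xi>. g \<xi> < 1}"
    proof (rule emeasure_mono)
      have "1 / real (Suc k) \<le> 1" by simp
      then show "A k \<subseteq> {\<xi>. g \<xi> < 1}" unfolding A_def by (blast intro: less_le_trans)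
    qed simp
    then show ?thesis using fin by (auto simp: top_unique)
  qed
  have "(\<lambda>k. emeasure lborel (A k)) \<longlonglongrightarrow> emeasure lborel (\<Inter>k. A k)"
  proof (rule Lim_emeasure_decseq)
    show "decseq A" unfolding decseq_def
    proof (intro allI impI subsetI)
      fix i j \<xi> assume "i \<le> j" "\<xi> \<in> A j"
      have "1 / real (Suc j) \<le> 1 / real (Suc i)" using \<open>i \<le> j\<close> by (intro divide_left_mono) auto
      with \<open>\<xi> \<in> A j\<close> show "\<xi> \<in> A i" unfolding A_def by (blast intro: less_le_trans)
    qed
  qed (use Afin in auto)
  moreover have "(\<Inter>k. A k) = {\<xi>. g \<xi> \<le> 0}"
  proof (intro set_eqI iffI)
    fix \<xi> assume "\<xi> \<in> (\<Inter>k. A k)"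
    then have "g \<xi> \<le> 1 / real (Suc k)" for k by (auto simp: A_def intro: less_imp_le)
    then have "g \<xi> \<le> 0" by (intro LIMSEQ_le_const[OF LIMSEQ_Suc[OF lim_1_over_n]]) auto
    then show "\<xi> \<in> {\<xi>. g \<xi> \<le> 0}" by simp
  next
    fix \<xi> assume "\<xi> \<in> {\<xi>. g \<xi> \<le> 0}"
    moreover have "0 < 1 / real (Suc k)" for k by simp
    ultimately show "\<xi> \<in> (\<Inter>k. A k)" unfolding A_def by (blast intro: le_less_trans)
  qed
  ultimately have lim: "(\<lambda>k. emeasure lborel (A k)) \<longlonglongrightarrow> 0" using null by simp
  \<comment> \<open>The squared transform is at most \<open>?V\<close>, so a set of measure below
    \<open>q\<close> carries at most half of the total mass \<open>?C\<close>. Adding 1 keeps the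
    denominator positive.\<close>
  define q where "q = ?C / (2 * (?V + 1))"
  have q: "0 < q" unfolding q_def by (intro divide_pos_pos mult_pos_pos add_nonneg_pos) auto
  have "\<forall>\<^sub>F k in sequentially. emeasure lborel (A k) < ennreal q"
    by (rule order_tendstoD(2)[OF lim]) (simp add: q)
  then obtain k where k: "emeasure lborel (A k) < ennreal q"
    by (auto simp: eventually_sequentially)
  \<comment> \<open>The other half of the mass lies where \<open>g\<close> is at least
    \<open>1 / Suc k\<close>.\<close>
  define \<delta> where "\<delta> = ?C / (2 * real (Suc k))"
  have "0 < \<delta>" by (simp add: \<delta>_def)
  moreover have "ennreal \<delta> \<le> (\<integral>\<^sup>+\<xi>. ennreal (g \<xi> * (cmod (Fourier u \<xi>))\<^sup>2) \<partial>lborel)"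
    if u: "u \<in> L2_on D" "L2_norm u = 1" for u
  proof -
    have uL: "u \<in> L12" by (rule L2_on_imp_L12(1)[OF u(1) D(2,1)])
    note [measurable] = L12_D(1)[OF uL]
    have bound: "(cmod (Fourier u \<xi>))\<^sup>2 \<le> ?V" for \<xi>
    proof -
      have "cmod (Fourier u \<xi>) \<le> sqrt ?V"
        using norm_Fourier_le[of u \<xi>] L2_on_imp_L12(2)[OF u(1) D(2,1)] u(2) by simp
      then have "(cmod (Fourier u \<xi>))\<^sup>2 \<le> (sqrt ?V)\<^sup>2" by (rule power_mono) simp
      then show ?thesis by simp
    qed
    define I where "I = (\<integral>\<^sup>+\<xi>. ennreal (g \<xi> * (cmod (Fourier u \<xi>))\<^sup>2) \<partial>lborel)"
    have "ennreal ?C = (\<integral>\<^sup>+\<xi>. ennreal ((cmod (Fourier u \<xi>))\<^sup>2) \<partial>lborel)"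
      unfolding nn_integral_sq_eq[OF Fourier_L2[OF uL]] Plancherel[OF uL] L2_norm_sq[symmetric] u(2) by simp
    also have "\<dots> \<le> (\<integral>\<^sup>+\<xi>. ennreal ?V * indicator (A k) \<xi> + ennreal (real (Suc k)) * ennreal (g \<xi> * (cmod (Fourier u \<xi>))\<^sup>2) \<partial>lborel)"
    proof (rule nn_integral_mono)
      fix \<xi>
      show "ennreal ((cmod (Fourier u \<xi>))\<^sup>2) \<le> ennreal ?V * indicator (A k) \<xi> + ennreal (real (Suc k)) * ennreal (g \<xi> * (cmod (Fourier u \<xi>))\<^sup>2)"
      proof (cases "\<xi> \<in> A k")
        case True
        have "ennreal ((cmod (Fourier u \<xi>))\<^sup>2) \<le> ennreal ?V" using bound by (rule ennreal_leI)
        then show ?thesis using True by (simp add: add_increasing2)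
      next
        case False
        then have "1 \<le> real (Suc k) * g \<xi>" by (simp add: A_def not_less divide_le_eq mult.commute)
        from mult_right_mono[OF this, of "(cmod (Fourier u \<xi>))\<^sup>2"]
        have "(cmod (Fourier u \<xi>))\<^sup>2 \<le> real (Suc k) * (g \<xi> * (cmod (Fourier u \<xi>))\<^sup>2)" by (simp add: mult.assoc)
        then have "ennreal ((cmod (Fourier u \<xi>))\<^sup>2) \<le> ennreal (real (Suc k)) * ennreal (g \<xi> * (cmod (Fourier u \<xi>))\<^sup>2)"
          by (subst ennreal_mult'[symmetric]) (auto intro: ennreal_leI simp del: of_nat_Suc)
        then show ?thesis using False by simp
      qed
    qed
    also have "\<dots> = ennreal ?V * emeasure lborel (A k) + ennreal (real (Suc k)) * I"
      unfolding I_def by (subst nn_integral_add, measurable) (simp add: nn_integral_cmult nn_integral_cmult_indicator del: of_nat_Suc)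
    also have "ennreal ?V * emeasure lborel (A k) \<le> ennreal ?V * ennreal q"
      using k by (intro mult_left_mono) auto
    also have "\<dots> \<le> ennreal (?C / 2)"
    proof -
      have "?V * q = (?V / (?V + 1)) * (?C / 2)" by (simp add: q_def)
      also have "\<dots> \<le> 1 * (?C / 2)" by (intro mult_right_mono) (auto simp: divide_le_eq_1 add_nonneg_pos)
      finally show ?thesis by (subst ennreal_mult'[symmetric]) (auto intro: ennreal_leI)
    qed
    finally have main: "ennreal ?C \<le> ennreal (?C / 2) + ennreal (real (Suc k)) * I" by (simp add: add_right_mono)
    show ?thesis
    proof (cases I)
      case (real r)
      have "ennreal ?C \<le> ennreal (?C / 2 + real (Suc k) * r)"
        using main real by (simp add: ennreal_mult'[symmetric] ennreal_plus[symmetric] del: ennreal_plus of_nat_Suc)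
      then have "?C \<le> ?C / 2 + real (Suc k) * r" using real by (subst (asm) ennreal_le_iff) auto
      then have "?C / 2 \<le> real (Suc k) * r" by simp
      then have "\<delta> \<le> r" unfolding \<delta>_def by (simp add: divide_le_eq mult_ac del: of_nat_Suc)
      then show ?thesis using real by (simp add: I_def[symmetric] ennreal_leI)
    next
      case top
      then show ?thesis by (simp add: I_def[symmetric])
    qed
  qed
  ultimately show thesis using that by blast
qed

section \<open>The quantitative Jensen inequality\<close>

lemma emeasure_level_sphere:
  assumes "0 \<le> t"
  shows "emeasure lborel {\<xi>::'a::euclidean_space. (norm \<xi>)\<^sup>2 = t} = 0"
proof -
  have eq: "{\<xi>::'a. (norm \<xi>)\<^sup>2 = t} = sphere 0 (sqrt t)"
    using assms by (auto simp: real_sqrt_unique)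
  have "sphere 0 (sqrt t) \<in> null_sets (completion (lborel :: 'a measure))"
    using negligible_sphere[of "0::'a" "sqrt t"] by (simp add: negligible_iff_null_sets)
  then have "sphere 0 (sqrt t) \<in> null_sets (lborel :: 'a measure)"
    by (subst (asm) null_sets_completion_iff) auto
  then show ?thesis unfolding eq by auto
qed

context Bernstein_representation
begin

text \<open>\<open>tangent_bound\<close> at |\<xi>|^2 is integrated against the density |Fu|^2,
  whose second moment the Dirichlet form controls. The correction is bounded below by
  \<open>Fourier_mass_spread\<close>; \<open>\<delta>\<close> depends on \<open>D\<close> and
  \<open>t\<close> only and hence survives a limit in \<open>\<tau>\<close>.\<close>

lemma psi_form_le:
  fixes D :: "'a::euclidean_space set"
  assumes D: "open D" "bounded D" and t: "0 < t"
  obtains \<delta> where "0 < \<delta>"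
    "\<And>u \<tau>. u \<in> L2_on D \<Longrightarrow> L2_norm u = 1 \<Longrightarrow> Dirichlet_form D u \<le> ennreal \<tau> \<Longrightarrow> 0 \<le> \<tau> \<Longrightarrow>
       0 \<le> \<psi> t + slope t * (\<tau> - t) - curvature t * \<delta> \<and>
       psi_form \<psi> D u \<le> ennreal (\<psi> t + slope t * (\<tau> - t) - curvature t * \<delta>)"
proof -
  let ?C = "(2 * pi) ^ DIM('a)"
  have C: "0 < ?C" by simp
  \<comment> \<open>The correction of \<open>tangent_bound\<close> at |\<xi>|^2. It vanishes only on
    a sphere and is less than 1 only on a bounded set, as \<open>Fourier_mass_spread\<close>
    demands.\<close>
  define g where "g \<xi> = ((norm \<xi>)\<^sup>2 - t)\<^sup>2 / ((norm \<xi>)\<^sup>2 + 1)" for \<xi> :: 'a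
  have pos1: "0 < (norm \<xi>)\<^sup>2 + 1" for \<xi> :: 'a by (rule add_nonneg_pos) auto
  have g_meas [measurable]: "g \<in> borel_measurable borel" unfolding g_def by measurable
  have g0: "0 \<le> g \<xi>" for \<xi> unfolding g_def using pos1[of \<xi>] by simp
  have g_le: "g \<xi> \<le> (norm \<xi>)\<^sup>2 + t\<^sup>2" for \<xi>
  proof -
    define x where "x = (norm \<xi>)\<^sup>2"
    have x: "0 \<le> x" by (simp add: x_def)
    have "(x - t)\<^sup>2 \<le> x\<^sup>2 + t\<^sup>2" using x t by (simp add: power2_diff)
    also have "\<dots> \<le> (x + t\<^sup>2) * (x + 1)" using x t by (simp add: algebra_simps power2_eq_square)
    finally show ?thesis unfolding g_def x_def[symmetric] using x by (simp add: divide_le_eq)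
  qed
  have sub: "{\<xi>. g \<xi> < 1} \<subseteq> cball 0 (2 * t + 5)"
  proof
    fix \<xi> :: 'a assume "\<xi> \<in> {\<xi>. g \<xi> < 1}"
    then have lt: "((norm \<xi>)\<^sup>2 - t)\<^sup>2 < (norm \<xi>)\<^sup>2 + 1" unfolding g_def using pos1[of \<xi>] by (simp add: divide_less_eq)
    define x where "x = (norm \<xi>)\<^sup>2"
    have "x \<le> 2 * t + 5"
    proof (rule ccontr)
      assume "\<not> x \<le> 2 * t + 5"
      then have "x / 2 + 5 / 2 \<le> x - t" by simp
      then have "(x / 2 + 5 / 2)\<^sup>2 \<le> (x - t)\<^sup>2" using x_def by (intro power_mono) auto
      moreover have "0 \<le> x" by (simp add: x_def)
      then have "x + 1 \<le> (x / 2 + 5 / 2)\<^sup>2"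
      proof -
        have "(x / 2 + 5 / 2)\<^sup>2 = x\<^sup>2 / 4 + 25 / 4 + x * 5 / 2" by (simp add: power2_sum power_divide)
        with \<open>0 \<le> x\<close> zero_le_power2[of x] show ?thesis by linarith
      qed
      ultimately show False using lt by (simp add: x_def)
    qed
    then have "(norm \<xi>)\<^sup>2 \<le> (2 * t + 5)\<^sup>2"
      using t unfolding x_def by (elim order_trans) (simp add: power2_eq_square algebra_simps)
    then show "\<xi> \<in> cball 0 (2 * t + 5)" using t by (auto simp: power2_le_iff_abs_le)
  qed
  have "emeasure lborel {\<xi>. g \<xi> < 1} \<le> emeasure lborel (cball 0 (2 * t + 5) :: 'a set)"
    by (rule emeasure_mono[OF sub]) simp
  also have "\<dots> < \<infinity>" by (rule emeasure_bounded_finite) simp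
  finally have fin: "emeasure lborel {\<xi>. g \<xi> < 1} < \<infinity>" .
  have "g \<xi> \<le> 0 \<longleftrightarrow> (norm \<xi>)\<^sup>2 = t" for \<xi>
  proof -
    have "g \<xi> \<le> 0 \<longleftrightarrow> ((norm \<xi>)\<^sup>2 - t)\<^sup>2 \<le> 0"
      unfolding g_def by (simp only: pos_divide_le_eq[OF pos1] mult_zero_left)
    then show ?thesis by simp
  qed
  then have "{\<xi>. g \<xi> \<le> 0} = {\<xi>. (norm \<xi>)\<^sup>2 = t}" by simp
  then have null: "emeasure lborel {\<xi>. g \<xi> \<le> 0} = 0" using emeasure_level_sphere[of t, where 'a = 'a] t by simp
  obtain \<delta>0 where \<delta>0: "0 < \<delta>0" "\<And>u. u \<in> L2_on D \<Longrightarrow> L2_norm u = 1 \<Longrightarrow> ennreal \<delta>0 \<le> (\<integral>\<^sup>+\<xi>. ennreal (g \<xi> * (cmod (Fourier u \<xi>))\<^sup>2) \<partial>lborel)"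
    using Fourier_mass_spread[OF D g_meas fin null] by metis
  show thesis
  proof (rule that[of "\<delta>0 / ?C"])
    show "0 < \<delta>0 / ?C" using \<delta>0(1) C by simp
    fix u \<tau> assume u: "u \<in> L2_on D" "L2_norm u = 1" and \<tau>: "Dirichlet_form D u \<le> ennreal \<tau>" "0 \<le> \<tau>"
    have uL: "u \<in> L12" by (rule L2_on_imp_L12(1)[OF u(1) D(2,1)])
    note [measurable] = L12_D(1)[OF uL] \<psi>_measurable
    let ?F = "\<lambda>\<xi>. (cmod (Fourier u \<xi>))\<^sup>2"
    have iF: "integrable lborel ?F" by (rule integrable_Fourier_sq(1)[OF uL])
    have F: "(\<integral>\<xi>. ?F \<xi> \<partial>lborel) = ?C" unfolding Plancherel[OF uL] L2_norm_sq[symmetric] u(2) by simp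
    have S: "(\<integral>\<^sup>+\<xi>. ennreal ((norm \<xi>)\<^sup>2 * ?F \<xi>) \<partial>lborel) \<le> ennreal (?C * \<tau>)"
    proof -
      have "(\<integral>\<^sup>+\<xi>. ennreal ((norm \<xi>)\<^sup>2 * ?F \<xi>) \<partial>lborel) \<le> ennreal ?C * Dirichlet_form D u"
        by (rule Dirichlet_form_Fourier_bound[OF uL])
      also have "\<dots> \<le> ennreal ?C * ennreal \<tau>" by (intro mult_left_mono \<tau>) simp
      finally show ?thesis using \<tau> by (simp add: ennreal_mult'[symmetric])
    qed
    have iS: "integrable lborel (\<lambda>\<xi>. (norm \<xi>)\<^sup>2 * ?F \<xi>)"
      using S by (intro integrableI_nonneg) (auto intro: le_less_trans)
    have S': "(\<integral>\<xi>. (norm \<xi>)\<^sup>2 * ?F \<xi> \<partial>lborel) \<le> ?C * \<tau>"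
      using S \<tau>(2) by (subst (asm) nn_integral_eq_integral[OF iS]) auto
    have iG: "integrable lborel (\<lambda>\<xi>. g \<xi> * ?F \<xi>)"
    proof (rule integrable_dominated)
      show "integrable lborel (\<lambda>\<xi>. (norm \<xi>)\<^sup>2 * ?F \<xi> + t\<^sup>2 * ?F \<xi>)" using iS iF by simp
      show "norm (g \<xi> * ?F \<xi>) \<le> (norm \<xi>)\<^sup>2 * ?F \<xi> + t\<^sup>2 * ?F \<xi>" for \<xi>
        using mult_right_mono[OF g_le[of \<xi>], of "?F \<xi>"] g0[of \<xi>] by (simp add: abs_mult distrib_right)
    qed measurable
    have G: "\<delta>0 \<le> (\<integral>\<xi>. g \<xi> * ?F \<xi> \<partial>lborel)"
      using \<delta>0(2)[OF u] g0 \<delta>0(1)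
      by (subst (asm) nn_integral_eq_integral[OF iG]) (auto simp: integral_nonneg_AE)
    let ?R = "\<lambda>\<xi>. (\<psi> t - slope t * t) * ?F \<xi> + slope t * ((norm \<xi>)\<^sup>2 * ?F \<xi>) - curvature t * (g \<xi> * ?F \<xi>)"
    have iR: "integrable lborel ?R" using iF iS iG by simp
    have ptw: "\<psi> ((norm \<xi>)\<^sup>2) * ?F \<xi> \<le> ?R \<xi>" for \<xi>
    proof -
      have "\<psi> ((norm \<xi>)\<^sup>2) \<le> \<psi> t + slope t * ((norm \<xi>)\<^sup>2 - t) - curvature t * g \<xi>"
        unfolding g_def by (rule tangent_bound[OF t]) simp
      from mult_right_mono[OF this, of "?F \<xi>"] show ?thesis by (simp add: algebra_simps)
    qed
    have nn: "0 \<le> ?R \<xi>" for \<xi> using ptw[of \<xi>] \<psi>_nonneg[of "(norm \<xi>)\<^sup>2"] by (smt (verit) mult_nonneg_nonneg zero_le_power2)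
    have "(\<integral>\<xi>. ?R \<xi> \<partial>lborel) = (\<psi> t - slope t * t) * ?C + slope t * (\<integral>\<xi>. (norm \<xi>)\<^sup>2 * ?F \<xi> \<partial>lborel) - curvature t * (\<integral>\<xi>. g \<xi> * ?F \<xi> \<partial>lborel)"
      using iF iS iG by (simp add: F)
    also have "\<dots> \<le> (\<psi> t - slope t * t) * ?C + slope t * (?C * \<tau>) - curvature t * \<delta>0"
      using mult_left_mono[OF S' slope_nonneg[of t]] mult_left_mono[OF G curvature_nonneg[of t]] by linarith
    also have "\<dots> = ?C * (\<psi> t + slope t * (\<tau> - t) - curvature t * (\<delta>0 / ?C))"
      using C by (simp add: algebra_simps)
    finally have R: "(\<integral>\<xi>. ?R \<xi> \<partial>lborel) \<le> ?C * (\<psi> t + slope t * (\<tau> - t) - curvature t * (\<delta>0 / ?C))" .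
    have "0 \<le> (\<integral>\<xi>. ?R \<xi> \<partial>lborel)" by (rule integral_nonneg_AE) (use nn in simp)
    with R have "?C * 0 \<le> ?C * (\<psi> t + slope t * (\<tau> - t) - curvature t * (\<delta>0 / ?C))" by linarith
    then have X0: "0 \<le> \<psi> t + slope t * (\<tau> - t) - curvature t * (\<delta>0 / ?C)"
      by (rule mult_left_le_imp_le[OF _ C])
    have "(\<integral>\<^sup>+\<xi>. ennreal (\<psi> ((norm \<xi>)\<^sup>2) * ?F \<xi>) \<partial>lborel) \<le> (\<integral>\<^sup>+\<xi>. ennreal (?R \<xi>) \<partial>lborel)"
      by (intro nn_integral_mono ennreal_leI ptw)
    also have "\<dots> = ennreal (\<integral>\<xi>. ?R \<xi> \<partial>lborel)" by (rule nn_integral_eq_integral[OF iR]) (use nn in simp)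
    also have "\<dots> \<le> ennreal (?C * (\<psi> t + slope t * (\<tau> - t) - curvature t * (\<delta>0 / ?C)))" by (rule ennreal_leI[OF R])
    finally have "ennreal (1 / ?C) * (\<integral>\<^sup>+\<xi>. ennreal (\<psi> ((norm \<xi>)\<^sup>2) * ?F \<xi>) \<partial>lborel)
      \<le> ennreal (1 / ?C) * ennreal (?C * (\<psi> t + slope t * (\<tau> - t) - curvature t * (\<delta>0 / ?C)))" by (rule mult_left_mono) simp
    also have "\<dots> = ennreal (\<psi> t + slope t * (\<tau> - t) - curvature t * (\<delta>0 / ?C))"
    proof -
      have "ennreal (1 / ?C) * ennreal (?C * X) = ennreal X" if "0 \<le> X" for X
        using that C by (subst ennreal_mult[symmetric]) auto
      then show ?thesis using X0 by blast
    qed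
    finally have "psi_form \<psi> D u \<le> ennreal (\<psi> t + slope t * (\<tau> - t) - curvature t * (\<delta>0 / ?C))"
      unfolding psi_form_def using u(1) by simp
    with X0 show "0 \<le> \<psi> t + slope t * (\<tau> - t) - curvature t * (\<delta>0 / ?C) \<and>
       psi_form \<psi> D u \<le> ennreal (\<psi> t + slope t * (\<tau> - t) - curvature t * (\<delta>0 / ?C))" by blast
  qed
qed

end

text \<open>A unit vector of L2(D) cannot have its Fourier mass near the origin. Positivity allows a
  supporting line of \<psi> at the eigenvalue.\<close>

lemma Dirichlet_eigenvalue_pos:
  fixes D :: "'a::euclidean_space set"
  assumes D: "open D" "bounded D" "D \<noteq> {}" and n: "1 \<le> n"
  shows "0 < Dirichlet_eigenvalue D n"
proof -
  let ?C = "(2 * pi) ^ DIM('a)"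
  let ?I = "INF E\<in>L2_subspaces D n. SUP u\<in>{u \<in> E. L2_norm u = 1}. Dirichlet_form D u"
  have "{\<xi>::'a. (norm \<xi>)\<^sup>2 < 1} \<subseteq> cball 0 1" by (auto simp: power2_less_imp_less abs_square_less_1 less_imp_le)
  then have "emeasure lborel {\<xi>::'a. (norm \<xi>)\<^sup>2 < 1} \<le> emeasure lborel (cball 0 1 :: 'a set)"
    by (rule emeasure_mono) simp
  also have "\<dots> < \<infinity>" by (rule emeasure_bounded_finite) simp
  finally have fin: "emeasure lborel {\<xi>::'a. (norm \<xi>)\<^sup>2 < 1} < \<infinity>" .
  have null: "emeasure lborel {\<xi>::'a. (norm \<xi>)\<^sup>2 \<le> 0} = 0"
    using emeasure_level_sphere[of 0, where 'a = 'a] by simp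
  obtain \<delta> where \<delta>: "0 < \<delta>" "\<And>u. u \<in> L2_on D \<Longrightarrow> L2_norm u = 1 \<Longrightarrow> ennreal \<delta> \<le> (\<integral>\<^sup>+\<xi>. ennreal ((norm \<xi>)\<^sup>2 * (cmod (Fourier u \<xi>))\<^sup>2) \<partial>lborel)"
  proof -
    have "(\<lambda>\<xi>::'a. (norm \<xi>)\<^sup>2) \<in> borel_measurable borel" by measurable
    from Fourier_mass_spread[OF D(1,2) this fin null] that show thesis by metis
  qed
  have "ennreal (\<delta> / ?C) \<le> ?I"
  proof (rule INF_greatest)
    fix E assume E: "E \<in> L2_subspaces D n"
    obtain u where u: "u \<in> E" "u \<in> L2_on D" "L2_norm u = 1"
      using subspace_orthogonal_unit_vector[OF D(1) E, of 0 "\<lambda>_ _. 0"] n by auto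
    have uL: "u \<in> L12" by (rule L2_on_imp_L12(1)[OF u(2) D(2,1)])
    have "ennreal \<delta> \<le> ennreal ?C * Dirichlet_form D u"
      using \<delta>(2)[OF u(2,3)] Dirichlet_form_Fourier_bound[OF uL, of D] by (rule order_trans)
    then have "ennreal (1 / ?C) * ennreal \<delta> \<le> ennreal (1 / ?C) * (ennreal ?C * Dirichlet_form D u)" by (rule mult_left_mono) simp
    also have "\<dots> = Dirichlet_form D u"
      by (subst mult.assoc[symmetric], subst ennreal_mult[symmetric]) auto
    also have "ennreal (1 / ?C) * ennreal \<delta> = ennreal (\<delta> / ?C)"
      using \<delta>(1) by (subst ennreal_mult[symmetric]) auto
    also have "Dirichlet_form D u \<le> (SUP u\<in>{u \<in> E. L2_norm u = 1}. Dirichlet_form D u)"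
      by (rule SUP_upper) (use u in simp)
    finally show "ennreal (\<delta> / ?C) \<le> (SUP u\<in>{u \<in> E. L2_norm u = 1}. Dirichlet_form D u)" .
  qed
  moreover have "?I < \<infinity>" by (rule Dirichlet_INF_finite[OF D(1,3)])
  ultimately have "enn2real (ennreal (\<delta> / ?C)) \<le> enn2real ?I" by (intro enn2real_mono) auto
  moreover have "0 < \<delta> / ?C" using \<delta>(1) by simp
  ultimately show ?thesis unfolding eigenvalue_def by simp
qed

context Bernstein_representation
begin

text \<open>A subspace that is nearly optimal for the Dirichlet form is a competitor for the form of
  \<psi>. The constant \<open>\<delta>\<close> is fixed before the error \<open>\<eta>\<close>, so
  the gain \<open>curvature t * \<delta>\<close> remains as \<open>\<eta>\<close> tends to 0. The
  finiteness shows that \<open>enn2real\<close> loses nothing in the eigenvalue.\<close>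

lemma psi_eigenvalue_upper:
  fixes D :: "'a::euclidean_space set"
  assumes D: "open D" "bounded D" "D \<noteq> {}" and n: "1 \<le> n"
  shows "(INF E\<in>L2_subspaces D n. SUP u\<in>{u \<in> E. L2_norm u = 1}. psi_form \<psi> D u) < \<infinity>"
    and "psi_eigenvalue \<psi> D n \<le> \<psi> (Dirichlet_eigenvalue D n)"
    and "\<not> (AE s in M. False) \<Longrightarrow> psi_eigenvalue \<psi> D n < \<psi> (Dirichlet_eigenvalue D n)"
proof -
  let ?I = "INF E\<in>L2_subspaces D n. SUP u\<in>{u \<in> E. L2_norm u = 1}. Dirichlet_form D u"
  let ?J = "INF E\<in>L2_subspaces D n. SUP u\<in>{u \<in> E. L2_norm u = 1}. psi_form \<psi> D u"
  define t where "t = Dirichlet_eigenvalue D n"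
  have t: "0 < t" unfolding t_def by (rule Dirichlet_eigenvalue_pos[OF D n])
  have It: "?I = ennreal t" unfolding t_def eigenvalue_def using Dirichlet_INF_finite[OF D(1,3), of n] by simp
  obtain \<delta> where \<delta>: "0 < \<delta>" "\<And>u \<tau>. u \<in> L2_on D \<Longrightarrow> L2_norm u = 1 \<Longrightarrow> Dirichlet_form D u \<le> ennreal \<tau> \<Longrightarrow> 0 \<le> \<tau> \<Longrightarrow>
       0 \<le> \<psi> t + slope t * (\<tau> - t) - curvature t * \<delta> \<and>
       psi_form \<psi> D u \<le> ennreal (\<psi> t + slope t * (\<tau> - t) - curvature t * \<delta>)"
    using psi_form_le[OF D(1,2) t] by metis
  have main: "?J \<le> ennreal (\<psi> t + slope t * \<eta> - curvature t * \<delta>) \<and> 0 \<le> \<psi> t + slope t * \<eta> - curvature t * \<delta>" if \<eta>: "0 < \<eta>" for \<eta>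
  proof -
    have "?I < ennreal (t + \<eta>)" unfolding It using t \<eta> by (simp add: ennreal_less_iff)
    then obtain E where E: "E \<in> L2_subspaces D n" "(SUP u\<in>{u \<in> E. L2_norm u = 1}. Dirichlet_form D u) < ennreal (t + \<eta>)"
      by (auto simp: INF_less_iff)
    have uD: "u \<in> L2_on D" if "u \<in> E" "L2_norm u = 1" "Dirichlet_form D u \<le> ennreal (t + \<eta>)" for u
    proof -
      have "Dirichlet_form D u \<noteq> \<infinity>" using that(3) by (auto simp: top_unique)
      then have "u \<in> H1 \<and> (AE x in lborel. x \<notin> D \<longrightarrow> u x = 0)" unfolding Dirichlet_form_def by (auto split: if_splits)
      then show ?thesis using H1_D(1) by (auto simp: L2_on_def)
    qed
    have each: "0 \<le> \<psi> t + slope t * \<eta> - curvature t * \<delta> \<and> psi_form \<psi> D u \<le> ennreal (\<psi> t + slope t * \<eta> - curvature t * \<delta>)"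
      if u: "u \<in> E" "L2_norm u = 1" for u
    proof -
      have le: "Dirichlet_form D u \<le> ennreal (t + \<eta>)"
        using E(2) u by (intro order_trans[OF SUP_upper less_imp_le]) auto
      show ?thesis using \<delta>(2)[OF uD[OF u le] u(2) le] t \<eta> by simp
    qed
    obtain u where u: "u \<in> E" "L2_norm u = 1"
      using subspace_orthogonal_unit_vector[OF D(1) E(1), of 0 "\<lambda>_ _. 0"] n by auto
    have "(SUP u\<in>{u \<in> E. L2_norm u = 1}. psi_form \<psi> D u) \<le> ennreal (\<psi> t + slope t * \<eta> - curvature t * \<delta>)"
      using each by (intro SUP_least) auto
    with E(1) have "?J \<le> ennreal (\<psi> t + slope t * \<eta> - curvature t * \<delta>)" by (rule INF_lower2)
    then show ?thesis using each[OF u] by blast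
  qed
  from main[of 1] show "?J < \<infinity>" by (auto intro: le_less_trans)
  have le: "psi_eigenvalue \<psi> D n \<le> \<psi> t + slope t * \<eta> - curvature t * \<delta>" if "0 < \<eta>" for \<eta>
    unfolding eigenvalue_def using main[OF that] by (intro enn2real_leI) auto
  have "psi_eigenvalue \<psi> D n \<le> \<psi> t - curvature t * \<delta> + e" if e: "0 < e" for e
  proof -
    have s: "0 < slope t + 1" using slope_nonneg[of t] by simp
    have "slope t * (e / (slope t + 1)) \<le> e" using s e by (simp add: divide_le_eq)
    moreover have "psi_eigenvalue \<psi> D n \<le> \<psi> t + slope t * (e / (slope t + 1)) - curvature t * \<delta>"
      using s e by (intro le) auto
    ultimately show ?thesis by linarith
  qed
  then have fin: "psi_eigenvalue \<psi> D n \<le> \<psi> t - curvature t * \<delta>" by (rule field_le_epsilon)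
  have k: "0 \<le> curvature t * \<delta>" using curvature_nonneg \<delta>(1) by simp
  show "psi_eigenvalue \<psi> D n \<le> \<psi> (Dirichlet_eigenvalue D n)" using fin k unfolding t_def by linarith
  assume "\<not> (AE s in M. False)"
  then have "curvature t \<noteq> 0" using curvature_zero[OF t] by blast
  with curvature_nonneg[of t] \<delta>(1) have "0 < curvature t * \<delta>" by (simp add: less_le)
  then show "psi_eigenvalue \<psi> D n < \<psi> (Dirichlet_eigenvalue D n)" using fin unfolding t_def by linarith
qed

end

subsection \<open>Holomorphic and meromorphic extensions\<close>

text \<open>Cauchy's inequality turns the bound on the functions into a bound on their derivatives,
  hence on difference quotients. Dominated convergence then differentiates under the
  integral.\<close>

lemma holomorphic_on_parametric_integral:
  fixes f :: "complex \<Rightarrow> 'b \<Rightarrow> complex"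
  assumes S: "open S" and hol: "\<And>s. s \<in> space M \<Longrightarrow> (\<lambda>z. f z s) holomorphic_on S"
    and meas: "\<And>z. z \<in> S \<Longrightarrow> f z \<in> borel_measurable M"
    and bound: "\<And>z s. z \<in> S \<Longrightarrow> s \<in> space M \<Longrightarrow> cmod (f z s) \<le> g s" and g: "integrable M g"
  shows "(\<lambda>z. \<integral>s. f z s \<partial>M) holomorphic_on S"
proof -
  have int: "integrable M (f z)" if "z \<in> S" for z
    by (rule Bochner_Integration.integrable_bound[OF g meas[OF that]])
       (use bound[OF that] in \<open>auto intro!: AE_I2 order_trans[OF _ abs_ge_self]\<close>)
  have "\<exists>D. ((\<lambda>z. \<integral>s. f z s \<partial>M) has_field_derivative D) (at z0)" if z0: "z0 \<in> S" for z0
  proof -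
    obtain e where e: "0 < e" "ball z0 e \<subseteq> S" by (rule openE[OF S z0])
    \<comment> \<open>Discs of radius \<open>r\<close> about points of \<open>ball z0 r\<close> stay
      in \<open>S\<close>.\<close>
    define r where "r = e / 3"
    have r: "0 < r" using e by (simp add: r_def)
    have sub: "cball w r \<subseteq> S" if "w \<in> ball z0 r" for w
    proof
      fix x assume x: "x \<in> cball w r"
      have "dist z0 x \<le> dist z0 w + dist w x" by (rule dist_triangle)
      also have "\<dots> < e" using that x e by (simp add: r_def)
      finally show "x \<in> S" using e by auto
    qed
    have der: "((\<lambda>z. f z s) has_field_derivative deriv (\<lambda>z. f z s) w) (at w)" if "s \<in> space M" "w \<in> ball z0 r" for s w
      using hol[OF that(1)] S sub[OF that(2)] r by (intro holomorphic_derivI[of _ S]) auto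
    have dbound: "cmod (deriv (\<lambda>z. f z s) w) \<le> g s / r" if s: "s \<in> space M" and w: "w \<in> ball z0 r" for s w
    proof -
      have "cmod ((deriv ^^ 1) (\<lambda>z. f z s) w) \<le> fact 1 * g s / r ^ 1"
      proof (rule Cauchy_inequality)
        show "(\<lambda>z. f z s) holomorphic_on ball w r"
          using hol[OF s] sub[OF w] ball_subset_cball holomorphic_on_subset by blast
        show "continuous_on (cball w r) (\<lambda>z. f z s)"
          using hol[OF s] sub[OF w] holomorphic_on_imp_continuous_on continuous_on_subset by blast
        show "cmod (f x s) \<le> g s" if "cmod (w - x) = r" for x
          using sub[OF w] that by (intro bound[OF _ s]) (auto simp: dist_norm)
      qed (rule r)
      then show ?thesis by simp
    qed
    have Lip: "cmod (f (z0 + h) s - f z0 s) \<le> g s / r * cmod h" if s: "s \<in> space M" and h: "cmod h < r" for s h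
    proof -
      have "cmod (f (z0 + h) s - f z0 s) \<le> g s / r * cmod ((z0 + h) - z0)"
      proof (rule field_differentiable_bound[of "ball z0 r"])
        show "((\<lambda>z. f z s) has_field_derivative deriv (\<lambda>z. f z s) w) (at w within ball z0 r)" if "w \<in> ball z0 r" for w
          using der[OF s that] by (rule has_field_derivative_at_within)
      qed (use dbound[OF s] h r in \<open>auto simp: dist_norm\<close>)
      then show ?thesis by simp
    qed
    have "((\<lambda>h. ((\<integral>s. f (z0 + h) s \<partial>M) - (\<integral>s. f z0 s \<partial>M)) / h) \<longlongrightarrow> (\<integral>s. deriv (\<lambda>z. f z s) z0 \<partial>M)) (at 0)"
      unfolding tendsto_at_iff_sequentially comp_def
    proof (intro allI impI)
      fix X :: "nat \<Rightarrow> complex" assume X: "\<forall>i. X i \<in> UNIV - {0}" "X \<longlonglongrightarrow> 0"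
      from X(2) have "\<forall>\<^sub>F i in sequentially. dist (X i) 0 < r" using r by (rule tendstoD)
      then obtain N where N: "\<And>i. i \<ge> N \<Longrightarrow> cmod (X i) < r" by (auto simp: eventually_sequentially)
      define Y where "Y i = X (i + N)" for i
      have Y: "Y i \<noteq> 0" "cmod (Y i) < r" for i using X(1) N by (auto simp: Y_def)
      have Y0: "Y \<longlonglongrightarrow> 0" unfolding Y_def by (rule LIMSEQ_ignore_initial_segment[OF X(2)])
      have inS: "z0 + Y i \<in> S" for i using e Y(2)[of i] r by (intro subsetD[OF e(2)]) (auto simp: dist_norm r_def)
      define q where "q i s = (f (z0 + Y i) s - f z0 s) / Y i" for i s
      have [measurable]: "q i \<in> borel_measurable M" for i
        unfolding q_def using meas[OF inS[of i]] meas[OF z0] by measurable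
      have lim: "(\<lambda>i. q i s) \<longlonglongrightarrow> deriv (\<lambda>z. f z s) z0" if "s \<in> space M" for s
      proof -
        have "((\<lambda>h. (f (z0 + h) s - f z0 s) / h) \<longlongrightarrow> deriv (\<lambda>z. f z s) z0) (at 0)"
          using der[OF that, of z0] r unfolding DERIV_def by simp
        moreover have "filterlim Y (at 0) sequentially"
          using Y0 Y(1) by (auto simp: filterlim_at)
        ultimately show ?thesis unfolding q_def by (rule filterlim_compose)
      qed
      have "(\<lambda>i. \<integral>s. q i s \<partial>M) \<longlonglongrightarrow> (\<integral>s. deriv (\<lambda>z. f z s) z0 \<partial>M)"
      proof (rule integral_dominated_convergence[where w = "\<lambda>s. g s / r"])
        show "(\<lambda>s. deriv (\<lambda>z. f z s) z0) \<in> borel_measurable M"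
          by (rule borel_measurable_LIMSEQ_metric[of q]) (use lim in auto)
        show "AE s in M. norm (q i s) \<le> g s / r" for i
        proof (rule AE_I2)
          fix s assume "s \<in> space M"
          from Lip[OF this Y(2)[of i]] show "norm (q i s) \<le> g s / r"
            using Y(1)[of i] by (simp add: q_def norm_divide divide_le_eq)
        qed
      qed (use g lim in auto)
      moreover have "(\<integral>s. q i s \<partial>M) = ((\<integral>s. f (z0 + Y i) s \<partial>M) - (\<integral>s. f z0 s \<partial>M)) / Y i" for i
        unfolding q_def using int[OF inS[of i]] int[OF z0] by simp
      ultimately have "(\<lambda>i. ((\<integral>s. f (z0 + X (i + N)) s \<partial>M) - (\<integral>s. f z0 s \<partial>M)) / X (i + N)) \<longlonglongrightarrow> (\<integral>s. deriv (\<lambda>z. f z s) z0 \<partial>M)"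
        by (simp add: Y_def)
      then show "(\<lambda>i. ((\<integral>s. f (z0 + X i) s \<partial>M) - (\<integral>s. f z0 s \<partial>M)) / X i) \<longlonglongrightarrow> (\<integral>s. deriv (\<lambda>z. f z s) z0 \<partial>M)"
        by (rule LIMSEQ_offset)
    qed
    then show ?thesis unfolding DERIV_def by blast
  qed
  then show ?thesis unfolding holomorphic_on_open[OF S] by blast
qed

context Bernstein_representation
begin

text \<open>Near a point z0 \<noteq> 0 the integrand is singular only for s close to -z0, and such s
  lie in a compact part of (0,\<infinity>). There the measure consists of finitely many atoms, which
  give simple poles; the rest of the integral is holomorphic. Atoms may still accumulate at 0, the
  point left out. With \<open>T\<close> empty the lemma covers affine \<psi>.\<close>

lemma extends_meromorphically_if_discrete:
  assumes T: "AE s in M. s \<in> T" and fin: "\<And>a b. 0 < a \<Longrightarrow> finite (T \<inter> {a..b})"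
  shows "extends_meromorphically \<psi>"
proof -
  define h where "h z s = z / (z + complex_of_real s)" for z s
  define f where "f z = of_real c\<^sub>1 * z + of_real c\<^sub>0 + of_real (1 / pi) * (\<integral>s. h z s \<partial>M)" for z
  have h_meas [measurable]: "h z \<in> borel_measurable borel" for z unfolding h_def by measurable
  have "f (complex_of_real \<xi>) = complex_of_real (\<psi> \<xi>)" if "0 < \<xi>" for \<xi>
  proof -
    have "h (complex_of_real \<xi>) s = complex_of_real (\<xi> / (\<xi> + s))" for s by (simp add: h_def)
    then have "(\<integral>s. h (complex_of_real \<xi>) s \<partial>M) = complex_of_real (\<integral>s. \<xi> / (\<xi> + s) \<partial>M)"
      by (simp only: integral_complex_of_real)
    then show ?thesis using that by (simp add: f_def \<psi>_eq)
  qed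
  moreover have "f meromorphic_on {z0}" if z0: "z0 \<noteq> 0" for z0
  proof -
    \<comment> \<open>As |z0| = 2r, the condition |z0 + s| < r forces r < s < 3r.\<close>
    define r where "r = cmod z0 / 2"
    have r: "0 < r" using z0 by (simp add: r_def)
    define F where "F = T \<inter> {r..3 * r}"
    have finF: "finite F" unfolding F_def by (rule fin[OF r])
    define W where "W = {s. r \<le> cmod (z0 + complex_of_real s)} - F"
    have [measurable]: "W \<in> sets borel"
    proof -
      have "{s. r \<le> cmod (z0 + complex_of_real s)} \<in> sets borel" by measurable
      then show ?thesis unfolding W_def by (rule sets.Diff) (rule borel_closed[OF finite_imp_closed[OF finF]])
    qed
    have cover: "AE s in M. s \<in> F \<or> s \<in> W"
      using T AE_space
    proof eventually_elim
      case (elim s)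
      then have s: "0 < s" by (auto dest: M_pos)
      show ?case
      proof (cases "r \<le> cmod (z0 + complex_of_real s)")
        case False
        have "cmod z0 \<le> cmod (z0 + complex_of_real s) + cmod (complex_of_real s)" by (metis add_diff_cancel_right' norm_triangle_ineq4)
        then have 1: "r \<le> s" using False s by (simp add: r_def)
        have "cmod (complex_of_real s) \<le> cmod (z0 + complex_of_real s) + cmod z0" by (metis add_diff_cancel_left' norm_triangle_ineq4)
        then have "s \<le> 3 * r" using False s by (simp add: r_def)
        with 1 elim show ?thesis by (auto simp: F_def)
      qed (auto simp: W_def)
    qed
    define k where "k z s = indicator W s * h z s" for z s
    \<comment> \<open>On the disc |z| is at most 5r/2 and |z + s| at least r/2, while 1 + s is at
      most 1 + 5r/2 + |z + s|.\<close>
    define C where "C = (5 / 2 * r) * ((1 + 5 / 2 * r) / (r / 2) + 1)"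
    have k_bound: "cmod (k z s) \<le> C / (1 + s)" if z: "z \<in> ball z0 (r / 2)" and s: "0 < s" for z s
    proof (cases "s \<in> W")
      case True
      have "cmod (z0 + complex_of_real s) \<le> cmod (z + complex_of_real s) + cmod (z0 - z)"
        using norm_triangle_ineq[of "z + complex_of_real s" "z0 - z"] by (simp add: add.commute)
      then have low: "r / 2 \<le> cmod (z + complex_of_real s)" using True z by (simp add: W_def dist_norm)
      have "cmod z \<le> cmod z0 + cmod (z0 - z)" using norm_triangle_ineq4[of z0 "z0 - z"] by simp
      then have up: "cmod z \<le> 5 / 2 * r" using z by (simp add: dist_norm r_def)
      have "s \<le> cmod (z + complex_of_real s) + cmod z"
        using norm_triangle_ineq4[of "z + complex_of_real s" z] s by simp
      then have "1 + s \<le> (1 + 5 / 2 * r) + cmod (z + complex_of_real s)" using up by simp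
      also have "1 + 5 / 2 * r \<le> ((1 + 5 / 2 * r) / (r / 2)) * cmod (z + complex_of_real s)"
        using mult_left_mono[OF low, of "(1 + 5 / 2 * r) / (r / 2)"] r by simp
      finally have "1 + s \<le> ((1 + 5 / 2 * r) / (r / 2) + 1) * cmod (z + complex_of_real s)" by (simp add: distrib_right)
      then have "cmod z * (1 + s) \<le> (5 / 2 * r) * (((1 + 5 / 2 * r) / (r / 2) + 1) * cmod (z + complex_of_real s))"
        using up s r by (intro mult_mono) auto
      then have "cmod z * (1 + s) \<le> C * cmod (z + complex_of_real s)" by (simp add: C_def mult.assoc)
      moreover have q: "0 < cmod (z + complex_of_real s)" using low r by linarith
      ultimately have "cmod z / cmod (z + complex_of_real s) \<le> C / (1 + s)"
        using s by (subst pos_divide_le_eq[OF q], subst times_divide_eq_left, subst pos_le_divide_eq) auto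
      then show ?thesis using True by (simp add: k_def h_def norm_divide)
    next
      case False
      have "0 \<le> C" using r by (simp add: C_def)
      then show ?thesis using False s by (simp add: k_def)
    qed
    have k_meas: "k z \<in> borel_measurable M" for z unfolding k_def by measurable
    have k_int: "integrable M (k z)" if "z \<in> ball z0 (r / 2)" for z
      by (rule integrable_M_bound[OF k_meas k_bound[OF that]])
    define R where "R z = (\<integral>s. k z s \<partial>M)" for z
    have "R holomorphic_on ball z0 (r / 2)"
      unfolding R_def
    proof (rule holomorphic_on_parametric_integral)
      fix s assume "s \<in> space M"
      show "(\<lambda>z. k z s) holomorphic_on ball z0 (r / 2)"
      proof (cases "s \<in> W")
        case True
        have "z + complex_of_real s \<noteq> 0" if "z \<in> ball z0 (r / 2)" for z
        proof
          assume "z + complex_of_real s = 0"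
          then have "z0 + complex_of_real s = z0 - z" by (simp add: add_eq_0_iff)
          then show False using True that r by (simp add: W_def dist_norm)
        qed
        then show ?thesis using True unfolding k_def h_def by (auto intro!: holomorphic_intros)
      qed (simp add: k_def)
    next
      show "cmod (k z s) \<le> C * (1 / (1 + s))" if "z \<in> ball z0 (r / 2)" "s \<in> space M" for z s
        using k_bound[OF that(1) M_pos[OF that(2)]] by simp
      show "integrable M (\<lambda>s. C * (1 / (1 + s)))" by (intro integrable_mult_right integrable_M) simp
    qed (auto intro: k_meas)
    then have Rm: "R meromorphic_on {z0}"
      using r unfolding analytic_at by (intro analytic_on_imp_meromorphic_on, unfold analytic_at)
        (auto intro!: exI[of _ "ball z0 (r / 2)"])
    define m where "m s = complex_of_real (measure M {s})" for s
    have eq: "f z = of_real c\<^sub>1 * z + of_real c\<^sub>0 + of_real (1 / pi) * ((\<Sum>s\<in>F. m s * (z / (z + complex_of_real s))) + R z)"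
      if z: "z \<in> ball z0 (r / 2)" for z
    proof -
      \<comment> \<open>Atoms have finite mass, since \<open>1 / (1 + s)\<close> is integrable and
        positive at each of them.\<close>
      have pt: "integrable M (\<lambda>s. complex_of_real (indicator {s0} s) * h z s0)" for s0
      proof (rule integrable_mult_left)
        show "integrable M (\<lambda>s. complex_of_real (indicator {s0} s))"
        proof (cases "0 < s0")
          case True
          show ?thesis
          proof (rule integrable_M_bound)
            show "norm (complex_of_real (indicator {s0} s)) \<le> (1 + s0) / (1 + s)" if "0 < s" for s
              using that True by (cases "s = s0") auto
          qed (rule measurable_M, measurable)
        next
          case False
          show ?thesis
          proof (rule integrable_M_bound)
            show "norm (complex_of_real (indicator {s0} s)) \<le> 0 / (1 + s)" if "0 < s" for s
              using that False by (cases "s = s0") auto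
          qed (rule measurable_M, measurable)
        qed
      qed
      have [measurable]: "(\<lambda>s. \<Sum>s0\<in>F. complex_of_real (indicator {s0} s) * h z s0) \<in> borel_measurable M"
        using pt by (intro borel_measurable_sum) auto
      have "(\<integral>s. h z s \<partial>M) = (\<integral>s. (\<Sum>s0\<in>F. complex_of_real (indicator {s0} s) * h z s0) + k z s \<partial>M)"
      proof (rule integral_cong_AE)
        show "h z \<in> borel_measurable M" by measurable
        show "(\<lambda>s. (\<Sum>s0\<in>F. complex_of_real (indicator {s0} s) * h z s0) + k z s) \<in> borel_measurable M"
          using k_meas[of z] by measurable
        show "AE s in M. h z s = (\<Sum>s0\<in>F. complex_of_real (indicator {s0} s) * h z s0) + k z s"
          using cover
        proof eventually_elim
          case (elim s)
          have "(\<Sum>s0\<in>F. complex_of_real (indicator {s0} s) * h z s0) = (\<Sum>s0\<in>F. if s0 = s then h z s else 0)"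
            by (intro sum.cong) (auto split: split_indicator)
          also have "\<dots> = (if s \<in> F then h z s else 0)" using finF by simp
          finally show ?case using elim by (auto simp: k_def W_def split: split_indicator)
        qed
      qed
      also have "\<dots> = (\<integral>s. (\<Sum>s0\<in>F. complex_of_real (indicator {s0} s) * h z s0) \<partial>M) + R z"
        unfolding R_def by (rule Bochner_Integration.integral_add[OF Bochner_Integration.integrable_sum[OF pt] k_int[OF z]])
      also have "(\<integral>s. (\<Sum>s0\<in>F. complex_of_real (indicator {s0} s) * h z s0) \<partial>M) = (\<Sum>s0\<in>F. \<integral>s. complex_of_real (indicator {s0} s) * h z s0 \<partial>M)"
        by (rule Bochner_Integration.integral_sum[OF pt])
      also have "\<dots> = (\<Sum>s0\<in>F. m s0 * (z / (z + complex_of_real s0)))"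
      proof (intro sum.cong refl)
        fix s0 assume "s0 \<in> F"
        then have "{s0} \<in> sets M" using r unfolding sets_M by (auto simp: F_def sets_restrict_space_iff)
        then have "(\<integral>s. complex_of_real (indicator {s0} s) \<partial>M) = m s0"
          unfolding integral_complex_of_real m_def by (simp add: Int_absorb2 sets.sets_into_space)
        then show "(\<integral>s. complex_of_real (indicator {s0} s) * h z s0 \<partial>M) = m s0 * (z / (z + complex_of_real s0))"
          by (simp only: integral_mult_left_zero h_def)
      qed
      finally show ?thesis by (simp add: f_def)
    qed
    have "(\<lambda>z. of_real c\<^sub>1 * z + of_real c\<^sub>0 + of_real (1 / pi) * ((\<Sum>s\<in>F. m s * (z / (z + complex_of_real s))) + R z)) meromorphic_on {z0}"
      by (intro meromorphic_intros Rm)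
    moreover have "\<forall>\<^sub>F z in at z0. f z = of_real c\<^sub>1 * z + of_real c\<^sub>0 + of_real (1 / pi) * ((\<Sum>s\<in>F. m s * (z / (z + complex_of_real s))) + R z)"
    proof (rule eventually_mono)
      show "\<forall>\<^sub>F z in at z0. z \<in> ball z0 (r / 2)" using r by (intro eventually_at_in_open') auto
    qed (rule eq)
    ultimately show ?thesis
      using meromorphic_on_cong[of "{z0}" f _ "{z0}"] by fastforce
  qed
  then have "f meromorphic_on (- {0})"
    unfolding meromorphic_on_def by blast
  ultimately show ?thesis unfolding extends_meromorphically_def by blast
qed

end

section \<open>Transforms of functions with bounded support\<close>

lemma cmod_exp_i_diff: "cmod (exp (- \<i> * complex_of_real a) - exp (- \<i> * complex_of_real b)) \<le> \<bar>a - b\<bar>"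
proof -
  have 1: "exp (- \<i> * complex_of_real a) - exp (- \<i> * complex_of_real b)
     = exp (- \<i> * complex_of_real b) * (exp (\<i> * complex_of_real (b - a)) - 1)"
    by (simp add: right_diff_distrib exp_add[symmetric] algebra_simps)
  have "cmod (exp (\<i> * complex_of_real (b - a)) - 1) \<le> \<bar>b - a\<bar>"
    using iexp_approx1[of "b - a" 0] by simp
  then show ?thesis unfolding 1 norm_mult by (simp add: norm_exp_eq_Re abs_minus_commute)
qed

text \<open>The phase changes by at most \<rho> times the shift of frequency on \<open>D\<close>.
  For unit vectors the constant is uniform, which supplies the equicontinuity used in the
  limit.\<close>

lemma Fourier_Lipschitz:
  fixes u :: "'a::euclidean_space \<Rightarrow> complex"
  assumes u: "u \<in> L2_on D" and D: "open D" "D \<subseteq> cball 0 \<rho>" and \<rho>: "0 \<le> \<rho>"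
  shows "cmod (Fourier u \<xi> - Fourier u \<eta>) \<le> \<rho> * norm (\<xi> - \<eta>) * (\<integral>x. cmod (u x) \<partial>lborel)"
proof -
  have uL: "u \<in> L12" using L2_on_imp_L12(1)[OF u _ D(1)] D(2) bounded_cball bounded_subset by blast
  have z: "AE x in lborel. x \<notin> D \<longrightarrow> u x = 0" using u by (simp add: L2_on_def)
  note i = Fourier_integrand_integrable[OF L12_D(2)[OF uL]]
  have "Fourier u \<xi> - Fourier u \<eta> = (\<integral>x. exp (- \<i> * complex_of_real (\<xi> \<bullet> x)) * u x - exp (- \<i> * complex_of_real (\<eta> \<bullet> x)) * u x \<partial>lborel)"
    unfolding Fourier_def using i[of \<xi>] i[of \<eta>] by simp
  also have "cmod \<dots> \<le> (\<integral>x. \<rho> * norm (\<xi> - \<eta>) * cmod (u x) \<partial>lborel)"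
  proof (rule order_trans[OF integral_norm_bound integral_mono_AE])
    show "integrable lborel (\<lambda>x. cmod (exp (- \<i> * complex_of_real (\<xi> \<bullet> x)) * u x - exp (- \<i> * complex_of_real (\<eta> \<bullet> x)) * u x))"
      by (intro integrable_norm Bochner_Integration.integrable_diff i)
    show "integrable lborel (\<lambda>x. \<rho> * norm (\<xi> - \<eta>) * cmod (u x))" using L12_D(2)[OF uL] by simp
    show "AE x in lborel. cmod (exp (- \<i> * complex_of_real (\<xi> \<bullet> x)) * u x - exp (- \<i> * complex_of_real (\<eta> \<bullet> x)) * u x) \<le> \<rho> * norm (\<xi> - \<eta>) * cmod (u x)"
      using z
    proof eventually_elim
      case (elim x)
      show ?case
      proof (cases "x \<in> D")
        case True
        have "\<bar>\<xi> \<bullet> x - \<eta> \<bullet> x\<bar> \<le> norm (\<xi> - \<eta>) * norm x"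
          unfolding inner_diff_left[symmetric] by (rule Cauchy_Schwarz_ineq2)
        also have "\<dots> \<le> norm (\<xi> - \<eta>) * \<rho>" using True D(2) by (intro mult_left_mono) auto
        finally have "cmod (exp (- \<i> * complex_of_real (\<xi> \<bullet> x)) - exp (- \<i> * complex_of_real (\<eta> \<bullet> x))) \<le> \<rho> * norm (\<xi> - \<eta>)"
          using cmod_exp_i_diff[of "\<xi> \<bullet> x" "\<eta> \<bullet> x"] by (simp add: mult.commute)
        then show ?thesis
          unfolding left_diff_distrib[symmetric] norm_mult by (rule mult_right_mono) simp
      qed (use elim in simp)
    qed
  qed
  finally show ?thesis by simp
qed

text \<open>The transform at the complex frequency \<xi> + z b. The factor \<open>restr D u\<close>
  instead of \<open>u\<close> keeps the growing exponential bounded at every point, and not only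
  almost everywhere.\<close>

definition Fourier_line :: "'a::euclidean_space set \<Rightarrow> ('a \<Rightarrow> complex) \<Rightarrow> 'a \<Rightarrow> 'a \<Rightarrow> complex \<Rightarrow> complex" where
  "Fourier_line D u \<xi> b z = (\<integral>x. exp (- \<i> * complex_of_real (\<xi> \<bullet> x)) * (exp (- \<i> * z * complex_of_real (x \<bullet> b)) * restr D u x) \<partial>lborel)"

lemma Fourier_line_real:
  fixes u :: "'a::euclidean_space \<Rightarrow> complex"
  assumes "u \<in> L2_on D" "open D"
  shows "Fourier_line D u \<xi> b (complex_of_real t) = Fourier u (\<xi> + t *\<^sub>R b)"
proof -
  have [measurable]: "u \<in> borel_measurable borel" "D \<in> sets borel" using assms by (auto simp: L2_on_def L2_def)
  have z: "AE x in lborel. x \<notin> D \<longrightarrow> u x = 0" using assms by (simp add: L2_on_def)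
  show ?thesis unfolding Fourier_line_def Fourier_def
  proof (rule integral_cong_AE)
    show "AE x in lborel. exp (- \<i> * complex_of_real (\<xi> \<bullet> x)) * (exp (- \<i> * complex_of_real t * complex_of_real (x \<bullet> b)) * restr D u x)
       = exp (- \<i> * complex_of_real ((\<xi> + t *\<^sub>R b) \<bullet> x)) * u x"
      using z
    proof eventually_elim
      case (elim x)
      have "exp (- \<i> * complex_of_real ((\<xi> + t *\<^sub>R b) \<bullet> x)) = exp (- \<i> * complex_of_real (\<xi> \<bullet> x)) * exp (- \<i> * complex_of_real t * complex_of_real (x \<bullet> b))"
        unfolding exp_add[symmetric] by (simp add: inner_add_left inner_commute algebra_simps)
      then show ?case using elim by (cases "x \<in> D") (simp_all add: restr_def)
    qed
  qed (unfold restr_def, measurable)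
qed

text \<open>The easy half of the Paley-Wiener theorem. The growth bound depends on \<open>u\<close>
  only through its norm, as needed for a normal family.\<close>

lemma Fourier_line_entire:
  fixes u :: "'a::euclidean_space \<Rightarrow> complex"
  assumes u: "u \<in> L2_on D" and D: "open D" "D \<subseteq> cball 0 \<rho>" and \<rho>: "0 \<le> \<rho>" and b: "norm b = 1"
  shows "Fourier_line D u \<xi> b holomorphic_on UNIV"
    and "cmod (Fourier_line D u \<xi> b z) \<le> exp (\<rho> * cmod z) * (sqrt (measure lborel D) * L2_norm u)"
proof -
  have [measurable]: "u \<in> borel_measurable borel" "D \<in> sets borel" using u D by (auto simp: L2_on_def L2_def)
  have bD: "bounded D" using D(2) bounded_cball bounded_subset by blast
  have uL: "u \<in> L12" by (rule L2_on_imp_L12(1)[OF u bD D(1)])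
  have iu: "integrable lborel (\<lambda>x. cmod (u x))" using L12_D(2)[OF uL] by simp
  have ptw: "cmod (exp (- \<i> * complex_of_real (\<xi> \<bullet> x)) * (exp (- \<i> * z * complex_of_real (x \<bullet> b)) * restr D u x)) \<le> exp (\<rho> * r) * cmod (u x)"
    if "cmod z \<le> r" for z x r
  proof (cases "x \<in> D")
    case True
    have "\<bar>x \<bullet> b\<bar> \<le> \<rho>" using Cauchy_Schwarz_ineq2[of x b] b True D(2) by auto
    then have "\<bar>Im z * (x \<bullet> b)\<bar> \<le> r * \<rho>"
      unfolding abs_mult using abs_Im_le_cmod[of z] that norm_ge_zero[of z] by (intro mult_mono) linarith+
    then have "Im z * (x \<bullet> b) \<le> \<rho> * r" by (simp add: abs_le_iff mult.commute)
    then have "exp (Im z * (x \<bullet> b)) * cmod (u x) \<le> exp (\<rho> * r) * cmod (u x)" by (intro mult_right_mono) auto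
    then show ?thesis using True by (simp add: norm_mult norm_exp_eq_Re restr_def)
  qed (simp add: restr_def)
  have "Fourier_line D u \<xi> b holomorphic_on ball 0 r" for r
    unfolding Fourier_line_def
  proof (rule holomorphic_on_parametric_integral)
    show "integrable lborel (\<lambda>x. exp (\<rho> * r) * cmod (u x))" using iu by simp
    show "(\<lambda>x. exp (- \<i> * complex_of_real (\<xi> \<bullet> x)) * (exp (- \<i> * z * complex_of_real (x \<bullet> b)) * restr D u x)) \<in> borel_measurable lborel" for z
      unfolding restr_def by measurable
    show "cmod (exp (- \<i> * complex_of_real (\<xi> \<bullet> x)) * (exp (- \<i> * z * complex_of_real (x \<bullet> b)) * restr D u x)) \<le> exp (\<rho> * r) * cmod (u x)"
      if "z \<in> ball 0 r" for z x by (rule ptw) (use that in auto)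
  qed (auto intro!: holomorphic_intros)
  then have "Fourier_line D u \<xi> b holomorphic_on (\<Union>r. ball 0 r)" by (intro holomorphic_on_UN_open) auto
  moreover have "(\<Union>r. ball 0 r) = (UNIV :: complex set)"   proof (rule UNIV_eq_I[symmetric])
    fix z :: complex show "z \<in> (\<Union>r. ball 0 r)" by (rule UN_I[of "cmod z + 1"]) auto
  qed
  ultimately show "Fourier_line D u \<xi> b holomorphic_on UNIV" by simp
  have "cmod (Fourier_line D u \<xi> b z) \<le> (\<integral>x. exp (\<rho> * cmod z) * cmod (u x) \<partial>lborel)"
    unfolding Fourier_line_def
  proof (rule order_trans[OF integral_norm_bound integral_mono_AE])
    have "integrable lborel (\<lambda>x. exp (- \<i> * complex_of_real (\<xi> \<bullet> x)) * (exp (- \<i> * z * complex_of_real (x \<bullet> b)) * restr D u x))"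
      by (rule integrable_dominated[of _ "\<lambda>x. exp (\<rho> * cmod z) * cmod (u x)"], use iu in simp, unfold restr_def, measurable)
         (use ptw[of z "cmod z"] in \<open>simp add: restr_def\<close>)
    then show "integrable lborel (\<lambda>x. cmod (exp (- \<i> * complex_of_real (\<xi> \<bullet> x)) * (exp (- \<i> * z * complex_of_real (x \<bullet> b)) * restr D u x)))"
      by (rule integrable_norm)
    show "integrable lborel (\<lambda>x. exp (\<rho> * cmod z) * cmod (u x))" using iu by simp
  qed (intro AE_I2 ptw order_refl)
  also have "\<dots> = exp (\<rho> * cmod z) * (\<integral>x. cmod (u x) \<partial>lborel)" by simp
  also have "\<dots> \<le> exp (\<rho> * cmod z) * (sqrt (measure lborel D) * L2_norm u)"
    by (intro mult_left_mono L2_on_imp_L12(2)[OF u bD D(1)]) simp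
  finally show "cmod (Fourier_line D u \<xi> b z) \<le> exp (\<rho> * cmod z) * (sqrt (measure lborel D) * L2_norm u)" .
qed

subsection \<open>The lower bound\<close>

text \<open>The form of \<open>- \<Delta> (\<sigma> - \<Delta>)\<^sup>-\<^sup>1\<close>.\<close>

definition resolvent_form :: "real \<Rightarrow> ('a::euclidean_space \<Rightarrow> complex) \<Rightarrow> real" where
  "resolvent_form \<sigma> u = (\<integral>\<xi>. (norm \<xi>)\<^sup>2 / ((norm \<xi>)\<^sup>2 + \<sigma>) * (cmod (Fourier u \<xi>))\<^sup>2 \<partial>lborel) / (2 * pi) ^ DIM('a)"

lemma resolvent_weight: "0 < \<sigma> \<Longrightarrow> 0 \<le> (norm \<xi>)\<^sup>2 / ((norm \<xi>)\<^sup>2 + \<sigma>)" "0 < \<sigma> \<Longrightarrow> (norm \<xi>)\<^sup>2 / ((norm \<xi>)\<^sup>2 + \<sigma>) \<le> 1"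
proof -
  assume "0 < \<sigma>"
  then have "0 < (norm \<xi>)\<^sup>2 + \<sigma>" by (intro add_nonneg_pos) auto
  then show "0 \<le> (norm \<xi>)\<^sup>2 / ((norm \<xi>)\<^sup>2 + \<sigma>)" "(norm \<xi>)\<^sup>2 / ((norm \<xi>)\<^sup>2 + \<sigma>) \<le> 1"
    using \<open>0 < \<sigma>\<close> by (simp_all add: pos_divide_le_eq)
qed

lemma resolvent_form_integrable:
  assumes "u \<in> L12" "0 < \<sigma>"
  shows "integrable lborel (\<lambda>\<xi>. (norm \<xi>)\<^sup>2 / ((norm \<xi>)\<^sup>2 + \<sigma>) * (cmod (Fourier u \<xi>))\<^sup>2)"
proof (rule integrable_dominated)
  note [measurable] = L12_D(1)[OF assms(1)]
  show "integrable lborel (\<lambda>\<xi>. (cmod (Fourier u \<xi>))\<^sup>2)" by (rule integrable_Fourier_sq(1)[OF assms(1)])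
  show "(\<lambda>\<xi>. (norm \<xi>)\<^sup>2 / ((norm \<xi>)\<^sup>2 + \<sigma>) * (cmod (Fourier u \<xi>))\<^sup>2) \<in> borel_measurable lborel" by measurable
  show "norm ((norm \<xi>)\<^sup>2 / ((norm \<xi>)\<^sup>2 + \<sigma>) * (cmod (Fourier u \<xi>))\<^sup>2) \<le> (cmod (Fourier u \<xi>))\<^sup>2" for \<xi>
  proof -
    have "0 \<le> (norm \<xi>)\<^sup>2 / ((norm \<xi>)\<^sup>2 + \<sigma>) * (cmod (Fourier u \<xi>))\<^sup>2" by (intro mult_nonneg_nonneg resolvent_weight assms zero_le_power2)
    moreover have "(norm \<xi>)\<^sup>2 / ((norm \<xi>)\<^sup>2 + \<sigma>) * (cmod (Fourier u \<xi>))\<^sup>2 \<le> (cmod (Fourier u \<xi>))\<^sup>2"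
      by (intro mult_left_le_one_le resolvent_weight assms zero_le_power2)
    ultimately show ?thesis unfolding real_norm_def by (simp only: abs_of_nonneg)
  qed
qed

lemma resolvent_form_bounds:
  fixes u :: "'a::euclidean_space \<Rightarrow> complex"
  assumes "u \<in> L12" "0 < \<sigma>"
  shows "0 \<le> resolvent_form \<sigma> u" "resolvent_form \<sigma> u \<le> (L2_norm u)\<^sup>2"
proof -
  have "0 \<le> (\<integral>\<xi>. (norm \<xi>)\<^sup>2 / ((norm \<xi>)\<^sup>2 + \<sigma>) * (cmod (Fourier u \<xi>))\<^sup>2 \<partial>lborel)"
    by (rule integral_nonneg_AE, rule AE_I2, rule mult_nonneg_nonneg) (auto intro: resolvent_weight assms)
  then show "0 \<le> resolvent_form \<sigma> u" by (simp add: resolvent_form_def)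
  have "(\<integral>\<xi>. (norm \<xi>)\<^sup>2 / ((norm \<xi>)\<^sup>2 + \<sigma>) * (cmod (Fourier u \<xi>))\<^sup>2 \<partial>lborel) \<le> (\<integral>\<xi>. (cmod (Fourier u \<xi>))\<^sup>2 \<partial>lborel)"
    by (rule integral_mono_AE[OF resolvent_form_integrable[OF assms] integrable_Fourier_sq(1)[OF assms(1)]])
       (intro AE_I2 mult_left_le_one_le resolvent_weight assms zero_le_power2)
  also have "\<dots> = (2 * pi) ^ DIM('a) * (L2_norm u)\<^sup>2" unfolding Plancherel[OF assms(1)] L2_norm_sq ..
  finally show "resolvent_form \<sigma> u \<le> (L2_norm u)\<^sup>2"
    unfolding resolvent_form_def by (simp add: pos_divide_le_eq mult.commute)
qed

definition resolvent_symbol :: "real \<Rightarrow> real \<Rightarrow> ('a::euclidean_space \<Rightarrow> complex) \<Rightarrow> 'a \<Rightarrow> complex" where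
  "resolvent_symbol \<sigma> R u \<xi> = indicator (ball 0 R) \<xi> * of_real (\<sigma> / (\<sigma> + (norm \<xi>)\<^sup>2)) * Fourier u \<xi>"

text \<open>A low-pass filtered version of \<open>\<sigma> (\<sigma> - \<Delta>)\<^sup>-\<^sup>1 u\<close>, the minimiser in the variational formula
  for \<open>resolvent_form\<close>; the cut-off keeps the symbol integrable.\<close>

definition resolvent :: "real \<Rightarrow> real \<Rightarrow> ('a::euclidean_space \<Rightarrow> complex) \<Rightarrow> 'a \<Rightarrow> complex" where
  "resolvent \<sigma> R u = inverse_Fourier (resolvent_symbol \<sigma> R u)"

text \<open>The transform is bounded and square integrable; a bounded multiplier with bounded
  support makes the product integrable as well.\<close>

lemma cutoff_L12:
  fixes u :: "'a::euclidean_space \<Rightarrow> complex"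
  assumes u: "u \<in> L12" and [measurable]: "h \<in> borel_measurable borel"
    and K: "\<And>\<xi>. \<xi> \<in> ball 0 R \<Longrightarrow> cmod (h \<xi>) \<le> K"
  shows "(\<lambda>\<xi>. indicator (ball 0 R) \<xi> * h \<xi> * Fourier u \<xi>) \<in> L12"
proof -
  note [measurable] = L12_D(1)[OF u]
  have bm [measurable]: "ball (0::'a) R \<in> sets borel" by simp
  define U where "U = (\<integral>x. cmod (u x) \<partial>lborel)"
  have K': "cmod (indicator (ball 0 R) \<xi> * h \<xi>) \<le> \<bar>K\<bar> * indicator (ball 0 R) \<xi>" for \<xi>
    using K[of \<xi>] by (auto simp: norm_mult split: split_indicator)
  have meas: "(\<lambda>\<xi>. indicator (ball 0 R) \<xi> * h \<xi> * Fourier u \<xi>) \<in> borel_measurable lborel" by measurable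
  have i1: "integrable lborel (\<lambda>\<xi>. indicator (ball 0 R) \<xi> * h \<xi> * Fourier u \<xi>)"
  proof (rule integrable_dominated[OF _ meas])
    have "integrable lborel (indicator (ball (0::'a) R) :: 'a \<Rightarrow> real)" by (rule integrable_indicator_bounded) auto
    then show "integrable lborel (\<lambda>\<xi>::'a. \<bar>K\<bar> * indicator (ball 0 R) \<xi> * U)" by simp
    show "norm (indicator (ball 0 R) \<xi> * h \<xi> * Fourier u \<xi>) \<le> \<bar>K\<bar> * indicator (ball 0 R) \<xi> * U" for \<xi>
      unfolding norm_mult[of _ "Fourier u \<xi>"] U_def by (intro mult_mono K' norm_Fourier_le) auto
  qed
  have i2: "integrable lborel (\<lambda>\<xi>. (cmod (indicator (ball 0 R) \<xi> * h \<xi> * Fourier u \<xi>))\<^sup>2)"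
  proof (rule integrable_dominated)
    show "integrable lborel (\<lambda>\<xi>. K\<^sup>2 * (cmod (Fourier u \<xi>))\<^sup>2)" using integrable_Fourier_sq(1)[OF u] by simp
    show "(\<lambda>\<xi>. (cmod (indicator (ball 0 R) \<xi> * h \<xi> * Fourier u \<xi>))\<^sup>2) \<in> borel_measurable lborel" by measurable
    show "norm ((cmod (indicator (ball 0 R) \<xi> * h \<xi> * Fourier u \<xi>))\<^sup>2) \<le> K\<^sup>2 * (cmod (Fourier u \<xi>))\<^sup>2" for \<xi>
    proof -
      have "cmod (indicator (ball 0 R) \<xi> * h \<xi>) \<le> \<bar>K\<bar>" using K'[of \<xi>] by (auto split: split_indicator_asm intro: order_trans)
      then have "(cmod (indicator (ball 0 R) \<xi> * h \<xi>))\<^sup>2 \<le> \<bar>K\<bar>\<^sup>2" by (rule power_mono) simp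
      then have "(cmod (indicator (ball 0 R) \<xi> * h \<xi>))\<^sup>2 * (cmod (Fourier u \<xi>))\<^sup>2 \<le> K\<^sup>2 * (cmod (Fourier u \<xi>))\<^sup>2"
        by (intro mult_right_mono) auto
      then show ?thesis by (simp add: norm_mult power_mult_distrib)
    qed
  qed
  show ?thesis using i1 i2 meas by (simp add: L12_def L2_def)
qed

lemma symbol_bound: "0 < \<sigma> \<Longrightarrow> \<bar>\<sigma> / (\<sigma> + (norm \<xi>)\<^sup>2)\<bar> \<le> 1"
proof -
  assume s: "0 < \<sigma>"
  then have "0 < \<sigma> + (norm \<xi>)\<^sup>2" by (intro add_pos_nonneg) auto
  then show ?thesis using s by (simp add: abs_of_pos pos_divide_le_eq)
qed

lemma resolvent_symbol_L12:
  assumes "u \<in> L12" "0 < \<sigma>"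
  shows "resolvent_symbol \<sigma> R u \<in> L12"
  unfolding resolvent_symbol_def[abs_def]
  by (rule cutoff_L12[OF assms(1), of _ _ 1]) (measurable, use symbol_bound[OF assms(2)] in \<open>simp only: norm_of_real\<close>)

lemma resolvent_symbol_grad_L12:
  fixes u :: "'a::euclidean_space \<Rightarrow> complex"
  assumes u: "u \<in> L12" and \<sigma>: "0 < \<sigma>" and b: "b \<in> Basis"
  shows "(\<lambda>\<xi>. \<i> * of_real (\<xi> \<bullet> b) * resolvent_symbol \<sigma> R u \<xi>) \<in> L12"
proof -
  have eq: "\<i> * of_real (\<xi> \<bullet> b) * resolvent_symbol \<sigma> R u \<xi>
    = indicator (ball 0 R) \<xi> * (\<i> * of_real (\<xi> \<bullet> b) * of_real (\<sigma> / (\<sigma> + (norm \<xi>)\<^sup>2))) * Fourier u \<xi>" for \<xi>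
    by (simp add: resolvent_symbol_def)
  show ?thesis unfolding eq
  proof (rule cutoff_L12[OF u, of _ _ R])
    show "cmod (\<i> * of_real (\<xi> \<bullet> b) * of_real (\<sigma> / (\<sigma> + (norm \<xi>)\<^sup>2))) \<le> R" if "\<xi> \<in> ball 0 R" for \<xi>
    proof -
      have "\<bar>\<xi> \<bullet> b\<bar> * \<bar>\<sigma> / (\<sigma> + (norm \<xi>)\<^sup>2)\<bar> \<le> R * 1"
        using Basis_le_norm[OF b, of \<xi>] that symbol_bound[OF \<sigma>, of \<xi>] by (intro mult_mono) auto
      then show ?thesis unfolding norm_mult norm_of_real by simp
    qed
  qed measurable
qed

lemma resolvent_H1:
  assumes "u \<in> L12" "0 < \<sigma>"
  shows "resolvent \<sigma> R u \<in> H1"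
    and "weak_gradient (resolvent \<sigma> R u) (\<lambda>b. inverse_Fourier (\<lambda>\<xi>. \<i> * of_real (\<xi> \<bullet> b) * resolvent_symbol \<sigma> R u \<xi>))"
proof -
  show wg: "weak_gradient (resolvent \<sigma> R u) (\<lambda>b. inverse_Fourier (\<lambda>\<xi>. \<i> * of_real (\<xi> \<bullet> b) * resolvent_symbol \<sigma> R u \<xi>))"
    unfolding resolvent_def
    by (rule weak_gradient_inverse_Fourier[OF resolvent_symbol_L12[OF assms] resolvent_symbol_grad_L12[OF assms]])
  show "resolvent \<sigma> R u \<in> H1"
    by (rule H1_I[OF _ wg]) (simp only: resolvent_def inverse_Fourier_L2(1)[OF resolvent_symbol_L12[OF assms]])
qed

lemma Re_ip_le:
  assumes "v \<in> L2" "D \<in> sets borel"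
  shows "Re (ip D v v) \<le> (\<integral>x. (cmod (v x))\<^sup>2 \<partial>lborel)"
  unfolding Re_ip
proof (rule integral_mono_AE)
  show "integrable lborel (\<lambda>x. (cmod (restr D v x))\<^sup>2)" "integrable lborel (\<lambda>x. (cmod (v x))\<^sup>2)"
    using restr_L2[OF assms] assms(1) by (auto simp: L2_def)
qed (auto simp: restr_def split: split_indicator)

text \<open>Equality would hold for the whole space. Passing to \<open>D\<close> discards the energy
  of the resolvent outside \<open>D\<close>.\<close>

lemma resolvent_energy_le:
  fixes u :: "'a::euclidean_space \<Rightarrow> complex"
  assumes u: "u \<in> L12" and \<sigma>: "0 < \<sigma>" and D: "D \<in> sets borel"
  shows "(2 * pi) ^ DIM('a) * Re (energy D (resolvent \<sigma> R u) (resolvent \<sigma> R u))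
    \<le> (\<integral>\<xi>. (norm \<xi>)\<^sup>2 * (cmod (resolvent_symbol \<sigma> R u \<xi>))\<^sup>2 \<partial>lborel)"
    and "integrable lborel (\<lambda>\<xi>. (norm \<xi>)\<^sup>2 * (cmod (resolvent_symbol \<sigma> R u \<xi>))\<^sup>2)"
proof -
  let ?v = "resolvent \<sigma> R u" and ?w = "resolvent_symbol \<sigma> R u"
  let ?g = "\<lambda>b \<xi>. \<i> * of_real (\<xi> \<bullet> b) * ?w \<xi>"
  let ?C = "(2 * pi) ^ DIM('a)"
  have eqb: "(cmod (?g b \<xi>))\<^sup>2 = (\<xi> \<bullet> b)\<^sup>2 * (cmod (?w \<xi>))\<^sup>2" for b \<xi>
    by (simp add: norm_mult power_mult_distrib)
  have ib: "integrable lborel (\<lambda>\<xi>. (\<xi> \<bullet> b)\<^sup>2 * (cmod (?w \<xi>))\<^sup>2)" if "b \<in> Basis" for b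
    using L12_D(3)[OF resolvent_symbol_grad_L12[OF u \<sigma> that, of R]] unfolding eqb .
  have nrm: "(norm \<xi>)\<^sup>2 * (cmod (?w \<xi>))\<^sup>2 = (\<Sum>b\<in>Basis. (\<xi> \<bullet> b)\<^sup>2 * (cmod (?w \<xi>))\<^sup>2)" for \<xi> :: 'a
    unfolding sum_distrib_right[symmetric] power2_norm_eq_inner by (subst euclidean_inner) (simp add: power2_eq_square)
  show "integrable lborel (\<lambda>\<xi>. (norm \<xi>)\<^sup>2 * (cmod (?w \<xi>))\<^sup>2)"
    unfolding nrm by (intro Bochner_Integration.integrable_sum ib)
  have each: "?C * Re (ip D (grad ?v b) (grad ?v b)) \<le> (\<integral>\<xi>. (\<xi> \<bullet> b)\<^sup>2 * (cmod (?w \<xi>))\<^sup>2 \<partial>lborel)" if b: "b \<in> Basis" for b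
  proof -
    note gL = resolvent_symbol_grad_L12[OF u \<sigma> b, of R]
    have vH: "?v \<in> H1" by (rule resolvent_H1(1)[OF u \<sigma>])
    have "AE x in lborel. x \<in> UNIV \<longrightarrow> grad ?v b x = inverse_Fourier (?g b) x"
      by (rule grad_AE[OF H1_D(1)[OF vH] resolvent_H1(2)[OF u \<sigma>] b vH]) auto
    then have ae: "AE x in lborel. (cmod (grad ?v b x))\<^sup>2 = (cmod (inverse_Fourier (?g b) x))\<^sup>2" by auto
    have "Re (ip D (grad ?v b) (grad ?v b)) \<le> (\<integral>x. (cmod (grad ?v b x))\<^sup>2 \<partial>lborel)"
      by (rule Re_ip_le[OF H1_D(3)[OF vH b] D])
    also have "\<dots> = (\<integral>x. (cmod (inverse_Fourier (?g b) x))\<^sup>2 \<partial>lborel)"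
      using H1_D(3)[OF vH b] inverse_Fourier_L2(1)[OF gL] by (intro integral_cong_AE ae) (auto simp: L2_def)
    finally have "?C * Re (ip D (grad ?v b) (grad ?v b)) \<le> ?C * (\<integral>x. (cmod (inverse_Fourier (?g b) x))\<^sup>2 \<partial>lborel)"
      by (rule mult_left_mono) simp
    then show ?thesis unfolding inverse_Fourier_L2(2)[OF gL] eqb .
  qed
  have "?C * Re (energy D ?v ?v) = (\<Sum>b\<in>Basis. ?C * Re (ip D (grad ?v b) (grad ?v b)))"
    unfolding energy_def Re_sum sum_distrib_left ..
  also have "\<dots> \<le> (\<Sum>b\<in>Basis. (\<integral>\<xi>. (\<xi> \<bullet> b)\<^sup>2 * (cmod (?w \<xi>))\<^sup>2 \<partial>lborel))" by (rule sum_mono[OF each])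
  also have "\<dots> = (\<integral>\<xi>. (norm \<xi>)\<^sup>2 * (cmod (?w \<xi>))\<^sup>2 \<partial>lborel)"
    unfolding nrm by (rule Bochner_Integration.integral_sum[symmetric, OF ib])
  finally show "?C * Re (energy D ?v ?v) \<le> (\<integral>\<xi>. (norm \<xi>)\<^sup>2 * (cmod (?w \<xi>))\<^sup>2 \<partial>lborel)" .
qed

lemma ip_complement_split:
  assumes "v \<in> L2" "D \<in> sets borel"
  shows "Re (ip D v v) + Re (ip (- D) v v) = (\<integral>x. (cmod (v x))\<^sup>2 \<partial>lborel)"
proof -
  have D': "- D \<in> sets borel" using assms(2) by auto
  have i: "integrable lborel (\<lambda>x. (cmod (restr D v x))\<^sup>2)" "integrable lborel (\<lambda>x. (cmod (restr (- D) v x))\<^sup>2)"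
    using restr_L2[OF assms] restr_L2[OF assms(1) D'] by (auto simp: L2_def)
  have "(cmod (v x))\<^sup>2 = (cmod (restr D v x))\<^sup>2 + (cmod (restr (- D) v x))\<^sup>2" for x
    by (auto simp: restr_def split: split_indicator)
  then show ?thesis unfolding Re_ip using i by simp
qed

text \<open>With x = |\<xi>|^2, the minimum of x m^2 + \<sigma> (1 - m)^2 over m is \<sigma> x / (x
  + \<sigma>), attained at the symbol m = \<sigma> / (\<sigma> + x). Beyond the cut-off the symbol
  is 0 and the cost is \<sigma>, which exceeds the minimum by the factor 1 + \<sigma> / x \<le> 1 +
  \<sigma> / R^2.\<close>

lemma resolvent_symbol_pointwise:
  assumes \<sigma>: "0 < \<sigma>" and R: "0 < R"
  shows "(norm \<xi>)\<^sup>2 * (cmod (resolvent_symbol \<sigma> R u \<xi>))\<^sup>2 + \<sigma> * (cmod (Fourier u \<xi> - resolvent_symbol \<sigma> R u \<xi>))\<^sup>2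
    \<le> \<sigma> * (1 + \<sigma> / R\<^sup>2) * ((norm \<xi>)\<^sup>2 / ((norm \<xi>)\<^sup>2 + \<sigma>) * (cmod (Fourier u \<xi>))\<^sup>2)"
proof -
  define x where "x = (norm \<xi>)\<^sup>2"
  define f where "f = (cmod (Fourier u \<xi>))\<^sup>2"
  have x: "0 \<le> x" and f: "0 \<le> f" by (simp_all add: x_def f_def)
  have p: "0 < x + \<sigma>" "0 < \<sigma> + x" using x \<sigma> by auto
  have r: "0 \<le> \<sigma> / R\<^sup>2" using \<sigma> by simp
  show ?thesis
  proof (cases "\<xi> \<in> ball 0 R")
    case True
    define m where "m = \<sigma> / (\<sigma> + x)"
    have w: "resolvent_symbol \<sigma> R u \<xi> = of_real m * Fourier u \<xi>" using True by (simp add: resolvent_symbol_def m_def x_def)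
    have w2: "Fourier u \<xi> - of_real m * Fourier u \<xi> = of_real (1 - m) * Fourier u \<xi>" by (simp add: algebra_simps)
    have "x * (cmod (of_real m * Fourier u \<xi>))\<^sup>2 + \<sigma> * (cmod (of_real (1 - m) * Fourier u \<xi>))\<^sup>2 = (x * m\<^sup>2 + \<sigma> * (1 - m)\<^sup>2) * f"
      unfolding norm_mult norm_of_real power_mult_distrib power2_abs f_def by (simp add: algebra_simps)
    also have "x * m\<^sup>2 + \<sigma> * (1 - m)\<^sup>2 = \<sigma> * (x / (x + \<sigma>))"
    proof -
      have m1: "1 - m = x / (\<sigma> + x)" using p by (simp add: m_def field_simps)
      have "x * m\<^sup>2 + \<sigma> * (1 - m)\<^sup>2 = \<sigma> * x * (\<sigma> + x) / (\<sigma> + x)\<^sup>2"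
        unfolding m1 unfolding m_def power_divide by (simp add: add_divide_distrib[symmetric] power2_eq_square algebra_simps)
      also have "\<dots> = \<sigma> * (x / (x + \<sigma>))" using p by (simp add: power2_eq_square add.commute)
      finally show ?thesis .
    qed
    also have "\<sigma> * (x / (x + \<sigma>)) * f \<le> \<sigma> * (1 + \<sigma> / R\<^sup>2) * (x / (x + \<sigma>) * f)"
    proof -
      have "1 * (\<sigma> * (x / (x + \<sigma>)) * f) \<le> (1 + \<sigma> / R\<^sup>2) * (\<sigma> * (x / (x + \<sigma>)) * f)"
        using r \<sigma> x f p by (intro mult_right_mono mult_nonneg_nonneg divide_nonneg_nonneg) auto
      then show ?thesis by (simp add: mult_ac)
    qed
    finally show ?thesis unfolding w w2 x_def[symmetric] f_def[symmetric] .
  next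
    case False
    then have w: "resolvent_symbol \<sigma> R u \<xi> = 0" by (simp add: resolvent_symbol_def)
    have "R \<le> norm \<xi>" using False by simp
    then have xR: "R\<^sup>2 \<le> x" unfolding x_def using R by (intro power_mono) auto
    have R2: "0 < R\<^sup>2" using R by simp
    have "1 \<le> (1 + \<sigma> / R\<^sup>2) * (x / (x + \<sigma>))"
    proof -
      have "\<sigma> * R\<^sup>2 \<le> \<sigma> * x" using xR \<sigma> by (intro mult_left_mono) auto
      then have "\<sigma> \<le> \<sigma> / R\<^sup>2 * x" using R2 by (simp add: pos_le_divide_eq)
      then have "x + \<sigma> \<le> (1 + \<sigma> / R\<^sup>2) * x" by (simp add: distrib_right)
      then show ?thesis using p by (simp add: pos_le_divide_eq)
    qed
    then have "1 * (\<sigma> * f) \<le> (1 + \<sigma> / R\<^sup>2) * (x / (x + \<sigma>)) * (\<sigma> * f)" using \<sigma> f by (intro mult_right_mono) auto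
    then show ?thesis unfolding w x_def[symmetric] f_def by (simp add: mult_ac)
  qed
qed

text \<open>The pointwise bound is integrated and carried back by Plancherel. As \<open>u\<close>
  vanishes outside \<open>D\<close>, the squared distance there is the mass of \<open>v\<close>;
  this term is kept, because the case of equality hinges on it.\<close>

lemma resolvent_variational_bound:
  fixes u :: "'a::euclidean_space \<Rightarrow> complex"
  assumes u: "u \<in> L12" "u \<in> L2_on D" and \<sigma>: "0 < \<sigma>" and R: "0 < R" and D: "D \<in> sets borel"
  defines "v \<equiv> resolvent \<sigma> R u"
  shows "Re (energy D v v) + \<sigma> * Re (ip D (\<lambda>x. u x - v x) (\<lambda>x. u x - v x)) + \<sigma> * Re (ip (- D) v v)
    \<le> \<sigma> * (1 + \<sigma> / R\<^sup>2) * resolvent_form \<sigma> u"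
proof -
  let ?C = "(2 * pi) ^ DIM('a)"
  let ?w = "resolvent_symbol \<sigma> R u"
  have C: "0 < ?C" by simp
  note wL = resolvent_symbol_L12[OF u(1) \<sigma>, of R]
  have vL: "v \<in> L2" unfolding v_def by (rule H1_D(1)[OF resolvent_H1(1)[OF u(1) \<sigma>]])
  have dL: "(\<lambda>x. u x - v x) \<in> L2" using L2_lin[OF vL L12_D(4)[OF u(1)], of "-1"] by simp
  have D': "- D \<in> sets borel" using D by auto
  have z: "AE x in lborel. x \<notin> D \<longrightarrow> u x = 0" using u(2) by (simp add: L2_on_def)
  have "Re (ip (- D) (\<lambda>x. u x - v x) (\<lambda>x. u x - v x)) = Re (ip (- D) v v)"
    unfolding Re_ip
  proof (rule integral_cong_AE)
    show "(\<lambda>x. (cmod (restr (- D) (\<lambda>x. u x - v x) x))\<^sup>2) \<in> borel_measurable lborel"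
      "(\<lambda>x. (cmod (restr (- D) v x))\<^sup>2) \<in> borel_measurable lborel"
      using restr_L2[OF dL D'] restr_L2[OF vL D'] by (auto simp: L2_def)
    show "AE x in lborel. (cmod (restr (- D) (\<lambda>x. u x - v x) x))\<^sup>2 = (cmod (restr (- D) v x))\<^sup>2"
      using z by eventually_elim (auto simp: restr_def split: split_indicator)
  qed
  with ip_complement_split[OF dL D]
  have split: "Re (ip D (\<lambda>x. u x - v x) (\<lambda>x. u x - v x)) + Re (ip (- D) v v) = (\<integral>x. (cmod (u x - v x))\<^sup>2 \<partial>lborel)" by simp
  have dist: "?C * (\<integral>x. (cmod (u x - v x))\<^sup>2 \<partial>lborel) = (\<integral>\<xi>. (cmod (Fourier u \<xi> - ?w \<xi>))\<^sup>2 \<partial>lborel)"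
    unfolding v_def resolvent_def by (rule L2_dist_inverse_Fourier[OF u(1) wL])
  have iE: "integrable lborel (\<lambda>\<xi>. (norm \<xi>)\<^sup>2 * (cmod (?w \<xi>))\<^sup>2)" by (rule resolvent_energy_le(2)[OF u(1) \<sigma> D])
  have iD: "integrable lborel (\<lambda>\<xi>. \<sigma> * (cmod (Fourier u \<xi> - ?w \<xi>))\<^sup>2)"
    using L2_lin[OF L12_D(4)[OF wL] Fourier_L2[OF u(1)], of "-1"] by (simp add: L2_def)
  have "?C * (Re (energy D v v) + \<sigma> * Re (ip D (\<lambda>x. u x - v x) (\<lambda>x. u x - v x)) + \<sigma> * Re (ip (- D) v v))
     = ?C * Re (energy D v v) + \<sigma> * (?C * (\<integral>x. (cmod (u x - v x))\<^sup>2 \<partial>lborel))"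
    unfolding split[symmetric] by (simp add: algebra_simps)
  also have "\<dots> \<le> (\<integral>\<xi>. (norm \<xi>)\<^sup>2 * (cmod (?w \<xi>))\<^sup>2 \<partial>lborel) + (\<integral>\<xi>. \<sigma> * (cmod (Fourier u \<xi> - ?w \<xi>))\<^sup>2 \<partial>lborel)"
    unfolding dist using resolvent_energy_le(1)[OF u(1) \<sigma> D, of R] by (simp add: v_def)
  also have "\<dots> = (\<integral>\<xi>. (norm \<xi>)\<^sup>2 * (cmod (?w \<xi>))\<^sup>2 + \<sigma> * (cmod (Fourier u \<xi> - ?w \<xi>))\<^sup>2 \<partial>lborel)"
    by (rule Bochner_Integration.integral_add[OF iE iD, symmetric])
  also have "\<dots> \<le> (\<integral>\<xi>. \<sigma> * (1 + \<sigma> / R\<^sup>2) * ((norm \<xi>)\<^sup>2 / ((norm \<xi>)\<^sup>2 + \<sigma>) * (cmod (Fourier u \<xi>))\<^sup>2) \<partial>lborel)"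
    by (rule integral_mono_AE[OF Bochner_Integration.integrable_add[OF iE iD] integrable_mult_right[OF resolvent_form_integrable[OF u(1) \<sigma>]]])
       (intro AE_I2 resolvent_symbol_pointwise[OF \<sigma> R])
  also have "\<dots> = ?C * (\<sigma> * (1 + \<sigma> / R\<^sup>2) * resolvent_form \<sigma> u)"
    unfolding resolvent_form_def by (simp only: integral_mult_right_zero) (use C in simp)
  finally show ?thesis by (rule mult_left_le_imp_le[OF _ C])
qed

section \<open>Integration over the resolvent parameter\<close>

context Bernstein_representation
begin

lemma sigma_finite_M: "sigma_finite_measure M"
proof
  have fin: "emeasure M ({0<..<real n}) \<noteq> \<infinity>" and sets: "{0<..<real n} \<in> sets M" for n
  proof -
    show s: "{0<..<real n} \<in> sets M" unfolding sets_M by (auto simp: sets_restrict_space_iff)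
    have "integrable M (indicator {0<..<real n} :: real \<Rightarrow> real)"
    proof (rule integrable_M_bound)
      show "norm (indicator {0<..<real n} x :: real) \<le> (1 + real n) / (1 + x)" if "0 < x" for x :: real
        using that by (auto simp: divide_simps split: split_indicator)
    qed (rule measurable_M, measurable)
    then show "emeasure M {0<..<real n} \<noteq> \<infinity>" using s by (simp add: integrable_indicator_iff less_top Int_absorb2 sets.sets_into_space)
  qed
  have "(\<Union>n. {0<..<real n}) = {0<..}"
    using reals_Archimedean2 by auto
  then show "\<exists>A. countable A \<and> A \<subseteq> sets M \<and> \<Union> A = space M \<and> (\<forall>a\<in>A. emeasure M a \<noteq> \<infinity>)"
    using fin sets by (intro exI[of _ "range (\<lambda>n. {0<..<real n})"]) (auto simp: space_M)
qed

lemma resolvent_form_measurable: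
  fixes u :: "'a::euclidean_space \<Rightarrow> complex"
  assumes [measurable]: "u \<in> borel_measurable borel"
  shows "(\<lambda>\<sigma>. resolvent_form \<sigma> u) \<in> borel_measurable M"
proof (rule measurable_M)
  show "(\<lambda>\<sigma>. resolvent_form \<sigma> u) \<in> borel_measurable borel"
    unfolding resolvent_form_def by measurable
qed

text \<open>The representation of \<psi> is inserted and Tonelli's theorem exchanges the integrals.
  Everything stays in \<open>ennreal\<close>, since each side may be infinite.\<close>

lemma psi_form_decomposition:
  fixes D :: "'a::euclidean_space set"
  assumes uD: "u \<in> L2_on D" and D: "open D" "bounded D" and u1: "L2_norm u = 1"
  shows "psi_form \<psi> D u = ennreal c\<^sub>1 * (ennreal (1 / (2 * pi) ^ DIM('a)) * (\<integral>\<^sup>+\<xi>. ennreal ((norm \<xi>)\<^sup>2 * (cmod (Fourier u \<xi>))\<^sup>2) \<partial>lborel))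
    + ennreal c\<^sub>0 + ennreal (1 / pi) * (\<integral>\<^sup>+\<sigma>. ennreal (resolvent_form \<sigma> u) \<partial>M)"
proof -
  interpret M: sigma_finite_measure M by (rule sigma_finite_M)
  interpret P: pair_sigma_finite "lborel :: 'a measure" M ..
  have uL: "u \<in> L12" by (rule L2_on_imp_L12(1)[OF uD D(2,1)])
  note [measurable] = L12_D(1)[OF uL]
  let ?C = "(2 * pi) ^ DIM('a)" and ?F = "\<lambda>\<xi>. (cmod (Fourier u \<xi>))\<^sup>2"
  have snd_meas [measurable]: "(\<lambda>p :: 'a \<times> real. snd p) \<in> borel_measurable (lborel \<Otimes>\<^sub>M M)"
    by (rule measurable_compose[OF measurable_snd measurable_M]) simp
  have pair_meas [measurable]: "(\<lambda>(\<xi> :: 'a, \<sigma>). ennreal ((norm \<xi>)\<^sup>2 / ((norm \<xi>)\<^sup>2 + \<sigma>) * ?F \<xi>)) \<in> borel_measurable (lborel \<Otimes>\<^sub>M M)"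
    unfolding case_prod_beta by measurable
  have inner_meas [measurable]: "(\<lambda>\<xi>. \<integral>\<^sup>+\<sigma>. ennreal ((norm \<xi>)\<^sup>2 / ((norm \<xi>)\<^sup>2 + \<sigma>) * ?F \<xi>) \<partial>M) \<in> borel_measurable lborel"
    using M.borel_measurable_nn_integral_fst[OF pair_meas] by simp
  have ptw: "ennreal (\<psi> ((norm \<xi>)\<^sup>2) * ?F \<xi>) = ennreal c\<^sub>1 * ennreal ((norm \<xi>)\<^sup>2 * ?F \<xi>) + ennreal c\<^sub>0 * ennreal (?F \<xi>)
     + ennreal (1 / pi) * (\<integral>\<^sup>+\<sigma>. ennreal ((norm \<xi>)\<^sup>2 / ((norm \<xi>)\<^sup>2 + \<sigma>) * ?F \<xi>) \<partial>M)" for \<xi>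
  proof -
    have i: "integrable M (\<lambda>s. (norm \<xi>)\<^sup>2 / ((norm \<xi>)\<^sup>2 + s) * ?F \<xi>)" by (intro integrable_mult_left integrable_M0) simp
    have nn: "AE s in M. 0 \<le> (norm \<xi>)\<^sup>2 / ((norm \<xi>)\<^sup>2 + s) * ?F \<xi>"
      by (intro AE_I2 mult_nonneg_nonneg resolvent_weight M_pos) auto
    have "(\<integral>\<^sup>+\<sigma>. ennreal ((norm \<xi>)\<^sup>2 / ((norm \<xi>)\<^sup>2 + \<sigma>) * ?F \<xi>) \<partial>M) = ennreal (\<integral>s. (norm \<xi>)\<^sup>2 / ((norm \<xi>)\<^sup>2 + s) * ?F \<xi> \<partial>M)"
      by (rule nn_integral_eq_integral[OF i nn])
    also have "(\<integral>s. (norm \<xi>)\<^sup>2 / ((norm \<xi>)\<^sup>2 + s) * ?F \<xi> \<partial>M) = (\<integral>s. (norm \<xi>)\<^sup>2 / ((norm \<xi>)\<^sup>2 + s) \<partial>M) * ?F \<xi>" by (rule integral_mult_left_zero)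
    finally have e: "(\<integral>\<^sup>+\<sigma>. ennreal ((norm \<xi>)\<^sup>2 / ((norm \<xi>)\<^sup>2 + \<sigma>) * ?F \<xi>) \<partial>M) = ennreal ((\<integral>s. (norm \<xi>)\<^sup>2 / ((norm \<xi>)\<^sup>2 + s) \<partial>M) * ?F \<xi>)" .
    have I0: "0 \<le> (\<integral>s. (norm \<xi>)\<^sup>2 / ((norm \<xi>)\<^sup>2 + s) \<partial>M)"
      by (rule integral_nonneg_AE, intro AE_I2 resolvent_weight M_pos)
    have "\<psi> ((norm \<xi>)\<^sup>2) * ?F \<xi> = c\<^sub>1 * ((norm \<xi>)\<^sup>2 * ?F \<xi>) + c\<^sub>0 * ?F \<xi> + 1 / pi * ((\<integral>s. (norm \<xi>)\<^sup>2 / ((norm \<xi>)\<^sup>2 + s) \<partial>M) * ?F \<xi>)"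
      by (subst \<psi>_eq) (simp_all add: algebra_simps)
    then show ?thesis
      unfolding e using c0 c1 I0
      by (simp only: ennreal_plus ennreal_mult mult_nonneg_nonneg add_nonneg_nonneg zero_le_power2 divide_nonneg_nonneg pi_ge_zero zero_le_one)
  qed
  have F1: "ennreal (1 / ?C) * (\<integral>\<^sup>+\<xi>. ennreal (?F \<xi>) \<partial>lborel) = 1"
    unfolding nn_integral_sq_eq[OF Fourier_L2[OF uL]] Plancherel[OF uL] L2_norm_sq[symmetric] u1
    by (subst ennreal_mult[symmetric]) auto
  have "(\<integral>\<^sup>+\<xi>. (\<integral>\<^sup>+\<sigma>. ennreal ((norm \<xi>)\<^sup>2 / ((norm \<xi>)\<^sup>2 + \<sigma>) * ?F \<xi>) \<partial>M) \<partial>lborel)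
     = (\<integral>\<^sup>+\<sigma>. (\<integral>\<^sup>+\<xi>. ennreal ((norm \<xi>)\<^sup>2 / ((norm \<xi>)\<^sup>2 + \<sigma>) * ?F \<xi>) \<partial>lborel) \<partial>M)"
    using P.Fubini'[OF pair_meas] by simp
  also have "\<dots> = (\<integral>\<^sup>+\<sigma>. ennreal ?C * ennreal (resolvent_form \<sigma> u) \<partial>M)"
  proof (rule nn_integral_cong)
    fix \<sigma> assume "\<sigma> \<in> space M"
    then have \<sigma>: "0 < \<sigma>" by (rule M_pos)
    have "(\<integral>\<^sup>+\<xi>. ennreal ((norm \<xi>)\<^sup>2 / ((norm \<xi>)\<^sup>2 + \<sigma>) * ?F \<xi>) \<partial>lborel) = ennreal (\<integral>\<xi>. (norm \<xi>)\<^sup>2 / ((norm \<xi>)\<^sup>2 + \<sigma>) * ?F \<xi> \<partial>lborel)"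
      by (rule nn_integral_eq_integral[OF resolvent_form_integrable[OF uL \<sigma>]]) (intro AE_I2 mult_nonneg_nonneg resolvent_weight \<sigma> zero_le_power2)
    also have "(\<integral>\<xi>. (norm \<xi>)\<^sup>2 / ((norm \<xi>)\<^sup>2 + \<sigma>) * ?F \<xi> \<partial>lborel) = ?C * resolvent_form \<sigma> u" by (simp add: resolvent_form_def)
    also have "ennreal \<dots> = ennreal ?C * ennreal (resolvent_form \<sigma> u)" by (rule ennreal_mult) (auto intro: resolvent_form_bounds[OF uL \<sigma>])
    finally show "(\<integral>\<^sup>+\<xi>. ennreal ((norm \<xi>)\<^sup>2 / ((norm \<xi>)\<^sup>2 + \<sigma>) * ?F \<xi>) \<partial>lborel) = ennreal ?C * ennreal (resolvent_form \<sigma> u)" .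
  qed
  also have "\<dots> = ennreal ?C * (\<integral>\<^sup>+\<sigma>. ennreal (resolvent_form \<sigma> u) \<partial>M)"
    using resolvent_form_measurable[OF L12_D(1)[OF uL]] by (intro nn_integral_cmult) auto
  finally have fub: "(\<integral>\<^sup>+\<xi>. (\<integral>\<^sup>+\<sigma>. ennreal ((norm \<xi>)\<^sup>2 / ((norm \<xi>)\<^sup>2 + \<sigma>) * ?F \<xi>) \<partial>M) \<partial>lborel) = ennreal ?C * (\<integral>\<^sup>+\<sigma>. ennreal (resolvent_form \<sigma> u) \<partial>M)" .
  have CC: "ennreal (1 / ?C) * ennreal ?C = 1" by (subst ennreal_mult[symmetric]) auto
  have "psi_form \<psi> D u = ennreal (1 / ?C) * (\<integral>\<^sup>+\<xi>. ennreal (\<psi> ((norm \<xi>)\<^sup>2) * ?F \<xi>) \<partial>lborel)"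
    unfolding psi_form_def using uD by simp
  also have "(\<integral>\<^sup>+\<xi>. ennreal (\<psi> ((norm \<xi>)\<^sup>2) * ?F \<xi>) \<partial>lborel)
     = ennreal c\<^sub>1 * (\<integral>\<^sup>+\<xi>. ennreal ((norm \<xi>)\<^sup>2 * ?F \<xi>) \<partial>lborel) + ennreal c\<^sub>0 * (\<integral>\<^sup>+\<xi>. ennreal (?F \<xi>) \<partial>lborel)
       + ennreal (1 / pi) * (ennreal ?C * (\<integral>\<^sup>+\<sigma>. ennreal (resolvent_form \<sigma> u) \<partial>M))"
    unfolding ptw fub[symmetric] by (simp add: nn_integral_add nn_integral_cmult)
  also have "ennreal (1 / ?C) * \<dots> = ennreal c\<^sub>1 * (ennreal (1 / ?C) * (\<integral>\<^sup>+\<xi>. ennreal ((norm \<xi>)\<^sup>2 * ?F \<xi>) \<partial>lborel))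
       + ennreal c\<^sub>0 * (ennreal (1 / ?C) * (\<integral>\<^sup>+\<xi>. ennreal (?F \<xi>) \<partial>lborel))
       + ennreal (1 / pi) * ((ennreal (1 / ?C) * ennreal ?C) * (\<integral>\<^sup>+\<sigma>. ennreal (resolvent_form \<sigma> u) \<partial>M))"
    by (simp only: distrib_left mult_ac)
  finally show ?thesis unfolding F1 CC by simp
qed

text \<open>One \<open>\<epsilon>\<close> is lost to get strictly below the eigenvalue and one to the use of near minimisers.\<close>

definition Neumann_level :: "'a::euclidean_space set \<Rightarrow> nat \<Rightarrow> real \<Rightarrow> real" where
  "Neumann_level D n \<epsilon> = max 0 (Neumann_eigenvalue D n - 2 * \<epsilon>)"

text \<open>The slack in the lower bound at the parameter \<open>\<sigma>\<close>; it dominates the mass of the resolvent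
  outside \<open>D\<close>.\<close>

definition resolvent_excess :: "'a::euclidean_space set \<Rightarrow> nat \<Rightarrow> real \<Rightarrow> ('a \<Rightarrow> complex) \<Rightarrow> real \<Rightarrow> real" where
  "resolvent_excess D n \<epsilon> u \<sigma> = (1 + \<epsilon>) * resolvent_form \<sigma> u - Neumann_level D n \<epsilon> / (Neumann_level D n \<epsilon> + \<sigma>)"

text \<open>The lower limit \<epsilon> on \<sigma> is the one required by the splitting into near
  minimisers. The upper limit makes \<sigma> / R^2 at most \<epsilon> for the cut-off R =
  1/\<epsilon>.\<close>

definition approximate_minimiser :: "'a::euclidean_space set \<Rightarrow> nat \<Rightarrow> real \<Rightarrow> ('a \<Rightarrow> complex) \<Rightarrow> bool" where
  "approximate_minimiser D n \<epsilon> u \<longleftrightarrow> u \<in> L2_on D \<and> L2_norm u = 1 \<and>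
     psi_form \<psi> D u \<le> ennreal (psi_eigenvalue \<psi> D n + \<epsilon>) \<and>
     (\<forall>\<sigma>. \<epsilon> \<le> \<sigma> \<longrightarrow> \<sigma> \<le> 1 / \<epsilon> \<longrightarrow>
       Re (ip (- D) (resolvent \<sigma> (1 / \<epsilon>) u) (resolvent \<sigma> (1 / \<epsilon>) u)) \<le> resolvent_excess D n \<epsilon> u \<sigma>)"

text \<open>A nearly optimal subspace of dimension \<open>n\<close> contains a unit vector
  orthogonal to the fewer than \<open>n\<close> functions of the Neumann splitting. For it the lower
  bound and the variational upper bound are compared, with the resolvent as competitor, and divided
  by \<sigma>.\<close>

lemma approximate_minimiser_exists:
  fixes D :: "'a::euclidean_space set"
  assumes D: "open D" "bounded D" "D \<noteq> {}" and n: "1 \<le> n" and \<epsilon>: "0 < \<epsilon>"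
  shows "\<exists>u. approximate_minimiser D n \<epsilon> u"
proof -
  let ?\<theta> = "Neumann_level D n \<epsilon>"
  let ?J = "INF E\<in>L2_subspaces D n. SUP u\<in>{u \<in> E. L2_norm u = 1}. psi_form \<psi> D u"
  have Db: "D \<in> sets borel" using D by simp
  have J: "?J = ennreal (psi_eigenvalue \<psi> D n)"
    unfolding eigenvalue_def using psi_eigenvalue_upper(1)[OF D n] by simp
  have l0: "0 \<le> psi_eigenvalue \<psi> D n" by (simp add: eigenvalue_def)
  have "?J < ennreal (psi_eigenvalue \<psi> D n + \<epsilon>)" unfolding J using \<epsilon> l0 by (simp add: ennreal_less_iff)
  then obtain E where E: "E \<in> L2_subspaces D n" "(SUP u\<in>{u \<in> E. L2_norm u = 1}. psi_form \<psi> D u) < ennreal (psi_eigenvalue \<psi> D n + \<epsilon>)"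
    unfolding INF_less_iff by blast
  obtain m \<phi> where m: "m < n" and \<phi>: "\<And>i. i < m \<Longrightarrow> \<phi> i \<in> L2"
    and low: "\<And>u v \<sigma>. u \<in> L2 \<Longrightarrow> (\<And>i. i < m \<Longrightarrow> ip D u (\<phi> i) = 0) \<Longrightarrow> v \<in> H1 \<Longrightarrow> \<epsilon> \<le> \<sigma> \<Longrightarrow>
      \<sigma> * ?\<theta> / (?\<theta> + \<sigma>) * Re (ip D u u) \<le> Re (energy D v v) + \<sigma> * Re (ip D (\<lambda>x. u x - v x) (\<lambda>x. u x - v x))"
    by (rule Neumann_resolvent_lower_bound[OF D(1) n \<epsilon> Neumann_level_def]) blast
  obtain u where u: "u \<in> E" "u \<in> L2_on D" "L2_norm u = 1" "\<And>i. i < m \<Longrightarrow> ip D u (\<phi> i) = 0"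
    by (rule subspace_orthogonal_unit_vector[OF D(1) E(1) m \<phi>]) blast+
  have uL: "u \<in> L12" by (rule L2_on_imp_L12(1)[OF u(2) D(2,1)])
  have "psi_form \<psi> D u \<le> (SUP u\<in>{u \<in> E. L2_norm u = 1}. psi_form \<psi> D u)" using u(1,3) by (intro SUP_upper) auto
  then have pf: "psi_form \<psi> D u \<le> ennreal (psi_eigenvalue \<psi> D n + \<epsilon>)" using E(2) by simp
  have ipu: "Re (ip D u u) = 1"
  proof -
    have "Re (ip D u u) = (\<integral>x. (cmod (u x))\<^sup>2 \<partial>lborel)"
      unfolding Re_ip
    proof (rule integral_cong_AE)
      show "(\<lambda>x. (cmod (restr D u x))\<^sup>2) \<in> borel_measurable lborel" "(\<lambda>x. (cmod (u x))\<^sup>2) \<in> borel_measurable lborel"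
        using restr_L2[OF L12_D(4)[OF uL] Db] L12_D(4)[OF uL] by (auto simp: L2_def)
      have "AE x in lborel. x \<notin> D \<longrightarrow> u x = 0" using u(2) by (simp add: L2_on_def)
      then show "AE x in lborel. (cmod (restr D u x))\<^sup>2 = (cmod (u x))\<^sup>2"
        by eventually_elim (auto simp: restr_def split: split_indicator)
    qed
    then show ?thesis using u(3) by (simp add: L2_norm_eq_1)
  qed
  have "Re (ip (- D) (resolvent \<sigma> (1 / \<epsilon>) u) (resolvent \<sigma> (1 / \<epsilon>) u)) \<le> resolvent_excess D n \<epsilon> u \<sigma>"
    if \<sigma>: "\<epsilon> \<le> \<sigma>" "\<sigma> \<le> 1 / \<epsilon>" for \<sigma>
  proof -
    let ?v = "resolvent \<sigma> (1 / \<epsilon>) u"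
    have s0: "0 < \<sigma>" using \<epsilon> \<sigma> by simp
    have R: "0 < 1 / \<epsilon>" using \<epsilon> by simp
    have 1: "\<sigma> * ?\<theta> / (?\<theta> + \<sigma>) * 1 \<le> Re (energy D ?v ?v) + \<sigma> * Re (ip D (\<lambda>x. u x - ?v x) (\<lambda>x. u x - ?v x))"
      unfolding ipu[symmetric] by (rule low[OF L12_D(4)[OF uL] u(4) resolvent_H1(1)[OF uL s0] \<sigma>(1)])
    have 2: "Re (energy D ?v ?v) + \<sigma> * Re (ip D (\<lambda>x. u x - ?v x) (\<lambda>x. u x - ?v x)) + \<sigma> * Re (ip (- D) ?v ?v)
      \<le> \<sigma> * (1 + \<sigma> / (1 / \<epsilon>)\<^sup>2) * resolvent_form \<sigma> u"
      by (rule resolvent_variational_bound[OF uL u(2) s0 R Db])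
    have "\<sigma> * \<epsilon> \<le> 1" using \<sigma>(2) \<epsilon> by (simp add: pos_le_divide_eq)
    then have "\<sigma> * \<epsilon> * \<epsilon> \<le> 1 * \<epsilon>" using \<epsilon> by (intro mult_right_mono) auto
    then have "\<sigma> / (1 / \<epsilon>)\<^sup>2 \<le> \<epsilon>" by (simp add: power_divide power2_eq_square mult.assoc)
    then have 3: "\<sigma> * (1 + \<sigma> / (1 / \<epsilon>)\<^sup>2) * resolvent_form \<sigma> u \<le> \<sigma> * (1 + \<epsilon>) * resolvent_form \<sigma> u"
      using s0 resolvent_form_bounds(1)[OF uL s0] by (intro mult_right_mono mult_left_mono) auto
    have "\<sigma> * (?\<theta> / (?\<theta> + \<sigma>) + Re (ip (- D) ?v ?v)) \<le> \<sigma> * ((1 + \<epsilon>) * resolvent_form \<sigma> u)"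
      using 1 2 3 unfolding distrib_left[of \<sigma> "?\<theta> / (?\<theta> + \<sigma>)"] mult.assoc times_divide_eq_right mult_1_right by linarith
    then show ?thesis unfolding mult_le_cancel_left_pos[OF s0] resolvent_excess_def by simp
  qed
  then show ?thesis unfolding approximate_minimiser_def using u(2,3) pf by blast
qed

lemma Re_ip_nonneg: "0 \<le> Re (ip D v v)"
  unfolding Re_ip by (rule integral_nonneg_AE) simp

text \<open>The inequality for each \<sigma> is integrated over the window; the rest of the measure
  contributes a nonnegative amount and is dropped. The linear part of \<psi> comes from the same
  inequality at \<sigma> = 1/\<epsilon>.\<close>

lemma approximate_minimiser_estimate:
  fixes D :: "'a::euclidean_space set"
  assumes D: "open D" "bounded D" and \<epsilon>: "0 < \<epsilon>" "\<epsilon> \<le> 1" and u: "approximate_minimiser D n \<epsilon> u"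
  defines "\<theta> \<equiv> Neumann_level D n \<epsilon>"
  shows "c\<^sub>1 * (\<theta> / (\<epsilon> * \<theta> + 1)) + c\<^sub>0 + 1 / pi * ((\<integral>\<sigma>. indicator {\<epsilon>..1 / \<epsilon>} \<sigma> * (\<theta> / (\<theta> + \<sigma>)) \<partial>M)
      + (\<integral>\<sigma>. indicator {\<epsilon>..1 / \<epsilon>} \<sigma> * resolvent_excess D n \<epsilon> u \<sigma> \<partial>M)) \<le> (1 + \<epsilon>) * (psi_eigenvalue \<psi> D n + \<epsilon>)" (is ?main)
    and "integrable M (\<lambda>\<sigma>. indicator {\<epsilon>..1 / \<epsilon>} \<sigma> * resolvent_excess D n \<epsilon> u \<sigma>)" (is ?integrable)
    and "\<And>\<sigma>. \<epsilon> \<le> \<sigma> \<Longrightarrow> \<sigma> \<le> 1 / \<epsilon> \<Longrightarrow> 0 \<le> resolvent_excess D n \<epsilon> u \<sigma>"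
proof -
  let ?C = "(2 * pi) ^ DIM('a)" and ?F = "\<lambda>\<xi>. (cmod (Fourier u \<xi>))\<^sup>2"
  let ?I = "indicator {\<epsilon>..1 / \<epsilon>} :: real \<Rightarrow> real"
  have uD: "u \<in> L2_on D" "L2_norm u = 1" and pf: "psi_form \<psi> D u \<le> ennreal (psi_eigenvalue \<psi> D n + \<epsilon>)"
    and ex: "\<And>\<sigma>. \<epsilon> \<le> \<sigma> \<Longrightarrow> \<sigma> \<le> 1 / \<epsilon> \<Longrightarrow> Re (ip (- D) (resolvent \<sigma> (1 / \<epsilon>) u) (resolvent \<sigma> (1 / \<epsilon>) u)) \<le> resolvent_excess D n \<epsilon> u \<sigma>"
    using u by (auto simp: approximate_minimiser_def)
  have uL: "u \<in> L12" by (rule L2_on_imp_L12(1)[OF uD(1) D(2,1)])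
  note [measurable] = L12_D(1)[OF uL]
  have l0: "0 \<le> psi_eigenvalue \<psi> D n" by (simp add: eigenvalue_def)
  have \<theta>0: "0 \<le> \<theta>" by (simp add: \<theta>_def Neumann_level_def)
  show ex0: "\<And>\<sigma>. \<epsilon> \<le> \<sigma> \<Longrightarrow> \<sigma> \<le> 1 / \<epsilon> \<Longrightarrow> 0 \<le> resolvent_excess D n \<epsilon> u \<sigma>"
    using order_trans[OF Re_ip_nonneg ex] .
  have rf: "0 \<le> resolvent_form \<sigma> u" "resolvent_form \<sigma> u \<le> 1" if "0 < \<sigma>" for \<sigma>
    using resolvent_form_bounds[OF uL that] uD(2) by auto
  have rfm: "(\<lambda>\<sigma>. resolvent_form \<sigma> u) \<in> borel_measurable M" by (rule resolvent_form_measurable) measurable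
  have Im: "?I \<in> borel_measurable M" by (rule measurable_M) measurable
  have bnd: "norm (?I \<sigma> * f \<sigma>) \<le> (1 + 1 / \<epsilon>) / (1 + \<sigma>)" if "\<bar>f \<sigma>\<bar> \<le> 1" "0 < \<sigma>" for f :: "real \<Rightarrow> real" and \<sigma>
  proof (cases "\<sigma> \<in> {\<epsilon>..1 / \<epsilon>}")
    case True
    then have "1 \<le> (1 + 1 / \<epsilon>) / (1 + \<sigma>)" using that(2) by (simp add: pos_le_divide_eq)
    then show ?thesis using True that(1) by simp
  qed (use that \<epsilon> in simp)
  have i1: "integrable M (\<lambda>\<sigma>. ?I \<sigma> * resolvent_form \<sigma> u)"
  proof (rule integrable_M_bound)
    show "(\<lambda>\<sigma>. ?I \<sigma> * resolvent_form \<sigma> u) \<in> borel_measurable M" using rfm Im by measurable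
    show "norm (?I \<sigma> * resolvent_form \<sigma> u) \<le> (1 + 1 / \<epsilon>) / (1 + \<sigma>)" if "0 < \<sigma>" for \<sigma>
      by (rule bnd[OF _ that]) (use rf[OF that] in simp)
  qed
  have i2: "integrable M (\<lambda>\<sigma>. ?I \<sigma> * (\<theta> / (\<theta> + \<sigma>)))"
  proof (rule integrable_M_bound)
    have "(\<lambda>\<sigma>. \<theta> / (\<theta> + \<sigma>)) \<in> borel_measurable M" by (rule measurable_M) measurable
    then show "(\<lambda>\<sigma>. ?I \<sigma> * (\<theta> / (\<theta> + \<sigma>))) \<in> borel_measurable M" using Im by measurable
    show "norm (?I \<sigma> * (\<theta> / (\<theta> + \<sigma>))) \<le> (1 + 1 / \<epsilon>) / (1 + \<sigma>)" if "0 < \<sigma>" for \<sigma>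
      by (rule bnd[OF _ that]) (use that \<theta>0 in simp)
  qed
  have eq: "?I \<sigma> * resolvent_excess D n \<epsilon> u \<sigma> = (1 + \<epsilon>) * (?I \<sigma> * resolvent_form \<sigma> u) - ?I \<sigma> * (\<theta> / (\<theta> + \<sigma>))" for \<sigma>
    unfolding resolvent_excess_def \<theta>_def[symmetric] right_diff_distrib by (simp only: mult.left_commute)
  have i1': "integrable M (\<lambda>\<sigma>. (1 + \<epsilon>) * (?I \<sigma> * resolvent_form \<sigma> u))" by (rule integrable_mult_right[OF i1])
  show ?integrable unfolding eq by (rule Bochner_Integration.integrable_diff[OF i1' i2])
  have sum: "(\<integral>\<sigma>. ?I \<sigma> * (\<theta> / (\<theta> + \<sigma>)) \<partial>M) + (\<integral>\<sigma>. ?I \<sigma> * resolvent_excess D n \<epsilon> u \<sigma> \<partial>M) = (1 + \<epsilon>) * (\<integral>\<sigma>. ?I \<sigma> * resolvent_form \<sigma> u \<partial>M)"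
    unfolding eq Bochner_Integration.integral_diff[OF i1' i2] integral_mult_right_zero by simp
  have s: "0 < 1 / \<epsilon>" "\<epsilon> \<le> 1 / \<epsilon>" using \<epsilon> mult_mono[of \<epsilon> 1 \<epsilon> 1] by (auto simp: pos_le_divide_eq)
  \<comment> \<open>For any \<sigma> the weight \<sigma> x / (x + \<sigma>) lies below x and tends
    to it as \<sigma> grows. So the scaled resolvent form replaces the Dirichlet integral, which
    could be infinite.\<close>
  have grad: "ennreal (1 / \<epsilon> * resolvent_form (1 / \<epsilon>) u) \<le> ennreal (1 / ?C) * (\<integral>\<^sup>+\<xi>. ennreal ((norm \<xi>)\<^sup>2 * ?F \<xi>) \<partial>lborel)"
  proof -
    have "ennreal (1 / \<epsilon> * (\<integral>\<xi>. (norm \<xi>)\<^sup>2 / ((norm \<xi>)\<^sup>2 + 1 / \<epsilon>) * ?F \<xi> \<partial>lborel)) = (\<integral>\<^sup>+\<xi>. ennreal (1 / \<epsilon> * ((norm \<xi>)\<^sup>2 / ((norm \<xi>)\<^sup>2 + 1 / \<epsilon>) * ?F \<xi>)) \<partial>lborel)"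
      unfolding integral_mult_right_zero[symmetric]
      by (rule nn_integral_eq_integral[symmetric, OF integrable_mult_right[OF resolvent_form_integrable[OF uL s(1)]]])
         (intro AE_I2 mult_nonneg_nonneg resolvent_weight s(1) zero_le_power2 less_imp_le[OF s(1)])
    also have "\<dots> \<le> (\<integral>\<^sup>+\<xi>. ennreal ((norm \<xi>)\<^sup>2 * ?F \<xi>) \<partial>lborel)"
    proof (intro nn_integral_mono ennreal_leI)
      fix \<xi> :: 'a
      have p: "0 < (norm \<xi>)\<^sup>2 + 1 / \<epsilon>" using s(1) by (intro add_nonneg_pos) auto
      have "1 / \<epsilon> * ((norm \<xi>)\<^sup>2 / ((norm \<xi>)\<^sup>2 + 1 / \<epsilon>)) \<le> (norm \<xi>)\<^sup>2"
        unfolding times_divide_eq_right pos_divide_le_eq[OF p] by (simp add: distrib_left)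
      then have "1 / \<epsilon> * ((norm \<xi>)\<^sup>2 / ((norm \<xi>)\<^sup>2 + 1 / \<epsilon>)) * ?F \<xi> \<le> (norm \<xi>)\<^sup>2 * ?F \<xi>" by (rule mult_right_mono) simp
      then show "1 / \<epsilon> * ((norm \<xi>)\<^sup>2 / ((norm \<xi>)\<^sup>2 + 1 / \<epsilon>) * ?F \<xi>) \<le> (norm \<xi>)\<^sup>2 * ?F \<xi>" by (simp only: mult.assoc)
    qed
    finally have "ennreal (1 / ?C) * ennreal (1 / \<epsilon> * (\<integral>\<xi>. (norm \<xi>)\<^sup>2 / ((norm \<xi>)\<^sup>2 + 1 / \<epsilon>) * ?F \<xi> \<partial>lborel)) \<le> ennreal (1 / ?C) * (\<integral>\<^sup>+\<xi>. ennreal ((norm \<xi>)\<^sup>2 * ?F \<xi>) \<partial>lborel)"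
      by (rule mult_left_mono) simp
    then show ?thesis unfolding resolvent_form_def by (simp add: ennreal_mult'[symmetric] mult_ac)
  qed
  have int: "ennreal (\<integral>\<sigma>. ?I \<sigma> * resolvent_form \<sigma> u \<partial>M) \<le> (\<integral>\<^sup>+\<sigma>. ennreal (resolvent_form \<sigma> u) \<partial>M)"
  proof -
    have "ennreal (\<integral>\<sigma>. ?I \<sigma> * resolvent_form \<sigma> u \<partial>M) = (\<integral>\<^sup>+\<sigma>. ennreal (?I \<sigma> * resolvent_form \<sigma> u) \<partial>M)"
      by (rule nn_integral_eq_integral[symmetric, OF i1]) (intro AE_I2 mult_nonneg_nonneg rf M_pos, auto)
    also have "\<dots> \<le> (\<integral>\<^sup>+\<sigma>. ennreal (resolvent_form \<sigma> u) \<partial>M)"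
      by (intro nn_integral_mono ennreal_leI) (use rf M_pos in \<open>auto split: split_indicator\<close>)
    finally show ?thesis .
  qed
  have I0: "0 \<le> (\<integral>\<sigma>. ?I \<sigma> * resolvent_form \<sigma> u \<partial>M)"
    by (rule integral_nonneg_AE) (intro AE_I2 mult_nonneg_nonneg rf M_pos, auto)
  have "ennreal (c\<^sub>1 * (1 / \<epsilon> * resolvent_form (1 / \<epsilon>) u) + c\<^sub>0 + 1 / pi * (\<integral>\<sigma>. ?I \<sigma> * resolvent_form \<sigma> u \<partial>M))
     = ennreal c\<^sub>1 * ennreal (1 / \<epsilon> * resolvent_form (1 / \<epsilon>) u) + ennreal c\<^sub>0 + ennreal (1 / pi) * ennreal (\<integral>\<sigma>. ?I \<sigma> * resolvent_form \<sigma> u \<partial>M)"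
    using c0 c1 I0 rf(1)[OF s(1)] less_imp_le[OF s(1)]
    by (simp only: ennreal_plus ennreal_mult mult_nonneg_nonneg add_nonneg_nonneg divide_nonneg_nonneg pi_ge_zero zero_le_one)
  also have "\<dots> \<le> psi_form \<psi> D u"
    unfolding psi_form_decomposition[OF uD(1) D uD(2)] by (intro add_mono mult_left_mono grad int) auto
  also note pf
  finally have main: "c\<^sub>1 * (1 / \<epsilon> * resolvent_form (1 / \<epsilon>) u) + c\<^sub>0 + 1 / pi * (\<integral>\<sigma>. ?I \<sigma> * resolvent_form \<sigma> u \<partial>M) \<le> psi_eigenvalue \<psi> D n + \<epsilon>"
    by (subst (asm) ennreal_le_iff) (use l0 \<epsilon> in auto)
  have "\<theta> / (\<epsilon> * \<theta> + 1) \<le> (1 + \<epsilon>) * (1 / \<epsilon> * resolvent_form (1 / \<epsilon>) u)"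
  proof -
    have "\<theta> / (\<theta> + 1 / \<epsilon>) \<le> (1 + \<epsilon>) * resolvent_form (1 / \<epsilon>) u"
      using ex0[OF s(2) order_refl] by (simp add: resolvent_excess_def \<theta>_def)
    then have "1 / \<epsilon> * (\<theta> / (\<theta> + 1 / \<epsilon>)) \<le> 1 / \<epsilon> * ((1 + \<epsilon>) * resolvent_form (1 / \<epsilon>) u)" using s(1) by (intro mult_left_mono) auto
    moreover have "1 / \<epsilon> * (\<theta> / (\<theta> + 1 / \<epsilon>)) = \<theta> / (\<epsilon> * \<theta> + 1)" using \<epsilon> \<theta>0 by (simp add: distrib_left)
    ultimately show ?thesis by (simp only: mult.left_commute)
  qed
  then have 1: "c\<^sub>1 * (\<theta> / (\<epsilon> * \<theta> + 1)) \<le> c\<^sub>1 * ((1 + \<epsilon>) * (1 / \<epsilon> * resolvent_form (1 / \<epsilon>) u))" by (rule mult_left_mono[OF _ c1])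
  have 2: "c\<^sub>0 \<le> (1 + \<epsilon>) * c\<^sub>0" using c0 \<epsilon> by (simp add: distrib_right)
  have 3: "(1 + \<epsilon>) * (c\<^sub>1 * (1 / \<epsilon> * resolvent_form (1 / \<epsilon>) u) + c\<^sub>0 + 1 / pi * (\<integral>\<sigma>. ?I \<sigma> * resolvent_form \<sigma> u \<partial>M)) \<le> (1 + \<epsilon>) * (psi_eigenvalue \<psi> D n + \<epsilon>)"
    using main \<epsilon> by (intro mult_left_mono) auto
  have 4: "c\<^sub>1 * ((1 + \<epsilon>) * r) + (1 + \<epsilon>) * c\<^sub>0 + 1 / pi * ((1 + \<epsilon>) * i) = (1 + \<epsilon>) * (c\<^sub>1 * r + c\<^sub>0 + 1 / pi * i)" for r i :: real
    by (simp only: distrib_left mult.left_commute)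
  show ?main unfolding sum using 1 2 3 unfolding 4[symmetric] by linarith
qed

text \<open>In the limit the estimate leaves the excess integral, which is nonnegative, squeezed
  below the difference of the two sides. Equality of the eigenvalues therefore makes the excess tend
  to 0 in the mean.\<close>

lemma Neumann_lower_limit:
  fixes D :: "'a::euclidean_space set"
  assumes D: "open D" "bounded D" and u: "\<And>k. approximate_minimiser D n (1 / real (Suc k)) (u k)"
  shows "\<psi> (Neumann_eigenvalue D n) \<le> psi_eigenvalue \<psi> D n"
    and "psi_eigenvalue \<psi> D n \<le> \<psi> (Neumann_eigenvalue D n) \<Longrightarrow>
      (\<lambda>k. \<integral>\<sigma>. indicator {1 / real (Suc k)..real (Suc k)} \<sigma> * resolvent_excess D n (1 / real (Suc k)) (u k) \<sigma> \<partial>M) \<longlonglongrightarrow> 0"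
proof -
  let ?\<mu> = "Neumann_eigenvalue D n" and ?l = "psi_eigenvalue \<psi> D n"
  define \<epsilon> where "\<epsilon> k = 1 / real (Suc k)" for k
  define \<theta> where "\<theta> k = Neumann_level D n (\<epsilon> k)" for k
  define a where "a k = (\<integral>\<sigma>. indicator {\<epsilon> k..1 / \<epsilon> k} \<sigma> * (\<theta> k / (\<theta> k + \<sigma>)) \<partial>M)" for k
  define b where "b k = (\<integral>\<sigma>. indicator {\<epsilon> k..1 / \<epsilon> k} \<sigma> * resolvent_excess D n (\<epsilon> k) (u k) \<sigma> \<partial>M)" for k
  have \<epsilon>: "0 < \<epsilon> k" "\<epsilon> k \<le> 1" for k by (auto simp: \<epsilon>_def)
  have \<mu>: "0 \<le> ?\<mu>" by (simp add: eigenvalue_def)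
  have \<epsilon>_lim: "\<epsilon> \<longlonglongrightarrow> 0" unfolding \<epsilon>_def using lim_inverse_n'[THEN LIMSEQ_Suc] by simp
  have "\<theta> \<longlonglongrightarrow> max 0 (?\<mu> - 2 * 0)" unfolding \<theta>_def Neumann_level_def by (intro tendsto_intros \<epsilon>_lim)
  then have \<theta>_lim: "\<theta> \<longlonglongrightarrow> ?\<mu>" using \<mu> by simp
  have \<theta>: "0 \<le> \<theta> k" "\<theta> k \<le> ?\<mu>" for k using \<epsilon>[of k] \<mu> by (auto simp: \<theta>_def Neumann_level_def)
  note est = approximate_minimiser_estimate[OF D \<epsilon> u[folded \<epsilon>_def], folded \<theta>_def]
  have main: "c\<^sub>1 * (\<theta> k / (\<epsilon> k * \<theta> k + 1)) + c\<^sub>0 + 1 / pi * (a k + b k) \<le> (1 + \<epsilon> k) * (?l + \<epsilon> k)" for k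
    unfolding a_def b_def by (rule est(1))
  have b0: "0 \<le> b k" for k
    unfolding b_def by (rule integral_nonneg_AE, rule AE_I2) (use est(3)[of k] in \<open>auto split: split_indicator\<close>)
  \<comment> \<open>The levels lie below the eigenvalue, so monotonicity in the level provides the
    dominating function.\<close>
  have a_lim: "a \<longlonglongrightarrow> (\<integral>\<sigma>. ?\<mu> / (?\<mu> + \<sigma>) \<partial>M)"
    unfolding a_def
  proof (rule integral_dominated_convergence)
    show "integrable M (\<lambda>\<sigma>. ?\<mu> / (?\<mu> + \<sigma>))" by (rule integrable_M0[OF \<mu>])
    show "(\<lambda>\<sigma>. ?\<mu> / (?\<mu> + \<sigma>)) \<in> borel_measurable M" by (rule measurable_M) measurable
    show "(\<lambda>\<sigma>. indicator {\<epsilon> k..1 / \<epsilon> k} \<sigma> * (\<theta> k / (\<theta> k + \<sigma>))) \<in> borel_measurable M" for k by (rule measurable_M) measurable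
    show "AE \<sigma> in M. (\<lambda>k. indicator {\<epsilon> k..1 / \<epsilon> k} \<sigma> * (\<theta> k / (\<theta> k + \<sigma>))) \<longlonglongrightarrow> ?\<mu> / (?\<mu> + \<sigma>)"
    proof (rule AE_I2)
      fix \<sigma> assume "\<sigma> \<in> space M"
      then have \<sigma>: "0 < \<sigma>" by (rule M_pos)
      have "(\<lambda>k. \<theta> k / (\<theta> k + \<sigma>)) \<longlonglongrightarrow> ?\<mu> / (?\<mu> + \<sigma>)" using \<mu> \<sigma> by (intro tendsto_intros \<theta>_lim) auto
      moreover have "\<forall>\<^sub>F k in sequentially. \<theta> k / (\<theta> k + \<sigma>) = indicator {\<epsilon> k..1 / \<epsilon> k} \<sigma> * (\<theta> k / (\<theta> k + \<sigma>))"
      proof -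
        have "\<forall>\<^sub>F k in sequentially. \<epsilon> k < \<sigma>" by (rule order_tendstoD(2)[OF \<epsilon>_lim \<sigma>])
        moreover have "\<forall>\<^sub>F k in sequentially. \<epsilon> k < 1 / \<sigma>"
          by (rule order_tendstoD(2)[OF \<epsilon>_lim]) (use \<sigma> in simp)
        ultimately show ?thesis
          by eventually_elim (use \<epsilon> \<sigma> in \<open>simp add: field_simps\<close>)
      qed
      ultimately show "(\<lambda>k. indicator {\<epsilon> k..1 / \<epsilon> k} \<sigma> * (\<theta> k / (\<theta> k + \<sigma>))) \<longlonglongrightarrow> ?\<mu> / (?\<mu> + \<sigma>)" by (rule Lim_transform_eventually)
    qed
    show "AE \<sigma> in M. norm (indicator {\<epsilon> k..1 / \<epsilon> k} \<sigma> * (\<theta> k / (\<theta> k + \<sigma>))) \<le> ?\<mu> / (?\<mu> + \<sigma>)" for k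
    proof (rule AE_I2)
      fix \<sigma> assume "\<sigma> \<in> space M"
      then have \<sigma>: "0 < \<sigma>" by (rule M_pos)
      have "\<theta> k * \<sigma> \<le> ?\<mu> * \<sigma>" using \<theta> \<sigma> by (intro mult_right_mono) auto
      then have "\<theta> k / (\<theta> k + \<sigma>) \<le> ?\<mu> / (?\<mu> + \<sigma>)" using \<theta>(1)[of k] \<mu> \<sigma> by (simp add: divide_simps algebra_simps)
      moreover have "0 \<le> \<theta> k / (\<theta> k + \<sigma>)" using \<theta>(1)[of k] \<sigma> by simp
      ultimately show "norm (indicator {\<epsilon> k..1 / \<epsilon> k} \<sigma> * (\<theta> k / (\<theta> k + \<sigma>))) \<le> ?\<mu> / (?\<mu> + \<sigma>)"
        using \<mu> \<sigma> unfolding real_norm_def abs_mult by (auto simp del: abs_divide split: split_indicator)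
    qed
  qed
  have "(\<lambda>k. \<theta> k / (\<epsilon> k * \<theta> k + 1)) \<longlonglongrightarrow> ?\<mu> / (0 * ?\<mu> + 1)" by (intro tendsto_intros \<theta>_lim \<epsilon>_lim) simp
  then have t_lim: "(\<lambda>k. \<theta> k / (\<epsilon> k * \<theta> k + 1)) \<longlonglongrightarrow> ?\<mu>" by simp
  have "(\<lambda>k. (1 + \<epsilon> k) * (?l + \<epsilon> k) - c\<^sub>1 * (\<theta> k / (\<epsilon> k * \<theta> k + 1)) - c\<^sub>0 - 1 / pi * a k)
    \<longlonglongrightarrow> (1 + 0) * (?l + 0) - c\<^sub>1 * ?\<mu> - c\<^sub>0 - 1 / pi * (\<integral>\<sigma>. ?\<mu> / (?\<mu> + \<sigma>) \<partial>M)"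
    by (intro tendsto_intros \<epsilon>_lim t_lim a_lim)
  also have "(1 + 0) * (?l + 0) - c\<^sub>1 * ?\<mu> - c\<^sub>0 - 1 / pi * (\<integral>\<sigma>. ?\<mu> / (?\<mu> + \<sigma>) \<partial>M) = ?l - \<psi> ?\<mu>" by (simp add: \<psi>_eq[OF \<mu>])
  finally have lim: "(\<lambda>k. (1 + \<epsilon> k) * (?l + \<epsilon> k) - c\<^sub>1 * (\<theta> k / (\<epsilon> k * \<theta> k + 1)) - c\<^sub>0 - 1 / pi * a k) \<longlonglongrightarrow> ?l - \<psi> ?\<mu>" .
  have bb: "1 / pi * b k \<le> (1 + \<epsilon> k) * (?l + \<epsilon> k) - c\<^sub>1 * (\<theta> k / (\<epsilon> k * \<theta> k + 1)) - c\<^sub>0 - 1 / pi * a k" for k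
    using main[of k] unfolding distrib_left[of "1 / pi"] by linarith
  have b0': "0 \<le> 1 / pi * b k" for k using b0[of k] by simp
  have "0 \<le> ?l - \<psi> ?\<mu>"
    by (rule LIMSEQ_le_const[OF lim]) (use order_trans[OF b0' bb] in blast)
  then show le: "\<psi> ?\<mu> \<le> ?l" by simp
  assume "?l \<le> \<psi> ?\<mu>"
  with le lim have lim0: "(\<lambda>k. (1 + \<epsilon> k) * (?l + \<epsilon> k) - c\<^sub>1 * (\<theta> k / (\<epsilon> k * \<theta> k + 1)) - c\<^sub>0 - 1 / pi * a k) \<longlonglongrightarrow> 0" by simp
  have "(\<lambda>k. 1 / pi * b k) \<longlonglongrightarrow> 0"
    by (rule tendsto_sandwich[OF _ _ tendsto_const lim0]) (intro always_eventually allI b0' bb)+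
  then have "(\<lambda>k. pi * (1 / pi * b k)) \<longlonglongrightarrow> pi * 0" by (intro tendsto_mult tendsto_const)
  then have "b \<longlonglongrightarrow> 0" by simp
  then show "(\<lambda>k. \<integral>\<sigma>. indicator {1 / real (Suc k)..real (Suc k)} \<sigma> * resolvent_excess D n (1 / real (Suc k)) (u k) \<sigma> \<partial>M) \<longlonglongrightarrow> 0"
    unfolding b_def \<epsilon>_def by simp
qed

end

subsection \<open>Strictness of the lower bound\<close>

text \<open>If the transform were small on the whole ball, nearly all mass would lie where \<psi> is
  at least \<open>\<psi> t\<close>, and the form would exceed \<open>l\<close>. This prevents a
  minimising sequence from losing all its frequencies in the limit.\<close>

lemma (in Bernstein_representation) low_frequency_value:
  fixes D :: "'a::euclidean_space set"
  assumes D: "open D" "bounded D" and t: "0 \<le> t" and l: "0 \<le> l" "l < \<psi> t"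
  obtains c where "0 < c" "\<And>u. u \<in> L2_on D \<Longrightarrow> L2_norm u = 1 \<Longrightarrow> psi_form \<psi> D u \<le> ennreal l \<Longrightarrow>
    \<exists>\<xi>\<in>cball 0 (sqrt t). c \<le> cmod (Fourier u \<xi>)"
proof -
  let ?C = "(2 * pi) ^ DIM('a)"
  let ?B = "cball (0::'a) (sqrt t)"
  define V where "V = measure lborel ?B"
  \<comment> \<open>The least fraction of the Fourier mass inside the ball. \<open>c\<close> is
    chosen so that a transform bounded by \<open>c\<close> there carries less than this.\<close>
  define q where "q = 1 - l / \<psi> t"
  define c where "c = sqrt (?C * q / (V + 1))"
  have V: "0 \<le> V" by (simp add: V_def)
  have V1: "0 < V + 1" using V by simp
  have C: "0 < ?C" by simp
  have \<psi>t: "0 < \<psi> t" using l by simp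
  have q: "0 < q" using l \<psi>t by (simp add: q_def)
  have c: "0 < c" unfolding c_def using C q V1 by simp
  have c2: "c\<^sup>2 = ?C * q / (V + 1)" unfolding c_def using C q V1 by simp
  show ?thesis
  proof (rule that[OF c])
    fix u :: "'a \<Rightarrow> complex" assume u: "u \<in> L2_on D" "L2_norm u = 1" and pf: "psi_form \<psi> D u \<le> ennreal l"
    let ?F = "\<lambda>\<xi>. (cmod (Fourier u \<xi>))\<^sup>2"
    have uL: "u \<in> L12" by (rule L2_on_imp_L12(1)[OF u(1) D(2,1)])
    note [measurable] = L12_D(1)[OF uL] \<psi>_measurable
    show "\<exists>\<xi>\<in>?B. c \<le> cmod (Fourier u \<xi>)"
    proof (rule ccontr)
      assume "\<not> (\<exists>\<xi>\<in>?B. c \<le> cmod (Fourier u \<xi>))"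
      then have low: "cmod (Fourier u \<xi>) \<le> c" if "\<xi> \<in> ?B" for \<xi> using that by force
      have ptw: "?F \<xi> \<le> 1 / \<psi> t * (\<psi> ((norm \<xi>)\<^sup>2) * ?F \<xi>) + c\<^sup>2 * indicator ?B \<xi>" for \<xi>
      proof (cases "\<xi> \<in> ?B")
        case True
        then have "?F \<xi> \<le> c\<^sup>2" using low by (intro power_mono) auto
        moreover have "0 \<le> 1 / \<psi> t * (\<psi> ((norm \<xi>)\<^sup>2) * ?F \<xi>)" using \<psi>t \<psi>_nonneg by (intro mult_nonneg_nonneg) auto
        ultimately show ?thesis using True by simp
      next
        case False
        then have "sqrt t \<le> norm \<xi>" by simp
        then have "t \<le> (norm \<xi>)\<^sup>2" by (rule sqrt_le_D)
        then have "\<psi> t \<le> \<psi> ((norm \<xi>)\<^sup>2)" by (rule \<psi>_mono[OF t])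
        then have "\<psi> t * ?F \<xi> \<le> \<psi> ((norm \<xi>)\<^sup>2) * ?F \<xi>" by (rule mult_right_mono) simp
        then show ?thesis using False \<psi>t by (simp add: pos_le_divide_eq mult.commute)
      qed
      have "ennreal ?C = (\<integral>\<^sup>+\<xi>. ennreal (?F \<xi>) \<partial>lborel)"
        unfolding nn_integral_sq_eq[OF Fourier_L2[OF uL]] Plancherel[OF uL] L2_norm_sq[symmetric] u(2) by simp
      also have "\<dots> \<le> (\<integral>\<^sup>+\<xi>. ennreal (1 / \<psi> t) * ennreal (\<psi> ((norm \<xi>)\<^sup>2) * ?F \<xi>) + ennreal (c\<^sup>2) * indicator ?B \<xi> \<partial>lborel)"
      proof (rule nn_integral_mono)
        fix \<xi> :: 'a
        have "ennreal (?F \<xi>) \<le> ennreal (1 / \<psi> t * (\<psi> ((norm \<xi>)\<^sup>2) * ?F \<xi>) + c\<^sup>2 * indicator ?B \<xi>)" by (rule ennreal_leI[OF ptw])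
        also have "\<dots> = ennreal (1 / \<psi> t) * ennreal (\<psi> ((norm \<xi>)\<^sup>2) * ?F \<xi>) + ennreal (c\<^sup>2) * indicator ?B \<xi>"
        proof -
          have "0 \<le> 1 / \<psi> t" "0 \<le> \<psi> ((norm \<xi>)\<^sup>2) * ?F \<xi>" using \<psi>t \<psi>_nonneg by auto
          then show ?thesis
            by (simp only: ennreal_plus ennreal_mult mult_nonneg_nonneg zero_le_power2 indicator_pos_le ennreal_indicator)
        qed
        finally show "ennreal (?F \<xi>) \<le> ennreal (1 / \<psi> t) * ennreal (\<psi> ((norm \<xi>)\<^sup>2) * ?F \<xi>) + ennreal (c\<^sup>2) * indicator ?B \<xi>" .
      qed
      also have "\<dots> = ennreal (1 / \<psi> t) * (\<integral>\<^sup>+\<xi>. ennreal (\<psi> ((norm \<xi>)\<^sup>2) * ?F \<xi>) \<partial>lborel) + ennreal (c\<^sup>2) * emeasure lborel ?B"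
      proof -
        have m: "(\<lambda>\<xi>. ennreal (\<psi> ((norm \<xi>)\<^sup>2) * ?F \<xi>)) \<in> borel_measurable lborel" by measurable
        have B: "?B \<in> sets lborel" by simp
        show ?thesis
          by (subst nn_integral_add) (use m B in \<open>simp_all only: nn_integral_cmult nn_integral_cmult_indicator, measurable\<close>)
      qed
      also have "emeasure lborel ?B = ennreal V"
        unfolding V_def using emeasure_bounded_finite[OF bounded_cball, of "0::'a" "sqrt t"] by (simp add: emeasure_eq_ennreal_measure)
      also have "(\<integral>\<^sup>+\<xi>. ennreal (\<psi> ((norm \<xi>)\<^sup>2) * ?F \<xi>) \<partial>lborel) = ennreal ?C * psi_form \<psi> D u"
      proof -
        have "ennreal ?C * ennreal (1 / ?C) = 1" by (subst ennreal_mult[symmetric]) auto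
        then show ?thesis unfolding psi_form_def using u(1) by (simp add: mult.assoc[symmetric])
      qed
      also have "ennreal (1 / \<psi> t) * (ennreal ?C * psi_form \<psi> D u) + ennreal (c\<^sup>2) * ennreal V
        \<le> ennreal (1 / \<psi> t) * (ennreal ?C * ennreal l) + ennreal (c\<^sup>2) * ennreal V"
        by (intro add_mono mult_left_mono pf) auto
      also have "\<dots> = ennreal (1 / \<psi> t * (?C * l) + c\<^sup>2 * V)"
      proof -
        have "0 \<le> 1 / \<psi> t" "0 \<le> ?C" using \<psi>t by auto
        then show ?thesis using l V by (simp only: ennreal_plus ennreal_mult mult_nonneg_nonneg zero_le_power2)
      qed
      finally have "?C \<le> 1 / \<psi> t * (?C * l) + c\<^sup>2 * V"
        by (subst (asm) ennreal_le_iff) (use \<psi>t l V in auto)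
      moreover have "c\<^sup>2 * V < ?C * q"
      proof -
        have "?C * q * V < ?C * q * (V + 1)" using C q by (simp add: distrib_left)
        then show ?thesis unfolding c2 using V1 by (simp add: pos_divide_less_eq)
      qed
      moreover have "1 / \<psi> t * (?C * l) = ?C - ?C * q" unfolding q_def using \<psi>t by (simp add: right_diff_distrib)
      ultimately show False by simp
    qed
  qed
qed

lemma restr_complement_dist:
  assumes "v \<in> L2"
  shows "(\<integral>x. (cmod (restr D v x - v x))\<^sup>2 \<partial>lborel) = Re (ip (- D) v v)"
  unfolding Re_ip by (rule Bochner_Integration.integral_cong) (auto simp: restr_def split: split_indicator)

text \<open>The symbol is at most 1 in modulus, and neither the cut-off nor the restriction
  increases the norm. So the restricted resolvents form a bounded family in L2(D).\<close>

lemma restr_resolvent_L2_norm_le: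
  fixes u :: "'a::euclidean_space \<Rightarrow> complex"
  assumes u: "u \<in> L12" and \<sigma>: "0 < \<sigma>" and D: "D \<in> sets borel"
  shows "L2_norm (restr D (resolvent \<sigma> R u)) \<le> L2_norm u"
proof -
  let ?C = "(2 * pi) ^ DIM('a)"
  note wL = resolvent_symbol_L12[OF u \<sigma>, of R]
  have vL: "resolvent \<sigma> R u \<in> L2" by (rule H1_D(1)[OF resolvent_H1(1)[OF u \<sigma>]])
  have "?C * (L2_norm (restr D (resolvent \<sigma> R u)))\<^sup>2 \<le> ?C * (\<integral>x. (cmod (resolvent \<sigma> R u x))\<^sup>2 \<partial>lborel)"
    unfolding L2_norm_sq Re_ip[symmetric] by (intro mult_left_mono Re_ip_le vL D) simp
  also have "\<dots> = (\<integral>\<xi>. (cmod (resolvent_symbol \<sigma> R u \<xi>))\<^sup>2 \<partial>lborel)"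
    unfolding resolvent_def by (rule inverse_Fourier_L2(2)[OF wL])
  also have "\<dots> \<le> (\<integral>\<xi>. (cmod (Fourier u \<xi>))\<^sup>2 \<partial>lborel)"
  proof (rule integral_mono_AE[OF L12_D(3)[OF wL] integrable_Fourier_sq(1)[OF u]], intro AE_I2 power_mono)
    fix \<xi> :: 'a
    have "cmod (indicator (ball 0 R) \<xi> * of_real (\<sigma> / (\<sigma> + (norm \<xi>)\<^sup>2))) \<le> 1"
      using symbol_bound[OF \<sigma>, of \<xi>] unfolding norm_mult norm_of_real by (auto split: split_indicator)
    then show "cmod (resolvent_symbol \<sigma> R u \<xi>) \<le> cmod (Fourier u \<xi>)"
      unfolding resolvent_symbol_def norm_mult[of _ "Fourier u \<xi>"] by (rule mult_left_le_one_le[OF norm_ge_zero norm_ge_zero])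
  qed simp
  also have "\<dots> = ?C * (L2_norm u)\<^sup>2" unfolding Plancherel[OF u] L2_norm_sq ..
  finally have "(L2_norm (restr D (resolvent \<sigma> R u)))\<^sup>2 \<le> (L2_norm u)\<^sup>2" by simp
  then show ?thesis by (rule power2_le_imp_le) (simp add: L2_norm_def)
qed

text \<open>The transform of the restricted resolvent differs from its symbol, in L2, by the mass
  outside \<open>D\<close>. A pointwise statement follows because the expression to be bounded is
  Lipschitz near \<eta> with a constant uniform in \<open>u\<close>: a large value at \<eta> would
  persist on a small ball. The cut-off exceeds |\<eta>| + 1, so it is not felt there.\<close>

lemma resolvent_Fourier_close:
  fixes D :: "'a::euclidean_space set" and \<eta> :: 'a
  assumes D: "open D" "D \<subseteq> cball 0 \<rho>" and \<rho>: "0 \<le> \<rho>" and \<sigma>: "0 < \<sigma>" and e: "0 < e"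
  obtains \<kappa> where "0 < \<kappa>" "\<And>u R. u \<in> L2_on D \<Longrightarrow> L2_norm u = 1 \<Longrightarrow> norm \<eta> + 1 \<le> R \<Longrightarrow>
    Re (ip (- D) (resolvent \<sigma> R u) (resolvent \<sigma> R u)) < \<kappa> \<Longrightarrow>
    cmod (of_real (\<sigma> + (norm \<eta>)\<^sup>2) * Fourier (restr D (resolvent \<sigma> R u)) \<eta> - of_real \<sigma> * Fourier u \<eta>) < e"
proof -
  let ?C = "(2 * pi) ^ DIM('a)"
  have Db: "D \<in> sets borel" using D by simp
  have bD: "bounded D" using D(2) bounded_cball bounded_subset by blast
  define S where "S = sqrt (measure lborel D)"
  \<comment> \<open>A Lipschitz bound at \<eta> for the difference \<open>d\<close> on the unit ball
    about \<eta>, from the product rule; \<open>S\<close> bounds the L1 norms.\<close>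
  define L where "L = (2 * norm \<eta> + 1) * S + (\<sigma> + (norm \<eta>)\<^sup>2) * (\<rho> * S) + \<sigma> * (\<rho> * S)"
  define \<delta> where "\<delta> = min 1 (e / (2 * (L + 1)))"
  define K where "K = \<sigma> + (norm \<eta> + 1)\<^sup>2"
  define V where "V = measure lborel (ball \<eta> \<delta>)"
  have S: "0 \<le> S" by (simp add: S_def)
  have L: "0 \<le> L" unfolding L_def using S \<sigma> \<rho> by (intro add_nonneg_nonneg mult_nonneg_nonneg) auto
  have \<delta>: "0 < \<delta>" "\<delta> \<le> 1" "L * \<delta> \<le> e / 2"
  proof -
    show "0 < \<delta>" "\<delta> \<le> 1" using L e by (auto simp: \<delta>_def)
    have "L * \<delta> \<le> (L + 1) * (e / (2 * (L + 1)))" using L \<open>0 < \<delta>\<close> by (intro mult_mono) (auto simp: \<delta>_def)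
    also have "\<dots> = e / 2" using L by (simp add: field_simps)
    finally show "L * \<delta> \<le> e / 2" .
  qed
  have K: "0 < K" using \<sigma> by (simp add: K_def add_pos_nonneg)
  have V: "0 < V" unfolding V_def using \<delta>(1) by (rule content_ball_pos)
  \<comment> \<open>If \<open>d\<close> is at least \<open>e\<close> at \<eta>, it is at least
    \<open>e / 2\<close> on the ball of radius \<open>\<delta>\<close>. Its square integral there
    contradicts an outside mass below this value.\<close>
  define \<kappa> where "\<kappa> = (e / 2)\<^sup>2 * V / (K\<^sup>2 * ?C)"
  have \<kappa>: "0 < \<kappa>" unfolding \<kappa>_def using e V K by (intro divide_pos_pos mult_pos_pos) auto
  show ?thesis
  proof (rule that[OF \<kappa>])
    fix u :: "'a \<Rightarrow> complex" and R
    assume u: "u \<in> L2_on D" "L2_norm u = 1" and R: "norm \<eta> + 1 \<le> R"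
      and small: "Re (ip (- D) (resolvent \<sigma> R u) (resolvent \<sigma> R u)) < \<kappa>"
    let ?v = "resolvent \<sigma> R u" and ?w = "resolvent_symbol \<sigma> R u"
    define f where "f = Fourier (restr D ?v)"
    define d where "d \<xi> = of_real (\<sigma> + (norm \<xi>)\<^sup>2) * f \<xi> - of_real \<sigma> * Fourier u \<xi>" for \<xi>
    have uL: "u \<in> L12" by (rule L2_on_imp_L12(1)[OF u(1) bD D(1)])
    have vL: "?v \<in> L2" by (rule H1_D(1)[OF resolvent_H1(1)[OF uL \<sigma>]])
    have rD: "restr D ?v \<in> L2_on D" by (rule restr_L2_on[OF vL Db])
    have rL: "restr D ?v \<in> L12" by (rule L2_on_imp_L12(1)[OF rD bD D(1)])
    note wL = resolvent_symbol_L12[OF uL \<sigma>, of R]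
    have L1u: "(\<integral>x. cmod (u x) \<partial>lborel) \<le> S" using L2_on_imp_L12(2)[OF u(1) bD D(1)] u(2) by (simp add: S_def)
    have "(\<integral>x. cmod (restr D ?v x) \<partial>lborel) \<le> S * L2_norm (restr D ?v)"
      unfolding S_def by (rule L2_on_imp_L12(2)[OF rD bD D(1)])
    also have "\<dots> \<le> S * 1" using restr_resolvent_L2_norm_le[OF uL \<sigma> Db, of R] u(2) S by (intro mult_left_mono) auto
    finally have L1v: "(\<integral>x. cmod (restr D ?v x) \<partial>lborel) \<le> S" by simp
    have f_le: "cmod (f \<xi>) \<le> S" for \<xi> unfolding f_def by (rule order_trans[OF norm_Fourier_le L1v])
    have f_Lip: "cmod (f \<xi> - f \<eta>) \<le> \<rho> * S * norm (\<xi> - \<eta>)" for \<xi>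
    proof -
      have "cmod (f \<xi> - f \<eta>) \<le> \<rho> * norm (\<xi> - \<eta>) * (\<integral>x. cmod (restr D ?v x) \<partial>lborel)"
        unfolding f_def by (rule Fourier_Lipschitz[OF rD D \<rho>])
      also have "\<dots> \<le> \<rho> * norm (\<xi> - \<eta>) * S" using \<rho> by (intro mult_left_mono L1v) auto
      finally show ?thesis by (simp only: mult_ac)
    qed
    have u_Lip: "cmod (Fourier u \<xi> - Fourier u \<eta>) \<le> \<rho> * S * norm (\<xi> - \<eta>)" for \<xi>
    proof -
      have "cmod (Fourier u \<xi> - Fourier u \<eta>) \<le> \<rho> * norm (\<xi> - \<eta>) * (\<integral>x. cmod (u x) \<partial>lborel)"
        by (rule Fourier_Lipschitz[OF u(1) D \<rho>])
      also have "\<dots> \<le> \<rho> * norm (\<xi> - \<eta>) * S" using \<rho> by (intro mult_left_mono L1u) auto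
      finally show ?thesis by (simp only: mult_ac)
    qed
    have d_Lip: "cmod (d \<xi> - d \<eta>) \<le> L * norm (\<xi> - \<eta>)" if x: "\<xi> \<in> ball \<eta> 1" for \<xi>
    proof -
      have n: "norm (\<xi> - \<eta>) \<le> 1" using x by (simp add: dist_norm norm_minus_commute)
      have nx: "norm \<xi> \<le> norm \<eta> + 1" using norm_triangle_ineq[of "\<xi> - \<eta>" \<eta>] n by simp
      have sq: "\<bar>(norm \<xi>)\<^sup>2 - (norm \<eta>)\<^sup>2\<bar> \<le> (2 * norm \<eta> + 1) * norm (\<xi> - \<eta>)"
      proof -
        have "\<bar>(norm \<xi>)\<^sup>2 - (norm \<eta>)\<^sup>2\<bar> = (norm \<xi> + norm \<eta>) * \<bar>norm \<xi> - norm \<eta>\<bar>"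
          by (simp add: power2_eq_square square_diff_square_factored abs_mult)
        also have "\<dots> \<le> (2 * norm \<eta> + 1) * norm (\<xi> - \<eta>)" using nx norm_triangle_ineq3[of \<xi> \<eta>] by (intro mult_mono) auto
        finally show ?thesis .
      qed
      have "d \<xi> - d \<eta> = of_real ((norm \<xi>)\<^sup>2 - (norm \<eta>)\<^sup>2) * f \<xi> + of_real (\<sigma> + (norm \<eta>)\<^sup>2) * (f \<xi> - f \<eta>) - of_real \<sigma> * (Fourier u \<xi> - Fourier u \<eta>)"
        by (simp add: d_def algebra_simps)
      also have "cmod \<dots> \<le> cmod (of_real ((norm \<xi>)\<^sup>2 - (norm \<eta>)\<^sup>2) * f \<xi>) + cmod (of_real (\<sigma> + (norm \<eta>)\<^sup>2) * (f \<xi> - f \<eta>)) + cmod (of_real \<sigma> * (Fourier u \<xi> - Fourier u \<eta>))"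
        by (intro order_trans[OF norm_triangle_ineq4] add_mono norm_triangle_ineq order_refl)
      also have "\<dots> = \<bar>(norm \<xi>)\<^sup>2 - (norm \<eta>)\<^sup>2\<bar> * cmod (f \<xi>) + \<bar>\<sigma> + (norm \<eta>)\<^sup>2\<bar> * cmod (f \<xi> - f \<eta>) + \<bar>\<sigma>\<bar> * cmod (Fourier u \<xi> - Fourier u \<eta>)"
        by (simp only: norm_mult norm_of_real)
      also have "\<dots> \<le> (2 * norm \<eta> + 1) * norm (\<xi> - \<eta>) * S + (\<sigma> + (norm \<eta>)\<^sup>2) * (\<rho> * S * norm (\<xi> - \<eta>)) + \<sigma> * (\<rho> * S * norm (\<xi> - \<eta>))"
        using \<sigma> S \<rho> by (intro add_mono mult_mono sq f_le f_Lip u_Lip) auto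
      also have "\<dots> = L * norm (\<xi> - \<eta>)" by (simp add: L_def algebra_simps)
      finally show ?thesis .
    qed
    have d_ball: "cmod (d \<xi>) \<le> K * cmod (f \<xi> - ?w \<xi>)" if x: "\<xi> \<in> ball \<eta> 1" for \<xi>
    proof -
      have "norm (\<xi> - \<eta>) < 1" using x by (simp add: dist_norm norm_minus_commute)
      then have nx: "norm \<xi> < norm \<eta> + 1" using norm_triangle_ineq[of "\<xi> - \<eta>" \<eta>] by simp
      then have w: "?w \<xi> = of_real (\<sigma> / (\<sigma> + (norm \<xi>)\<^sup>2)) * Fourier u \<xi>" using R by (simp add: resolvent_symbol_def)
      have p: "0 < \<sigma> + (norm \<xi>)\<^sup>2" using \<sigma> by (simp add: add_pos_nonneg)
      have "of_real (\<sigma> + (norm \<xi>)\<^sup>2) * ?w \<xi> = of_real ((\<sigma> + (norm \<xi>)\<^sup>2) * (\<sigma> / (\<sigma> + (norm \<xi>)\<^sup>2))) * Fourier u \<xi>"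
        unfolding w of_real_mult by (simp only: mult.assoc)
      also have "(\<sigma> + (norm \<xi>)\<^sup>2) * (\<sigma> / (\<sigma> + (norm \<xi>)\<^sup>2)) = \<sigma>" using p by simp
      finally have "d \<xi> = of_real (\<sigma> + (norm \<xi>)\<^sup>2) * (f \<xi> - ?w \<xi>)" by (simp only: d_def right_diff_distrib)
      moreover have "\<sigma> + (norm \<xi>)\<^sup>2 \<le> K" unfolding K_def using nx by (intro add_left_mono power_mono) auto
      ultimately show ?thesis using p by (simp only: norm_mult norm_of_real abs_of_pos mult_right_mono norm_ge_zero)
    qed
    have "cmod (d \<eta>) < e"
    proof (rule ccontr)
      assume "\<not> cmod (d \<eta>) < e"
      then have de: "e \<le> cmod (d \<eta>)" by simp
      have big: "(e / 2)\<^sup>2 * indicator (ball \<eta> \<delta>) \<xi> \<le> K\<^sup>2 * (cmod (f \<xi> - ?w \<xi>))\<^sup>2" for \<xi>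
      proof (cases "\<xi> \<in> ball \<eta> \<delta>")
        case True
        then have x1: "\<xi> \<in> ball \<eta> 1" using \<delta>(2) by auto
        have "L * norm (\<xi> - \<eta>) \<le> L * \<delta>" using True L by (intro mult_left_mono) (auto simp: dist_norm norm_minus_commute)
        then have "cmod (d \<xi> - d \<eta>) \<le> e / 2" using d_Lip[OF x1] \<delta>(3) by linarith
        then have "e / 2 \<le> cmod (d \<xi>)" using de norm_triangle_ineq4[of "d \<xi>" "d \<xi> - d \<eta>"] by simp
        then have "e / 2 \<le> K * cmod (f \<xi> - ?w \<xi>)" using d_ball[OF x1] by linarith
        then have "(e / 2)\<^sup>2 \<le> (K * cmod (f \<xi> - ?w \<xi>))\<^sup>2" using e by (intro power_mono) auto
        then show ?thesis using True by (simp add: power_mult_distrib)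
      qed simp
      have iB: "integrable lborel (indicator (ball \<eta> \<delta>) :: 'a \<Rightarrow> real)" by (rule integrable_indicator_bounded) auto
      have ifw: "integrable lborel (\<lambda>\<xi>. (cmod (f \<xi> - ?w \<xi>))\<^sup>2)"
        using L2_lin[OF L12_D(4)[OF wL] Fourier_L2[OF rL], of "-1"] by (simp add: L2_def f_def)
      have "(e / 2)\<^sup>2 * V = (\<integral>\<xi>. (e / 2)\<^sup>2 * indicator (ball \<eta> \<delta>) \<xi> \<partial>lborel)" by (simp add: V_def)
      also have "\<dots> \<le> (\<integral>\<xi>. K\<^sup>2 * (cmod (f \<xi> - ?w \<xi>))\<^sup>2 \<partial>lborel)"
        by (rule integral_mono_AE[OF integrable_mult_right[OF iB] integrable_mult_right[OF ifw]]) (intro AE_I2 big)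
      also have "\<dots> = K\<^sup>2 * (?C * Re (ip (- D) ?v ?v))"
      proof -
        have "(\<integral>\<xi>. (cmod (f \<xi> - ?w \<xi>))\<^sup>2 \<partial>lborel) = ?C * (\<integral>x. (cmod (restr D ?v x - ?v x))\<^sup>2 \<partial>lborel)"
          unfolding f_def by (subst (2) resolvent_def) (rule L2_dist_inverse_Fourier[OF rL wL, symmetric])
        then show ?thesis unfolding restr_complement_dist[OF vL] by simp
      qed
      also have "\<dots> < K\<^sup>2 * (?C * \<kappa>)" using K small by (intro mult_strict_left_mono) auto
      also have "\<dots> = (e / 2)\<^sup>2 * V" using K by (simp add: \<kappa>_def)
      finally show False by simp
    qed
    then show "cmod (of_real (\<sigma> + (norm \<eta>)\<^sup>2) * Fourier (restr D ?v) \<eta> - of_real \<sigma> * Fourier u \<eta>) < e"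
      by (simp only: d_def f_def)
  qed
qed

lemma Fourier_line_normal_family:
  fixes u :: "nat \<Rightarrow> 'a::euclidean_space \<Rightarrow> complex"
  assumes u: "\<And>k. u k \<in> L2_on D" "\<And>k. L2_norm (u k) \<le> 1" and D: "open D" "D \<subseteq> cball 0 \<rho>" and \<rho>: "0 \<le> \<rho>" and b: "norm b = 1"
  obtains g r where "g holomorphic_on UNIV" "strict_mono (r :: nat \<Rightarrow> nat)"
    "\<And>z. (\<lambda>k. Fourier_line D (u (r k)) \<xi> b z) \<longlonglongrightarrow> g z"
proof -
  let ?F = "\<lambda>k. Fourier_line D (u k) \<xi> b"
  note ent = Fourier_line_entire[OF u(1) D \<rho> b]
  obtain g r where g: "g holomorphic_on UNIV" "strict_mono (r :: nat \<Rightarrow> nat)" "\<And>z. z \<in> UNIV \<Longrightarrow> (\<lambda>k. ?F (r k) z) \<longlonglongrightarrow> g z"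
  proof (rule Montel[of UNIV "range ?F" ?F])
    show "\<exists>B. \<forall>h\<in>range ?F. \<forall>z\<in>K. cmod (h z) \<le> B" if K: "compact K" for K
    proof -
      obtain m where m: "\<And>z. z \<in> K \<Longrightarrow> cmod z \<le> m" using compact_imp_bounded[OF K] unfolding bounded_iff by blast
      have "cmod (?F k z) \<le> exp (\<rho> * m) * (sqrt (measure lborel D) * 1)" if "z \<in> K" for k z
        by (rule order_trans[OF ent(2)]) (use m[OF that] \<rho> u(2)[of k] in \<open>intro mult_mono mult_left_mono; simp add: L2_norm_def mult_left_mono\<close>)
      then show ?thesis by (intro exI[of _ "exp (\<rho> * m) * (sqrt (measure lborel D) * 1)"]) blast
    qed
  qed (use ent(1) in auto)
  show ?thesis by (rule that[OF g(1,2)]) (simp add: g(3))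
qed

text \<open>The quadratic polynomial in \<open>z\<close> is \<sigma> + |\<xi> + z b|^2, continued
  from real \<open>z\<close> as a polynomial. Along a subsequence the transforms of the restricted
  resolvents converge to an entire \<open>g\<close> with polynomial times \<open>g\<close> equal to
  \<sigma> \<Phi> on the real axis, hence everywhere; at a root of the polynomial \<Phi> must
  vanish.\<close>

lemma Fourier_line_limit_zero:
  fixes u :: "nat \<Rightarrow> 'a::euclidean_space \<Rightarrow> complex"
  assumes u: "\<And>k. u k \<in> L2_on D" "\<And>k. L2_norm (u k) = 1" and D: "open D" "D \<subseteq> cball 0 \<rho>" and \<rho>: "0 \<le> \<rho>" and b: "norm b = 1"
    and \<Phi>: "\<Phi> holomorphic_on UNIV" "\<And>z. (\<lambda>k. Fourier_line D (u k) \<xi> b z) \<longlonglongrightarrow> \<Phi> z"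
    and \<sigma>: "0 < \<sigma>" and R: "filterlim R at_top sequentially"
    and small: "(\<lambda>k. Re (ip (- D) (resolvent \<sigma> (R k) (u k)) (resolvent \<sigma> (R k) (u k)))) \<longlonglongrightarrow> 0"
    and z: "of_real (\<sigma> + (norm \<xi>)\<^sup>2) + of_real (2 * (\<xi> \<bullet> b)) * z + z\<^sup>2 = 0"
  shows "\<Phi> z = 0"
proof -
  have Db: "D \<in> sets borel" using D by simp
  have bD: "bounded D" using D(2) bounded_cball bounded_subset by blast
  define v where "v k = restr D (resolvent \<sigma> (R k) (u k))" for k
  have uL: "u k \<in> L12" for k by (rule L2_on_imp_L12(1)[OF u(1) bD D(1)])
  have vD: "v k \<in> L2_on D" for k
    unfolding v_def by (rule restr_L2_on[OF H1_D(1)[OF resolvent_H1(1)[OF uL \<sigma>]] Db])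
  have v1: "L2_norm (v k) \<le> 1" for k
    unfolding v_def using restr_resolvent_L2_norm_le[OF uL[of k] \<sigma> Db] by (simp add: u(2))
  obtain g r where g: "g holomorphic_on UNIV" "strict_mono (r :: nat \<Rightarrow> nat)"
    "\<And>z. (\<lambda>k. Fourier_line D (v (r k)) \<xi> b z) \<longlonglongrightarrow> g z"
    by (rule Fourier_line_normal_family[where u = v and \<xi> = \<xi>, OF vD v1 D \<rho> b]) blast
  have close: "(\<lambda>k. of_real (\<sigma> + (norm \<eta>)\<^sup>2) * Fourier (v k) \<eta> - of_real \<sigma> * Fourier (u k) \<eta>) \<longlonglongrightarrow> 0" for \<eta>
  proof (rule tendstoI)
    fix e :: real assume e: "0 < e"
    obtain \<kappa> where \<kappa>: "0 < \<kappa>" "\<And>u R. u \<in> L2_on D \<Longrightarrow> L2_norm u = 1 \<Longrightarrow> norm \<eta> + 1 \<le> R \<Longrightarrow>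
      Re (ip (- D) (resolvent \<sigma> R u) (resolvent \<sigma> R u)) < \<kappa> \<Longrightarrow>
      cmod (of_real (\<sigma> + (norm \<eta>)\<^sup>2) * Fourier (restr D (resolvent \<sigma> R u)) \<eta> - of_real \<sigma> * Fourier u \<eta>) < e"
      by (rule resolvent_Fourier_close[OF D \<rho> \<sigma> e, of \<eta>]) blast
    have "\<forall>\<^sub>F k in sequentially. norm \<eta> + 1 \<le> R k" using R unfolding filterlim_at_top by blast
    moreover have "\<forall>\<^sub>F k in sequentially. Re (ip (- D) (resolvent \<sigma> (R k) (u k)) (resolvent \<sigma> (R k) (u k))) < \<kappa>"
      by (rule order_tendstoD(2)[OF small \<kappa>(1)])
    ultimately show "\<forall>\<^sub>F k in sequentially. dist (of_real (\<sigma> + (norm \<eta>)\<^sup>2) * Fourier (v k) \<eta> - of_real \<sigma> * Fourier (u k) \<eta>) 0 < e"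
      by eventually_elim (use \<kappa>(2)[OF u] in \<open>simp only: dist_norm diff_0_right v_def\<close>)
  qed
  \<comment> \<open>An entire function that vanishes on the real axis and so is identically
    zero.\<close>
  define h where "h z = (of_real (\<sigma> + (norm \<xi>)\<^sup>2) + of_real (2 * (\<xi> \<bullet> b)) * z + z\<^sup>2) * g z - of_real \<sigma> * \<Phi> z" for z
  have hR: "h (of_real t) = 0" for t
  proof -
    let ?\<eta> = "\<xi> + t *\<^sub>R b"
    have "b \<bullet> b = 1" using b by (simp add: norm_eq_1)
    then have "(norm ?\<eta>)\<^sup>2 = (norm \<xi>)\<^sup>2 + 2 * (\<xi> \<bullet> b) * t + t\<^sup>2"
      unfolding power2_norm_eq_inner by (simp add: inner_add_left inner_add_right inner_commute power2_eq_square algebra_simps)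
    then have n: "complex_of_real (\<sigma> + (norm ?\<eta>)\<^sup>2) = of_real (\<sigma> + (norm \<xi>)\<^sup>2) + of_real (2 * (\<xi> \<bullet> b)) * of_real t + (of_real t)\<^sup>2"
      by simp
    have "(\<lambda>k. of_real (\<sigma> + (norm ?\<eta>)\<^sup>2) * Fourier (v (r k)) ?\<eta> - of_real \<sigma> * Fourier (u (r k)) ?\<eta>) \<longlonglongrightarrow> 0"
      using LIMSEQ_subseq_LIMSEQ[OF close[of ?\<eta>] g(2)] by (simp add: o_def)
    moreover have "(\<lambda>k. of_real (\<sigma> + (norm ?\<eta>)\<^sup>2) * Fourier (v (r k)) ?\<eta> - of_real \<sigma> * Fourier (u (r k)) ?\<eta>)
      \<longlonglongrightarrow> of_real (\<sigma> + (norm ?\<eta>)\<^sup>2) * g (of_real t) - of_real \<sigma> * \<Phi> (of_real t)"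
      unfolding Fourier_line_real[OF vD D(1), symmetric] Fourier_line_real[OF u(1) D(1), symmetric]
      using LIMSEQ_subseq_LIMSEQ[OF \<Phi>(2)[of "of_real t"] g(2)] by (intro tendsto_intros g(3)) (simp add: o_def)
    ultimately have "0 = of_real (\<sigma> + (norm ?\<eta>)\<^sup>2) * g (of_real t) - of_real \<sigma> * \<Phi> (of_real t)" by (rule LIMSEQ_unique)
    then show ?thesis unfolding h_def n[symmetric] by simp
  qed
  have "h z = 0"
  proof (rule analytic_continuation[of h UNIV "range complex_of_real" 0])
    show "h holomorphic_on UNIV" unfolding h_def using g(1) \<Phi>(1) by (intro holomorphic_intros)
    have "(\<lambda>k. complex_of_real (inverse (real (Suc k)))) \<longlonglongrightarrow> complex_of_real 0" by (intro tendsto_of_real LIMSEQ_inverse_real_of_nat)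
    then show "0 islimpt range complex_of_real"
      unfolding islimpt_sequential
      by (intro exI[of _ "\<lambda>k. complex_of_real (inverse (real (Suc k)))"])
         (simp only: of_real_0 of_real_eq_0_iff inverse_nonzero_iff_nonzero Diff_iff rangeI singleton_iff of_nat_eq_0_iff nat.distinct simp_thms)
  qed (use hR in auto)
  then show ?thesis unfolding h_def z using \<sigma> by simp
qed

text \<open>Under equality a single limit function \<Phi> acquires a zero for almost every \<sigma>.
  If \<psi> has no meromorphic extension, these \<sigma> accumulate in (0,\<infinity>), hence so do
  the zeros, and \<Phi> would vanish identically. That \<Phi> does not is where the strict upper
  bound enters.\<close>

lemma (in Bernstein_representation) Neumann_lower_strict:
  fixes D :: "'a::euclidean_space set"
  assumes D: "open D" "bounded D" "D \<noteq> {}" and n: "1 \<le> n" and mero: "\<not> extends_meromorphically \<psi>"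
  shows "\<psi> (Neumann_eigenvalue D n) < psi_eigenvalue \<psi> D n"
proof (rule ccontr)
  let ?l = "psi_eigenvalue \<psi> D n"
  assume "\<not> \<psi> (Neumann_eigenvalue D n) < ?l"
  then have le: "?l \<le> \<psi> (Neumann_eigenvalue D n)" by simp
  define \<epsilon> where "\<epsilon> k = 1 / real (Suc k)" for k
  have \<epsilon>: "0 < \<epsilon> k" "\<epsilon> k \<le> 1" for k by (auto simp: \<epsilon>_def)
  have \<epsilon>_lim: "\<epsilon> \<longlonglongrightarrow> 0" unfolding \<epsilon>_def using lim_inverse_n'[THEN LIMSEQ_Suc] by simp
  obtain \<rho> where \<rho>: "0 \<le> \<rho>" "D \<subseteq> cball 0 \<rho>"
  proof -
    obtain \<rho> where "\<forall>x\<in>D. norm x \<le> \<rho>" using D(2) unfolding bounded_iff by blast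
    then show thesis by (intro that[of "max 0 \<rho>"]) (auto simp: le_max_iff_disj)
  qed
  obtain b :: 'a where b: "b \<in> Basis" using nonempty_Basis by blast
  then have nb: "norm b = 1" by simp
  have nonnull: "\<not> (AE s in M. False)"
  proof
    assume "AE s in M. False"
    then have "extends_meromorphically \<psi>" by (intro extends_meromorphically_if_discrete[of "{}"]) auto
    with mero show False ..
  qed
  define \<tau> where "\<tau> = Dirichlet_eigenvalue D n"
  have \<tau>: "0 < \<tau>" unfolding \<tau>_def by (rule Dirichlet_eigenvalue_pos[OF D n])
  have l\<tau>: "?l < \<psi> \<tau>" unfolding \<tau>_def by (rule psi_eigenvalue_upper(3)[OF D n nonnull])
  have l0: "0 \<le> ?l" by (simp add: eigenvalue_def)
  \<comment> \<open>A level strictly between the eigenvalue and \<psi> at the Dirichlet eigenvalue;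
    the strict upper bound makes room for it.\<close>
  define l where "l = (?l + \<psi> \<tau>) / 2"
  have l: "0 \<le> l" "?l < l" "l < \<psi> \<tau>" using l\<tau> l0 by (auto simp: l_def)
  obtain c where c: "0 < c" "\<And>u. u \<in> L2_on D \<Longrightarrow> L2_norm u = 1 \<Longrightarrow> psi_form \<psi> D u \<le> ennreal l \<Longrightarrow>
    \<exists>\<xi>\<in>cball 0 (sqrt \<tau>). c \<le> cmod (Fourier u \<xi>)"
    by (rule low_frequency_value[OF D(1,2) less_imp_le[OF \<tau>] l(1,3)]) blast
  have "\<forall>k. \<exists>u. approximate_minimiser D n (\<epsilon> k) u" using approximate_minimiser_exists[OF D n \<epsilon>(1)] by blast
  then obtain u where u: "\<And>k. approximate_minimiser D n (\<epsilon> k) (u k)" by metis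
  have uD: "u k \<in> L2_on D" "L2_norm (u k) = 1" for k using u[of k] by (auto simp: approximate_minimiser_def)
  define X where "X k \<sigma> = indicator {\<epsilon> k..1 / \<epsilon> k} \<sigma> * resolvent_excess D n (\<epsilon> k) (u k) \<sigma>" for k \<sigma>
  have X0: "0 \<le> X k \<sigma>" for k \<sigma>
    unfolding X_def using approximate_minimiser_estimate(3)[OF D(1,2) \<epsilon> u] by (auto split: split_indicator)
  have "(\<lambda>k. \<integral>\<sigma>. X k \<sigma> \<partial>M) \<longlonglongrightarrow> 0"
    using Neumann_lower_limit(2)[OF D(1,2) u[unfolded \<epsilon>_def] le] by (simp add: X_def \<epsilon>_def)
  then have "(\<lambda>k. \<integral>\<sigma>. norm (X k \<sigma>) \<partial>M) \<longlonglongrightarrow> 0" using X0 by simp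
  moreover have "integrable M (X k)" for k
    unfolding X_def by (rule approximate_minimiser_estimate(2)[OF D(1,2) \<epsilon> u])
  ultimately obtain r\<^sub>1 where r1: "strict_mono r\<^sub>1" "AE \<sigma> in M. (\<lambda>k. X (r\<^sub>1 k) \<sigma>) \<longlonglongrightarrow> 0"
    using tendsto_L1_AE_subseq[of M X] by blast
  have "\<forall>\<^sub>F k in sequentially. \<epsilon> k < l - ?l" by (rule order_tendstoD(2)[OF \<epsilon>_lim]) (use l in simp)
  then obtain N where N: "\<And>k. N \<le> k \<Longrightarrow> \<epsilon> k < l - ?l" unfolding eventually_sequentially by blast
  \<comment> \<open>The shift brings the form below \<open>l\<close> for every index, so that each
    member has a substantial low frequency.\<close>
  define r\<^sub>2 where "r\<^sub>2 k = r\<^sub>1 (k + N)" for k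
  have r2: "strict_mono r\<^sub>2" using r1(1) by (simp add: r\<^sub>2_def strict_mono_def)
  have "\<exists>\<xi>\<in>cball 0 (sqrt \<tau>). c \<le> cmod (Fourier (u (r\<^sub>2 k)) \<xi>)" for k
  proof (rule c(2)[OF uD])
    have "N \<le> r\<^sub>2 k" using seq_suble[OF r1(1), of "k + N"] by (simp add: r\<^sub>2_def)
    then have "?l + \<epsilon> (r\<^sub>2 k) \<le> l" using N[of "r\<^sub>2 k"] by simp
    then show "psi_form \<psi> D (u (r\<^sub>2 k)) \<le> ennreal l"
      using u[of "r\<^sub>2 k"] order_trans[OF _ ennreal_leI] unfolding approximate_minimiser_def by metis
  qed
  then obtain x where x: "\<And>k. x k \<in> cball 0 (sqrt \<tau>)" "\<And>k. c \<le> cmod (Fourier (u (r\<^sub>2 k)) (x k))" by metis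
  \<comment> \<open>The frequencies vary with the index. Their limit is the base point of the
    complex line, and the uniform Lipschitz bound carries the lower bound \<open>c\<close> over to
    it.\<close>
  obtain \<xi> r\<^sub>3 where r3: "strict_mono r\<^sub>3" "(x \<circ> r\<^sub>3) \<longlonglongrightarrow> \<xi>"
    by (rule seq_compactE[OF compact_imp_seq_compact[OF compact_cball[of "0::'a" "sqrt \<tau>"]], of x]) (use x(1) in blast)+
  obtain \<Phi> r\<^sub>4 where \<Phi>: "\<Phi> holomorphic_on UNIV" "strict_mono r\<^sub>4"
    "\<And>z. (\<lambda>k. Fourier_line D (u (r\<^sub>2 (r\<^sub>3 (r\<^sub>4 k)))) \<xi> b z) \<longlonglongrightarrow> \<Phi> z"
    by (rule Fourier_line_normal_family[where u = "\<lambda>k. u (r\<^sub>2 (r\<^sub>3 k))" and \<xi> = \<xi>, OF uD(1) eq_refl[OF uD(2)] D(1) \<rho>(2,1) nb]) blast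
  define q where "q k = r\<^sub>2 (r\<^sub>3 (r\<^sub>4 k))" for k
  have q: "strict_mono q" unfolding q_def using r2 r3(1) \<Phi>(2) by (simp add: strict_mono_def)
  have \<Phi>q: "(\<lambda>k. Fourier_line D (u (q k)) \<xi> b z) \<longlonglongrightarrow> \<Phi> z" for z unfolding q_def by (rule \<Phi>(3))
  have \<epsilon>q: "(\<lambda>k. \<epsilon> (q k)) \<longlonglongrightarrow> 0" using LIMSEQ_subseq_LIMSEQ[OF \<epsilon>_lim q] by (simp add: o_def)
  have \<Phi>0: "\<Phi> 0 \<noteq> 0"
  proof -
    let ?y = "\<lambda>k. x (r\<^sub>3 (r\<^sub>4 k))"
    let ?S = "sqrt (measure lborel D)"
    have y: "?y \<longlonglongrightarrow> \<xi>" using LIMSEQ_subseq_LIMSEQ[OF r3(2) \<Phi>(2)] by (simp add: o_def)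
    have "(\<lambda>k. c - \<rho> * norm (?y k - \<xi>) * ?S) \<longlonglongrightarrow> c - \<rho> * norm (\<xi> - \<xi>) * ?S" by (intro tendsto_intros y)
    then have lim: "(\<lambda>k. c - \<rho> * norm (?y k - \<xi>) * ?S) \<longlonglongrightarrow> c" by simp
    have "c - \<rho> * norm (?y k - \<xi>) * ?S \<le> cmod (Fourier_line D (u (q k)) \<xi> b 0)" for k
    proof -
      have "cmod (Fourier (u (q k)) (?y k) - Fourier (u (q k)) \<xi>) \<le> \<rho> * norm (?y k - \<xi>) * (\<integral>z. cmod (u (q k) z) \<partial>lborel)"
        by (rule Fourier_Lipschitz[OF uD(1) D(1) \<rho>(2,1)])
      also have "\<dots> \<le> \<rho> * norm (?y k - \<xi>) * ?S"
        using L2_on_imp_L12(2)[OF uD(1) D(2,1), of "q k"] \<rho>(1) by (intro mult_left_mono) (auto simp: uD(2))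
      finally have 1: "cmod (Fourier (u (q k)) (?y k) - Fourier (u (q k)) \<xi>) \<le> \<rho> * norm (?y k - \<xi>) * ?S" .
      have "c \<le> cmod (Fourier (u (q k)) (?y k))" using x(2)[of "r\<^sub>3 (r\<^sub>4 k)"] by (simp add: q_def)
      also have "\<dots> \<le> cmod (Fourier (u (q k)) \<xi>) + cmod (Fourier (u (q k)) (?y k) - Fourier (u (q k)) \<xi>)"
        using norm_triangle_ineq[of "Fourier (u (q k)) \<xi>" "Fourier (u (q k)) (?y k) - Fourier (u (q k)) \<xi>"] by simp
      finally show ?thesis using 1 Fourier_line_real[OF uD(1) D(1), of "q k" \<xi> b 0] by simp
    qed
    then have "c \<le> cmod (\<Phi> 0)" by (intro LIMSEQ_le[OF lim tendsto_norm[OF \<Phi>q]]) blast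
    then show ?thesis using c(1) by auto
  qed
  define T where "T = {\<sigma>. 0 < \<sigma> \<and> (\<lambda>k. X (q k) \<sigma>) \<longlonglongrightarrow> 0}"
  have T_AE: "AE \<sigma> in M. \<sigma> \<in> T"
    using r1(2) AE_space
  proof eventually_elim
    case (elim \<sigma>)
    have "strict_mono (\<lambda>k. r\<^sub>3 (r\<^sub>4 k) + N)" using r3(1) \<Phi>(2) by (simp add: strict_mono_def)
    from LIMSEQ_subseq_LIMSEQ[OF elim(1) this] show ?case using M_pos[OF elim(2)] by (simp add: T_def q_def r\<^sub>2_def o_def)
  qed
  define \<beta> where "\<beta> = \<xi> \<bullet> b"
  \<comment> \<open>The root of z^2 + 2 \<beta> z + \<sigma> + |\<xi>|^2 in the upper half plane.
    The radicand is positive by Cauchy-Schwarz, and the root is an injective continuous function of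
    \<sigma>.\<close>
  define Z where "Z \<sigma> = Complex (- \<beta>) (sqrt (\<sigma> + (norm \<xi>)\<^sup>2 - \<beta>\<^sup>2))" for \<sigma>
  have \<beta>: "\<beta>\<^sup>2 \<le> (norm \<xi>)\<^sup>2"
    using Cauchy_Schwarz_ineq2[of \<xi> b] nb unfolding \<beta>_def by (intro power2_le_iff_abs_le[THEN iffD2]) auto
  have zero: "\<Phi> (Z \<sigma>) = 0" if "\<sigma> \<in> T" for \<sigma>
  proof -
    have \<sigma>: "0 < \<sigma>" and X: "(\<lambda>k. X (q k) \<sigma>) \<longlonglongrightarrow> 0" using that by (auto simp: T_def)
    show ?thesis
    proof (rule Fourier_line_limit_zero[where u = "\<lambda>k. u (q k)" and R = "\<lambda>k. 1 / \<epsilon> (q k)", OF uD D(1) \<rho>(2,1) nb \<Phi>(1) \<Phi>q \<sigma>])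
      show "filterlim (\<lambda>k. 1 / \<epsilon> (q k)) at_top sequentially"
      proof -
        have "filterlim (\<lambda>k. real (Suc (q k))) at_top sequentially"
          by (intro filterlim_compose[OF filterlim_real_sequentially] filterlim_compose[OF filterlim_Suc] filterlim_subseq[OF q])
        then show ?thesis by (simp add: \<epsilon>_def)
      qed
      have "\<forall>\<^sub>F k in sequentially. Re (ip (- D) (resolvent \<sigma> (1 / \<epsilon> (q k)) (u (q k))) (resolvent \<sigma> (1 / \<epsilon> (q k)) (u (q k)))) \<le> X (q k) \<sigma>"
      proof -
        have "\<forall>\<^sub>F k in sequentially. \<epsilon> (q k) < \<sigma>" by (rule order_tendstoD(2)[OF \<epsilon>q \<sigma>])
        moreover have "\<forall>\<^sub>F k in sequentially. \<epsilon> (q k) < 1 / \<sigma>" by (rule order_tendstoD(2)[OF \<epsilon>q]) (use \<sigma> in simp)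
        ultimately show ?thesis
        proof eventually_elim
          case (elim k)
          then have "\<epsilon> (q k) \<le> \<sigma>" "\<sigma> \<le> 1 / \<epsilon> (q k)" using \<epsilon>(1)[of "q k"] \<sigma> by (auto simp: field_simps)
          then show ?case using u[of "q k"] unfolding approximate_minimiser_def X_def by simp
        qed
      qed
      then show "(\<lambda>k. Re (ip (- D) (resolvent \<sigma> (1 / \<epsilon> (q k)) (u (q k))) (resolvent \<sigma> (1 / \<epsilon> (q k)) (u (q k))))) \<longlonglongrightarrow> 0"
        by (rule tendsto_sandwich[OF always_eventually _ tendsto_const X, rotated]) (intro allI Re_ip_nonneg)
      have "0 \<le> \<sigma> + (norm \<xi>)\<^sup>2 - \<beta>\<^sup>2" using \<beta> \<sigma> by simp
      then have "(sqrt (\<sigma> + (norm \<xi>)\<^sup>2 - \<beta>\<^sup>2))\<^sup>2 = \<sigma> + (norm \<xi>)\<^sup>2 - \<beta>\<^sup>2" by simp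
      then show "of_real (\<sigma> + (norm \<xi>)\<^sup>2) + of_real (2 * (\<xi> \<bullet> b)) * Z \<sigma> + (Z \<sigma>)\<^sup>2 = 0"
        unfolding \<beta>_def[symmetric] by (simp add: complex_eq_iff Z_def power2_eq_square)
    qed
  qed
  \<comment> \<open>Otherwise \<open>T\<close> would carry \<open>M\<close> and be discrete in
    (0,\<infinity>), which would extend \<psi>.\<close>
  obtain s t where st: "0 < s" "infinite (T \<inter> {s..t})"
    using extends_meromorphically_if_discrete[OF T_AE] mero by blast
  have inj: "inj_on Z (T \<inter> {s..t})" by (rule inj_onI) (simp add: Z_def)
  have "continuous_on {s..t} Z" unfolding Z_def Complex_eq by (intro continuous_intros)
  then have "compact (Z ` {s..t})" by (rule compact_continuous_image) simp
  moreover have "infinite (Z ` (T \<inter> {s..t}))" using st(2) finite_imageD[OF _ inj] by blast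
  moreover have "Z ` (T \<inter> {s..t}) \<subseteq> Z ` {s..t}" by blast
  ultimately obtain p where "p islimpt Z ` (T \<inter> {s..t})" by (metis compact_eq_Bolzano_Weierstrass)
  then have "\<Phi> 0 = 0"
    using analytic_continuation[OF \<Phi>(1) open_UNIV connected_UNIV subset_UNIV UNIV_I _ _ UNIV_I] zero by blast
  with \<Phi>0 show False ..
qed

theorem theorem1p1:
  fixes \<psi> :: "real \<Rightarrow> real" and D :: "'a::euclidean_space set"
  assumes "complete_Bernstein \<psi>"
    and "Lipschitz_domain D" and "bounded D" and "D \<noteq> {}"
  shows "(\<forall>n\<ge>1. \<psi> (Neumann_eigenvalue D n) \<le> psi_eigenvalue \<psi> D n \<and>
                 psi_eigenvalue \<psi> D n \<le> \<psi> (Dirichlet_eigenvalue D n)) \<and>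
         (\<not> extends_meromorphically \<psi> \<longrightarrow>
            (\<forall>n\<ge>1. \<psi> (Neumann_eigenvalue D n) < psi_eigenvalue \<psi> D n \<and>
                   psi_eigenvalue \<psi> D n < \<psi> (Dirichlet_eigenvalue D n)))"
proof -
  obtain c\<^sub>0 c\<^sub>1 M where "c\<^sub>0 \<ge> 0" "c\<^sub>1 \<ge> 0" "sets (M :: real measure) = sets (restrict_space borel {0<..})"
    "\<forall>\<xi>>0. integrable M (\<lambda>s. \<xi> / (\<xi> + s))" "\<forall>\<xi>\<ge>0. \<psi> \<xi> = c\<^sub>1 * \<xi> + c\<^sub>0 + 1 / pi * (\<integral>s. \<xi> / (\<xi> + s) \<partial>M)"
    using assms(1) unfolding complete_Bernstein_def by blast
  then interpret Bernstein_representation \<psi> c\<^sub>0 c\<^sub>1 M by unfold_locales blast+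
  have D: "open D" "bounded D" "D \<noteq> {}" using assms by (auto simp: Lipschitz_domain_def)
  \<comment> \<open>A null measure would make \<psi> affine, hence meromorphic.\<close>
  have nonnull: "\<not> (AE s in M. False)" if "\<not> extends_meromorphically \<psi>"
    using that extends_meromorphically_if_discrete[of "{}"] by auto
  have low: "\<psi> (Neumann_eigenvalue D n) \<le> psi_eigenvalue \<psi> D n" if n: "1 \<le> n" for n
  proof -
    have "\<forall>k. \<exists>u. approximate_minimiser D n (1 / real (Suc k)) u" using approximate_minimiser_exists[OF D n] by simp
    then obtain u where "\<And>k. approximate_minimiser D n (1 / real (Suc k)) (u k)" by metis
    from Neumann_lower_limit(1)[OF D(1,2) this] show ?thesis .
  qed
  show ?thesis
    using low psi_eigenvalue_upper(2)[OF D] psi_eigenvalue_upper(3)[OF D _ nonnull] Neumann_lower_strict[OF D] by blast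
qed

end
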